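(* The operator $\partial'=\partial+\operatorname{ad}_\Delta$ on the graded operad $\mathit{mQuilt}$ satisfies $(\partial')^2=0$ and makes $\mathit{mQuilt}$ a differential graded operad.
   Context: Write $\langle n\rangle=\{1,\dots,n\}$. TREES. A tree $T$ consists of a finite set $V_T$ (vertices), a set $E_T\subset V_T\times V_T$ (edges) and a partial order $\trianglelefteq_T$ on $V_T$ (strict part $\vartriangleleft_T$) such that: $(u,u)\notin E_T$; $E_T$ generates a partial order $\le_T$ with $(u,v)\in E_T\Rightarrow u<_Tv$; there is a unique $\le_T$-minimal vertex (the root); if $(u,v)\in E_T$ there is no $t$ with $u<_Tt<_Tv$; for all $u,v$ exactly one of $u=v$, $u<_Tv$, $u>_Tv$, $u\vartriangleleft_Tv$, $u\vartriangleright_Tv$ holds; if $u\vartriangleleft_Tv$, $u\le_Tu'$, $v\le_Tv'$ then $u'\vartriangleleft_Tv'$. If $(u,v)\in E_T$, $v$ is a child of $u$. $\mathsf{Tree}(n)$ is the set of trees with vertex set $\langle n\rangle$. WORDS. $\mathsf{F_2S}(n)$ is the set of words (finite sequences) $W$ over $\langle n\rangle$ such that every element of $\langle n\rangle$ appears, no element appears twice consecutively, and for $u\ne v$ there is no subsequence $u,v,u,v$. $|W|$ is the length and $\deg W=|W|-n$. Elements of $\langle n\rangle$ are called vertices. QUILTS. $\mathsf{Quilt}(n)$ is the set of pairs $Q=(W_Q,T_Q)\in\mathsf{F_2S}(n)\times\mathsf{Tree}(n)$ such that (1) if some occurrence of $u$ precedes some occurrence of $v$ in $W_Q$ then not $u>_{T_Q}v$;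 (2) if some occurrence of $v$ lies between two occurrences of $u$ in $W_Q$ then $v\trianglelefteq_{T_Q}u$. $\deg Q=\deg W_Q$, arity $\#Q=n$. OCCURRENCES. $\underline a$ denotes an occurrence (position) of $a$ in $W$. The $\downarrow$ order is the order of first occurrences in $W$. An occurrence of $u$ is a caesura if $u$ occurs again later. If $W=\dots uv\dots u\dots$ ($v$ immediately after an occurrence of $u$, and $u$ occurs again later), $v$ is interposed; caesurae and interposed vertices correspond bijectively, and there are $\deg W$ of each. BOUNDARY. If $a$ is repeated in $W$, $\partial_{\underline a}W$ is $W$ with $\underline a$ deleted; otherwise $\partial_{\underline a}W=0$. Number the caesurae $1,2,\dots$ from left to right; if $\underline a$ is the $k$-th caesura, $\operatorname{sgn}_W\underline a=(-1)^k$; if $\underline a$ is the last occurrence of $a$ and the previous occurrence of $a$ is the $k$-th caesura, $\operatorname{sgn}_W\underline a=(-1)^{k+1}$. PERMUTATIONS. $\sigma\in\mathbb S_n$ acts on words and trees on the right by replacing each vertex $u$ by $\sigma^{-1}(u)$. EXTENSIONS. For $a\in\langle m\rangle$ let $\alpha:\langle n\rangle\to\langle n+m-1\rangle$, $\alpha(j)=j+a-1$, and $\beta:\langle n+m-1\rangle\to\langle m\rangle$, $\beta(k)=k$ for $k<a$, $\beta(k)=a$ for $a\le k<a+n$, $\beta(k)=k+1-n$ for $k\ge a+n$. For $S\in\mathsf{Tree}(m)$, $T\in\mathsf{Tree}(n)$, $\mathrm{Ext}(S,T,a)$ is the set of $U\in\mathsf{Tree}(n+m-1)$ with: $(r,s)\in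 E_T\Leftrightarrow(\alpha r,\alpha s)\in E_U$; $r\vartriangleleft_Ts\Leftrightarrow\alpha r\vartriangleleft_U\alpha s$; $(u,w)\in E_U\Rightarrow(\beta u,\beta w)\in E_S$ or $\beta u=\beta w=a$; $\beta u\vartriangleleft_S\beta w\Rightarrow u\vartriangleleft_Uw$. For $V\in\mathsf{F_2S}(m)$, $W\in\mathsf{F_2S}(n)$, $\mathrm{Ext}(V,W,a)$ is the set of $X\in\mathsf{F_2S}(n+m-1)$ such that: deleting from $X$ all vertices not in the image of $\alpha$ and eliminating consecutive repetitions gives $W$ relabelled by $\alpha$; wherever letters have been deleted between two remaining letters, these two are equal (a repetition occurs there); relabelling $X$ by $\beta$ and eliminating consecutive repetitions gives $V$. Identify interposed vertices of $V$ and $W$ with interposed vertices of $X$: $w$ interposed in $W$ with $\alpha w$; $v\neq a$ interposed in $V$ with $\beta^{-1}(v)$; $a$, if interposed in $V$, with $\alpha w$ where $w$ is the first letter of $W$. $\operatorname{sgn}_{V,W,a}(X)$ is the sign of the shuffle from (interposed vertices of $V$ in $\downarrow$ order, then those of $W$ in $\downarrow$ order) to (interposed vertices of $X$ in $\downarrow$ order). THE OPERAD $\mathit{Quilt}$. $\mathit{Quilt}(n)$ is the free graded abelian group on $\mathsf{Quilt}(n)$, with diagonal permutation action, boundary $\partial(W,T)=\sum_{\underline a}\operatorname{sgn}_W(\underline a)(\partial_{\underline a}W,T)$ of degree $-1$, and partial composition $(V,S)\circ_a(W,T)=\sum_{X\in\mathrm{Ext}(V,W,a)}\sum_{U\in\mathrm{Ext}(S,T,a)}\operatorname{sgn}_{V,W,a}(X)\,(X,U)$.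 This is a dg-operad. THE OPERAD $\mathit{mQuilt}$. Let $B=(12,T)\in\mathsf{Quilt}(2)$, where $T$ has root $1$ with the single child $2$. As a graded operad, $\mathit{mQuilt}$ is generated by the graded operad $\mathit{Quilt}$ and one additional generator $\mathsf m$ of arity $0$ and degree $-1$, subject to the relations: (1) the composite of $B$ with $\mathsf m$ in both inputs is $0$; (2) if a vertex $u$ of a quilt $Q$ has more than $2$ children, $Q\circ_u\mathsf m=0$; (3) if $u$ is repeated in $W_Q$, $Q\circ_u\mathsf m=0$; (4) if $W_Q=\dots vuv\dots$ for some $v$, $Q\circ_u\mathsf m=0$; (5) if $P,Q$ are quilts of the same arity with $T_Q=T_P$ and $W_Q,W_P$ are equal except for the position of $u$, then $Q\circ_u\mathsf m=P\circ_u\mathsf m$. The boundary $\partial$ is extended as a derivation by $\partial\mathsf m=0$. Put $\Delta=B\circ_1\mathsf m-B\circ_2\mathsf m$ (arity $1$, degree $-1$) and $\operatorname{ad}_\Delta X=\Delta\circ_1X-(-1)^{\deg X}\sum_{a=1}^{\#X}X\circ_a\Delta$, where $\#X$ is the arity of $X$. *)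

theory Defs
  imports
    "HOL-Algebra.Free_Abelian_Groups"
    "HOL-Combinatorics.Permutations"
    "HOL-Library.Sublist"
begin

section \<open>Trees\<close>

record tree =
  verts :: "nat set"
  edges :: "(nat \<times> nat) set"
  horder :: "(nat \<times> nat) set"

definition vle :: "tree \<Rightarrow> (nat \<times> nat) set" where
  "vle T = {(u, v). u \<in> verts T \<and> v \<in> verts T \<and> (u, v) \<in> (edges T)\<^sup>*}"

definition vless :: "tree \<Rightarrow> (nat \<times> nat) set" where
  "vless T = vle T - Id"

definition hless :: "tree \<Rightarrow> (nat \<times> nat) set" where
  "hless T = horder T - Id"

definition is_tree :: "tree \<Rightarrow> bool" where
  "is_tree T \<longleftrightarrow>
     finite (verts T) \<and> edges T \<subseteq> verts T \<times> verts T \<and>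
     partial_order_on (verts T) (horder T) \<and>
     (\<forall>u. (u, u) \<notin> edges T) \<and>
     partial_order_on (verts T) (vle T) \<and> edges T \<subseteq> vless T \<and>
     (\<exists>!r. r \<in> verts T \<and> (\<forall>v \<in> verts T. (v, r) \<notin> vless T)) \<and>
     (\<forall>(u, v) \<in> edges T. \<not> (\<exists>t. (u, t) \<in> vless T \<and> (t, v) \<in> vless T)) \<and>
     (\<forall>u \<in> verts T. \<forall>v \<in> verts T.
        length (filter (\<lambda>b. b)
          [u = v, (u, v) \<in> vless T, (v, u) \<in> vless T, (u, v) \<in> hless T, (v, u) \<in> hless T]) = 1) \<and>
     (\<forall>u v u' v'. (u, v) \<in> hless T \<and> (u, u') \<in> vle T \<and> (v, v') \<in> vle T \<longrightarrow> (u', v') \<in> hless T)"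

definition Tree :: "nat \<Rightarrow> tree set" where
  "Tree n = {T. is_tree T \<and> verts T = {1..n}}"

definition relabel_tree :: "(nat \<Rightarrow> nat) \<Rightarrow> tree \<Rightarrow> tree" where
  "relabel_tree f T =
     \<lparr>verts = f ` verts T, edges = map_prod f f ` edges T, horder = map_prod f f ` horder T\<rparr>"


section \<open>Words\<close>

definition F2S :: "nat \<Rightarrow> nat list set" where
  "F2S n = {w. set w = {1..n} \<and> distinct_adj w \<and> (\<forall>u v. u \<noteq> v \<longrightarrow> \<not> subseq [u, v, u, v] w)}"

definition wdeg :: "nat list \<Rightarrow> int" where
  "wdeg w = int (length w) - int (card (set w))"

text \<open>Occurrences are positions in the list, counted from 0.\<close>

definition caesura :: "nat list \<Rightarrow> nat \<Rightarrow> bool" where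
  "caesura w i \<longleftrightarrow> (\<exists>j. i < j \<and> j < length w \<and> w ! j = w ! i)"

definition interposed :: "nat list \<Rightarrow> nat \<Rightarrow> bool" where
  "interposed w v \<longleftrightarrow> (\<exists>i. Suc i < length w \<and> w ! Suc i = v \<and> caesura w i)"

text \<open>The letters in the order of their first occurrences (\<^const>\<open>remdups\<close> keeps last ones).\<close>

definition down_order :: "nat list \<Rightarrow> nat list" where
  "down_order w = rev (remdups (rev w))"

definition interposed_list :: "nat list \<Rightarrow> nat list" where
  "interposed_list w = filter (interposed w) (down_order w)"

text \<open>The number of a caesura, counting caesurae from the left starting with 1.\<close>

definition caesura_number :: "nat list \<Rightarrow> nat \<Rightarrow> nat" where
  "caesura_number w i = card {j. j \<le> i \<and> caesura w j}"

definition prev_occ :: "nat list \<Rightarrow> nat \<Rightarrow> nat" where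
  "prev_occ w i = Max {j. j < i \<and> w ! j = w ! i}"

definition occ_sgn :: "nat list \<Rightarrow> nat \<Rightarrow> int" where
  "occ_sgn w i =
     (if caesura w i then (-1) ^ caesura_number w i
      else (-1) ^ (caesura_number w (prev_occ w i) + 1))"

definition delete_at :: "nat \<Rightarrow> 'a list \<Rightarrow> 'a list" where
  "delete_at i w = take i w @ drop (Suc i) w"


section \<open>Extensions\<close>

text \<open>\<open>shift a\<close> is the map \<open>\<alpha>\<close> and \<open>collapse n a\<close> is the map \<open>\<beta>\<close>
  belonging to the substitution of an \<open>n\<close>-ary object for \<open>a\<close>.\<close>

definition shift :: "nat \<Rightarrow> nat \<Rightarrow> nat" where
  "shift a j = j + a - 1"

definition collapse :: "nat \<Rightarrow> nat \<Rightarrow> nat \<Rightarrow> nat" where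
  "collapse n a k = (if k < a then k else if k < a + n then a else k + 1 - n)"

definition Ext_tree :: "nat \<Rightarrow> nat \<Rightarrow> tree \<Rightarrow> tree \<Rightarrow> nat \<Rightarrow> tree set" where
  "Ext_tree m n S T a = {U \<in> Tree (n + m - 1).
     (\<forall>r \<in> {1..n}. \<forall>s \<in> {1..n}. (r, s) \<in> edges T \<longleftrightarrow> (shift a r, shift a s) \<in> edges U) \<and>
     (\<forall>r \<in> {1..n}. \<forall>s \<in> {1..n}. (r, s) \<in> hless T \<longleftrightarrow> (shift a r, shift a s) \<in> hless U) \<and>
     (\<forall>(u, w) \<in> edges U. (collapse n a u, collapse n a w) \<in> edges S \<or>
        (collapse n a u = a \<and> collapse n a w = a)) \<and>
     (\<forall>u \<in> {1..n + m - 1}. \<forall>w \<in> {1..n + m - 1}.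
        (collapse n a u, collapse n a w) \<in> hless S \<longrightarrow> (u, w) \<in> hless U)}"

definition Ext_word :: "nat \<Rightarrow> nat \<Rightarrow> nat list \<Rightarrow> nat list \<Rightarrow> nat \<Rightarrow> nat list set" where
  "Ext_word m n V W a = {X \<in> F2S (n + m - 1).
     remdups_adj (filter (\<lambda>u. u \<in> shift a ` {1..n}) X) = map (shift a) W \<and>
     (\<forall>i j. i + 1 < j \<and> j < length X \<and>
        X ! i \<in> shift a ` {1..n} \<and> X ! j \<in> shift a ` {1..n} \<and>
        (\<forall>k. i < k \<and> k < j \<longrightarrow> X ! k \<notin> shift a ` {1..n}) \<longrightarrow> X ! i = X ! j) \<and>
     remdups_adj (map (collapse n a) X) = V}"

text \<open>The vertex of an extension identified with the vertex \<open>v\<close> interposed in the outer word;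
  \<open>W\<close> is the inner word, of arity \<open>n\<close>. For \<open>v \<noteq> a\<close> it is the unique \<open>collapse n a\<close>-preimage of \<open>v\<close>.\<close>

definition outer_vertex :: "nat \<Rightarrow> nat list \<Rightarrow> nat \<Rightarrow> nat \<Rightarrow> nat" where
  "outer_vertex n W a v =
     (if v < a then v else if v = a then shift a (hd W) else v + n - 1)"

definition rearrangement_sgn :: "'a list \<Rightarrow> 'a list \<Rightarrow> int" where
  "rearrangement_sgn xs ys =
     sign (THE p. p permutes {..<length xs} \<and> permute_list p xs = ys)"

definition ext_sgn :: "nat \<Rightarrow> nat list \<Rightarrow> nat list \<Rightarrow> nat \<Rightarrow> nat list \<Rightarrow> int" where
  "ext_sgn n V W a X =
     rearrangement_sgn
       (map (outer_vertex n W a) (interposed_list V) @ map (shift a) (interposed_list W))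
       (interposed_list X)"


section \<open>Graded and differential graded operads\<close>

text \<open>Symmetric operads in graded abelian groups, given by partial compositions and right
  actions of the symmetric groups. \<open>piece P n k\<close> is the abelian group of elements of arity \<open>n\<close> and
  degree \<open>k\<close>; it is a \<^typ>\<open>'a monoid\<close> and hence written multiplicatively, so integer
  multiples appear as integer powers. The element \<open>opcomp P x a y\<close> is \<open>x \<circ>\<^sub>a y\<close>.\<close>

record 'a operad_data =
  piece :: "nat \<Rightarrow> int \<Rightarrow> 'a monoid"
  opunit :: 'a
  opact :: "'a \<Rightarrow> (nat \<Rightarrow> nat) \<Rightarrow> 'a"
  opcomp :: "'a \<Rightarrow> nat \<Rightarrow> 'a \<Rightarrow> 'a"

definition ksgn :: "int \<Rightarrow> int" where
  "ksgn k = (if even k then 1 else -1)"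

text \<open>The permutation \<open>\<sigma> \<circ>\<^sub>a \<tau>\<close>, where \<open>\<tau>\<close> permutes \<open>{1..n}\<close>. In \<open>x \<cdot> \<sigma>\<close>, the input labelled \<open>j\<close> is
  the input of \<open>x\<close> labelled \<open>\<sigma> j\<close>.\<close>

definition perm_comp :: "nat \<Rightarrow> (nat \<Rightarrow> nat) \<Rightarrow> nat \<Rightarrow> (nat \<Rightarrow> nat) \<Rightarrow> nat \<Rightarrow> nat" where
  "perm_comp n \<sigma> a \<tau> k =
     (if a \<le> k \<and> k < a + n then shift (\<sigma> a) (\<tau> (k + 1 - a))
      else let j = \<sigma> (collapse n a k) in if j < \<sigma> a then j else j + n - 1)"

definition graded_operad :: "'a operad_data \<Rightarrow> bool" where
  "graded_operad P \<longleftrightarrow>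
     (\<forall>n k. comm_group (piece P n k)) \<and>
     opunit P \<in> carrier (piece P 1 0) \<and>
     \<comment> \<open>symmetric group actions\<close>
     (\<forall>n k \<sigma>. \<sigma> permutes {1..n} \<longrightarrow> (\<lambda>x. opact P x \<sigma>) \<in> hom (piece P n k) (piece P n k)) \<and>
     (\<forall>n k. \<forall>x \<in> carrier (piece P n k). opact P x id = x) \<and>
     (\<forall>n k \<sigma> \<tau>. \<sigma> permutes {1..n} \<and> \<tau> permutes {1..n} \<longrightarrow>
        (\<forall>x \<in> carrier (piece P n k). opact P x (\<sigma> \<circ> \<tau>) = opact P (opact P x \<sigma>) \<tau>)) \<and>
     \<comment> \<open>biadditivity of the partial compositions\<close>
     (\<forall>m n j k. \<forall>a \<in> {1..m}. \<forall>y \<in> carrier (piece P n k).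
        (\<lambda>x. opcomp P x a y) \<in> hom (piece P m j) (piece P (m + n - 1) (j + k))) \<and>
     (\<forall>m n j k. \<forall>a \<in> {1..m}. \<forall>x \<in> carrier (piece P m j).
        (\<lambda>y. opcomp P x a y) \<in> hom (piece P n k) (piece P (m + n - 1) (j + k))) \<and>
     \<comment> \<open>unit laws\<close>
     (\<forall>n k. \<forall>x \<in> carrier (piece P n k).
        opcomp P (opunit P) 1 x = x \<and> (\<forall>a \<in> {1..n}. opcomp P x a (opunit P) = x)) \<and>
     \<comment> \<open>sequential associativity\<close>
     (\<forall>m n p i j k. \<forall>x \<in> carrier (piece P m i). \<forall>y \<in> carrier (piece P n j).
        \<forall>z \<in> carrier (piece P p k). \<forall>a \<in> {1..m}. \<forall>b \<in> {1..n}.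
        opcomp P (opcomp P x a y) (a + b - 1) z = opcomp P x a (opcomp P y b z)) \<and>
     \<comment> \<open>parallel associativity, with the Koszul sign\<close>
     (\<forall>m n p i j k. \<forall>x \<in> carrier (piece P m i). \<forall>y \<in> carrier (piece P n j).
        \<forall>z \<in> carrier (piece P p k). \<forall>a \<in> {1..m}. \<forall>b \<in> {1..m}. a < b \<longrightarrow>
        opcomp P (opcomp P x a y) (b + n - 1) z =
          opcomp P (opcomp P x b z) a y
            [^]\<^bsub>piece P (m + n + p - 2) (i + j + k)\<^esub> ksgn (j * k)) \<and>
     \<comment> \<open>equivariance\<close>
     (\<forall>m n j k \<sigma> \<tau>. \<sigma> permutes {1..m} \<and> \<tau> permutes {1..n} \<longrightarrow>
        (\<forall>x \<in> carrier (piece P m j). \<forall>y \<in> carrier (piece P n k). \<forall>a \<in> {1..m}.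
        opcomp P (opact P x \<sigma>) a (opact P y \<tau>) =
          opact P (opcomp P x (\<sigma> a) y) (perm_comp n \<sigma> a \<tau>)))"

text \<open>Operators are indexed by the arity and the degree of the piece they act on.\<close>

definition operad_derivation :: "'a operad_data \<Rightarrow> (nat \<Rightarrow> int \<Rightarrow> 'a \<Rightarrow> 'a) \<Rightarrow> bool" where
  "operad_derivation P d \<longleftrightarrow>
     (\<forall>n k. d n k \<in> hom (piece P n k) (piece P n (k - 1))) \<and>
     (\<forall>n k \<sigma>. \<sigma> permutes {1..n} \<longrightarrow>
        (\<forall>x \<in> carrier (piece P n k). d n k (opact P x \<sigma>) = opact P (d n k x) \<sigma>)) \<and>
     (\<forall>m n j k. \<forall>x \<in> carrier (piece P m j). \<forall>y \<in> carrier (piece P n k). \<forall>a \<in> {1..m}.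
        d (m + n - 1) (j + k) (opcomp P x a y) =
          opcomp P (d m j x) a y
            \<otimes>\<^bsub>piece P (m + n - 1) (j + k - 1)\<^esub>
          (opcomp P x a (d n k y) [^]\<^bsub>piece P (m + n - 1) (j + k - 1)\<^esub> ksgn j))"

definition square_zero :: "'a operad_data \<Rightarrow> (nat \<Rightarrow> int \<Rightarrow> 'a \<Rightarrow> 'a) \<Rightarrow> bool" where
  "square_zero P d \<longleftrightarrow>
     (\<forall>n k. \<forall>x \<in> carrier (piece P n k). d n (k - 1) (d n k x) = \<one>\<^bsub>piece P n (k - 2)\<^esub>)"

definition dg_operad :: "'a operad_data \<Rightarrow> (nat \<Rightarrow> int \<Rightarrow> 'a \<Rightarrow> 'a) \<Rightarrow> bool" where
  "dg_operad P d \<longleftrightarrow> graded_operad P \<and> operad_derivation P d \<and> square_zero P d"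

text \<open>The operator \<open>ad\<^sub>\<delta>\<close> for \<open>\<delta>\<close> of arity 1 and degree -1.\<close>

definition operad_ad :: "'a operad_data \<Rightarrow> 'a \<Rightarrow> nat \<Rightarrow> int \<Rightarrow> 'a \<Rightarrow> 'a" where
  "operad_ad P \<delta> n k x =
     opcomp P \<delta> 1 x \<otimes>\<^bsub>piece P n (k - 1)\<^esub>
     (finprod (piece P n (k - 1)) (\<lambda>a. opcomp P x a \<delta>) {1..n}
        [^]\<^bsub>piece P n (k - 1)\<^esub> (- ksgn k))"


section \<open>The operad of quilts\<close>

type_synonym quilt = "nat list \<times> tree"

definition Quilts :: "nat \<Rightarrow> quilt set" where
  "Quilts n = {(W, T). W \<in> F2S n \<and> T \<in> Tree n \<and>
     (\<forall>i j. i < j \<and> j < length W \<longrightarrow> (W ! j, W ! i) \<notin> vless T) \<and>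
     (\<forall>i j k. i < j \<and> j < k \<and> k < length W \<and> W ! i = W ! k \<longrightarrow> (W ! j, W ! i) \<in> horder T)}"

definition qdeg :: "quilt \<Rightarrow> int" where
  "qdeg Q = wdeg (fst Q)"

definition qarity :: "quilt \<Rightarrow> nat" where
  "qarity Q = card (verts (snd Q))"

definition quilt_bd_basis :: "quilt \<Rightarrow> quilt \<Rightarrow>\<^sub>0 int" where
  "quilt_bd_basis Q = (case Q of (W, T) \<Rightarrow>
     \<Sum>i \<in> {i. i < length W \<and> count_list W (W ! i) \<ge> 2}.
       frag_cmul (occ_sgn W i) (frag_of (delete_at i W, T)))"

definition quilt_bd :: "(quilt \<Rightarrow>\<^sub>0 int) \<Rightarrow> (quilt \<Rightarrow>\<^sub>0 int)" where
  "quilt_bd = frag_extend quilt_bd_basis"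

definition quilt_act :: "(quilt \<Rightarrow>\<^sub>0 int) \<Rightarrow> (nat \<Rightarrow> nat) \<Rightarrow> (quilt \<Rightarrow>\<^sub>0 int)" where
  "quilt_act x \<sigma> =
     frag_extend (\<lambda>(W, T). frag_of (map (inv_into UNIV \<sigma>) W, relabel_tree (inv_into UNIV \<sigma>) T)) x"

definition quilt_comp_basis :: "quilt \<Rightarrow> nat \<Rightarrow> quilt \<Rightarrow> quilt \<Rightarrow>\<^sub>0 int" where
  "quilt_comp_basis P a Q =
     (let m = qarity P; n = qarity Q in
      \<Sum>X \<in> Ext_word m n (fst P) (fst Q) a. \<Sum>U \<in> Ext_tree m n (snd P) (snd Q) a.
        frag_cmul (ext_sgn n (fst P) (fst Q) a X) (frag_of (X, U)))"

definition quilt_comp ::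
  "(quilt \<Rightarrow>\<^sub>0 int) \<Rightarrow> nat \<Rightarrow> (quilt \<Rightarrow>\<^sub>0 int) \<Rightarrow> (quilt \<Rightarrow>\<^sub>0 int)" where
  "quilt_comp x a y = frag_extend (\<lambda>P. frag_extend (\<lambda>Q. quilt_comp_basis P a Q) y) x"

definition quilt_unit :: quilt where
  "quilt_unit = ([1], \<lparr>verts = {1}, edges = {}, horder = {(1, 1)}\<rparr>)"

definition Quilt_op :: "(quilt \<Rightarrow>\<^sub>0 int) operad_data" where
  "Quilt_op =
     \<lparr>piece = (\<lambda>n k. free_Abelian_group {Q \<in> Quilts n. qdeg Q = k}),
      opunit = frag_of quilt_unit,
      opact = quilt_act,
      opcomp = quilt_comp\<rparr>"

definition quilt_B :: quilt where
  "quilt_B = ([1, 2], \<lparr>verts = {1, 2}, edges = {(1, 2)}, horder = {(1, 1), (2, 2)}\<rparr>)"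


section \<open>Adjoining a generator to a graded operad\<close>

text \<open>The graded operad generated by a graded operad \<open>P\<close> and one generator of arity \<open>r\<close> and
  degree \<open>e\<close> subject to a set of homogeneous relations, constructed as the quotient of the
  well-typed operadic expressions (in the elements of \<open>P\<close> and the generator) by the congruence
  generated by the axioms of graded operads, the operations of \<open>P\<close> and the given relations.\<close>

datatype 'a opterm =
    Elem nat int 'a
  | Gen
  | Zero nat int
  | Plus "'a opterm" "'a opterm"
  | Neg "'a opterm"
  | Act "'a opterm" "nat \<Rightarrow> nat"
  | Comp "'a opterm" nat "'a opterm"

inductive opterm_typ :: "'a operad_data \<Rightarrow> nat \<Rightarrow> int \<Rightarrow> nat \<Rightarrow> int \<Rightarrow> 'a opterm \<Rightarrow> bool"
  for P :: "'a operad_data" and r :: nat and e :: int where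
  typ_Elem: "x \<in> carrier (piece P n k) \<Longrightarrow> opterm_typ P r e n k (Elem n k x)"
| typ_Gen: "opterm_typ P r e r e Gen"
| typ_Zero: "opterm_typ P r e n k (Zero n k)"
| typ_Plus: "opterm_typ P r e n k t \<Longrightarrow> opterm_typ P r e n k s \<Longrightarrow> opterm_typ P r e n k (Plus t s)"
| typ_Neg: "opterm_typ P r e n k t \<Longrightarrow> opterm_typ P r e n k (Neg t)"
| typ_Act: "opterm_typ P r e n k t \<Longrightarrow> \<sigma> permutes {1..n} \<Longrightarrow> opterm_typ P r e n k (Act t \<sigma>)"
| typ_Comp: "opterm_typ P r e m j t \<Longrightarrow> opterm_typ P r e n k s \<Longrightarrow> a \<in> {1..m} \<Longrightarrow>
    opterm_typ P r e (m + n - 1) (j + k) (Comp t a s)"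

definition signed :: "int \<Rightarrow> 'a opterm \<Rightarrow> 'a opterm" where
  "signed k t = (if even k then t else Neg t)"

inductive opterm_eq ::
  "'a operad_data \<Rightarrow> nat \<Rightarrow> int \<Rightarrow> (nat \<Rightarrow> int \<Rightarrow> 'a opterm \<Rightarrow> 'a opterm \<Rightarrow> bool) \<Rightarrow>
     nat \<Rightarrow> int \<Rightarrow> 'a opterm \<Rightarrow> 'a opterm \<Rightarrow> bool"
  for P :: "'a operad_data" and r :: nat and e :: int
    and R :: "nat \<Rightarrow> int \<Rightarrow> 'a opterm \<Rightarrow> 'a opterm \<Rightarrow> bool" where
  \<comment> \<open>congruence\<close>
  eq_refl: "opterm_typ P r e n k t \<Longrightarrow> opterm_eq P r e R n k t t"
| eq_sym: "opterm_eq P r e R n k t s \<Longrightarrow> opterm_eq P r e R n k s t"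
| eq_trans: "opterm_eq P r e R n k t s \<Longrightarrow> opterm_eq P r e R n k s u \<Longrightarrow>
    opterm_eq P r e R n k t u"
| cong_Plus: "opterm_eq P r e R n k t t' \<Longrightarrow> opterm_eq P r e R n k s s' \<Longrightarrow>
    opterm_eq P r e R n k (Plus t s) (Plus t' s')"
| cong_Neg: "opterm_eq P r e R n k t t' \<Longrightarrow> opterm_eq P r e R n k (Neg t) (Neg t')"
| cong_Act: "opterm_eq P r e R n k t t' \<Longrightarrow> \<sigma> permutes {1..n} \<Longrightarrow>
    opterm_eq P r e R n k (Act t \<sigma>) (Act t' \<sigma>)"
| cong_Comp: "opterm_eq P r e R m j t t' \<Longrightarrow> opterm_eq P r e R n k s s' \<Longrightarrow> a \<in> {1..m} \<Longrightarrow>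
    opterm_eq P r e R (m + n - 1) (j + k) (Comp t a s) (Comp t' a s')"
  \<comment> \<open>abelian groups\<close>
| Plus_assoc: "opterm_typ P r e n k t \<Longrightarrow> opterm_typ P r e n k s \<Longrightarrow> opterm_typ P r e n k u \<Longrightarrow>
    opterm_eq P r e R n k (Plus (Plus t s) u) (Plus t (Plus s u))"
| Plus_commute: "opterm_typ P r e n k t \<Longrightarrow> opterm_typ P r e n k s \<Longrightarrow>
    opterm_eq P r e R n k (Plus t s) (Plus s t)"
| Plus_Zero: "opterm_typ P r e n k t \<Longrightarrow> opterm_eq P r e R n k (Plus t (Zero n k)) t"
| Plus_Neg: "opterm_typ P r e n k t \<Longrightarrow> opterm_eq P r e R n k (Plus t (Neg t)) (Zero n k)"
  \<comment> \<open>symmetric group actions\<close>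
| Act_Plus: "opterm_typ P r e n k t \<Longrightarrow> opterm_typ P r e n k s \<Longrightarrow> \<sigma> permutes {1..n} \<Longrightarrow>
    opterm_eq P r e R n k (Act (Plus t s) \<sigma>) (Plus (Act t \<sigma>) (Act s \<sigma>))"
| Act_id: "opterm_typ P r e n k t \<Longrightarrow> opterm_eq P r e R n k (Act t id) t"
| Act_Act: "opterm_typ P r e n k t \<Longrightarrow> \<sigma> permutes {1..n} \<Longrightarrow> \<tau> permutes {1..n} \<Longrightarrow>
    opterm_eq P r e R n k (Act t (\<sigma> \<circ> \<tau>)) (Act (Act t \<sigma>) \<tau>)"
  \<comment> \<open>partial compositions\<close>
| Comp_Plus_left: "opterm_typ P r e m j t \<Longrightarrow> opterm_typ P r e m j t' \<Longrightarrow>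
    opterm_typ P r e n k s \<Longrightarrow> a \<in> {1..m} \<Longrightarrow>
    opterm_eq P r e R (m + n - 1) (j + k) (Comp (Plus t t') a s) (Plus (Comp t a s) (Comp t' a s))"
| Comp_Plus_right: "opterm_typ P r e m j t \<Longrightarrow> opterm_typ P r e n k s \<Longrightarrow>
    opterm_typ P r e n k s' \<Longrightarrow> a \<in> {1..m} \<Longrightarrow>
    opterm_eq P r e R (m + n - 1) (j + k) (Comp t a (Plus s s')) (Plus (Comp t a s) (Comp t a s'))"
| unit_left: "opterm_typ P r e n k t \<Longrightarrow>
    opterm_eq P r e R n k (Comp (Elem 1 0 (opunit P)) 1 t) t"
| unit_right: "opterm_typ P r e n k t \<Longrightarrow> a \<in> {1..n} \<Longrightarrow>
    opterm_eq P r e R n k (Comp t a (Elem 1 0 (opunit P))) t"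
| assoc_seq: "opterm_typ P r e m i t \<Longrightarrow> opterm_typ P r e n j s \<Longrightarrow> opterm_typ P r e p k u \<Longrightarrow>
    a \<in> {1..m} \<Longrightarrow> b \<in> {1..n} \<Longrightarrow>
    opterm_eq P r e R (m + n + p - 2) (i + j + k)
      (Comp (Comp t a s) (a + b - 1) u) (Comp t a (Comp s b u))"
| assoc_par: "opterm_typ P r e m i t \<Longrightarrow> opterm_typ P r e n j s \<Longrightarrow> opterm_typ P r e p k u \<Longrightarrow>
    a \<in> {1..m} \<Longrightarrow> b \<in> {1..m} \<Longrightarrow> a < b \<Longrightarrow>
    opterm_eq P r e R (m + n + p - 2) (i + j + k)
      (Comp (Comp t a s) (b + n - 1) u) (signed (j * k) (Comp (Comp t b u) a s))"
| equivariance: "opterm_typ P r e m j t \<Longrightarrow> opterm_typ P r e n k s \<Longrightarrow> a \<in> {1..m} \<Longrightarrow>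
    \<sigma> permutes {1..m} \<Longrightarrow> \<tau> permutes {1..n} \<Longrightarrow>
    opterm_eq P r e R (m + n - 1) (j + k)
      (Comp (Act t \<sigma>) a (Act s \<tau>)) (Act (Comp t (\<sigma> a) s) (perm_comp n \<sigma> a \<tau>))"
  \<comment> \<open>the operations of \<open>P\<close>\<close>
| Elem_mult: "x \<in> carrier (piece P n k) \<Longrightarrow> y \<in> carrier (piece P n k) \<Longrightarrow>
    opterm_eq P r e R n k (Elem n k (x \<otimes>\<^bsub>piece P n k\<^esub> y)) (Plus (Elem n k x) (Elem n k y))"
| Elem_act: "x \<in> carrier (piece P n k) \<Longrightarrow> \<sigma> permutes {1..n} \<Longrightarrow>
    opterm_eq P r e R n k (Elem n k (opact P x \<sigma>)) (Act (Elem n k x) \<sigma>)"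
| Elem_comp: "x \<in> carrier (piece P m j) \<Longrightarrow> y \<in> carrier (piece P n k) \<Longrightarrow> a \<in> {1..m} \<Longrightarrow>
    opterm_eq P r e R (m + n - 1) (j + k)
      (Elem (m + n - 1) (j + k) (opcomp P x a y)) (Comp (Elem m j x) a (Elem n k y))"
  \<comment> \<open>the imposed relations\<close>
| relation: "R n k t s \<Longrightarrow> opterm_typ P r e n k t \<Longrightarrow> opterm_typ P r e n k s \<Longrightarrow>
    opterm_eq P r e R n k t s"

context
  fixes P :: "'a operad_data" and r :: nat and e :: int
    and R :: "nat \<Rightarrow> int \<Rightarrow> 'a opterm \<Rightarrow> 'a opterm \<Rightarrow> bool"
begin

definition opterm_class :: "nat \<Rightarrow> int \<Rightarrow> 'a opterm \<Rightarrow> 'a opterm set" where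
  "opterm_class n k t = {s. opterm_eq P r e R n k t s}"

definition adjoin :: "'a opterm set operad_data" where
  "adjoin =
     \<lparr>piece = (\<lambda>n k.
        \<lparr>carrier = {t. opterm_typ P r e n k t} // {(t, s). opterm_eq P r e R n k t s},
         monoid.mult = (\<lambda>A B. \<Union>t \<in> A. \<Union>s \<in> B. opterm_class n k (Plus t s)),
         one = opterm_class n k (Zero n k)\<rparr>),
      opunit = opterm_class 1 0 (Elem 1 0 (opunit P)),
      opact = (\<lambda>A \<sigma>. \<Union>t \<in> A. \<Union>n. \<Union>k. opterm_class n k (Act t \<sigma>)),
      opcomp = (\<lambda>A a B. \<Union>t \<in> A. \<Union>s \<in> B. \<Union>n. \<Union>k. opterm_class n k (Comp t a s))\<rparr>"

definition adjoin_incl :: "nat \<Rightarrow> int \<Rightarrow> 'a \<Rightarrow> 'a opterm set" where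
  "adjoin_incl n k x = opterm_class n k (Elem n k x)"

definition adjoin_gen :: "'a opterm set" where
  "adjoin_gen = opterm_class r e Gen"

end


section \<open>The operad \<open>mQuilt\<close>\<close>

definition plug_m :: "nat \<Rightarrow> quilt \<Rightarrow> nat \<Rightarrow> (quilt \<Rightarrow>\<^sub>0 int) opterm" where
  "plug_m n Q u = Comp (Elem n (qdeg Q) (frag_of Q)) u Gen"

text \<open>In \<open>rel_move\<close>, ``equal except for the position of \<open>u\<close>'' means that \<open>u\<close> occurs exactly once
  in each word and that the words agree after deleting it. Repeated \<open>u\<close> are covered by
  \<open>rel_repeated\<close>.\<close>

inductive mquilt_rel ::
  "nat \<Rightarrow> int \<Rightarrow> (quilt \<Rightarrow>\<^sub>0 int) opterm \<Rightarrow> (quilt \<Rightarrow>\<^sub>0 int) opterm \<Rightarrow> bool" where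
  rel_B: "mquilt_rel 0 (-2) (Comp (plug_m 2 quilt_B 1) 1 Gen) (Zero 0 (-2))"
| rel_children: "Q \<in> Quilts n \<Longrightarrow> u \<in> {1..n} \<Longrightarrow> card {v. (u, v) \<in> edges (snd Q)} > 2 \<Longrightarrow>
    mquilt_rel (n - 1) (qdeg Q - 1) (plug_m n Q u) (Zero (n - 1) (qdeg Q - 1))"
| rel_repeated: "Q \<in> Quilts n \<Longrightarrow> u \<in> {1..n} \<Longrightarrow> count_list (fst Q) u \<ge> 2 \<Longrightarrow>
    mquilt_rel (n - 1) (qdeg Q - 1) (plug_m n Q u) (Zero (n - 1) (qdeg Q - 1))"
| rel_between: "Q \<in> Quilts n \<Longrightarrow> u \<in> {1..n} \<Longrightarrow> fst Q = xs @ [v, u, v] @ ys \<Longrightarrow>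
    mquilt_rel (n - 1) (qdeg Q - 1) (plug_m n Q u) (Zero (n - 1) (qdeg Q - 1))"
| rel_move: "Q \<in> Quilts n \<Longrightarrow> Q' \<in> Quilts n \<Longrightarrow> u \<in> {1..n} \<Longrightarrow> snd Q = snd Q' \<Longrightarrow>
    count_list (fst Q) u = 1 \<Longrightarrow> count_list (fst Q') u = 1 \<Longrightarrow>
    removeAll u (fst Q) = removeAll u (fst Q') \<Longrightarrow>
    mquilt_rel (n - 1) (qdeg Q - 1) (plug_m n Q u) (plug_m n Q' u)"

definition mQuilt :: "(quilt \<Rightarrow>\<^sub>0 int) opterm set operad_data" where
  "mQuilt = adjoin Quilt_op 0 (-1) mquilt_rel"

definition mquilt_incl :: "nat \<Rightarrow> int \<Rightarrow> (quilt \<Rightarrow>\<^sub>0 int) \<Rightarrow> (quilt \<Rightarrow>\<^sub>0 int) opterm set" where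
  "mquilt_incl = adjoin_incl Quilt_op 0 (-1) mquilt_rel"

definition mquilt_m :: "(quilt \<Rightarrow>\<^sub>0 int) opterm set" where
  "mquilt_m = adjoin_gen Quilt_op 0 (-1) mquilt_rel"

text \<open>\<open>d\<close> is the extension of the boundary of quilts to \<open>mQuilt\<close> as a derivation annihilating the generator.\<close>

definition mquilt_boundary ::
  "(nat \<Rightarrow> int \<Rightarrow> (quilt \<Rightarrow>\<^sub>0 int) opterm set \<Rightarrow> (quilt \<Rightarrow>\<^sub>0 int) opterm set) \<Rightarrow> bool" where
  "mquilt_boundary d \<longleftrightarrow>
     operad_derivation mQuilt d \<and>
     (\<forall>n k. \<forall>x \<in> carrier (piece Quilt_op n k).
        d n k (mquilt_incl n k x) = mquilt_incl n (k - 1) (quilt_bd x)) \<and>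
     d 0 (-1) mquilt_m = \<one>\<^bsub>piece mQuilt 0 (-2)\<^esub>"

definition mquilt_Delta :: "(quilt \<Rightarrow>\<^sub>0 int) opterm set" where
  "mquilt_Delta =
     (let B = mquilt_incl 2 0 (frag_of quilt_B) in
      opcomp mQuilt B 1 mquilt_m
        \<otimes>\<^bsub>piece mQuilt 1 (-1)\<^esub> (inv\<^bsub>piece mQuilt 1 (-1)\<^esub> opcomp mQuilt B 2 mquilt_m))"

definition twisted_boundary ::
  "(nat \<Rightarrow> int \<Rightarrow> (quilt \<Rightarrow>\<^sub>0 int) opterm set \<Rightarrow> (quilt \<Rightarrow>\<^sub>0 int) opterm set) \<Rightarrow>
     nat \<Rightarrow> int \<Rightarrow> (quilt \<Rightarrow>\<^sub>0 int) opterm set \<Rightarrow> (quilt \<Rightarrow>\<^sub>0 int) opterm set" where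
  "twisted_boundary d n k x =
     d n k x \<otimes>\<^bsub>piece mQuilt n (k - 1)\<^esub> operad_ad mQuilt mquilt_Delta n k x"

end

theory Submission
  imports Defs
begin

text \<open>Substituting words into words is given by a recursion over both words, for which the Leibniz rule
  holds letter by letter; hence the boundary of quilts is a derivation. It extends to \<open>mQuilt\<close> because
  the relations make the substitution of \<open>m\<close> for a vertex \<open>u\<close> factor through the deletion of \<open>u\<close>:
  deleting \<open>u\<close> commutes with the boundary of a word in which \<open>u\<close> occurs once, and annihilates the
  boundary of any other word.

  For the twisted boundary, \<open>ad\<^sub>\<Delta>\<close> is a derivation, it anticommutes with \<open>\<partial>\<close> because \<open>\<partial>\<Delta> = 0\<close>, and it
  squares to zero as soon as \<open>\<Delta> \<circ>\<^sub>1 \<Delta> = 0\<close>. Expanding \<open>\<Delta> \<circ>\<^sub>1 \<Delta>\<close> leaves substitutions of two copies of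
  \<open>m\<close> into \<open>B \<circ>\<^sub>1 B\<close> and \<open>B \<circ>\<^sub>2 B\<close>. These differ by the two quilts on the word \<open>123\<close> whose tree has root
  \<open>1\<close> and leaves \<open>2\<close>, \<open>3\<close>; the transposition of the leaves followed by relation (5) exchanges them,
  which together with the relation \<open>B(m, m) = 0\<close> makes all terms cancel.\<close>

section \<open>Chains of words\<close>

text \<open>The definitions speak of positions in a word, of sets of extensions and of signs of
  rearrangements, and none of these behaves well when a letter is prefixed. The boundary, the
  substitution and the list of interposed vertices are therefore given by recursions
  (\<open>wbd\<close>, \<open>wsub\<close>, \<open>il\<close>), which are identified with the
  definitions separately. Trees are mere labels here: neither the boundary nor the sign of a
  composite looks at them. Deleting the only occurrence of a letter may leave two equal neighbours,
  which no quilt allows. Relation (4) turns such words into zero, and this is consistent because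
  they span a subcomplex. \<open>mQuilt\<close> is a quotient of expressions, so a derivation is
  defined on expressions and has to respect every rule of the congruence. For this purpose the
  values prescribed by the Leibniz rule are compared for arbitrary candidates \<open>dx\<close>,
  \<open>dy\<close>, before any operator exists. That a square vanishes may be tested on generators
  because the operators are odd: the two mixed terms in the square on a composite cancel.\<close>

lemma frag_additive_eqI:
  fixes f g :: "('a \<Rightarrow>\<^sub>0 int) \<Rightarrow> 'b::ab_group_add"
  assumes f: "\<And>a b. f (a - b) = f a - f b" and g: "\<And>a b. g (a - b) = g a - g b"
    and eq: "\<And>x. x \<in> Poly_Mapping.keys c \<Longrightarrow> f (frag_of x) = g (frag_of x)"
  shows "f c = g c"
\<comment> \<open>The induction principle closes under differences, which is why additivity is
  assumed in the form with \<open>-\<close>.\<close>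
proof (rule frag_induction[of c "Poly_Mapping.keys c" "\<lambda>c. f c = g c"])
  show "f 0 = g 0" using f[of 0 0] g[of 0 0] by simp
qed (use f g eq in auto)

lemma keys_frag_extend_imp:
  assumes "q \<in> Poly_Mapping.keys (frag_extend f c)"
  obtains x where "x \<in> Poly_Mapping.keys c" "q \<in> Poly_Mapping.keys (f x)"
  using assms keys_frag_extend[of f c] by blast

lemma in_keys_plus: "q \<in> Poly_Mapping.keys (x + y) \<Longrightarrow> q \<in> Poly_Mapping.keys x \<or> q \<in> Poly_Mapping.keys y"
  using Poly_Mapping.keys_add[of x y] by blast

lemma in_keys_minus: "q \<in> Poly_Mapping.keys (x - y) \<Longrightarrow> q \<in> Poly_Mapping.keys x \<or> q \<in> Poly_Mapping.keys y"
  using keys_diff[of x y] by blast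

lemma frag_cmul_diff: "frag_cmul k (a - b) = frag_cmul k a - frag_cmul k b"
  by (rule poly_mapping_eqI) (simp add: lookup_minus right_diff_distrib)

lemma count_list_removeAll: "count_list (removeAll x w) y = (if x = y then 0 else count_list w y)"
  by (induction w) auto

definition consm :: "'a \<Rightarrow> ('a list \<Rightarrow>\<^sub>0 int) \<Rightarrow> ('a list \<Rightarrow>\<^sub>0 int)" where
  "consm x = frag_extend (\<lambda>w. frag_of (x # w))"

lemma consm_0 [simp]: "consm x 0 = 0"
  and consm_of [simp]: "consm x (frag_of w) = frag_of (x # w)"
  and consm_add: "consm x (a + b) = consm x a + consm x b"
  and consm_diff: "consm x (a - b) = consm x a - consm x b"
  and consm_minus: "consm x (- a) = - consm x a"
  and consm_cmul: "consm x (frag_cmul k a) = frag_cmul k (consm x a)"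
  by (simp_all add: consm_def frag_extend_add frag_extend_diff frag_extend_minus frag_extend_cmul)

lemmas consm_linear = consm_add consm_diff consm_minus consm_cmul

lemma keys_consm: "q \<in> Poly_Mapping.keys (consm x z) \<Longrightarrow> \<exists>w \<in> Poly_Mapping.keys z. q = x # w"
  unfolding consm_def by (erule keys_frag_extend_imp) auto

text \<open>Words in which \<open>x\<close> is missing or repeated become zero. This is the
  word-level image of substituting \<open>m\<close> for \<open>x\<close>: relation (3) kills
  repeated vertices, and relation (5) forgets where a single one stood.\<close>

definition wrem :: "'a \<Rightarrow> ('a list \<Rightarrow>\<^sub>0 int) \<Rightarrow> ('a list \<Rightarrow>\<^sub>0 int)" where
  "wrem x = frag_extend (\<lambda>w. if count_list w x = 1 then frag_of (removeAll x w) else 0)"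

lemma wrem_0 [simp]: "wrem x 0 = 0"
  and wrem_of: "wrem x (frag_of w) = (if count_list w x = 1 then frag_of (removeAll x w) else 0)"
  and wrem_add: "wrem x (a + b) = wrem x a + wrem x b"
  and wrem_diff: "wrem x (a - b) = wrem x a - wrem x b"
  and wrem_minus: "wrem x (- a) = - wrem x a"
  and wrem_cmul: "wrem x (frag_cmul k a) = frag_cmul k (wrem x a)"
  by (simp_all add: wrem_def frag_extend_add frag_extend_diff frag_extend_minus frag_extend_cmul)

lemmas wrem_linear = wrem_add wrem_diff wrem_minus wrem_cmul

lemma wrem_eq_0: "(\<And>q. q \<in> Poly_Mapping.keys z \<Longrightarrow> count_list q x \<noteq> 1) \<Longrightarrow> wrem x z = 0"
  unfolding wrem_def by (rule frag_extend_eq_0) auto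

lemma wrem_consm_neq: "x \<noteq> u \<Longrightarrow> wrem u (consm x z) = consm x (wrem u z)"
  by (rule frag_additive_eqI[where c = z]) (simp_all add: wrem_linear consm_linear wrem_of)

lemma wrem_consm_same:
  assumes "\<And>q. q \<in> Poly_Mapping.keys z \<Longrightarrow> u \<notin> set q"
  shows "wrem u (consm u z) = z"
  by (rule frag_additive_eqI[where c = z])
     (use assms in \<open>auto simp add: wrem_linear consm_linear wrem_of count_list_0_iff\<close>)

lemma wrem_consm_repeated:
  assumes "\<And>q. q \<in> Poly_Mapping.keys z \<Longrightarrow> u \<in> set q"
  shows "wrem u (consm u z) = 0"
  by (rule wrem_eq_0) (use assms in \<open>auto dest!: keys_consm simp: count_list_0_iff\<close>)

section \<open>The boundary of words\<close>

text \<open>The three terms list what can be deleted from \<open>x # w\<close> when \<open>x\<close>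
  recurs. Deleting the head, which is caesura number 1, gives \<open>- frag_of w\<close>. All
  caesurae of \<open>w\<close> move up by one number, which gives \<open>- consm x (wbd w)\<close>.
  If \<open>w\<close> contains \<open>x\<close> exactly once, that occurrence becomes deletable; its
  previous occurrence is caesura number 1, so its sign is \<open>(-1) ^ 2\<close>.\<close>

fun wbd :: "'a list \<Rightarrow> ('a list \<Rightarrow>\<^sub>0 int)" where
  "wbd [] = 0"
| "wbd (x # w) =
     (if x \<in> set w then consm x (wrem x (frag_of w)) - consm x (wbd w) - frag_of w
      else consm x (wbd w))"

definition wbdm :: "('a list \<Rightarrow>\<^sub>0 int) \<Rightarrow> ('a list \<Rightarrow>\<^sub>0 int)" where
  "wbdm = frag_extend wbd"

lemma wbdm_0 [simp]: "wbdm 0 = 0"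
  and wbdm_of [simp]: "wbdm (frag_of w) = wbd w"
  and wbdm_add: "wbdm (a + b) = wbdm a + wbdm b"
  and wbdm_diff: "wbdm (a - b) = wbdm a - wbdm b"
  and wbdm_minus: "wbdm (- a) = - wbdm a"
  and wbdm_cmul: "wbdm (frag_cmul k a) = frag_cmul k (wbdm a)"
  by (simp_all add: wbdm_def frag_extend_add frag_extend_diff frag_extend_minus frag_extend_cmul)

lemmas wbdm_linear = wbdm_add wbdm_diff wbdm_minus wbdm_cmul

lemma length_removeAll: "length (removeAll x w) + count_list w x = length w"
  by (induction w) auto

lemma keys_wbd:
  "q \<in> Poly_Mapping.keys (wbd w) \<Longrightarrow> set q = set w \<and> length w = Suc (length q)"
proof (induction w arbitrary: q)
  case (Cons x w)
  show ?case
  proof (cases "x \<in> set w")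
    case True
    then have "q \<in> Poly_Mapping.keys (consm x (wrem x (frag_of w)) - consm x (wbd w) - frag_of w)"
      using Cons.prems by simp
    then consider "q \<in> Poly_Mapping.keys (consm x (wrem x (frag_of w)))"
      | "q \<in> Poly_Mapping.keys (consm x (wbd w))" | "q \<in> Poly_Mapping.keys (frag_of w)"
      by (meson in_keys_minus)
    then show ?thesis
    proof cases
      case 1
      then have "count_list w x = 1 \<and> q = x # removeAll x w"
        by (cases "count_list w x = 1") (simp_all add: wrem_of)
      then show ?thesis using length_removeAll[of x w] True by auto
    next
      case 2
      then show ?thesis using keys_consm[OF 2] Cons.IH by auto
    next
      case 3
      then show ?thesis using True by auto
    qed
  next
    case False
    then have "q \<in> Poly_Mapping.keys (consm x (wbd w))" using Cons.prems by simp
    then show ?thesis using Cons.IH by (auto dest: keys_consm)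
  qed
qed simp

lemma keys_wbd_set: "q \<in> Poly_Mapping.keys (wbd w) \<Longrightarrow> set q = set w"
  and keys_wbd_length: "q \<in> Poly_Mapping.keys (wbd w) \<Longrightarrow> length w = Suc (length q)"
  by (simp_all add: keys_wbd)

lemma wbdm_consm_new:
  assumes "\<And>q. q \<in> Poly_Mapping.keys z \<Longrightarrow> x \<notin> set q"
  shows "wbdm (consm x z) = consm x (wbdm z)"
  by (rule frag_additive_eqI[where c = z]) (use assms in \<open>auto simp add: wbdm_linear consm_linear\<close>)

lemma wbdm_consm_old:
  assumes "\<And>q. q \<in> Poly_Mapping.keys z \<Longrightarrow> x \<in> set q"
  shows "wbdm (consm x z) = consm x (wrem x z) - consm x (wbdm z) - z"
  by (rule frag_additive_eqI[where c = z]) (use assms in \<open>auto simp add: wbdm_linear consm_linear wrem_linear\<close>)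

lemma removeAll_commute: "removeAll x (removeAll y w) = removeAll y (removeAll x w)"
  by (induction w) auto

lemma wrem_comm: "wrem x (wrem y z) = wrem y (wrem x z)"
proof (cases "x = y")
  case False
  then show ?thesis
    by - (rule frag_additive_eqI[where c = z],
      auto simp: wrem_linear wrem_of count_list_removeAll removeAll_commute[of x y])
qed simp

text \<open>A letter occurring once is never deleted by the boundary and is no caesura, so taking it
  away changes neither the summands nor the numbering behind their signs.\<close>

lemma wrem_wbd_single:
  "count_list w u = 1 \<Longrightarrow> wrem u (wbd w) = wbd (removeAll u w)"
proof (induction w)
  case (Cons x w)
  show ?case
  proof (cases "x = u")
    case True
    then have "u \<notin> set w" using Cons.prems by (simp add: count_list_0_iff)
    then show ?thesis using True by (auto simp: keys_wbd_set intro!: wrem_consm_same)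
  next
    case False
    then have c: "count_list w u = 1" using Cons.prems by simp
    then have "wrem u (frag_of w) = frag_of (removeAll u w)" by (simp add: wrem_of)
    then have "wrem u (wrem x (frag_of w)) = wrem x (frag_of (removeAll u w))"
      using wrem_comm[of u x "frag_of w"] by simp
    then show ?thesis using False c Cons.IH by (auto simp: wrem_linear wrem_consm_neq wrem_of[of u w])
  qed
qed simp

text \<open>The two deletions of a letter occurring twice cancel after removing the remaining occurrence.\<close>

lemma wrem_wbd_repeated:
  "count_list w u \<noteq> 1 \<Longrightarrow> wrem u (wbd w) = 0"
proof (induction w)
  case (Cons x w)
  show ?case
  proof (cases "x = u")
    case True
    then have u: "u \<in> set w" using Cons.prems by (auto simp: count_list_0_iff)
    then have 1: "wrem u (consm u (wbd w)) = 0"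
      by (intro wrem_consm_repeated) (auto dest: keys_wbd_set)
    have 2: "wrem u (consm u (wrem u (frag_of w))) = wrem u (frag_of w)"
      by (rule wrem_consm_same) (auto simp: wrem_of split: if_splits)
    show ?thesis using True u 1 2 by (simp add: wrem_linear)
  next
    case False
    then have c: "count_list w u \<noteq> 1" using Cons.prems by simp
    then have 0: "wrem u (frag_of w) = 0" by (simp add: wrem_of)
    then have "wrem u (wrem x (frag_of w)) = 0"
      using wrem_comm[of u x "frag_of w"] by simp
    then show ?thesis using False c Cons.IH 0 by (auto simp: wrem_linear wrem_consm_neq)
  qed
qed simp

text \<open>When \<open>x\<close> recurs, the boundaries of the three terms of
  \<open>wbd (x # w)\<close> are \<open>consm x (wbdm ?r)\<close> twice and \<open>wbd w\<close>
  twice, each time with opposite signs, plus a term that vanishes by induction.\<close>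

lemma wbdm_wbd: "wbdm (wbd w) = 0"
proof (induction w)
  case (Cons x w)
  show ?case
  proof (cases "x \<in> set w")
    case True
    let ?r = "wrem x (frag_of w)"
    have 1: "wbdm (consm x (wbd w)) = consm x (wrem x (wbd w)) - consm x (wbdm (wbd w)) - wbd w"
      by (rule wbdm_consm_old) (use True keys_wbd_set in fastforce)
    have 2: "wbdm (consm x ?r) = consm x (wbdm ?r)"
      by (rule wbdm_consm_new) (auto simp: wrem_of split: if_splits)
    \<comment> \<open>The two cases of the count together say that \<open>wrem x\<close> is a chain
      map.\<close>
    have 3: "wrem x (wbd w) = wbdm ?r"
      using wrem_wbd_single[of w x] wrem_wbd_repeated[of w x] by (auto simp: wrem_of)
    show ?thesis using True 1 2 3 Cons.IH by (simp add: wbdm_linear)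
  next
    case False
    then have "wbdm (consm x (wbd w)) = consm x (wbdm (wbd w))"
      by (intro wbdm_consm_new) (auto dest: keys_wbd_set)
    then show ?thesis using False Cons.IH by simp
  qed
qed simp

definition mapc :: "('a \<Rightarrow> 'b) \<Rightarrow> ('a list \<Rightarrow>\<^sub>0 int) \<Rightarrow> ('b list \<Rightarrow>\<^sub>0 int)" where
  "mapc f = frag_extend (\<lambda>w. frag_of (map f w))"

lemma mapc_0 [simp]: "mapc f 0 = 0"
  and mapc_of [simp]: "mapc f (frag_of w) = frag_of (map f w)"
  and mapc_diff: "mapc f (a - b) = mapc f a - mapc f b"
  by (simp_all add: mapc_def frag_extend_diff)

lemma mapc_consm: "mapc f (consm y z) = consm (f y) (mapc f z)"
  by (rule frag_additive_eqI[where c = z]) (auto simp: consm_linear mapc_diff)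

lemma removeAll_map_inj_on:
  "inj_on f (insert x (set w)) \<Longrightarrow> removeAll (f x) (map f w) = map f (removeAll x w)"
  by (induction w) (auto simp: inj_on_def)

lemma count_list_map_inj_on: "inj_on f (insert x (set w)) \<Longrightarrow> count_list (map f w) (f x) = count_list w x"
  by (induction w) (auto simp: inj_on_def)

lemma wbd_map: "inj_on f (set w) \<Longrightarrow> wbd (map f w) = mapc f (wbd w)"
proof (induction w)
  case (Cons x w)
  have "f x \<in> f ` set w \<longleftrightarrow> x \<in> set w" using Cons.prems by (auto simp: inj_on_def)
  moreover have "wrem (f x) (frag_of (map f w)) = mapc f (wrem x (frag_of w))"
    using Cons.prems by (simp add: wrem_of removeAll_map_inj_on count_list_map_inj_on)
  ultimately show ?case
    using Cons by (simp add: mapc_diff mapc_consm inj_on_insert)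
qed simp

section \<open>Substitution of words\<close>

text \<open>The degree as an exponent of \<open>-1\<close>. It counts the caesurae, since every
  letter has exactly one occurrence that is not a caesura.\<close>

definition wexc :: "'a list \<Rightarrow> nat" where
  "wexc w = length w - card (set w)"

lemma wexc_Cons: "wexc (x # w) = (if x \<in> set w then Suc (wexc w) else wexc w)"
  using card_length[of w] by (auto simp: wexc_def insert_absorb)

lemma keys_wbd_wexc: "q \<in> Poly_Mapping.keys (wbd w) \<Longrightarrow> wexc w = Suc (wexc q)"
  using keys_wbd_set[of q w] keys_wbd_length[of q w] card_length[of q] by (simp add: wexc_def)

lemma wexc_removeAll_single:
  assumes "count_list w x = 1"
  shows "wexc (removeAll x w) = wexc w"
proof -
  have "x \<in> set w" using assms count_list_0_iff[of w x] by auto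
  then have "card (set w) = Suc (card (set w - {x}))" by (metis List.finite_set card_Suc_Diff1)
  then show ?thesis using length_removeAll[of x w] assms by (simp add: wexc_def)
qed

text \<open>In the outer word the letter to be substituted is \<^const>\<open>None\<close>. The recursion decides, at each
  letter of the inner word, whether the next block of the outer word is inserted there; the sign
  moves the caesurae of the remaining outer word past the caesurae of the inner one.\<close>

fun wsub :: "'a option list \<Rightarrow> 'a list \<Rightarrow> ('a list \<Rightarrow>\<^sub>0 int)" where
  "wsub [] W = 0"
| "wsub (Some x # V) W = consm x (wsub V W)"
| "wsub (None # V) [] = (if None \<in> set V then 0 else frag_of (map the V))"
| "wsub (None # V) (w # W) = consm w (wsub V (w # W)) +
     frag_cmul (if w \<in> set W then (-1) ^ wexc (None # V) else 1) (consm w (wsub (None # V) W))"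

text \<open>Without a placeholder the recursion copies letters until it meets
  \<open>wsub [] W = 0\<close>. This default discards the choice of leaving the last placeholder
  before the inner word is used up.\<close>

lemma wsub_no_None: "None \<notin> set V \<Longrightarrow> wsub V W = 0"
  by (induction V W rule: wsub.induct) auto

lemma count_list_map_the: "None \<notin> set V \<Longrightarrow> count_list (map the V) x = count_list V (Some x)"
  by (induction V) auto

lemma keys_wsub_outer:
  "q \<in> Poly_Mapping.keys (wsub V W) \<Longrightarrow> x \<notin> set W \<Longrightarrow> count_list q x = count_list V (Some x)"
proof (induction V W arbitrary: q rule: wsub.induct)
  case (4 V w W)
  then show ?case by (auto dest!: in_keys_plus keys_consm)
qed (auto dest!: keys_consm simp: count_list_map_the split: if_splits)

lemma keys_wsub_inner:
  "q \<in> Poly_Mapping.keys (wsub V W) \<Longrightarrow> x \<in> set W \<Longrightarrow> x \<in> set q"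
proof (induction V W arbitrary: q rule: wsub.induct)
  case (4 V w W)
  then show ?case by (auto dest!: in_keys_plus keys_consm)
qed (auto dest!: keys_consm)

text \<open>Each word of the substitution contains \<open>x\<close> as often as \<open>V\<close>
  does. Erasing a single letter preserves the excess, hence the signs of the recursion.\<close>

lemma wrem_wsub_outer:
  "x \<notin> set W \<Longrightarrow>
   wrem x (wsub V W) = (if count_list V (Some x) = 1 then wsub (removeAll (Some x) V) W else 0)"
proof (cases "count_list V (Some x) = 1")
  case False
  then show "x \<notin> set W \<Longrightarrow> ?thesis"
    by (auto intro!: wrem_eq_0 simp: keys_wsub_outer)
next
  case True
  have "x \<notin> set W \<Longrightarrow> count_list V (Some x) = 1 \<Longrightarrow> wrem x (wsub V W) = wsub (removeAll (Some x) V) W"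
  proof (induction V W rule: wsub.induct)
    case (2 y V W)
    show ?case
    proof (cases "x = y")
      case True
      then have "Some x \<notin> set V" using 2 by (simp add: count_list_0_iff)
      moreover have "wrem x (consm x (wsub V W)) = wsub V W"
        by (rule wrem_consm_same)
          (use keys_wsub_outer[OF _ \<open>x \<notin> set W\<close>] calculation in \<open>metis count_list_0_iff\<close>)
      ultimately show ?thesis using True by simp
    next
      case False
      then show ?thesis using 2 by (simp add: wrem_consm_neq)
    qed
  next
    case (3 V)
    have "None \<notin> set V \<Longrightarrow> removeAll x (map the V) = map the (removeAll (Some x) V)" for x :: 'a
      by (induction V) auto
    then show ?case using 3 by (auto simp: wrem_of count_list_map_the)
  next
    case (4 V w W)
    have "wexc (removeAll (Some x) V) = wexc V"
      using 4 by (simp add: wexc_removeAll_single)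
    then have "wexc (None # V) = wexc (None # removeAll (Some x) V)"
      by (auto simp: wexc_Cons)
    then show ?case using 4 by (auto simp: wrem_linear wrem_consm_neq)
  qed simp
  then show "x \<notin> set W \<Longrightarrow> ?thesis" using True by simp
qed

text \<open>A word in which the inner word is interrupted at \<open>u\<close> repeats
  \<open>u\<close> and is killed. The surviving words are interrupted only at other letters, so
  erasing \<open>u\<close> gives the extensions by the shortened inner word.\<close>

lemma wrem_wsub_inner:
  "u \<in> set W \<Longrightarrow> Some u \<notin> set V \<Longrightarrow>
   wrem u (wsub V W) = (if count_list W u = 1 then wsub V (removeAll u W) else 0)"
proof (induction V W rule: wsub.induct)
  case (2 y V W)
  then show ?case by (auto simp add: wrem_consm_neq)
next
  case (4 V w W)
  show ?case
  proof (cases "w = u")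
    case True
    have 1: "wrem u (consm u (wsub V (u # W))) = 0"
      by (rule wrem_consm_repeated) (auto intro: keys_wsub_inner)
    show ?thesis
    proof (cases "u \<in> set W")
      case u: True
      then have 2: "wrem u (consm u (wsub (None # V) W)) = 0"
        by (intro wrem_consm_repeated) (auto simp del: wsub.simps intro: keys_wsub_inner)
      have "count_list (w # W) u \<noteq> 1" using u True by (auto simp: count_list_0_iff)
      then show ?thesis using True 1 2 by (auto simp: wrem_linear)
    next
      case u: False
      have "u \<notin> set q" if "q \<in> Poly_Mapping.keys (wsub (None # V) W)" for q
        using keys_wsub_outer[OF that u] 4(4) by (simp add: count_list_0_iff)
      then have 2: "wrem u (consm u (wsub (None # V) W)) = wsub (None # V) W"
        by (rule wrem_consm_same)
      show ?thesis using True 1 2 u by (auto simp: wrem_linear count_list_0_iff)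
    qed
  next
    case False
    then show ?thesis using 4 by (auto simp: wrem_linear wrem_consm_neq)
  qed
qed auto

section \<open>Substitution extended linearly in either word\<close>

definition wsub_left :: "('a option list \<Rightarrow>\<^sub>0 int) \<Rightarrow> 'a list \<Rightarrow> ('a list \<Rightarrow>\<^sub>0 int)" where
  "wsub_left z W = frag_extend (\<lambda>V. wsub V W) z"

definition wsub_right :: "'a option list \<Rightarrow> ('a list \<Rightarrow>\<^sub>0 int) \<Rightarrow> ('a list \<Rightarrow>\<^sub>0 int)" where
  "wsub_right V z = frag_extend (wsub V) z"

lemma wsub_left_0 [simp]: "wsub_left 0 W = 0"
  and wsub_left_of [simp]: "wsub_left (frag_of V) W = wsub V W"
  and wsub_left_add: "wsub_left (a + b) W = wsub_left a W + wsub_left b W"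
  and wsub_left_diff: "wsub_left (a - b) W = wsub_left a W - wsub_left b W"
  and wsub_left_minus: "wsub_left (- a) W = - wsub_left a W"
  and wsub_left_cmul: "wsub_left (frag_cmul k a) W = frag_cmul k (wsub_left a W)"
  by (simp_all add: wsub_left_def frag_extend_add frag_extend_diff frag_extend_minus frag_extend_cmul)

lemmas wsub_left_linear = wsub_left_add wsub_left_diff wsub_left_minus wsub_left_cmul

lemma wsub_right_0 [simp]: "wsub_right V 0 = 0"
  and wsub_right_of [simp]: "wsub_right V (frag_of W) = wsub V W"
  and wsub_right_add: "wsub_right V (a + b) = wsub_right V a + wsub_right V b"
  and wsub_right_diff: "wsub_right V (a - b) = wsub_right V a - wsub_right V b"
  and wsub_right_minus: "wsub_right V (- a) = - wsub_right V a"
  and wsub_right_cmul: "wsub_right V (frag_cmul k a) = frag_cmul k (wsub_right V a)"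
  by (simp_all add: wsub_right_def frag_extend_add frag_extend_diff frag_extend_minus frag_extend_cmul)

lemmas wsub_right_linear = wsub_right_add wsub_right_diff wsub_right_minus wsub_right_cmul

lemma wsub_left_consm_Some: "wsub_left (consm (Some x) z) W = consm x (wsub_left z W)"
  by (rule frag_additive_eqI[where c = z]) (simp_all add: wsub_left_linear consm_linear)

lemma wsub_right_consm_Some: "wsub_right (Some x # V) z = consm x (wsub_right V z)"
  by (rule frag_additive_eqI[where c = z]) (simp_all add: wsub_right_linear consm_linear)

lemma wsub_left_no_None:
  "(\<And>q. q \<in> Poly_Mapping.keys z \<Longrightarrow> None \<notin> set q) \<Longrightarrow> wsub_left z W = 0"
  unfolding wsub_left_def by (rule frag_extend_eq_0) (simp add: wsub_no_None)

lemma wsub_right_no_None: "None \<notin> set V \<Longrightarrow> wsub_right V z = 0"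
  unfolding wsub_right_def by (rule frag_extend_eq_0) (simp add: wsub_no_None)

lemma diff_plus_diff: "(a - b) + (c - d) = (a + c) - (b + d :: 'a :: ab_group_add)"
  by simp

text \<open>The sign in the recursion depends on the outer word, so the recursion extends to a chain
  only when the parity of the excess is constant on it.\<close>

lemma wsub_left_consm_None:
  assumes "\<And>q. q \<in> Poly_Mapping.keys z \<Longrightarrow> (-1 :: int) ^ wexc (None # q) = s"
  shows "wsub_left (consm None z) (w # W) = consm w (wsub_left z (w # W)) +
    frag_cmul (if w \<in> set W then s else 1) (consm w (wsub_left (consm None z) W))"
proof (rule frag_additive_eqI[where c = z], goal_cases)
  case (3 q)
  then show ?case using assms[OF 3] by simp
qed (simp_all only: wsub_left_linear consm_linear frag_cmul_diff diff_plus_diff)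

text \<open>The sign also depends on whether \<open>w\<close> recurs in the inner word, so this has
  to be constant on the chain.\<close>

lemma wsub_right_consm_None:
  assumes "\<And>q. q \<in> Poly_Mapping.keys z \<Longrightarrow> w \<in> set q \<longleftrightarrow> b"
  shows "wsub_right (None # V) (consm w z) = consm w (wsub_right V (consm w z)) +
    frag_cmul (if b then (-1) ^ wexc (None # V) else 1) (consm w (wsub_right (None # V) z))"
proof (rule frag_additive_eqI[where c = z], goal_cases)
  case (3 q)
  then show ?case using assms[OF 3] by simp
qed (simp_all only: wsub_right_linear consm_linear frag_cmul_diff diff_plus_diff)

lemma neg_one_power_cases:
  obtains "(-1 :: int) ^ n = 1" | "(-1 :: int) ^ n = -1"
  by (metis neg_one_even_power neg_one_odd_power)

lemma wsub_left_wrem: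
  "wsub_left (wrem y (frag_of V)) W = (if count_list V y = 1 then wsub (removeAll y V) W else 0)"
  by (simp add: wrem_of)

lemma wsub_right_wrem:
  "wsub_right V (wrem y (frag_of W)) = (if count_list W y = 1 then wsub V (removeAll y W) else 0)"
  by (simp add: wrem_of)

lemma keys_wrem: "q \<in> Poly_Mapping.keys (wrem x (frag_of w)) \<Longrightarrow> q = removeAll x w \<and> count_list w x = 1"
  by (cases "count_list w x = 1") (simp_all add: wrem_of)

text \<open>Stated for all words with disjoint letters, so that it applies to the tails met in the
  recursion. The substance is in the case of a leading placeholder and a nonempty inner word, where
  both summands of \<open>wsub\<close> contribute and the terms joining them have to cancel.\<close>

theorem wbdm_wsub:
  assumes "\<And>x. Some x \<in> set V \<Longrightarrow> x \<notin> set W"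
  shows "wbdm (wsub V W) =
    wsub_left (wbd V) W + frag_cmul ((-1) ^ wexc V) (wsub_right V (wbd W))"
  using assms
proof (induction V W rule: wsub.induct)
  case (1 W)
  have "wsub_right [] (wbd W) = 0" by (rule wsub_right_no_None) simp
  then show ?case by simp
next
  case (2 x V W)
  have IH: "wbdm (wsub V W) = wsub_left (wbd V) W + frag_cmul ((-1) ^ wexc V) (wsub_right V (wbd W))"
    using 2 by simp
  have x: "x \<notin> set W" using 2 by simp
  have k: "x \<in> set q \<longleftrightarrow> Some x \<in> set V" if "q \<in> Poly_Mapping.keys (wsub V W)" for q
    using keys_wsub_outer[OF that x] count_list_0_iff[of q x] count_list_0_iff[of V "Some x"] by simp
  show ?case
  proof (cases "Some x \<in> set V")
    case True
    have "wbdm (consm x (wsub V W)) =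
        consm x (wrem x (wsub V W)) - consm x (wbdm (wsub V W)) - wsub V W"
      by (rule wbdm_consm_old) (use True k in blast)
    moreover have "wrem x (wsub V W) = wsub_left (wrem (Some x) (frag_of V)) W"
      using x by (simp add: wsub_left_wrem wrem_wsub_outer)
    ultimately show ?thesis
      using True IH by (simp add: wsub_left_linear wsub_left_consm_Some wsub_right_consm_Some wexc_Cons
          consm_linear frag_cmul_distrib2 flip: minus_frag_cmul)
  next
    case False
    have "wbdm (consm x (wsub V W)) = consm x (wbdm (wsub V W))"
      by (rule wbdm_consm_new) (use False k in blast)
    then show ?thesis
      using False IH by (simp add: wsub_left_consm_Some wsub_right_consm_Some wexc_Cons consm_linear)
  qed
next
  case (3 V)
  show ?case
  proof (cases "None \<in> set V")
    case False
    have "wsub_left (consm None z) [] = mapc the z"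
      if "\<And>q. q \<in> Poly_Mapping.keys z \<Longrightarrow> None \<notin> set q" for z :: "'a option list \<Rightarrow>\<^sub>0 int"
      by (rule frag_additive_eqI[where c = z])
        (use that in \<open>auto simp: wsub_left_linear consm_linear mapc_diff\<close>)
    then have 1: "wsub_left (consm None (wbd V)) [] = mapc the (wbd V)"
      using False by (auto dest: keys_wbd_set)
    have "inj_on the (set V)"
      using False by (intro inj_onI) (metis option.expand)
    then have "wbd (map the V) = mapc the (wbd V)" by (rule wbd_map)
    with False 1 show ?thesis by simp
  next
    case True
    have 1: "wsub_left (consm None (wbd V)) [] = 0"
    proof -
      have "wsub_left (consm None z) [] = 0" if "\<And>q. q \<in> Poly_Mapping.keys z \<Longrightarrow> None \<in> set q"
        for z :: "'a option list \<Rightarrow>\<^sub>0 int"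
        by (rule frag_additive_eqI[where c = z])
          (use that in \<open>auto simp: wsub_left_linear consm_linear\<close>)
      then show ?thesis using True by (auto dest: keys_wbd_set)
    qed
    \<comment> \<open>Substituting the empty word erases a placeholder that occurs once and kills
      all other words with placeholders. Hence the \<open>wrem\<close> term of the boundary of
      \<open>None # V\<close> cancels against \<open>- frag_of V\<close>.\<close>
    have "wsub V [] = (if count_list V None = 1 then frag_of (map the (removeAll None V)) else 0)"
    proof (induction V rule: list.induct)
      case (Cons y V)
      show ?case
      proof (cases y)
        case None
        then show ?thesis by (auto simp: count_list_0_iff)
      qed (use Cons in auto)
    qed simp
    then show ?thesis using True 1 by (auto simp: wsub_left_linear wrem_of)
  qed
next
  case (4 V w W)
  let ?G = "wsub V (w # W)" and ?H = "wsub (None # V) W" and ?z = "wbd V" and ?Z = "wbd W"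
  define s :: int where "s = (-1) ^ wexc (None # V)"
  have w: "Some w \<notin> set V" using 4 by auto
  have IH1: "wbdm ?G = wsub_left ?z (w # W) + frag_cmul ((-1) ^ wexc V) (wsub_right V (wbd (w # W)))"
    using 4 by auto
  have IH2: "wbdm ?H = wsub_left (wbd (None # V)) W + frag_cmul s (wsub_right (None # V) ?Z)"
    unfolding s_def using 4 by auto
  \<comment> \<open>Every word of \<open>?G\<close> contains \<open>w\<close> again, because the
    next block resumes with it; the prefixed \<open>w\<close> is thus always a caesura.\<close>
  have G: "wbdm (consm w ?G) =
      (if w \<in> set W then 0 else consm w (wsub V W)) - consm w (wbdm ?G) - ?G"
  proof -
    have "wbdm (consm w ?G) = consm w (wrem w ?G) - consm w (wbdm ?G) - ?G"
      by (rule wbdm_consm_old) (auto intro: keys_wsub_inner)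
    moreover have "wrem w ?G = (if w \<in> set W then 0 else wsub V W)"
      using w wrem_wsub_inner[of w "w # W" V] by (auto simp: count_list_0_iff)
    ultimately show ?thesis by simp
  qed
  have H: "wbdm (consm w ?H) = (if w \<in> set W
      then consm w (wsub_right (None # V) (wrem w (frag_of W))) - consm w (wbdm ?H) - ?H
      else consm w (wbdm ?H))"
  proof (cases "w \<in> set W")
    case True
    then have "wbdm (consm w ?H) = consm w (wrem w ?H) - consm w (wbdm ?H) - ?H"
      by (intro wbdm_consm_old) (auto simp del: wsub.simps intro: keys_wsub_inner)
    moreover have "wrem w ?H = wsub_right (None # V) (wrem w (frag_of W))"
      unfolding wsub_right_wrem by (rule wrem_wsub_inner) (use True w in auto)
    ultimately show ?thesis using True by (simp del: wsub.simps)
  next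
    case False
    have "w \<notin> set q" if "q \<in> Poly_Mapping.keys ?H" for q
      using keys_wsub_outer[OF that False] w count_list_0_iff[of V "Some w"]
      by (simp add: count_list_0_iff)
    then have "wbdm (consm w ?H) = consm w (wbdm ?H)"
      by (rule wbdm_consm_new)
    then show ?thesis using False by (simp del: wsub.simps)
  qed
  have sub: "wsub (None # V) (w # W) = consm w ?G + frag_cmul (if w \<in> set W then s else 1) (consm w ?H)"
    by (simp add: s_def)
  \<comment> \<open>A boundary term of \<open>V\<close> has excess one less and the same letters, so
    its sign is opposite to \<open>s\<close>.\<close>
  have Lz: "wsub_left (consm None ?z) (w # W) = consm w (wsub_left ?z (w # W)) +
      frag_cmul (if w \<in> set W then - s else 1) (consm w (wsub_left (consm None ?z) W))"
  proof (rule wsub_left_consm_None)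
    fix q assume "q \<in> Poly_Mapping.keys ?z"
    then show "(-1) ^ wexc (None # q) = - s"
      using keys_wbd_wexc[of q V] keys_wbd_set[of q V] by (auto simp: s_def wexc_Cons)
  qed
  \<comment> \<open>Erasing the second placeholder makes the first one lose its status as a caesura;
    this again lowers the excess of \<open>None # V\<close> by one.\<close>
  have Lr: "wsub_left (consm None (wrem None (frag_of V))) (w # W) =
      frag_cmul (if w \<in> set W then - s else 1)
        (consm w (wsub_left (consm None (wrem None (frag_of V))) W))" if "None \<in> set V"
  proof -
    have "(-1) ^ wexc (None # q) = - s" if "q \<in> Poly_Mapping.keys (wrem None (frag_of V))" for q
      using keys_wrem[OF that] \<open>None \<in> set V\<close>
      by (auto simp: s_def wexc_Cons wexc_removeAll_single)
    note this[THEN wsub_left_consm_None]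
    moreover have "wsub_left (wrem None (frag_of V)) (w # W) = 0"
      by (rule wsub_left_no_None) (auto dest: keys_wrem)
    ultimately show ?thesis by simp
  qed
  have L: "wsub_left (wbd (None # V)) (w # W) =
      frag_cmul (if w \<in> set W then - s else 1)
        (consm w (wsub_left (wbd (None # V)) W) + (if None \<in> set V then consm w (wsub V W) else 0))
      - (if None \<in> set V then consm w (wsub_left ?z (w # W)) + ?G else 0)"
  proof (cases "None \<in> set V")
    case True
    then show ?thesis
      using Lz Lr[OF True]
      by (simp add: wsub_left_linear consm_linear frag_cmul_diff frag_cmul_distrib2 del: wsub.simps)
  next
    case False
    have "wsub_left ?z (w # W) = 0"
      by (rule wsub_left_no_None) (use False keys_wbd_set in blast)
    then show ?thesis using Lz False by (simp add: frag_cmul_distrib2)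
  qed
  \<comment> \<open>The words of \<open>wbd W\<close> keep the letter \<open>w\<close> whereas those
    of \<open>wrem w (frag_of W)\<close> have lost it, so the two chains are expanded with different
    signs.\<close>
  have R: "wsub_right (None # V) (wbd (w # W)) =
      consm w (if w \<in> set W then wsub_right V (wbd (w # W)) + wsub V W else wsub_right V (wbd (w # W)))
      + (if w \<in> set W
         then consm w (wsub_right (None # V) (wrem w (frag_of W)))
              - frag_cmul s (consm w (wsub_right (None # V) ?Z)) - ?H
         else consm w (wsub_right (None # V) ?Z))"
  proof (cases "w \<in> set W")
    case True
    have 1: "wsub_right (None # V) (consm w ?Z) = consm w (wsub_right V (consm w ?Z)) +
        frag_cmul s (consm w (wsub_right (None # V) ?Z))"
      using wsub_right_consm_None[of ?Z w True V] True keys_wbd_set[of _ W] by (simp add: s_def)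
    have "w \<in> set q \<longleftrightarrow> False" if "q \<in> Poly_Mapping.keys (wrem w (frag_of W))" for q
      using keys_wrem[OF that] by simp
    from wsub_right_consm_None[OF this, where V = V]
    have 2: "wsub_right (None # V) (consm w (wrem w (frag_of W))) =
        consm w (wsub_right V (consm w (wrem w (frag_of W)))) +
        consm w (wsub_right (None # V) (wrem w (frag_of W)))" by simp
    show ?thesis using True 1 2 by (simp add: wsub_right_linear consm_linear del: wsub.simps)
  next
    case False
    have "w \<in> set q \<longleftrightarrow> False" if "q \<in> Poly_Mapping.keys ?Z" for q
      using keys_wbd_set[OF that] False by simp
    from wsub_right_consm_None[OF this, where V = V] show ?thesis using False by simp
  qed
  \<comment> \<open>Without a further placeholder the current block cannot be left early, and every
    term passing through \<open>V\<close> vanishes.\<close>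
  have V0: "?G = 0" "wsub V W = 0" "\<And>y. wsub_right V y = 0" "wsub_left ?z (w # W) = 0"
    if "None \<notin> set V"
    using that by (auto intro!: wsub_no_None wsub_right_no_None wsub_left_no_None dest: keys_wbd_set)
  have sV: "(-1) ^ wexc V = (if None \<in> set V then - s else s)"
    by (simp add: s_def wexc_Cons)
  \<comment> \<open>With \<open>s\<close> an explicit unit, what remains in each case is an identity
    of formal sums that can be checked by rearranging.\<close>
  have "s = 1 \<or> s = -1" unfolding s_def by (metis neg_one_power_cases)
  then show ?case
    unfolding sub L R s_def[symmetric] wbdm_add wbdm_cmul G H IH1 IH2
    using V0 sV
    by (cases "w \<in> set W"; cases "None \<in> set V"; elim disjE;
        simp only: sV if_True if_False frag_cmul_one frag_cmul_minus_one minus_minus simp_thms;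
        simp add: consm_linear algebra_simps del: wbd.simps wsub.simps)
qed

section \<open>The boundary of quilts\<close>

lemma caesura_Cons_0: "caesura (x # w) 0 \<longleftrightarrow> x \<in> set w"
proof
  assume "caesura (x # w) 0"
  then obtain j where "0 < j" "j < length (x # w)" "(x # w) ! j = x" by (auto simp: caesura_def)
  then show "x \<in> set w" by (cases j) auto
next
  assume "x \<in> set w"
  then obtain j where "j < length w" "w ! j = x" by (metis in_set_conv_nth)
  then show "caesura (x # w) 0" unfolding caesura_def by (intro exI[of _ "Suc j"]) simp
qed

lemma caesura_Cons_Suc: "caesura (x # w) (Suc i) \<longleftrightarrow> caesura w i"
proof
  assume "caesura (x # w) (Suc i)"
  then obtain j where "Suc i < j" "j < length (x # w)" "(x # w) ! j = w ! i" by (auto simp: caesura_def)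
  then show "caesura w i" unfolding caesura_def by (intro exI[of _ "j - 1"]) auto
next
  assume "caesura w i"
  then obtain j where "i < j" "j < length w" "w ! j = w ! i" by (auto simp: caesura_def)
  then show "caesura (x # w) (Suc i)" unfolding caesura_def by (intro exI[of _ "Suc j"]) simp
qed

lemma caesura_number_Cons_0: "caesura_number (x # w) 0 = (if x \<in> set w then 1 else 0)"
proof -
  have "{j. j \<le> 0 \<and> caesura (x # w) j} = (if x \<in> set w then {0} else {})"
    by (auto simp: caesura_Cons_0)
  then show ?thesis by (simp add: caesura_number_def)
qed

lemma caesura_number_Cons_Suc:
  "caesura_number (x # w) (Suc i) = (if x \<in> set w then 1 else 0) + caesura_number w i"
proof -
  have "{j. j \<le> Suc i \<and> caesura (x # w) j} =
      (if x \<in> set w then {0} else {}) \<union> Suc ` {j. j \<le> i \<and> caesura w j}" (is "?A = ?B")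
  proof (rule Set.set_eqI)
    fix j show "j \<in> ?A \<longleftrightarrow> j \<in> ?B"
      by (cases j) (auto simp: caesura_Cons_0 caesura_Cons_Suc)
  qed
  then show ?thesis
    by (simp add: caesura_number_def card_image card_insert_if)
qed

lemma count_list_card: "count_list w x = card {i. i < length w \<and> w ! i = x}"
  by (simp add: count_list_eq_length_filter length_filter_conv_card eq_commute)

lemma repeated_index:
  "i < length w \<Longrightarrow> count_list w (w ! i) \<ge> 2 \<longleftrightarrow> (\<exists>j < length w. j \<noteq> i \<and> w ! j = w ! i)"
proof
  assume i: "i < length w" and c: "count_list w (w ! i) \<ge> 2"
  have "\<not> {j. j < length w \<and> w ! j = w ! i} \<subseteq> {i}"
  proof
    assume "{j. j < length w \<and> w ! j = w ! i} \<subseteq> {i}"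
    from card_mono[OF _ this] show False using c by (simp add: count_list_card)
  qed
  then show "\<exists>j < length w. j \<noteq> i \<and> w ! j = w ! i" by auto
next
  assume "i < length w" "\<exists>j < length w. j \<noteq> i \<and> w ! j = w ! i"
  then obtain j where "j < length w" "j \<noteq> i" "w ! j = w ! i" by auto
  then have "card {i, j} \<le> card {j. j < length w \<and> w ! j = w ! i}"
    using \<open>i < length w\<close> by (intro card_mono) auto
  then show "count_list w (w ! i) \<ge> 2" using \<open>j \<noteq> i\<close> by (simp add: count_list_card)
qed

text \<open>The earlier occurrence inside \<open>w\<close> prevents the new position 0 from being
  the maximum. The complementary situation, where the prefixed letter is the previous occurrence,
  produces the \<open>wrem\<close> term of \<open>wbd\<close>.\<close>

lemma prev_occ_Cons_Suc:
  assumes "j < i" "w ! j = w ! i"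
  shows "prev_occ (x # w) (Suc i) = Suc (prev_occ w i)"
proof -
  let ?A = "{j. j < i \<and> w ! j = w ! i}"
  have "{j. j < Suc i \<and> (x # w) ! j = (x # w) ! Suc i} = (if x = w ! i then {0} else {}) \<union> Suc ` ?A"
    (is "?L = ?R")
  proof (rule Set.set_eqI)
    fix j show "j \<in> ?L \<longleftrightarrow> j \<in> ?R" by (cases j) auto
  qed
  moreover have "Max (Suc ` ?A) = Suc (Max ?A)"
    using assms by (intro mono_Max_commute[symmetric]) (auto simp: mono_def)
  moreover have "Max ({0} \<union> Suc ` ?A) = Max (Suc ` ?A)"
    using assms by (subst Max_Un) auto
  ultimately show ?thesis by (simp add: prev_occ_def)
qed

lemma occ_sgn_Cons_Suc:
  assumes "i < length w" "count_list w (w ! i) \<ge> 2"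
  shows "occ_sgn (x # w) (Suc i) = (if x \<in> set w then - occ_sgn w i else occ_sgn w i)"
proof (cases "caesura w i")
  case True
  then show ?thesis by (simp add: occ_sgn_def caesura_Cons_Suc caesura_number_Cons_Suc)
next
  case False
  obtain j where j: "j < length w" "j \<noteq> i" "w ! j = w ! i" using repeated_index assms by blast
  then have "j < i" using False by (metis caesura_def linorder_neqE_nat)
  then show ?thesis
    using False j by (simp add: occ_sgn_def caesura_Cons_Suc prev_occ_Cons_Suc caesura_number_Cons_Suc)
qed

lemma delete_at_Cons_0: "delete_at 0 (x # w) = w"
  and delete_at_Cons_Suc: "delete_at (Suc i) (x # w) = x # delete_at i w"
  by (simp_all add: delete_at_def)

lemma delete_at_single:
  "i < length w \<Longrightarrow> count_list w (w ! i) = 1 \<Longrightarrow> delete_at i w = removeAll (w ! i) w"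
proof (induction w arbitrary: i)
  case (Cons x w)
  show ?case
  proof (cases i)
    case 0
    then show ?thesis using Cons.prems by (simp add: delete_at_Cons_0 count_list_0_iff)
  next
    case (Suc j)
    then have "w ! j \<in> set w" using Cons.prems by simp
    then have "x \<noteq> w ! j" using Cons.prems Suc by (auto simp: count_list_0_iff)
    then show ?thesis using Cons Suc by (simp add: delete_at_Cons_Suc)
  qed
qed simp

text \<open>The deletable positions of \<open>x # w\<close> are the head if \<open>x\<close> recurs,
  the shifted deletable positions of \<open>w\<close>, and the position of an \<open>x\<close> that
  was single in \<open>w\<close>. These match the terms of the recursion.\<close>

theorem wbd_eq_sum:
  "(\<Sum>i \<in> {i. i < length w \<and> count_list w (w ! i) \<ge> 2}.
      frag_cmul (occ_sgn w i) (frag_of (delete_at i w))) = wbd w"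
proof (induction w)
  case (Cons x w)
  let ?I = "\<lambda>w. {i. i < length w \<and> count_list w (w ! i) \<ge> 2}"
  let ?f = "\<lambda>w i. frag_cmul (occ_sgn w i) (frag_of (delete_at i w))"
  let ?S = "{i. i < length w \<and> w ! i = x \<and> count_list w x = 1}"
  have I: "?I (x # w) = (if x \<in> set w then {0} else {}) \<union> (Suc ` ?I w \<union> Suc ` ?S)" (is "?A = ?B")
  proof (rule Set.set_eqI)
    fix j show "j \<in> ?A \<longleftrightarrow> j \<in> ?B"
    proof (cases j)
      case 0
      have "2 \<le> Suc (count_list w x) \<longleftrightarrow> x \<in> set w" using count_list_0_iff[of w x] by linarith
      then show ?thesis using 0 by auto
    next
      case (Suc i)
      then show ?thesis by (auto simp: image_iff)
    qed
  qed
  have disj: "Suc ` ?I w \<inter> Suc ` ?S = {}" by auto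
  have "sum (?f (x # w)) (?I (x # w)) =
      sum (?f (x # w)) (if x \<in> set w then {0} else {}) + sum (?f (x # w)) (Suc ` ?I w \<union> Suc ` ?S)"
    unfolding I by (rule sum.union_disjoint) auto
  also have "sum (?f (x # w)) (Suc ` ?I w \<union> Suc ` ?S) =
      sum (?f (x # w)) (Suc ` ?I w) + sum (?f (x # w)) (Suc ` ?S)"
    by (rule sum.union_disjoint) (use disj in simp_all)
  also have "sum (?f (x # w)) (Suc ` ?I w) = (\<Sum>i \<in> ?I w. ?f (x # w) (Suc i))"
    by (simp add: sum.reindex)
  also have "\<dots> = (\<Sum>i \<in> ?I w. frag_cmul (if x \<in> set w then -1 else 1) (consm x (?f w i)))"
    by (intro sum.cong) (auto simp: occ_sgn_Cons_Suc delete_at_Cons_Suc consm_cmul)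
  also have "\<dots> = frag_cmul (if x \<in> set w then -1 else 1) (consm x (wbd w))"
    unfolding Cons.IH[symmetric] by (simp add: consm_def frag_cmul_sum frag_extend_sum)
  also have "sum (?f (x # w)) (Suc ` ?S) = (if x \<in> set w then consm x (wrem x (frag_of w)) else 0)"
  proof (cases "count_list w x = 1")
    case True
    then have "x \<in> set w" using count_list_0_iff[of w x] by auto
    then obtain i where i: "i < length w" "w ! i = x" by (metis in_set_conv_nth)
    have uniq: "j = i" if "j < length w" "w ! j = x" for j
    proof (rule ccontr)
      assume "j \<noteq> i"
      then have "\<exists>j < length w. j \<noteq> i \<and> w ! j = w ! i"
        using that i(2) by (intro exI[of _ j]) simp
      then have "count_list w (w ! i) \<ge> 2"
        by (rule iffD2[OF repeated_index[OF i(1)]])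
      then show False unfolding i(2) True by simp
    qed
    have S: "?S = {i}"
    proof (intro equalityI subsetI)
      fix j assume "j \<in> ?S"
      then show "j \<in> {i}" using uniq[of j] by simp
    next
      fix j assume "j \<in> {i}"
      then have "j = i" by simp
      with i True show "j \<in> ?S" by simp
    qed
    have nc: "\<not> caesura w i"
    proof
      assume "caesura w i"
      then obtain j where j: "i < j" "j < length w" "w ! j = w ! i" unfolding caesura_def by blast
      have "j = i" using j(2) j(3)[unfolded i(2)] by (rule uniq)
      then show False using j(1) by simp
    qed
    \<comment> \<open>The previous occurrence is the head, which is caesura number 1, so the sign of
      this last occurrence is \<open>(-1) ^ (1 + 1)\<close>.\<close>
    have "prev_occ (x # w) (Suc i) = 0"
    proof -
      have "{j. j < Suc i \<and> (x # w) ! j = (x # w) ! Suc i} = {0}"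
      proof (intro equalityI subsetI)
        fix j assume j: "j \<in> {j. j < Suc i \<and> (x # w) ! j = (x # w) ! Suc i}"
        show "j \<in> {0}"
        proof (cases j)
          case (Suc k)
          then have "k < i" "w ! k = x" using j i(2) by simp_all
          then show ?thesis using uniq[of k] i(1) by simp
        qed simp
      qed (use i(2) in simp)
      then show ?thesis by (simp add: prev_occ_def)
    qed
    then have "occ_sgn (x # w) (Suc i) = 1"
      using nc \<open>x \<in> set w\<close> by (simp add: occ_sgn_def caesura_Cons_Suc caesura_number_Cons_0)
    moreover have "delete_at i w = removeAll x w" using delete_at_single[of i w] i True by simp
    ultimately show ?thesis
      unfolding S using True \<open>x \<in> set w\<close> by (simp add: wrem_of delete_at_Cons_Suc)
  next
    case False
    then show ?thesis by (simp add: wrem_of)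
  qed
  also have "sum (?f (x # w)) (if x \<in> set w then {0} else {}) = (if x \<in> set w then - frag_of w else 0)"
    by (simp add: occ_sgn_def caesura_Cons_0 caesura_number_Cons_0 delete_at_Cons_0)
  finally show ?case by (auto simp: algebra_simps)
qed simp

section \<open>Chains of quilts with a fixed tree\<close>

definition qpair :: "tree \<Rightarrow> (nat list \<Rightarrow>\<^sub>0 int) \<Rightarrow> (quilt \<Rightarrow>\<^sub>0 int)" where
  "qpair T = frag_extend (\<lambda>W. frag_of (W, T))"

lemma qpair_0 [simp]: "qpair T 0 = 0"
  and qpair_of [simp]: "qpair T (frag_of W) = frag_of (W, T)"
  and qpair_add: "qpair T (a + b) = qpair T a + qpair T b"
  and qpair_diff: "qpair T (a - b) = qpair T a - qpair T b"
  and qpair_cmul: "qpair T (frag_cmul k a) = frag_cmul k (qpair T a)"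
  and qpair_sum: "finite I \<Longrightarrow> qpair T (sum g I) = (\<Sum>i \<in> I. qpair T (g i))"
  by (simp_all add: qpair_def frag_extend_add frag_extend_diff frag_extend_minus frag_extend_cmul
      frag_extend_sum o_def)

lemma keys_qpair: "Q \<in> Poly_Mapping.keys (qpair T z) \<Longrightarrow> \<exists>W \<in> Poly_Mapping.keys z. Q = (W, T)"
  unfolding qpair_def by (erule keys_frag_extend_imp) auto

lemma quilt_bd_basis_eq: "quilt_bd_basis (W, T) = qpair T (wbd W)"
  unfolding wbd_eq_sum[symmetric] quilt_bd_basis_def by (simp add: qpair_sum qpair_cmul)

lemma quilt_bd_0 [simp]: "quilt_bd 0 = 0"
  and quilt_bd_of [simp]: "quilt_bd (frag_of Q) = quilt_bd_basis Q"
  and quilt_bd_add: "quilt_bd (a + b) = quilt_bd a + quilt_bd b"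
  and quilt_bd_diff: "quilt_bd (a - b) = quilt_bd a - quilt_bd b"
  and quilt_bd_sum: "finite I \<Longrightarrow> quilt_bd (sum g I) = (\<Sum>i \<in> I. quilt_bd (g i))"
  by (simp_all add: quilt_bd_def frag_extend_add frag_extend_diff frag_extend_minus frag_extend_cmul
      frag_extend_sum o_def)

lemma quilt_bd_qpair: "quilt_bd (qpair T z) = qpair T (wbdm z)"
  by (rule frag_additive_eqI[where c = z])
     (simp_all add: quilt_bd_diff qpair_diff wbdm_diff quilt_bd_basis_eq)

theorem quilt_bd_quilt_bd: "quilt_bd (quilt_bd z) = 0"
proof -
  have "quilt_bd (quilt_bd z) = (\<lambda>z. 0) z"
    by (rule frag_additive_eqI[where c = z])
      (auto simp: quilt_bd_diff quilt_bd_basis_eq quilt_bd_qpair wbdm_wbd)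
  then show ?thesis by simp
qed

section \<open>Deletions preserve the quilt conditions\<close>

lemma subseq_pair_iff: "subseq [u, v] w \<longleftrightarrow> (\<exists>i j. i < j \<and> j < length w \<and> w ! i = u \<and> w ! j = v)"
proof
  assume "subseq [u, v] w"
  then obtain xs ys where w: "w = xs @ u # ys" and "subseq [v] ys" by (auto dest: list_emb_ConsD)
  then obtain as bs where "ys = as @ v # bs" by (auto dest: list_emb_ConsD)
  then show "\<exists>i j. i < j \<and> j < length w \<and> w ! i = u \<and> w ! j = v"
    using w by (intro exI[of _ "length xs"] exI[of _ "Suc (length xs + length as)"]) (simp add: nth_append)
next
  assume "\<exists>i j. i < j \<and> j < length w \<and> w ! i = u \<and> w ! j = v"
  then obtain i j where ij: "i < j" "j < length w" "w ! i = u" "w ! j = v" by auto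
  then have "w = take i w @ u # drop (Suc i) w" by (metis id_take_nth_drop less_trans)
  moreover have "v \<in> set (drop (Suc i) w)"
    using ij by (auto simp: in_set_conv_nth intro!: exI[of _ "j - Suc i"])
  then have "subseq [v] (drop (Suc i) w)" by (simp add: subseq_singleton_left)
  then have "subseq [u, v] (u # drop (Suc i) w)" by simp
  then have "subseq [u, v] (take i w @ u # drop (Suc i) w)" by (rule list_emb_append2)
  ultimately show "subseq [u, v] w" by simp
qed

lemma subseq_triple_iff:
  "subseq [u, v, x] w \<longleftrightarrow>
     (\<exists>i j k. i < j \<and> j < k \<and> k < length w \<and> w ! i = u \<and> w ! j = v \<and> w ! k = x)"
proof
  assume "subseq [u, v, x] w"
  then obtain xs ys where w: "w = xs @ u # ys" and "subseq [v, x] ys" by (auto dest: list_emb_ConsD)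
  then obtain j k where "j < k" "k < length ys" "ys ! j = v" "ys ! k = x"
    by (auto simp: subseq_pair_iff)
  then show "\<exists>i j k. i < j \<and> j < k \<and> k < length w \<and> w ! i = u \<and> w ! j = v \<and> w ! k = x"
    using w by (intro exI[of _ "length xs"] exI[of _ "Suc (length xs + j)"]
        exI[of _ "Suc (length xs + k)"]) (simp add: nth_append)
next
  assume "\<exists>i j k. i < j \<and> j < k \<and> k < length w \<and> w ! i = u \<and> w ! j = v \<and> w ! k = x"
  then obtain i j k where ij: "i < j" "j < k" "k < length w" "w ! i = u" "w ! j = v" "w ! k = x" by auto
  then have "w = take i w @ u # drop (Suc i) w" by (metis id_take_nth_drop less_trans)
  moreover have "subseq [v, x] (drop (Suc i) w)"
    unfolding subseq_pair_iff
    using ij by (intro exI[of _ "j - Suc i"] exI[of _ "k - Suc i"]) auto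
  then have "subseq [u, v, x] (u # drop (Suc i) w)" by simp
  then have "subseq [u, v, x] (take i w @ u # drop (Suc i) w)" by (rule list_emb_append2)
  ultimately show "subseq [u, v, x] w" by simp
qed

text \<open>In terms of \<open>subseq\<close> both conditions visibly pass to subsequences, and they
  can be transported along \<open>map\<close>, \<open>filter\<close> and
  \<open>remdups_adj\<close>.\<close>

lemma Quilts_iff:
  "(W, T) \<in> Quilts n \<longleftrightarrow> W \<in> F2S n \<and> T \<in> Tree n \<and>
     (\<forall>u v. subseq [u, v] W \<longrightarrow> (v, u) \<notin> vless T) \<and>
     (\<forall>u v. subseq [u, v, u] W \<longrightarrow> (v, u) \<in> horder T)"
proof -
  have "(\<forall>i j. i < j \<and> j < length W \<longrightarrow> (W ! j, W ! i) \<notin> vless T) \<longleftrightarrow>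
      (\<forall>u v. subseq [u, v] W \<longrightarrow> (v, u) \<notin> vless T)"
    unfolding subseq_pair_iff by blast
  moreover have "(\<forall>i j k. i < j \<and> j < k \<and> k < length W \<and> W ! i = W ! k \<longrightarrow> (W ! j, W ! i) \<in> horder T) \<longleftrightarrow>
      (\<forall>u v. subseq [u, v, u] W \<longrightarrow> (v, u) \<in> horder T)"
    unfolding subseq_triple_iff by metis
  ultimately show ?thesis by (simp add: Quilts_def)
qed

lemma subseq_delete: "subseq (xs @ ys) (xs @ u # ys)"
  by (simp only: subseq_append') (rule list_emb_Cons, simp)

text \<open>Only the adjacency condition is at risk. If both neighbours of the deleted
  \<open>u\<close> were \<open>v\<close>, another occurrence of \<open>u\<close> on either side of
  \<open>v u v\<close> would give the forbidden pattern \<open>u v u v\<close> or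
  \<open>v u v u\<close>.\<close>

lemma F2S_delete:
  assumes "xs @ u # ys \<in> F2S n" "u \<in> set (xs @ ys)"
  shows "xs @ ys \<in> F2S n"
proof -
  have s: "set (xs @ u # ys) = {1..n}" and d: "distinct_adj (xs @ u # ys)"
    and ns: "\<And>u' v. u' \<noteq> v \<Longrightarrow> \<not> subseq [u', v, u', v] (xs @ u # ys)"
    using assms(1) by (auto simp: F2S_def)
  have sub: "subseq (xs @ ys) (xs @ u # ys)" by (simp add: subseq_delete)
  have "distinct_adj (xs @ ys)"
  proof (cases "xs = [] \<or> ys = []")
    case True
    then show ?thesis using d by (auto simp: distinct_adj_append_iff distinct_adj_Cons)
  next
    case False
    then obtain xs' v ys' v' where xy: "xs = xs' @ [v]" "ys = v' # ys'"
      by (metis neq_Nil_conv rev_exhaust)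
    have "v \<noteq> u" "v' \<noteq> u" using d xy by (auto simp: distinct_adj_append_iff)
    have "v \<noteq> v'"
    proof
      assume "v = v'"
      then consider "u \<in> set xs'" | "u \<in> set ys'" using assms(2) xy \<open>v \<noteq> u\<close> by auto
      then show False
      proof cases
        case 1
        then have "subseq ([u] @ [v, u, v]) (xs' @ [v, u, v])"
          by (intro list_emb_append_mono) (auto simp: subseq_singleton_left)
        then have "subseq [u, v, u, v] ((xs' @ [v, u, v]) @ ys')"
          by (simp only: append_Cons append_Nil list_emb_prefix)
        then show False using ns[of u v] xy \<open>v = v'\<close> \<open>v \<noteq> u\<close> by simp
      next
        case 2
        then have "subseq ([v, u, v] @ [u]) ([v, u, v] @ ys')"
          by (intro list_emb_append_mono) (auto simp: subseq_singleton_left)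
        then have "subseq [v, u, v, u] (xs' @ [v, u, v] @ ys')"
          by (simp only: append_Cons append_Nil list_emb_append2)
        then show False using ns[of v u] xy \<open>v = v'\<close> \<open>v \<noteq> u\<close> by simp
      qed
    qed
    then show ?thesis using d xy by (auto simp: distinct_adj_append_iff distinct_adj_Cons)
  qed
  moreover have "\<not> subseq [u', v, u', v] (xs @ ys)" if "u' \<noteq> v" for u' v
    using ns[OF that] sub subseq_order.order_trans by blast
  moreover have "set (xs @ ys) = {1..n}" using s assms(2) by auto
  ultimately show ?thesis by (simp add: F2S_def)
qed

lemma keys_wbd_delete:
  fixes w :: "nat list"
  assumes "q \<in> Poly_Mapping.keys (wbd w)"
  obtains xs u ys where "w = xs @ u # ys" "q = xs @ ys" "u \<in> set (xs @ ys)"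
proof -
  obtain i where i: "i < length w" "count_list w (w ! i) \<ge> 2" "q = delete_at i w"
  proof -
    have "q \<in> Poly_Mapping.keys (\<Sum>i \<in> {i. i < length w \<and> count_list w (w ! i) \<ge> 2}.
        frag_cmul (occ_sgn w i) (frag_of (delete_at i w)))"
      using assms by (simp add: wbd_eq_sum)
    then obtain i where "i \<in> {i. i < length w \<and> count_list w (w ! i) \<ge> 2}"
      "q \<in> Poly_Mapping.keys (frag_cmul (occ_sgn w i) (frag_of (delete_at i w)))"
      using keys_sum[of "\<lambda>i. frag_cmul (occ_sgn w i) (frag_of (delete_at i w))"] by blast
    then show ?thesis using that[of i] by simp
  qed
  have w: "w = take i w @ w ! i # drop (Suc i) w" using i(1) by (rule id_take_nth_drop)
  have "count_list w (w ! i) = Suc (count_list (take i w @ drop (Suc i) w) (w ! i))"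
    using arg_cong[OF w, of "\<lambda>v. count_list v (w ! i)"] by simp
  then have "w ! i \<in> set (take i w @ drop (Suc i) w)"
    using i(2) count_list_0_iff[of "take i w @ drop (Suc i) w" "w ! i"] by force
  then show ?thesis using that[OF w] i(3) by (simp add: delete_at_def)
qed

lemma F2S_wbd: "W \<in> F2S n \<Longrightarrow> q \<in> Poly_Mapping.keys (wbd W) \<Longrightarrow> q \<in> F2S n"
  by (metis F2S_delete keys_wbd_delete)

lemma Quilts_wbd:
  assumes "(W, T) \<in> Quilts n" "q \<in> Poly_Mapping.keys (wbd W)"
  shows "(q, T) \<in> Quilts n"
proof -
  obtain xs u ys where "W = xs @ u # ys" "q = xs @ ys" using keys_wbd_delete[OF assms(2)] .
  then have "subseq q W" by (simp add: subseq_delete)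
  moreover have "q \<in> F2S n" using F2S_wbd assms by (auto simp: Quilts_iff)
  ultimately show ?thesis
    using assms(1) subseq_order.order_trans by (simp add: Quilts_iff)
qed

lemma wdeg_wbd: "q \<in> Poly_Mapping.keys (wbd W) \<Longrightarrow> wdeg q = wdeg W - 1"
  using keys_wbd[of q W] by (simp add: wdeg_def)

lemma wdeg_eq_wexc: "wdeg w = int (wexc w)"
  using card_length[of w] by (simp add: wdeg_def wexc_def)

abbreviation qchains :: "nat \<Rightarrow> int \<Rightarrow> (quilt \<Rightarrow>\<^sub>0 int) set" where
  "qchains n k \<equiv> {x. Poly_Mapping.keys x \<subseteq> {Q \<in> Quilts n. qdeg Q = k}}"

lemma carrier_Quilt_op: "carrier (piece Quilt_op n k) = qchains n k"
  by (auto simp: Quilt_op_def)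

lemma quilt_bd_closed:
  assumes "x \<in> qchains n k" shows "quilt_bd x \<in> qchains n (k - 1)"
proof -
  have "R \<in> Quilts n \<and> qdeg R = k - 1" if "R \<in> Poly_Mapping.keys (quilt_bd x)" for R
  proof -
    from that obtain Q where "Q \<in> Poly_Mapping.keys x" "R \<in> Poly_Mapping.keys (quilt_bd_basis Q)"
      unfolding quilt_bd_def by (rule keys_frag_extend_imp)
    moreover obtain W T where "Q = (W, T)" by fastforce
    ultimately show ?thesis
      using assms keys_qpair[of R T "wbd W"] Quilts_wbd[of W T n] wdeg_wbd[of _ W]
      by (auto simp: quilt_bd_basis_eq qdeg_def)
  qed
  then show ?thesis by auto
qed

section \<open>Words with adjacent repetitions\<close>

text \<open>Deleting \<open>u\<close> from \<open>v u v\<close> leaves two adjacent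
  \<open>v\<close>. Relation (4) sends the corresponding composite to zero, and this projection is
  its counterpart on chains of words.\<close>

definition dadj :: "('a list \<Rightarrow>\<^sub>0 int) \<Rightarrow> ('a list \<Rightarrow>\<^sub>0 int)" where
  "dadj = frag_extend (\<lambda>w. if distinct_adj w then frag_of w else 0)"

lemma dadj_0 [simp]: "dadj 0 = 0"
  and dadj_of: "dadj (frag_of w) = (if distinct_adj w then frag_of w else 0)"
  and dadj_diff: "dadj (a - b) = dadj a - dadj b"
  by (simp_all add: dadj_def frag_extend_diff)

lemma dadj_consm: "dadj (consm x z) = dadj (consm x (dadj z))"
  by (rule frag_additive_eqI[where c = z]) (auto simp: dadj_diff consm_linear dadj_of distinct_adj_Cons)

text \<open>A letter that occurs once neither belongs to a pair of equal neighbours nor stands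
  between them.\<close>

lemma not_distinct_adj_removeAll:
  "\<not> distinct_adj w \<Longrightarrow> count_list w x = 1 \<Longrightarrow> \<not> distinct_adj (removeAll x w)"
proof (induction w)
  case (Cons y w)
  show ?case
  proof (cases "w \<noteq> [] \<and> hd w = y")
    case True
    then obtain w' where "w = y # w'" by (cases w) auto
    then show ?thesis using Cons.prems by (auto simp: distinct_adj_Cons split: if_splits)
  next
    case False
    then have n: "\<not> distinct_adj w" using Cons.prems by (auto simp: distinct_adj_Cons)
    show ?thesis
    proof (cases "x = y")
      case True
      then show ?thesis using Cons.prems n by (simp add: count_list_0_iff)
    next
      case False
      then show ?thesis using Cons.IH Cons.prems n by (auto simp: distinct_adj_Cons)
    qed
  qed
qed simp

text \<open>The two deletions inside a pair of equal neighbours give the same word with opposite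
  signs, and any other deletion keeps the pair. Hence the degenerate words span a
  subcomplex.\<close>

lemma dadj_wbd: "\<not> distinct_adj w \<Longrightarrow> dadj (wbd w) = 0"
proof (induction w)
  case (Cons x w)
  show ?case
  proof (cases "w \<noteq> [] \<and> hd w = x")
    case True
    then obtain v where w: "w = x # v" by (cases w) auto
    have "dadj (consm x (consm x z)) = 0" for z
    proof -
      have "dadj (consm x (consm x z)) = (\<lambda>z. 0) z"
        by (rule frag_additive_eqI[where c = z]) (auto simp: dadj_diff consm_linear dadj_of)
      then show ?thesis by simp
    qed
    then show ?thesis
      unfolding w by (auto simp: dadj_diff consm_linear wrem_of count_list_0_iff)
  next
    case False
    then have n: "\<not> distinct_adj w" using Cons.prems by (auto simp: distinct_adj_Cons)
    have 1: "dadj (consm x (wbd w)) = 0" using Cons.IH[OF n] by (subst dadj_consm) simp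
    have 2: "dadj (consm x (wrem x (frag_of w))) = 0"
      using not_distinct_adj_removeAll[OF n] by (subst dadj_consm) (simp add: wrem_of dadj_of)
    show ?thesis using 1 2 n by (simp add: dadj_diff dadj_of)
  qed
qed simp

section \<open>Extensions of words\<close>

text \<open>\<open>F2S\<close> without the prescribed set of letters, hence inherited by tails and
  available for words with a placeholder.\<close>

definition no_interlace :: "'a list \<Rightarrow> bool" where
  "no_interlace w \<longleftrightarrow> distinct_adj w \<and> (\<forall>u v. u \<noteq> v \<longrightarrow> \<not> subseq [u, v, u, v] w)"

lemma F2S_iff: "w \<in> F2S n \<longleftrightarrow> set w = {1..n} \<and> no_interlace w"
  by (auto simp: F2S_def no_interlace_def)

lemma no_interlace_Cons: "no_interlace (x # w) \<Longrightarrow> no_interlace w"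
  unfolding no_interlace_def by (metis distinct_adj_ConsD list_emb_Cons)

lemma subseq_map_inj:
  assumes "inj f" shows "subseq (map f xs) (map f ys) \<longleftrightarrow> subseq xs ys"
proof
  show "subseq xs ys \<Longrightarrow> subseq (map f xs) (map f ys)" by (rule subseq_map)
  assume "subseq (map f xs) (map f ys)"
  from subseq_map[OF this, of "inv_into UNIV f"] show "subseq xs ys" using assms by simp
qed

lemma no_interlace_map:
  assumes "inj f" shows "no_interlace (map f w) \<longleftrightarrow> no_interlace w"
proof -
  have d: "distinct_adj (map f w) \<longleftrightarrow> distinct_adj w"
    by (rule distinct_adj_map_iff[OF inj_on_subset[OF assms subset_UNIV]])
  have s: "subseq [f u, f v, f u, f v] (map f w) \<longleftrightarrow> subseq [u, v, u, v] w" for u v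
    using subseq_map_inj[OF assms, of "[u, v, u, v]" w] by simp
  have r: "u \<in> range f \<and> v \<in> range f" if "subseq [u, v, u, v] (map f w)" for u v
  proof -
    have "z \<in> range f" if z: "z \<in> set [u, v, u, v]" for z
    proof -
      from list_emb_set[OF \<open>subseq [u, v, u, v] (map f w)\<close> z]
      obtain y where "y \<in> set (map f w)" "z = y" by blast
      then show ?thesis by auto
    qed
    then show ?thesis by simp
  qed
  show ?thesis
  proof
    assume L: "no_interlace (map f w)"
    have "\<not> subseq [u, v, u, v] w" if "u \<noteq> v" for u v
    proof -
      have "f u \<noteq> f v" using that assms by (simp add: inj_eq)
      then have "\<not> subseq [f u, f v, f u, f v] (map f w)" using L by (simp only: no_interlace_def) simp
      then show ?thesis by (simp add: s)
    qed
    then show "no_interlace w" using L d by (simp add: no_interlace_def)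
  next
    assume R: "no_interlace w"
    have "\<not> subseq [u, v, u, v] (map f w)" if "u \<noteq> v" for u v
    proof
      assume *: "subseq [u, v, u, v] (map f w)"
      then have "u \<in> range f" "v \<in> range f" using r by simp_all
      then obtain u' v' where uv: "u = f u'" "v = f v'" by (elim rangeE)
      then have "subseq [u', v', u', v'] w" using * s by simp
      moreover have "u' \<noteq> v'" using that uv by auto
      ultimately show False using R by (simp add: no_interlace_def)
    qed
    then show "no_interlace (map f w)" using R d by (simp add: no_interlace_def)
  qed
qed

text \<open>\<open>wext V W X\<close>: the word \<open>X\<close> arises by substituting \<open>W\<close> for the letter \<^const>\<open>None\<close> of \<open>V\<close>.\<close>

inductive wext :: "'a option list \<Rightarrow> 'a list \<Rightarrow> 'a list \<Rightarrow> bool" where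
  wext_skip: "wext V W X \<Longrightarrow> wext (Some x # V) W (x # X)"
| wext_stay: "wext V (w # W) X \<Longrightarrow> wext (None # V) (w # W) (w # X)"
| wext_step: "wext (None # V) (w' # W) X \<Longrightarrow> wext (None # V) (w # w' # W) (w # X)"
| wext_last: "wext (None # map Some V) [w] (w # V)"

lemma wext_set: "wext V W X \<Longrightarrow> set X = {x. Some x \<in> set V} \<union> set W"
  by (induction rule: wext.induct) auto

lemma wext_length: "wext V W X \<Longrightarrow> Suc (length X) = length V + length W"
  by (induction rule: wext.induct) auto

lemma wext_None: "wext V W X \<Longrightarrow> None \<in> set V"
  by (induction rule: wext.induct) auto

lemma wext_nonempty: "wext V W X \<Longrightarrow> V \<noteq> [] \<and> W \<noteq> [] \<and> X \<noteq> []"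
  by (induction rule: wext.induct) auto

lemma wext_hd: "wext V W X \<Longrightarrow> hd X = (case hd V of None \<Rightarrow> hd W | Some x \<Rightarrow> x)"
  by (induction rule: wext.induct) auto

text \<open>The gap condition of \<open>Ext_word\<close> in terms of splittings of the list, which
  suits induction; \<open>ys \<noteq> []\<close> corresponds to \<open>i + 1 < j\<close>.\<close>

definition gaps_constant :: "'a set \<Rightarrow> 'a list \<Rightarrow> bool" where
  "gaps_constant P X \<longleftrightarrow> (\<forall>as x ys z zs. X = as @ x # ys @ z # zs \<and> ys \<noteq> [] \<and> x \<in> P \<and> z \<in> P \<and>
     (\<forall>y \<in> set ys. y \<notin> P) \<longrightarrow> x = z)"

lemma gaps_constant_iff:
  "gaps_constant P X \<longleftrightarrow>
     (\<forall>i j. i + 1 < j \<and> j < length X \<and> X ! i \<in> P \<and> X ! j \<in> P \<and>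
        (\<forall>k. i < k \<and> k < j \<longrightarrow> X ! k \<notin> P) \<longrightarrow> X ! i = X ! j)" (is "_ = ?R")
proof
  assume L: "gaps_constant P X"
  show ?R
  proof (intro allI impI, elim conjE)
    fix i j assume ij: "i + 1 < j" "j < length X" "X ! i \<in> P" "X ! j \<in> P"
      and k: "\<forall>k. i < k \<and> k < j \<longrightarrow> X ! k \<notin> P"
    let ?ys = "take (j - Suc i) (drop (Suc i) X)"
    have "drop (Suc i) X = ?ys @ drop (j - Suc i) (drop (Suc i) X)"
      by (rule append_take_drop_id[symmetric])
    also have "drop (j - Suc i) (drop (Suc i) X) = X ! j # drop (Suc j) X"
      using ij by (simp add: Cons_nth_drop_Suc)
    finally have "X = take i X @ X ! i # ?ys @ X ! j # drop (Suc j) X"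
      using ij id_take_nth_drop[of i X] by simp
    moreover have "?ys \<noteq> []" using ij by simp
    moreover have "\<forall>y \<in> set ?ys. y \<notin> P"
    proof
      fix y assume "y \<in> set ?ys"
      then obtain l where l: "l < length ?ys" "y = ?ys ! l" by (metis in_set_conv_nth)
      then have "y = X ! (Suc i + l)" "Suc i + l < j" using ij by auto
      then show "y \<notin> P" using k by simp
    qed
    ultimately show "X ! i = X ! j" using L ij unfolding gaps_constant_def by blast
  qed
next
  assume R: ?R
  show "gaps_constant P X"
    unfolding gaps_constant_def
  proof (intro allI impI, elim conjE)
    fix as x ys z zs
    assume X: "X = as @ x # ys @ z # zs" and *: "ys \<noteq> []" "x \<in> P" "z \<in> P" "\<forall>y \<in> set ys. y \<notin> P"
    let ?i = "length as" and ?j = "Suc (length as + length ys)"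
    have i: "X ! ?i = x" and j: "X ! ?j = z" using X by (simp_all add: nth_append)
    have "X ! k \<notin> P" if "?i < k" "k < ?j" for k
    proof -
      obtain l where "k = Suc (?i + l)" using \<open>?i < k\<close> less_iff_Suc_add by auto
      then have "l < length ys" "X ! k = ys ! l" using that X by (simp_all add: nth_append)
      then show ?thesis using * by simp
    qed
    then have "X ! ?i = X ! ?j" using R[rule_format, of ?i ?j] i j * X by simp
    then show "x = z" using i j by simp
  qed
qed

lemma gaps_constant_Cons:
  "gaps_constant P (x # X) \<longleftrightarrow> gaps_constant P X \<and>
     (x \<in> P \<longrightarrow> (\<forall>ys z zs. X = ys @ z # zs \<and> ys \<noteq> [] \<and> z \<in> P \<and> (\<forall>y \<in> set ys. y \<notin> P) \<longrightarrow> x = z))"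
  (is "?L \<longleftrightarrow> ?A \<and> ?B")
proof
  assume L: ?L
  have ?A unfolding gaps_constant_def
  proof (intro allI impI)
    fix as x' ys z zs
    assume "X = as @ x' # ys @ z # zs \<and> ys \<noteq> [] \<and> x' \<in> P \<and> z \<in> P \<and> (\<forall>y\<in>set ys. y \<notin> P)"
    then show "x' = z"
      using L[unfolded gaps_constant_def, rule_format, of "x # as" x' ys z zs] by simp
  qed
  moreover have ?B
  proof (intro allI impI)
    fix ys z zs
    assume "x \<in> P" "X = ys @ z # zs \<and> ys \<noteq> [] \<and> z \<in> P \<and> (\<forall>y\<in>set ys. y \<notin> P)"
    then show "x = z"
      using L[unfolded gaps_constant_def, rule_format, of "[]" x ys z zs] by simp
  qed
  ultimately show "?A \<and> ?B" ..
next
  assume R: "?A \<and> ?B"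
  show ?L unfolding gaps_constant_def
  proof (intro allI impI)
    fix as x' ys z zs
    assume *: "x # X = as @ x' # ys @ z # zs \<and> ys \<noteq> [] \<and> x' \<in> P \<and> z \<in> P \<and> (\<forall>y\<in>set ys. y \<notin> P)"
    show "x' = z"
    proof (cases as)
      case Nil
      then have "x = x'" "X = ys @ z # zs" using * by simp_all
      then show ?thesis using * R[THEN conjunct2] by blast
    next
      case (Cons b bs)
      then show ?thesis
        using * R[THEN conjunct1, unfolded gaps_constant_def, rule_format, of bs x' ys z zs] by simp
    qed
  qed
qed

text \<open>This is \<open>collapse n a\<close> except that the outer letters keep the names they
  have in the extension, so only the inner letters are identified.\<close>

definition collapse_to_None :: "'a set \<Rightarrow> 'a list \<Rightarrow> 'a option list" where
  "collapse_to_None P = map (\<lambda>x. if x \<in> P then None else Some x)"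

lemma collapse_to_None_simps [simp]:
  "collapse_to_None P [] = []"
  "collapse_to_None P (x # X) = (if x \<in> P then None else Some x) # collapse_to_None P X"
  by (simp_all add: collapse_to_None_def)

lemma collapse_to_None_eq_map_Some: "set X \<inter> P = {} \<Longrightarrow> collapse_to_None P X = map Some X"
  by (induction X) auto

lemma remdups_adj_Cons_neq: "xs = [] \<or> hd xs \<noteq> x \<Longrightarrow> remdups_adj (x # xs) = x # remdups_adj xs"
  by (cases xs) auto

lemma remdups_adj_Cons_eq: "xs \<noteq> [] \<Longrightarrow> hd xs = x \<Longrightarrow> remdups_adj (x # xs) = remdups_adj xs"
  by (cases xs) auto

lemma remdups_adj_Cons_obtains:
  obtains ys where "remdups_adj (x # xs) = x # ys"
  using remdups_adj_Cons_alt[of x xs] by metis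

lemma distinct_adj_remdups_adj_id: "distinct_adj xs \<Longrightarrow> remdups_adj xs = xs"
  by (simp add: distinct_adj_altdef)

lemma distinct_adj_map_Some: "distinct_adj (map Some X) \<longleftrightarrow> distinct_adj X"
  by (rule distinct_adj_map_iff) simp

text \<open>The rule of \<open>wext\<close> is read off from the next letters of \<open>X\<close>.
  An outer letter is a skip; an inner letter followed by no further inner letter is the last one,
  followed directly by an inner letter it is a step, and followed by a gap it is a stay.\<close>

lemma wextI:
  assumes "distinct_adj X" "remdups_adj (filter (\<lambda>x. x \<in> P) X) = W" "gaps_constant P X"
    "remdups_adj (collapse_to_None P X) = V" "W \<noteq> []"
  shows "wext V W X"
  using assms
proof (induction X arbitrary: V W)
  case (Cons x X)
  let ?f = "filter (\<lambda>x. x \<in> P)" and ?c = "collapse_to_None P"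
  have dX: "distinct_adj X" and gX: "gaps_constant P X"
    using Cons.prems by (auto simp: gaps_constant_Cons dest: distinct_adj_ConsD)
  have IH: "wext (remdups_adj (?c X)) (remdups_adj (?f X)) X" if "?f X \<noteq> []"
    using Cons.IH[OF dX refl gX refl] that by simp
  have hd: "X = [] \<or> hd X \<noteq> x" using Cons.prems(1) by (cases X) auto
  show ?case
  proof (cases "x \<in> P")
    case False
    then have "?f X \<noteq> []" using Cons.prems by auto
    moreover have "remdups_adj (?c (x # X)) = Some x # remdups_adj (?c X)"
    proof -
      have "?c X = [] \<or> hd (?c X) \<noteq> Some x" using hd by (cases X) auto
      then show ?thesis using False by (simp add: remdups_adj_Cons_neq)
    qed
    ultimately show ?thesis using False Cons.prems IH wext_skip by fastforce
  next
    case True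
    show ?thesis
    proof (cases "?f X = []")
      case e: True
      then have X: "set X \<inter> P = {}" by (auto simp: filter_empty_conv)
      then have c: "?c X = map Some X" by (rule collapse_to_None_eq_map_Some)
      have "distinct_adj (None # map Some X)"
        using dX distinct_adj_map_Some[of X] by (cases X) auto
      then have "remdups_adj (None # ?c X) = None # map Some X"
        using c distinct_adj_remdups_adj_id by metis
      then show ?thesis using True e Cons.prems wext_last[of X x] by simp
    next
      case False
      then obtain y X' where y: "X = y # X'" by (cases X) auto
      show ?thesis
      proof (cases "y \<in> P")
        case yP: True
        have "remdups_adj (?f (x # X)) = x # remdups_adj (?f X)"
          using True yP y hd by (auto simp: remdups_adj_Cons_neq)
        moreover have "remdups_adj (?c (x # X)) = remdups_adj (?c X)"
          using True yP y by simp
        moreover obtain V1 where "remdups_adj (?c X) = None # V1"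
          using yP y remdups_adj_Cons_obtains[of None "?c X'"] by auto
        moreover obtain W1 where "remdups_adj (?f X) = y # W1"
          using yP y remdups_adj_Cons_obtains[of y "?f X'"] by auto
        moreover have "V = remdups_adj (?c (x # X))" "W = remdups_adj (?f (x # X))"
          using Cons.prems by simp_all
        ultimately show ?thesis using IH[OF False] wext_step[of V1 y W1 X x] by simp
      next
        case yP: False
        obtain as z zs where z: "X = as @ z # zs" "\<forall>y \<in> set as. y \<notin> P" "z \<in> P"
          using False split_list_first_prop[of X "\<lambda>x. x \<in> P"] by (auto simp: filter_empty_conv)
        then have "as \<noteq> []" using y yP by auto
        \<comment> \<open>By the gap condition the block after the gap resumes with the same letter,
          so the inner word still starts with \<open>x\<close> there.\<close>
        then have "x = z" using Cons.prems(3) z True unfolding gaps_constant_Cons by blast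
        have "?f as = []" using z(2) by (simp add: filter_empty_conv)
        then have f: "?f X = x # ?f zs" using z \<open>x = z\<close> by simp
        have "remdups_adj (?f (x # X)) = remdups_adj (?f X)"
          using True f by simp
        moreover have "remdups_adj (?c (x # X)) = None # remdups_adj (?c X)"
          using True yP y by simp
        moreover obtain W1 where "remdups_adj (?f X) = x # W1"
          using f remdups_adj_Cons_obtains[of x "?f zs"] by auto
        moreover have "V = remdups_adj (?c (x # X))" "W = remdups_adj (?f (x # X))"
          using Cons.prems by simp_all
        ultimately show ?thesis
          using IH[OF False] wext_stay[of "remdups_adj (?c X)" x W1 X] by simp
      qed
    qed
  qed
qed simp

text \<open>The interleaving can be undone because neither word has equal neighbours:
  \<open>remdups_adj\<close> merges exactly the letters repeated by a stay, respectively the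
  placeholders of one block.\<close>

lemma wextD:
  assumes "wext V W X" "set W \<subseteq> P" "\<And>x. Some x \<in> set V \<Longrightarrow> x \<notin> P" "distinct_adj V" "distinct_adj W"
  shows "distinct_adj X \<and> remdups_adj (filter (\<lambda>x. x \<in> P) X) = W \<and> gaps_constant P X \<and>
    remdups_adj (collapse_to_None P X) = V"
  using assms
proof (induction rule: wext.induct)
  case (wext_skip V W X x)
  let ?f = "filter (\<lambda>x. x \<in> P)" and ?c = "collapse_to_None P"
  have IH: "distinct_adj X" "remdups_adj (?f X) = W" "gaps_constant P X" "remdups_adj (?c X) = V"
    using wext_skip by (auto dest: distinct_adj_ConsD)
  have ne: "V \<noteq> []" "X \<noteq> []" using wext_nonempty[OF wext_skip.hyps] by auto
  have "hd (?c X) = hd V" using IH(4) hd_remdups_adj by metis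
  then have "hd (?c X) \<noteq> Some x" using wext_skip.prems(3) ne by (auto simp: distinct_adj_Cons)
  moreover have "x \<notin> P" using wext_skip.prems(2) by simp
  moreover have "hd X \<noteq> x" using calculation ne by (cases X) auto
  ultimately show ?case
    using IH ne by (auto simp: distinct_adj_Cons remdups_adj_Cons_neq gaps_constant_Cons)
next
  case (wext_stay V w W X)
  let ?f = "filter (\<lambda>x. x \<in> P)" and ?c = "collapse_to_None P"
  have IH: "distinct_adj X" "remdups_adj (?f X) = w # W" "gaps_constant P X" "remdups_adj (?c X) = V"
    using wext_stay by (auto dest: distinct_adj_ConsD)
  have ne: "V \<noteq> []" "X \<noteq> []" using wext_nonempty[OF wext_stay.hyps] by auto
  have "hd (?c X) = hd V" using IH(4) hd_remdups_adj by metis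
  then have h: "hd (?c X) \<noteq> None" using wext_stay.prems(3) ne by (metis distinct_adj_Cons)
  have w: "w \<in> P" using wext_stay.prems(1) by simp
  have "hd X \<notin> P" using h ne by (cases X) (auto split: if_splits)
  have f: "?f X \<noteq> []" "hd (?f X) = w" using IH(2) by (auto, metis hd_remdups_adj list.sel(1))
  have "w = z" if "X = ys @ z # zs" "z \<in> P" "\<forall>y \<in> set ys. y \<notin> P" for ys z zs
  proof -
    have "?f ys = []" using that(3) by (simp add: filter_empty_conv)
    then show ?thesis using f(2) that by simp
  qed
  then have "gaps_constant P (w # X)" using IH by (auto simp: gaps_constant_Cons)
  moreover have "distinct_adj (w # X)" using \<open>hd X \<notin> P\<close> w IH by (auto simp: distinct_adj_Cons)
  moreover have "remdups_adj (?f (w # X)) = w # W"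
    using w f IH by (simp add: remdups_adj_Cons_eq)
  moreover have "remdups_adj (?c (w # X)) = None # V"
    using w h IH by (simp add: remdups_adj_Cons_neq)
  ultimately show ?case by simp
next
  case (wext_step V w' W X w)
  let ?f = "filter (\<lambda>x. x \<in> P)" and ?c = "collapse_to_None P"
  have IH: "distinct_adj X" "remdups_adj (?f X) = w' # W" "gaps_constant P X"
    "remdups_adj (?c X) = None # V"
    using wext_step by (auto dest: distinct_adj_ConsD)
  have ne: "X \<noteq> []" using wext_nonempty[OF wext_step.hyps] by auto
  have h: "hd (?c X) = None" using IH(4) by (metis hd_remdups_adj list.sel(1))
  have w: "w \<in> P" using wext_step.prems(1) by simp
  have hX: "hd X \<in> P" using h ne by (cases X) (auto split: if_splits)
  then have "hd (?f X) = hd X" using ne by (cases X) auto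
  then have "hd X = w'" using IH(2) by (metis hd_remdups_adj list.sel(1))
  moreover have "w \<noteq> w'" using wext_step.prems(4) by simp
  ultimately have hw: "hd X \<noteq> w" by simp
  have "gaps_constant P (w # X)"
    unfolding gaps_constant_Cons
  proof (intro conjI impI allI IH(3))
    fix ys z zs assume *: "X = ys @ z # zs \<and> ys \<noteq> [] \<and> z \<in> P \<and> (\<forall>y\<in>set ys. y \<notin> P)"
    then have "hd X = hd ys" by simp
    then show "w = z" using * hX by simp
  qed
  moreover have "distinct_adj (w # X)" using hw IH by (auto simp: distinct_adj_Cons)
  moreover have "remdups_adj (?f (w # X)) = w # w' # W"
    using w hw IH \<open>hd (?f X) = hd X\<close> by (simp add: remdups_adj_Cons_neq)
  moreover have "remdups_adj (?c (w # X)) = None # V"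
    using w h IH ne by (simp add: remdups_adj_Cons_eq collapse_to_None_def)
  ultimately show ?case by simp
next
  case (wext_last V w)
  have V: "set V \<inter> P = {}" and w: "w \<in> P" using wext_last by auto
  have dV: "distinct_adj V"
    using wext_last.prems(3) distinct_adj_ConsD by (fastforce simp: distinct_adj_map_Some)
  have "gaps_constant P (w # V)"
    using V by (auto simp: gaps_constant_def append_eq_Cons_conv Cons_eq_append_conv)
  moreover have "distinct_adj (w # V)"
    using V w dV by (cases V) auto
  moreover have "filter (\<lambda>x. x \<in> P) V = []" using V by (auto simp: filter_empty_conv)
  moreover have "remdups_adj (None # map Some V) = None # map Some V"
    using wext_last.prems(3) by (rule distinct_adj_remdups_adj_id)
  ultimately show ?case using V w by (simp add: collapse_to_None_eq_map_Some)
qed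

section \<open>Interposed vertices and signs of extensions\<close>

text \<open>The interposed vertices in the order of their positions, one for each caesura. For words
  without interlacing this agrees with the order of first occurrences, see
  \<open>interposed_list_eq_il\<close>.\<close>

fun il :: "'a list \<Rightarrow> 'a list" where
  "il [] = []"
| "il (x # w) = (if x \<in> set w then hd w # il w else il w)"

lemma set_il: "set (il w) \<subseteq> set w"
proof (induction w)
  case (Cons x w)
  then show ?case by (cases w) auto
qed simp

lemma length_il: "length (il w) = wexc w"
  by (induction w) (auto simp: wexc_Cons, simp add: wexc_def)

lemma il_map: "inj f \<Longrightarrow> il (map f w) = map f (il w)"
proof (induction w)
  case (Cons x w)
  then have IH: "il (map f w) = map f (il w)" by simp
  have "f x \<in> f ` set w \<longleftrightarrow> x \<in> set w" using Cons.prems by (simp add: inj_image_mem_iff)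
  then show ?case using IH by (cases w) auto
qed simp

lemma in_il_subseq:
  "distinct_adj w \<Longrightarrow> v \<in> set (il w) \<Longrightarrow> \<exists>u. u \<noteq> v \<and> subseq [u, v, u] w"
proof (induction w)
  case (Cons x w)
  show ?case
  proof (cases "v \<in> set (il w)")
    case True
    then obtain u where "u \<noteq> v" "subseq [u, v, u] w"
      using Cons.IH[OF distinct_adj_ConsD[OF Cons.prems(1)]] by auto
    then show ?thesis by (intro exI[of _ u] conjI list_emb_Cons)
  next
    case False
    then have x: "x \<in> set w" "v = hd w" using Cons.prems(2) by (simp_all split: if_splits)
    then obtain w' where w: "w = v # w'" by (cases w) simp_all
    then have "x \<noteq> v" using Cons.prems(1) by simp
    then have "x \<in> set w'" using x(1) w by simp
    then have "subseq [x, v, x] (x # w)" using w by (simp add: subseq_singleton_left)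
    then show ?thesis using \<open>x \<noteq> v\<close> by (intro exI[of _ x] conjI)
  qed
qed simp

text \<open>If the first letter \<open>x\<close> were interposed, it would occur again between two
  copies of some \<open>u\<close>, and together with the first position this is the pattern
  \<open>x u x u\<close>.\<close>

lemma hd_notin_il:
  assumes "no_interlace w" "w \<noteq> []" shows "hd w \<notin> set (il w)"
proof
  obtain x v where w: "w = x # v" using assms by (cases w) auto
  assume "hd w \<in> set (il w)"
  then have *: "x \<in> set (il (x # v))" using w by simp
  have d: "distinct_adj v" "v = [] \<or> hd v \<noteq> x"
    using assms(1) unfolding w no_interlace_def distinct_adj_Cons by auto
  have "x \<in> set (il v)" using * d(2) by (cases "x \<in> set v"; cases v) simp_all
  then obtain u where u: "u \<noteq> x" "subseq [u, x, u] v" using in_il_subseq[OF d(1)] by auto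
  have "subseq [x, u, x, u] w" unfolding w using u(2) by simp
  then show False using assms(1) u(1) by (simp add: no_interlace_def)
qed

text \<open>Neighbouring letters of \<open>xs\<close> differ and are therefore matched in different
  runs of \<open>ys\<close>, so one representative per run suffices.\<close>

lemma subseq_remdups_adj: "subseq xs ys \<Longrightarrow> distinct_adj xs \<Longrightarrow> subseq xs (remdups_adj ys)"
proof (induction ys arbitrary: xs rule: remdups_adj.induct)
  case (3 x y ys)
  show ?case
  proof (cases "x = y")
    case True
    have "subseq xs (x # ys)"
    proof (cases xs)
      case (Cons z zs)
      show ?thesis
      proof (cases "z = x")
        case zx: True
        then have zs: "subseq zs (x # ys)" using 3 True Cons by simp
        have "zs = [] \<or> hd zs \<noteq> x"
          using 3(4) unfolding Cons zx distinct_adj_Cons by auto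
        then have "subseq zs ys" using zs by (cases zs) auto
        then show ?thesis using Cons zx by simp
      next
        case False
        then show ?thesis using 3 True Cons by simp
      qed
    qed simp
    then show ?thesis using 3 True by simp
  next
    case False
    show ?thesis
    proof (cases xs)
      case (Cons z zs)
      then show ?thesis using 3 False by (cases "z = x") (auto dest: distinct_adj_ConsD simp del: remdups_adj.simps(3) simp add: remdups_adj.simps(3)[of x y])
    qed simp
  qed
qed auto

text \<open>An interlacing of two inner letters survives the restriction to the inner word; any
  other one survives the collapse to the outer word.\<close>

lemma wext_no_interlace:
  assumes "wext V W X" "no_interlace V" "no_interlace W" "\<And>x. Some x \<in> set V \<Longrightarrow> x \<notin> set W"
  shows "no_interlace X"
proof -
  let ?c = "\<lambda>x. if x \<in> set W then None else Some x"
  have D: "distinct_adj X" "remdups_adj (filter (\<lambda>x. x \<in> set W) X) = W"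
    "remdups_adj (map ?c X) = V"
    using wextD[OF assms(1) subset_refl assms(4)] assms(2,3)
    by (auto simp: no_interlace_def collapse_to_None_def)
  have "\<not> subseq [u, v, u, v] X" if "u \<noteq> v" for u v
  proof
    assume *: "subseq [u, v, u, v] X"
    show False
    proof (cases "u \<in> set W \<and> v \<in> set W")
      case True
      have "subseq (filter (\<lambda>x. x \<in> set W) [u, v, u, v]) (filter (\<lambda>x. x \<in> set W) X)"
        using * by (rule subseq_filter)
      then have "subseq [u, v, u, v] (filter (\<lambda>x. x \<in> set W) X)" using True by simp
      then have "subseq [u, v, u, v] (remdups_adj (filter (\<lambda>x. x \<in> set W) X))"
        using that by (intro subseq_remdups_adj) simp_all
      then have "subseq [u, v, u, v] W" unfolding D(2) .
      then show False using assms(3) that by (simp add: no_interlace_def)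
    next
      case False
      define p q where "p = ?c u" and "q = ?c v"
      then have c: "p \<noteq> q" using that False by simp
      have "subseq (map ?c [u, v, u, v]) (map ?c X)" using * by (rule subseq_map)
      then have "subseq [p, q, p, q] (map ?c X)" unfolding p_def q_def by simp
      then have "subseq [p, q, p, q] (remdups_adj (map ?c X))"
        by (rule subseq_remdups_adj) (use c in simp)
      then have "subseq [p, q, p, q] V" unfolding D(3) .
      then show False using assms(2) c by (simp add: no_interlace_def)
    qed
  qed
  then show ?thesis using D(1) by (simp add: no_interlace_def)
qed

text \<open>Carries out the identification of an interposed \<open>a\<close> with the first letter
  \<open>h\<close> of the inner word.\<close>

definition fill :: "'a \<Rightarrow> 'a option \<Rightarrow> 'a" where
  "fill h v = (case v of None \<Rightarrow> h | Some x \<Rightarrow> x)"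

lemma fill_simps [simp]: "fill h None = h" "fill h (Some x) = x"
  by (simp_all add: fill_def)

lemma map_fill_cong: "None \<notin> set V \<Longrightarrow> map (fill a) V = map (fill b) V"
  by (auto simp: fill_def split: option.splits)

lemma map_fill_Some: "map (fill a) (map Some V) = V"
  by (induction V) auto

lemma wext_hd_fill: "wext V W X \<Longrightarrow> hd X = fill (hd W) (hd V)"
  using wext_hd[of V W X] by (simp add: fill_def)

lemma wext_hd_notin:
  assumes "wext V W X" "no_interlace W" "\<And>x. Some x \<in> set V \<Longrightarrow> x \<notin> set W"
  shows "hd X \<notin> set (il W)"
proof -
  have ne: "V \<noteq> []" "W \<noteq> []" using wext_nonempty[OF assms(1)] by auto
  show ?thesis
  proof (cases "hd V")
    case None
    then show ?thesis using wext_hd_fill[OF assms(1)] hd_notin_il[OF assms(2) ne(2)] by simp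
  next
    case (Some y)
    then have "Some y \<in> set V" using ne hd_in_set by metis
    then have "y \<notin> set (il W)" using assms(3) set_il[of W] by blast
    then show ?thesis using wext_hd_fill[OF assms(1)] Some by simp
  qed
qed

text \<open>The number of inversions of \<open>ys\<close> with respect to the arrangement that
  places all entries outside \<open>A\<close> before those in \<open>A\<close>; its parity is the
  sign of the shuffle.\<close>

fun winv :: "'a set \<Rightarrow> 'a list \<Rightarrow> nat" where
  "winv A [] = 0"
| "winv A (y # ys) = (if y \<in> A then length (filter (\<lambda>x. x \<notin> A) ys) else 0) + winv A ys"

lemma winv_cong: "(\<And>x. x \<in> set ys \<Longrightarrow> x \<in> A \<longleftrightarrow> x \<in> B) \<Longrightarrow> winv A ys = winv B ys"
proof (induction ys)
  case (Cons y ys)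
  have "filter (\<lambda>x. x \<notin> A) ys = filter (\<lambda>x. x \<notin> B) ys"
    by (rule filter_cong) (use Cons.prems in auto)
  then show ?case using Cons by simp
qed simp

lemma winv_empty [simp]: "winv {} ys = 0"
  by (induction ys) auto

definition wsgn :: "'a list \<Rightarrow> 'a list \<Rightarrow> int" where
  "wsgn W X = (-1) ^ winv (set (il W)) (il X)"

text \<open>An entry that a skip puts in front is not interposed in \<open>W\<close>, so it adds no
  inversion. The same is true of a stay; only a step can change the sign.\<close>

lemma wext_il_skip:
  assumes "wext V W X" "no_interlace W" "\<And>y. Some y \<in> set (Some x # V) \<Longrightarrow> y \<notin> set W"
  shows "il (x # X) = map (fill (hd W)) (if Some x \<in> set V then [hd V] else []) @ il X"
    and "wsgn W (x # X) = wsgn W X"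
proof -
  have x: "x \<in> set X \<longleftrightarrow> Some x \<in> set V"
    using wext_set[OF assms(1)] assms(3)[of x] by auto
  show "il (x # X) = map (fill (hd W)) (if Some x \<in> set V then [hd V] else []) @ il X"
    using x wext_hd_fill[OF assms(1)] by simp
  have "hd X \<notin> set (il W)" using wext_hd_notin[OF assms(1,2)] assms(3) by simp
  then show "wsgn W (x # X) = wsgn W X" by (simp add: wsgn_def)
qed

lemma wext_il_stay:
  assumes "wext V (w # W) X" "no_interlace (w # W)" "\<And>y. Some y \<in> set (None # V) \<Longrightarrow> y \<notin> set (w # W)"
  shows "il (w # X) = fill w (hd V) # il X" and "wsgn (w # W) (w # X) = wsgn (w # W) X"
proof -
  have w: "w \<in> set X" using wext_set[OF assms(1)] by auto
  show "il (w # X) = fill w (hd V) # il X" using w wext_hd_fill[OF assms(1)] by simp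
  have "hd X \<notin> set (il (w # W))" using wext_hd_notin[OF assms(1,2)] assms(3) by simp
  then show "wsgn (w # W) (w # X) = wsgn (w # W) X" by (simp add: wsgn_def del: il.simps) simp
qed

lemma wext_il_step:
  assumes "wext (None # V) (w' # W) X" "no_interlace (None # V)" "no_interlace (w # w' # W)"
    "\<And>y. Some y \<in> set (None # V) \<Longrightarrow> y \<notin> set (w # w' # W)"
  shows "il (w # X) = (if w \<in> set (w' # W) then [w'] else []) @ il X" "w' \<notin> set (il X)"
proof -
  have "w \<notin> {x. Some x \<in> set (None # V)}" using assms(4)[of w] by auto
  then have w: "w \<in> set X \<longleftrightarrow> w \<in> set (w' # W)" using wext_set[OF assms(1)] by auto
  have h: "hd X = w'" using wext_hd_fill[OF assms(1)] by simp
  show "il (w # X) = (if w \<in> set (w' # W) then [w'] else []) @ il X" using w h by simp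
  have "no_interlace X"
    using wext_no_interlace[OF assms(1,2) no_interlace_Cons[OF assms(3)]] assms(4) by simp
  then show "w' \<notin> set (il X)" using hd_notin_il wext_nonempty[OF assms(1)] h by metis
qed

text \<open>Thus \<open>il X\<close> is a genuine shuffle of the interposed vertices of the two
  words, each list keeping its own order.\<close>

lemma wext_il:
  assumes "wext V W X" "no_interlace V" "no_interlace W" "\<And>x. Some x \<in> set V \<Longrightarrow> x \<notin> set W"
  shows "filter (\<lambda>x. x \<in> set (il W)) (il X) = il W \<and>
    filter (\<lambda>x. x \<notin> set (il W)) (il X) = map (fill (hd W)) (il V)"
  using assms
proof (induction rule: wext.induct)
  case (wext_skip V W X x)
  have IH: "filter (\<lambda>x. x \<in> set (il W)) (il X) = il W"
    "filter (\<lambda>x. x \<notin> set (il W)) (il X) = map (fill (hd W)) (il V)"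
    using wext_skip by (auto dest: no_interlace_Cons)
  have h: "fill (hd W) (hd V) \<notin> set (il W)"
    using wext_hd_notin[OF wext_skip.hyps wext_skip.prems(2)] wext_skip.prems(3)
    by (simp add: wext_hd_fill[OF wext_skip.hyps])
  have il: "il (x # X) = map (fill (hd W)) (if Some x \<in> set V then [hd V] else []) @ il X"
    by (rule wext_il_skip(1)[OF wext_skip.hyps wext_skip.prems(2)]) (erule wext_skip.prems(3))
  show ?case unfolding il using IH h by simp
next
  case (wext_stay V w W X)
  have IH: "filter (\<lambda>x. x \<in> set (il (w # W))) (il X) = il (w # W)"
    "filter (\<lambda>x. x \<notin> set (il (w # W))) (il X) = map (fill w) (il V)"
    using wext_stay by (auto dest: no_interlace_Cons simp del: il.simps)
  have h: "fill w (hd V) \<notin> set (il (w # W))"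
    using wext_hd_notin[OF wext_stay.hyps wext_stay.prems(2)] wext_stay.prems(3)
    by (simp add: wext_hd_fill[OF wext_stay.hyps] del: il.simps)
  have il: "il (w # X) = fill w (hd V) # il X"
    by (rule wext_il_stay(1)[OF wext_stay.hyps wext_stay.prems(2)]) (erule wext_stay.prems(3))
  have "il (None # V) = hd V # il V" using wext_None[OF wext_stay.hyps] by simp
  then show ?case unfolding il using IH h by (simp del: il.simps)
next
  case (wext_step V w' W X w)
  have IH: "filter (\<lambda>x. x \<in> set (il (w' # W))) (il X) = il (w' # W)"
    "filter (\<lambda>x. x \<notin> set (il (w' # W))) (il X) = map (fill w') (il (None # V))"
    using wext_step by (auto dest: no_interlace_Cons simp del: il.simps)
  \<comment> \<open>The leading placeholder is not interposed, so it is immaterial whether the inner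
    word is taken to start with \<open>w\<close> or with \<open>w'\<close>.\<close>
  have "None \<notin> set (il (None # V))"
    using hd_notin_il[OF wext_step.prems(1)] by simp
  then have cong: "map (fill w') (il (None # V)) = map (fill w) (il (None # V))"
    by (rule map_fill_cong)
  have step: "il (w # X) = (if w \<in> set (w' # W) then [w'] else []) @ il X" "w' \<notin> set (il X)"
    by (rule wext_il_step[OF wext_step.hyps wext_step.prems(1,2)], erule wext_step.prems(3))+
  let ?b = "w \<in> set (w' # W)"
  have ilW: "il (w # w' # W) = (if ?b then [w'] else []) @ il (w' # W)" by simp
  have m: "x \<in> set (il (w # w' # W)) \<longleftrightarrow> x \<in> set (il (w' # W))" if "x \<in> set (il X)" for x
    unfolding ilW using step(2) that by auto
  have f: "filter (\<lambda>x. x \<in> set (il (w # w' # W))) (il X) = il (w' # W)"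
    "filter (\<lambda>x. x \<notin> set (il (w # w' # W))) (il X) = map (fill w) (il (None # V))"
    using IH cong m by (metis (no_types, lifting) filter_cong)+
  have w': "?b \<Longrightarrow> w' \<in> set (il (w # w' # W))" unfolding ilW by simp
  show ?case
    unfolding step(1) filter_append f using w' by (cases ?b) (simp_all add: ilW del: il.simps)
next
  case (wext_last V w)
  have "w \<notin> set V" using wext_last.prems(3)[of w] by auto
  then have "il (w # V) = il V" "il (None # map Some V) = map Some (il V)" "il [w] = []"
    by (auto simp: il_map)
  then show ?case by (simp add: map_fill_Some del: il.simps map_map)
qed

text \<open>If \<open>w\<close> recurs, the new front entry \<open>w'\<close> is an inner one and
  precedes all outer entries of \<open>il X\<close>. By \<open>wext_il\<close> there is one of these
  for each caesura of \<open>None # V\<close>, which explains the sign in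
  \<open>wsub\<close>.\<close>

lemma wsgn_step:
  assumes "wext (None # V) (w' # W) X" "no_interlace (None # V)" "no_interlace (w # w' # W)"
    "\<And>y. Some y \<in> set (None # V) \<Longrightarrow> y \<notin> set (w # w' # W)"
  shows "wsgn (w # w' # W) (w # X) =
    (if w \<in> set (w' # W) then (-1) ^ wexc (None # V) else 1) * wsgn (w' # W) X"
proof -
  have step: "il (w # X) = (if w \<in> set (w' # W) then [w'] else []) @ il X" "w' \<notin> set (il X)"
    by (rule wext_il_step[OF assms(1-3)], erule assms(4))+
  let ?b = "w \<in> set (w' # W)"
  have ilW: "il (w # w' # W) = (if ?b then [w'] else []) @ il (w' # W)" by simp
  have m: "x \<in> set (il (w # w' # W)) \<longleftrightarrow> x \<in> set (il (w' # W))" if "x \<in> set (il X)" for x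
    unfolding ilW using step(2) that by auto
  have c: "winv (set (il (w # w' # W))) (il X) = winv (set (il (w' # W))) (il X)"
    by (rule winv_cong) (rule m)
  show ?thesis
  proof (cases ?b)
    case True
    have "filter (\<lambda>x. x \<notin> set (il (w # w' # W))) (il X) = filter (\<lambda>x. x \<notin> set (il (w' # W))) (il X)"
      using m by (metis (no_types, lifting) filter_cong)
    also have "\<dots> = map (fill w') (il (None # V))"
      using wext_il[OF assms(1,2) no_interlace_Cons[OF assms(3)]] assms(4) by (simp del: il.simps)
    finally have "length (filter (\<lambda>x. x \<notin> set (il (w # w' # W))) (il X)) = wexc (None # V)"
      by (simp add: length_il del: il.simps)
    moreover have "w' \<in> set (il (w # w' # W))" unfolding ilW using True by simp
    ultimately show ?thesis
      unfolding wsgn_def step(1) using True c by (simp add: power_add del: il.simps)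
  next
    case False
    then show ?thesis unfolding wsgn_def step(1) using c by (simp del: il.simps)
  qed
qed

lemma wsgn_last: "w \<notin> set V \<Longrightarrow> wsgn [w] (w # V) = 1"
  by (simp add: wsgn_def)

section \<open>The recursive substitution as the signed sum over all extensions\<close>

definition wexts :: "'a option list \<Rightarrow> 'a list \<Rightarrow> 'a list set" where
  "wexts V W = {X. wext V W X}"

lemma wexts_simps:
  "wexts [] W = {}"
  "wexts V [] = {}"
  "wexts (Some x # V) W = (#) x ` wexts V W"
  "wexts (None # V) [w] = (#) w ` wexts V [w] \<union> (if None \<in> set V then {} else {w # map the V})"
  "wexts (None # V) (w # w' # W) = (#) w ` wexts V (w # w' # W) \<union> (#) w ` wexts (None # V) (w' # W)"
proof -
  show "wexts [] W = {}" "wexts V [] = {}" by (auto simp: wexts_def dest: wext_nonempty)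
  show "wexts (Some x # V) W = (#) x ` wexts V W"
    by (auto simp: wexts_def intro: wext_skip elim: wext.cases)
  show "wexts (None # V) (w # w' # W) = (#) w ` wexts V (w # w' # W) \<union> (#) w ` wexts (None # V) (w' # W)"
    by (auto simp: wexts_def intro: wext_stay wext_step elim: wext.cases)
  have "None \<notin> set V \<Longrightarrow> map Some (map the V) = V" by (induction V) auto
  then have "None \<notin> set V \<Longrightarrow> wext (None # V) [w] (w # map the V)"
    using wext_last[of "map the V" w] by simp
  moreover have "map (the \<circ> Some) V' = V'" "None \<notin> set (map Some V')" for V' :: "'a list"
    by (induction V') auto
  moreover have "X \<in> (#) w ` wexts V [w] \<or> (\<exists>V'. V = map Some V' \<and> X = w # V')"
    if "wext (None # V) [w] X" for X
    using that by (cases rule: wext.cases) (auto simp: wexts_def)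
  ultimately show "wexts (None # V) [w] =
      (#) w ` wexts V [w] \<union> (if None \<in> set V then {} else {w # map the V})"
    unfolding wexts_def
  proof (intro equalityI subsetI, goal_cases)
    case (1 X)
    then have X: "wext (None # V) [w] X" by simp
    from 1(4)[OF X] show ?case
    proof
      assume "\<exists>V'. V = map Some V' \<and> X = w # V'"
      then obtain V' where "V = map Some V'" "X = w # V'" by blast
      then show ?thesis using 1(2)[of V'] 1(3)[of V'] by simp
    qed (simp add: wexts_def)
  next
    case (2 X)
    then show ?case by (auto intro: wext_stay split: if_splits)
  qed
qed

lemma finite_wexts: "finite (wexts V W)"
proof (induction V W rule: wsub.induct)
  case (4 V w W)
  then show ?case by (cases W) (auto simp: wexts_simps)
qed (simp_all add: wexts_simps)

text \<open>The two summands of the recursion enumerate the extensions that leave the block after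
  \<open>w\<close> and those that continue it; each extension is reached once and with the sign of
  its shuffle.\<close>

theorem wsub_eq_sum:
  assumes "no_interlace V" "no_interlace W" "\<And>x. Some x \<in> set V \<Longrightarrow> x \<notin> set W" "W \<noteq> []"
  shows "wsub V W = (\<Sum>X \<in> wexts V W. frag_cmul (wsgn W X) (frag_of X))"
  using assms
proof (induction V W rule: wsub.induct)
  case (1 W)
  then show ?case by (simp add: wexts_simps)
next
  case (2 x V W)
  have IH: "wsub V W = (\<Sum>X \<in> wexts V W. frag_cmul (wsgn W X) (frag_of X))"
    using 2 by (auto dest: no_interlace_Cons)
  have "(\<Sum>X \<in> wexts (Some x # V) W. frag_cmul (wsgn W X) (frag_of X)) =
      (\<Sum>X \<in> wexts V W. frag_cmul (wsgn W (x # X)) (frag_of (x # X)))"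
    by (simp add: wexts_simps sum.reindex)
  also have "\<dots> = (\<Sum>X \<in> wexts V W. frag_cmul (wsgn W X) (frag_of (x # X)))"
  proof (intro sum.cong refl)
    fix X assume "X \<in> wexts V W"
    then have "wext V W X" by (simp add: wexts_def)
    then have "wsgn W (x # X) = wsgn W X"
      by (rule wext_il_skip(2)[OF _ 2(3)]) (erule 2(4))
    then show "frag_cmul (wsgn W (x # X)) (frag_of (x # X)) = frag_cmul (wsgn W X) (frag_of (x # X))"
      by simp
  qed
  finally show ?case
    using IH finite_wexts[of V W] by (simp add: consm_def frag_extend_sum frag_extend_cmul o_def)
next
  case (3 V)
  then show ?case by simp
next
  case (4 V w W)
  let ?f = "\<lambda>W X. frag_cmul (wsgn W X) (frag_of X)"
  have V: "no_interlace V" using 4 by (auto dest: no_interlace_Cons)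
  have IH1: "wsub V (w # W) = sum (?f (w # W)) (wexts V (w # W))"
    using 4 V by auto
  have reindex: "sum (?f Y) ((#) w ` A) = (\<Sum>X \<in> A. frag_cmul (wsgn Y (w # X)) (frag_of (w # X)))" for Y A
    by (simp add: sum.reindex)
  have cons: "consm w (sum (?f Y) A) = (\<Sum>X \<in> A. frag_cmul (wsgn Y X) (frag_of (w # X)))" if "finite A" for A Y
    using that by (simp add: consm_def frag_extend_sum frag_extend_cmul o_def)
  have stay: "sum (?f (w # W)) ((#) w ` wexts V (w # W)) = consm w (wsub V (w # W))"
    unfolding reindex IH1 cons[OF finite_wexts]
  proof (intro sum.cong refl)
    fix X assume "X \<in> wexts V (w # W)"
    then have "wext V (w # W) X" by (simp add: wexts_def)
    then have "wsgn (w # W) (w # X) = wsgn (w # W) X"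
      by (rule wext_il_stay(2)[OF _ 4(4)]) (erule 4(5))
    then show "frag_cmul (wsgn (w # W) (w # X)) (frag_of (w # X)) =
        frag_cmul (wsgn (w # W) X) (frag_of (w # X))" by simp
  qed
  show ?case
  proof (cases W)
    case Nil
    show ?thesis
    proof (cases "None \<in> set V")
      case True
      then show ?thesis using stay Nil by (simp add: wexts_simps)
    next
      case False
      have "w \<notin> set (map the V)"
      proof
        assume "w \<in> set (map the V)"
        then obtain y where "y \<in> set V" "w = the y" unfolding set_map by blast
        then have "y \<noteq> None" using False by metis
        then have "y = Some w" using \<open>w = the y\<close> by simp
        then have "Some w \<in> set (None # V)" using \<open>y \<in> set V\<close> by simp
        then show False using 4(5)[of w] by simp
      qed
      moreover have "wexts V [w] = {}" using False wext_None unfolding wexts_def by blast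
      ultimately show ?thesis
        using Nil False by (simp add: wexts_simps wsub_no_None wsgn_last)
    qed
  next
    case (Cons w' W')
    have IH2: "wsub (None # V) W = sum (?f W) (wexts (None # V) W)"
      using 4 Cons by (auto dest: no_interlace_Cons)
    \<comment> \<open>Placeholders are not adjacent, so after leaving the block the next letter is
      an outer one, whereas continuing the block puts \<open>w'\<close> there.\<close>
    have disj: "(#) w ` wexts V (w # W) \<inter> (#) w ` wexts (None # V) W = {}"
    proof -
      have False if "wext V (w # W) X" "wext (None # V) W X" for X
      proof -
        have "V \<noteq> []" using wext_nonempty[OF that(1)] by simp
        moreover have "hd V \<noteq> None"
          using 4(3) calculation unfolding no_interlace_def by (metis distinct_adj_Cons)
        ultimately obtain y where "hd V = Some y" "Some y \<in> set (None # V)"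
          by (metis hd_in_set list.set_intros(2) option.exhaust)
        moreover have "hd X = y" using wext_hd_fill[OF that(1)] calculation by simp
        moreover have "hd X = w'" using wext_hd_fill[OF that(2)] Cons by simp
        ultimately show False using 4(5)[of y] Cons by simp
      qed
      then show ?thesis by (auto simp: wexts_def)
    qed
    have step: "sum (?f (w # W)) ((#) w ` wexts (None # V) W) =
        frag_cmul (if w \<in> set W then (-1) ^ wexc (None # V) else 1) (consm w (wsub (None # V) W))"
      unfolding reindex IH2 cons[OF finite_wexts] frag_cmul_sum
    proof (simp only: o_def frag_cmul_cmul, intro sum.cong refl)
      fix X assume "X \<in> wexts (None # V) W"
      then have "wext (None # V) (w' # W') X" by (simp add: wexts_def Cons)
      then have "wsgn (w # W) (w # X) =
          (if w \<in> set W then (-1) ^ wexc (None # V) else 1) * wsgn W X"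
        unfolding Cons
        by (rule wsgn_step[OF _ 4(3) 4(4)[unfolded Cons]]) (erule 4(5)[unfolded Cons])
      then show "frag_cmul (wsgn (w # W) (w # X)) (frag_of (w # X)) =
          frag_cmul ((if w \<in> set W then (-1) ^ wexc (None # V) else 1) * wsgn W X) (frag_of (w # X))"
        by simp
    qed
    have "sum (?f (w # W)) (wexts (None # V) (w # W)) =
        sum (?f (w # W)) ((#) w ` wexts V (w # W)) + sum (?f (w # W)) ((#) w ` wexts (None # V) W)"
      unfolding Cons wexts_simps using disj unfolding Cons
      by (intro sum.union_disjoint) (simp_all add: finite_wexts)
    then show ?thesis using stay step by simp
  qed
qed

section \<open>Shuffle signs\<close>

lemma remdups_snoc: "remdups (xs @ [x]) = filter (\<lambda>y. y \<noteq> x) (remdups xs) @ [x]"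
  by (induction xs) auto

lemma down_order_Cons: "down_order (x # w) = x # filter (\<lambda>y. y \<noteq> x) (down_order w)"
  by (simp add: down_order_def remdups_snoc rev_filter)

lemma interposed_iff: "interposed w v \<longleftrightarrow> v \<in> set (il w)"
proof (induction w)
  case Nil
  then show ?case by (simp add: interposed_def)
next
  case (Cons x w)
  have "interposed (x # w) v \<longleftrightarrow> (x \<in> set w \<and> v = hd w) \<or> interposed w v"
  proof
    assume "interposed (x # w) v"
    then obtain i where i: "Suc i < length (x # w)" "(x # w) ! Suc i = v" "caesura (x # w) i"
      by (auto simp: interposed_def)
    show "(x \<in> set w \<and> v = hd w) \<or> interposed w v"
    proof (cases i)
      case 0
      then show ?thesis using i by (simp add: caesura_Cons_0 hd_conv_nth)
    next
      case (Suc j)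
      then show ?thesis using i by (auto simp: caesura_Cons_Suc interposed_def)
    qed
  next
    assume "(x \<in> set w \<and> v = hd w) \<or> interposed w v"
    then show "interposed (x # w) v"
    proof
      assume x: "x \<in> set w \<and> v = hd w"
      then show ?thesis unfolding interposed_def
        by (intro exI[of _ 0]) (cases w, auto simp: caesura_Cons_0)
    next
      assume "interposed w v"
      then obtain i where "Suc i < length w" "w ! Suc i = v" "caesura w i"
        by (auto simp: interposed_def)
      then show ?thesis unfolding interposed_def
        by (intro exI[of _ "Suc i"]) (simp add: caesura_Cons_Suc)
    qed
  qed
  then show ?case using Cons.IH by auto
qed

lemma interposed_eq: "interposed w = (\<lambda>v. v \<in> set (il w))"
  by (simp add: fun_eq_iff interposed_iff)

text \<open>If \<open>x\<close> recurs, the new entry is the first letter of \<open>w\<close>, which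
  heads the order of first occurrences and by \<open>hd_notin_il\<close> was not interposed before.
  Removing \<open>x\<close> from that order is harmless because \<open>x\<close> is not
  interposed.\<close>

lemma interposed_list_eq_il: "no_interlace w \<Longrightarrow> interposed_list w = il w"
proof (induction w)
  case Nil
  then show ?case by (simp add: interposed_list_def down_order_def)
next
  case (Cons x w)
  have IH: "filter (\<lambda>v. v \<in> set (il w)) (down_order w) = il w"
    using Cons.IH[OF no_interlace_Cons[OF Cons.prems]] by (simp only: interposed_list_def interposed_eq)
  have x: "x \<notin> set (il (x # w))" using hd_notin_il[OF Cons.prems] by simp
  have "interposed_list (x # w) = filter (\<lambda>v. v \<in> set (il (x # w))) (x # filter (\<lambda>y. y \<noteq> x) (down_order w))"
    by (simp only: interposed_list_def down_order_Cons interposed_eq)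
  also have "\<dots> = filter (\<lambda>v. v \<in> set (il (x # w))) (filter (\<lambda>y. y \<noteq> x) (down_order w))"
    using x by (simp del: il.simps)
  also have "\<dots> = filter (\<lambda>v. v \<in> set (il (x # w))) (down_order w)"
    unfolding filter_filter by (rule filter_cong) (use x in \<open>auto simp del: il.simps\<close>)
  also have "\<dots> = il (x # w)"
  proof (cases "x \<in> set w")
    case False
    then show ?thesis using IH by simp
  next
    case True
    then obtain h v where w: "w = h # v" by (cases w) auto
    have h: "h \<notin> set (il w)" using hd_notin_il[of w] Cons.prems w no_interlace_Cons by fastforce
    have il: "il (x # w) = h # il w" using True w by simp
    let ?d = "filter (\<lambda>y. y \<noteq> h) (down_order v)"
    have dw: "down_order w = h # ?d" by (simp only: w down_order_Cons)
    have "filter (\<lambda>u. u \<in> set (h # il w)) ?d = filter (\<lambda>u. u \<in> set (il w)) ?d"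
      unfolding filter_filter by (rule filter_cong) auto
    moreover have "filter (\<lambda>u. u \<in> set (il w)) ?d = il w"
      using IH h unfolding dw by simp
    ultimately show ?thesis unfolding il dw by simp
  qed
  finally show ?case .
qed

text \<open>On a list of distinct entries the rearranged list determines the permutation, so the
  description in \<open>rearrangement_sgn\<close> has exactly one candidate.\<close>

lemma rearrangement_sgn_permute:
  assumes "distinct xs" "p permutes {..<length xs}"
  shows "rearrangement_sgn xs (permute_list p xs) = sign p"
proof -
  have "q = p" if q: "q permutes {..<length xs}" "permute_list q xs = permute_list p xs" for q
  proof
    fix i
    show "q i = p i"
    proof (cases "i < length xs")
      case True
      then have "xs ! q i = xs ! p i"
        using q(2) permute_list_nth[OF q(1) True] permute_list_nth[OF assms(2) True] by simp
      moreover have "q i < length xs" "p i < length xs"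
        using True permutes_in_image[OF q(1)] permutes_in_image[OF assms(2)] by auto
      ultimately show ?thesis using assms(1) by (simp add: nth_eq_iff_index_eq)
    next
      case False
      then show ?thesis using q(1) assms(2) by (simp add: permutes_def)
    qed
  qed
  then have "(THE q. q permutes {..<length xs} \<and> permute_list q xs = permute_list p xs) = p"
    using assms(2) by (intro the_equality) auto
  then show ?thesis by (simp add: rearrangement_sgn_def)
qed

lemma rearrangement_sgn_refl: "distinct xs \<Longrightarrow> rearrangement_sgn xs xs = 1"
  using rearrangement_sgn_permute[of xs id] by (simp add: permutes_id)

lemma rearrangement_sgn_trans:
  assumes "distinct xs" "mset xs = mset ys" "mset ys = mset zs"
  shows "rearrangement_sgn xs zs = rearrangement_sgn xs ys * rearrangement_sgn ys zs"
proof -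
  obtain p where p: "p permutes {..<length xs}" "permute_list p xs = ys"
    using mset_eq_permutation[OF assms(2)[symmetric]] .
  obtain q where q: "q permutes {..<length ys}" "permute_list q ys = zs"
    using mset_eq_permutation[OF assms(3)[symmetric]] .
  have len: "length ys = length xs" using assms(2) by (metis size_mset)
  have "distinct ys" using assms(1,2) by (metis mset_eq_imp_distinct_iff)
  have q': "q permutes {..<length xs}" using q(1) len by simp
  have "permute_list (p \<circ> q) xs = zs" using permute_list_compose[OF q'] p q by simp
  moreover have "p \<circ> q permutes {..<length xs}" using permutes_compose[OF q' p(1)] .
  ultimately have "rearrangement_sgn xs zs = sign (p \<circ> q)"
    using rearrangement_sgn_permute[OF assms(1)] by metis
  also have "\<dots> = sign p * sign q"
    using p(1) q' by (intro sign_compose permutes_imp_permutation[of "{..<length xs}"]) auto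
  also have "sign p = rearrangement_sgn xs ys"
    using rearrangement_sgn_permute[OF assms(1) p(1)] p(2) by simp
  also have "sign q = rearrangement_sgn ys zs"
    using rearrangement_sgn_permute[OF \<open>distinct ys\<close> q(1)] q(2) by simp
  finally show ?thesis .
qed

lemma rearrangement_sgn_swap:
  assumes "distinct (as @ x # y # bs)"
  shows "rearrangement_sgn (as @ x # y # bs) (as @ y # x # bs) = -1"
proof -
  let ?xs = "as @ x # y # bs" and ?p = "transpose (length as) (Suc (length as))"
  have p: "?p permutes {..<length ?xs}" by (rule permutes_swap_id) auto
  have "permute_list ?p ?xs = as @ y # x # bs"
  proof (rule nth_equalityI)
    fix i assume "i < length (permute_list ?p ?xs)"
    then have i: "i < length ?xs" by simp
    have "permute_list ?p ?xs ! i = ?xs ! ?p i" by (rule permute_list_nth[OF p i])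
    also have "\<dots> = (as @ y # x # bs) ! i"
    proof -
      consider "i < length as" | "i = length as" | "i = Suc (length as)" | l where "i = Suc (Suc (length as + l))"
        using less_iff_Suc_add[of "Suc (length as)" i] by (metis add_Suc linorder_neqE_nat less_SucE)
      then show ?thesis
        by cases (simp_all add: nth_append transpose_def)
    qed
    finally show "permute_list ?p ?xs ! i = (as @ y # x # bs) ! i" .
  qed simp
  then show ?thesis using rearrangement_sgn_permute[OF assms p] by (simp add: sign_swap_id)
qed

lemma rearrangement_sgn_move:
  "distinct (as @ F @ y # bs) \<Longrightarrow>
   rearrangement_sgn (as @ F @ y # bs) (as @ y # F @ bs) = (-1) ^ length F"
proof (induction F arbitrary: as)
  case Nil
  then show ?case by (simp add: rearrangement_sgn_refl)
next
  case (Cons f F)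
  have "rearrangement_sgn (as @ (f # F) @ y # bs) (as @ y # (f # F) @ bs) =
      rearrangement_sgn (as @ (f # F) @ y # bs) (as @ f # y # F @ bs) *
      rearrangement_sgn (as @ f # y # F @ bs) (as @ y # (f # F) @ bs)"
    by (rule rearrangement_sgn_trans) (use Cons.prems in simp_all)
  also have "rearrangement_sgn (as @ (f # F) @ y # bs) (as @ f # y # F @ bs) = (-1) ^ length F"
    using Cons.IH[of "as @ [f]"] Cons.prems by simp
  also have "rearrangement_sgn (as @ f # y # F @ bs) (as @ y # (f # F) @ bs) = -1"
    using rearrangement_sgn_swap[of as f y "F @ bs"] Cons.prems by auto
  finally show ?case by simp
qed

text \<open>The prefix \<open>as\<close> holds the entries already in place, as the induction
  requires. An entry of \<open>A\<close> is moved to the front past all entries outside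
  \<open>A\<close> that follow it, which is its contribution to \<open>winv\<close>.\<close>

lemma rearrangement_sgn_shuffle_context:
  "distinct (as @ ys) \<Longrightarrow>
   rearrangement_sgn (as @ filter (\<lambda>x. x \<notin> A) ys @ filter (\<lambda>x. x \<in> A) ys) (as @ ys) = (-1) ^ winv A ys"
proof (induction ys arbitrary: as)
  case Nil
  then show ?case by (simp add: rearrangement_sgn_refl)
next
  case (Cons y ys)
  let ?N = "filter (\<lambda>x. x \<notin> A) ys" and ?F = "filter (\<lambda>x. x \<in> A) ys"
  have IH: "rearrangement_sgn (as @ y # ?N @ ?F) (as @ y # ys) = (-1) ^ winv A ys"
    using Cons.IH[of "as @ [y]"] Cons.prems by simp
  show ?case
  proof (cases "y \<in> A")
    case False
    then show ?thesis using IH by simp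
  next
    case True
    have m: "mset (?N @ ?F) = mset ys" by (simp add: add.commute flip: mset_filter) (metis multiset_partition add.commute mset_filter)
    have d: "distinct (as @ ?N @ y # ?F)" using Cons.prems by auto
    have "rearrangement_sgn (as @ ?N @ y # ?F) (as @ y # ys) =
        rearrangement_sgn (as @ ?N @ y # ?F) (as @ y # ?N @ ?F) *
        rearrangement_sgn (as @ y # ?N @ ?F) (as @ y # ys)"
      using m by (intro rearrangement_sgn_trans d) (simp_all add: add.assoc)
    also have "rearrangement_sgn (as @ ?N @ y # ?F) (as @ y # ?N @ ?F) = (-1) ^ length ?N"
      using d by (rule rearrangement_sgn_move)
    finally show ?thesis using True IH by (simp add: power_add)
  qed
qed

lemma rearrangement_sgn_shuffle:
  "distinct ys \<Longrightarrow>
   rearrangement_sgn (filter (\<lambda>x. x \<notin> A) ys @ filter (\<lambda>x. x \<in> A) ys) ys = (-1) ^ winv A ys"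
  using rearrangement_sgn_shuffle_context[of "[]"] by simp

lemma distinct_il: "no_interlace w \<Longrightarrow> distinct (il w)"
proof (induction w)
  case (Cons x w)
  then have w: "no_interlace w" "distinct (il w)" by (auto dest: no_interlace_Cons)
  show ?case
  proof (cases "x \<in> set w")
    case True
    then have "hd w \<notin> set (il w)" by (intro hd_notin_il[OF w(1)]) auto
    then show ?thesis using w True by simp
  qed (use w in simp)
qed simp

section \<open>Extensions of words as substitutions\<close>

text \<open>Gives the outer letters the names they have in the extension and turns the slot
  \<open>a\<close> into the placeholder.\<close>

definition outer_letter :: "nat \<Rightarrow> nat \<Rightarrow> nat \<Rightarrow> nat option" where
  "outer_letter n a v = (if v = a then None else Some (if v < a then v else v + n - 1))"

lemma inj_outer_letter: "n \<ge> 1 \<Longrightarrow> inj (outer_letter n a)"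
  by (rule injI) (auto simp: outer_letter_def split: if_splits)

lemma inj_shift: "a \<ge> 1 \<Longrightarrow> inj (shift a)"
  by (rule injI) (auto simp: shift_def)

lemma shift_image: "a \<ge> 1 \<Longrightarrow> shift a ` {1..n} = {a..<a + n}"
proof (intro equalityI subsetI)
  fix x assume "a \<ge> 1" "x \<in> {a..<a + n}"
  then have "x = shift a (x + 1 - a)" "x + 1 - a \<in> {1..n}" by (auto simp: shift_def)
  then show "x \<in> shift a ` {1..n}" by blast
qed (auto simp: shift_def)

lemma in_shift_image: "a \<ge> 1 \<Longrightarrow> x \<in> shift a ` {1..n} \<longleftrightarrow> a \<le> x \<and> x < a + n"
  by (simp only: shift_image) simp

lemma outer_letter_collapse:
  "n \<ge> 1 \<Longrightarrow> a \<ge> 1 \<Longrightarrow> outer_letter n a (collapse n a x) = (if x \<in> shift a ` {1..n} then None else Some x)"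
  by (simp only: in_shift_image) (auto simp: outer_letter_def collapse_def)

lemma Some_outer_letter:
  "Some x \<in> outer_letter n a ` A \<Longrightarrow> a \<ge> 1 \<Longrightarrow> x \<notin> shift a ` {1..n}"
  by (simp only: in_shift_image) (auto simp: outer_letter_def split: if_splits)

lemma outer_letter_Some_set:
  "a \<in> {1..m} \<Longrightarrow> n \<ge> 1 \<Longrightarrow>
   {x. Some x \<in> outer_letter n a ` {1..m}} \<union> shift a ` {1..n} = {1..n + m - 1}"
proof (intro equalityI subsetI)
  fix x assume *: "a \<in> {1..m}" "n \<ge> 1" and x: "x \<in> {1..n + m - 1}"
  show "x \<in> {x. Some x \<in> outer_letter n a ` {1..m}} \<union> shift a ` {1..n}"
  proof (cases "x \<in> shift a ` {1..n}")
    case False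
    then have "outer_letter n a (collapse n a x) = Some x" using * by (simp add: outer_letter_collapse)
    moreover have "collapse n a x \<in> {1..m}" using x * by (auto simp: collapse_def)
    ultimately show ?thesis by force
  qed simp
qed (auto simp: outer_letter_def shift_def split: if_splits)

context
  fixes m n :: nat and V W :: "nat list" and a :: nat
  assumes V: "V \<in> F2S m" and W: "W \<in> F2S n" and a: "a \<in> {1..m}" and n: "n \<ge> 1"
begin

lemma ext_no_interlace:
  "no_interlace (map (outer_letter n a) V)" "no_interlace (map (shift a) W)"
  using V W a n inj_outer_letter[OF n] inj_shift[of a] by (auto simp: F2S_iff no_interlace_map)

lemma ext_disjoint:
  "Some x \<in> set (map (outer_letter n a) V) \<Longrightarrow> x \<notin> set (map (shift a) W)"
  using Some_outer_letter[of x n a "set V"] a W by (auto simp: F2S_iff)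

lemma ext_inner_nonempty: "map (shift a) W \<noteq> []"
  using W n by (auto simp: F2S_iff)

text \<open>Composing with the injective map \<open>outer_letter n a\<close> turns
  \<open>collapse n a\<close> into \<open>collapse_to_None\<close>, so the conditions of
  \<open>Ext_word\<close> become those of \<open>wextI\<close> and \<open>wextD\<close>.\<close>

lemma Ext_word_eq: "Ext_word m n V W a = wexts (map (outer_letter n a) V) (map (shift a) W)"
proof -
  let ?P = "shift a ` {1..n}" and ?V = "map (outer_letter n a) V" and ?W = "map (shift a) W"
  have a1: "a \<ge> 1" using a by simp
  have c: "collapse_to_None ?P X = map (outer_letter n a) (map (collapse n a) X)" for X
    using n a1 by (simp add: collapse_to_None_def outer_letter_collapse)
  have r: "remdups_adj (collapse_to_None ?P X) = ?V \<longleftrightarrow> remdups_adj (map (collapse n a) X) = V" for X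
    unfolding c remdups_adj_map_injective[OF inj_outer_letter[OF n]]
    using inj_outer_letter[OF n] by (simp add: inj_map_eq_map)
  show ?thesis
  proof (intro equalityI subsetI)
    fix X assume X: "X \<in> Ext_word m n V W a"
    note X' = X[unfolded Ext_word_def mem_Collect_eq]
    have "distinct_adj X" using X' by (simp only: F2S_iff no_interlace_def)
    moreover have "gaps_constant ?P X"
      unfolding gaps_constant_iff using X'[THEN conjunct2, THEN conjunct2, THEN conjunct1] .
    moreover have "remdups_adj (filter (\<lambda>x. x \<in> ?P) X) = ?W"
      using X'[THEN conjunct2, THEN conjunct1] .
    moreover have "remdups_adj (collapse_to_None ?P X) = ?V"
      unfolding r using X'[THEN conjunct2, THEN conjunct2, THEN conjunct2] .
    ultimately have "wext ?V ?W X" using ext_inner_nonempty by (intro wextI[where P = ?P])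
    then show "X \<in> wexts ?V ?W" by (simp add: wexts_def)
  next
    fix X assume "X \<in> wexts ?V ?W"
    then have X: "wext ?V ?W X" by (simp add: wexts_def)
    have "set ?W \<subseteq> ?P" using W by (auto simp: F2S_iff)
    then have D: "distinct_adj X \<and> remdups_adj (filter (\<lambda>x. x \<in> ?P) X) = ?W \<and> gaps_constant ?P X \<and>
        remdups_adj (collapse_to_None ?P X) = ?V"
      using ext_no_interlace Some_outer_letter[of _ n a "set V"] a1
      by (intro wextD[OF X]) (auto simp: no_interlace_def)
    have "no_interlace X" using wext_no_interlace[OF X ext_no_interlace ext_disjoint] by simp
    moreover have "set X = {1..n + m - 1}"
      using wext_set[OF X] V W outer_letter_Some_set[OF a n] by (simp add: F2S_iff)
    ultimately show "X \<in> Ext_word m n V W a"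
      using D unfolding Ext_word_def r gaps_constant_iff by (simp add: F2S_iff)
  qed
qed

text \<open>By \<open>wext_il\<close> the source of the rearrangement is the outer part of
  \<open>il X\<close> followed by its inner part, so the sign is the parity of the
  inversions.\<close>

lemma ext_sgn_eq:
  assumes "X \<in> Ext_word m n V W a"
  shows "ext_sgn n V W a X = wsgn (map (shift a) W) X"
proof -
  let ?V = "map (outer_letter n a) V" and ?W = "map (shift a) W"
  have X: "wext ?V ?W X" using assms by (simp add: Ext_word_eq wexts_def)
  have nX: "no_interlace X" using wext_no_interlace[OF X ext_no_interlace ext_disjoint] by simp
  have il: "filter (\<lambda>x. x \<in> set (il ?W)) (il X) = il ?W"
    "filter (\<lambda>x. x \<notin> set (il ?W)) (il X) = map (fill (hd ?W)) (il ?V)"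
    using wext_il[OF X ext_no_interlace ext_disjoint] by simp_all
  have "fill (hd ?W) (outer_letter n a v) = outer_vertex n W a v" for v
    using ext_inner_nonempty by (simp add: outer_letter_def outer_vertex_def hd_map)
  then have oV: "map (fill (hd ?W)) (il ?V) = map (outer_vertex n W a) (interposed_list V)"
    using V inj_outer_letter[OF n] by (simp add: il_map interposed_list_eq_il F2S_iff)
  have oW: "il ?W = map (shift a) (interposed_list W)"
    using W inj_shift[of a] a by (simp add: il_map interposed_list_eq_il F2S_iff)
  have "ext_sgn n V W a X = rearrangement_sgn (map (fill (hd ?W)) (il ?V) @ il ?W) (il X)"
    unfolding ext_sgn_def interposed_list_eq_il[OF nX] oV oW ..
  also have "\<dots> = rearrangement_sgn
      (filter (\<lambda>x. x \<notin> set (il ?W)) (il X) @ filter (\<lambda>x. x \<in> set (il ?W)) (il X)) (il X)"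
    by (simp only: il)
  also have "\<dots> = wsgn ?W X"
    unfolding wsgn_def by (rule rearrangement_sgn_shuffle[OF distinct_il[OF nX]])
  finally show ?thesis .
qed

lemma Ext_word_wdeg:
  assumes "X \<in> Ext_word m n V W a"
  shows "wdeg X = wdeg V + wdeg W"
proof -
  have "Suc (length X) = length V + length W"
    using assms wext_length[of "map (outer_letter n a) V" "map (shift a) W" X]
    by (simp add: Ext_word_eq wexts_def)
  moreover have "set X = {1..n + m - 1}" using assms by (simp add: Ext_word_def F2S_iff)
  ultimately show ?thesis using V W n a by (simp add: wdeg_def F2S_iff)
qed

lemma wsub_eq_sum_Ext_word:
  "wsub (map (outer_letter n a) V) (map (shift a) W) =
     (\<Sum>X \<in> Ext_word m n V W a. frag_cmul (ext_sgn n V W a X) (frag_of X))"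
  using wsub_eq_sum[OF ext_no_interlace ext_disjoint ext_inner_nonempty]
  by (simp add: Ext_word_eq[symmetric] ext_sgn_eq)

lemma finite_Ext_word: "finite (Ext_word m n V W a)"
  by (simp add: Ext_word_eq finite_wexts)

end

section \<open>Quilts are closed under composition\<close>

lemma collapse_eq_iff: "n \<ge> 1 \<Longrightarrow> a \<ge> 1 \<Longrightarrow> collapse n a x = a \<longleftrightarrow> x \<in> shift a ` {1..n}"
  by (simp only: in_shift_image) (auto simp: collapse_def)

lemma collapse_inj: "n \<ge> 1 \<Longrightarrow> collapse n a x = collapse n a y \<Longrightarrow> collapse n a x \<noteq> a \<Longrightarrow> x = y"
  by (auto simp: collapse_def split: if_splits)

lemma collapse_in: "n \<ge> 1 \<Longrightarrow> a \<in> {1..m} \<Longrightarrow> x \<in> {1..n + m - 1} \<Longrightarrow> collapse n a x \<in> {1..m}"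
  by (auto simp: collapse_def)

lemma Tree_facts:
  assumes "T \<in> Tree n"
  shows "verts T = {1..n}" "edges T \<subseteq> {1..n} \<times> {1..n}" "partial_order_on {1..n} (horder T)"
    "partial_order_on {1..n} (vle T)" "n \<ge> 1"
proof -
  have t: "is_tree T" "verts T = {1..n}" using assms by (simp_all add: Tree_def)
  note f = t(1)[unfolded is_tree_def t(2)]
  show "verts T = {1..n}" by (rule t(2))
  show "edges T \<subseteq> {1..n} \<times> {1..n}" using f by (elim conjE)
  show "partial_order_on {1..n} (horder T)" using f by (elim conjE)
  show "partial_order_on {1..n} (vle T)" using f by (elim conjE)
  have "\<exists>!r. r \<in> {1..n} \<and> (\<forall>v \<in> {1..n}. (v, r) \<notin> vless T)" using f by (elim conjE)
  then show "n \<ge> 1" by (cases n) auto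
qed

context
  fixes m n :: nat and S T U :: tree and a :: nat
  assumes S: "S \<in> Tree m" and T: "T \<in> Tree n" and a: "a \<in> {1..m}" and U: "U \<in> Ext_tree m n S T a"
begin

lemma ext_tree_facts:
  shows "U \<in> Tree (n + m - 1)"
    and "\<And>r s. r \<in> {1..n} \<Longrightarrow> s \<in> {1..n} \<Longrightarrow> (r, s) \<in> edges T \<longleftrightarrow> (shift a r, shift a s) \<in> edges U"
    and "\<And>r s. r \<in> {1..n} \<Longrightarrow> s \<in> {1..n} \<Longrightarrow> (r, s) \<in> hless T \<longleftrightarrow> (shift a r, shift a s) \<in> hless U"
    and "\<And>u w. (u, w) \<in> edges U \<Longrightarrow>
      (collapse n a u, collapse n a w) \<in> edges S \<or> collapse n a u = a \<and> collapse n a w = a"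
    and "\<And>u w. u \<in> {1..n + m - 1} \<Longrightarrow> w \<in> {1..n + m - 1} \<Longrightarrow>
      (collapse n a u, collapse n a w) \<in> hless S \<Longrightarrow> (u, w) \<in> hless U"
  using U unfolding Ext_tree_def by auto

lemma collapse_path: "(u, w) \<in> (edges U)\<^sup>* \<Longrightarrow> (collapse n a u, collapse n a w) \<in> (edges S)\<^sup>*"
proof (induction rule: rtrancl_induct)
  case (step x y)
  then show ?case using ext_tree_facts(4)[OF step(2)] by (auto intro: rtrancl.rtrancl_into_rtrancl)
qed simp

lemma edges_verts: "(u, w) \<in> edges U \<Longrightarrow> u \<in> {1..n + m - 1} \<and> w \<in> {1..n + m - 1}"
  using Tree_facts(2)[OF ext_tree_facts(1)] by auto

lemma n_ge_1: "n \<ge> 1" and a_ge_1: "a \<ge> 1"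
  using Tree_facts(5)[OF T] a by auto

text \<open>A path of \<open>U\<close> between two inserted vertices collapses to a closed path of
  \<open>S\<close> through \<open>a\<close>. Antisymmetry makes it constant, so the path never
  leaves the inserted copy of \<open>T\<close>.\<close>

lemma inner_path:
  "(u, w) \<in> (edges U)\<^sup>* \<Longrightarrow> u = shift a r \<Longrightarrow> w = shift a s \<Longrightarrow> r \<in> {1..n} \<Longrightarrow> s \<in> {1..n} \<Longrightarrow>
   (r, s) \<in> (edges T)\<^sup>*"
proof (induction arbitrary: r rule: converse_rtrancl_induct)
  case base
  then have "r = s" using inj_shift[OF a_ge_1] by (auto dest: injD)
  then show ?case by simp
next
  case (step u x)
  have cu: "collapse n a u = a" and cw: "collapse n a w = a"
    using step collapse_eq_iff[OF n_ge_1 a_ge_1] by auto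
  have xv: "x \<in> {1..n + m - 1}" using edges_verts[OF step(1)] by simp
  have cx: "collapse n a x \<in> {1..m}" using collapse_in[OF n_ge_1 a xv] .
  have "(collapse n a x, a) \<in> (edges S)\<^sup>*" using collapse_path[OF step(2)] cw by simp
  then have 1: "(collapse n a x, a) \<in> vle S" using Tree_facts(1)[OF S] cx a by (simp add: vle_def)
  have "(a, collapse n a x) \<in> (edges S)\<^sup>*" using collapse_path[of u x] step(1) cu by auto
  then have 2: "(a, collapse n a x) \<in> vle S" using Tree_facts(1)[OF S] cx a by (simp add: vle_def)
  have "antisym (vle S)" using Tree_facts(4)[OF S] by (simp add: partial_order_on_def)
  then have "collapse n a x = a" using 1 2 by (simp add: antisym_def)
  then obtain t where t: "x = shift a t" "t \<in> {1..n}"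
    using collapse_eq_iff[OF n_ge_1 a_ge_1] by auto
  then have "(t, s) \<in> (edges T)\<^sup>*" using step by simp
  moreover have "(r, t) \<in> edges T" using ext_tree_facts(2)[of r t] step t by simp
  ultimately show ?case by simp
qed

context
  fixes V W :: "nat list"
  assumes VS: "(V, S) \<in> Quilts m" and WT: "(W, T) \<in> Quilts n"
begin

text \<open>Two letters that remain distinct after collapsing are controlled by the outer quilt; two
  distinct letters that are identified both lie in the inserted copy and are controlled by the inner
  one.\<close>

lemma Quilts_Ext:
  assumes X: "X \<in> Ext_word m n V W a"
  shows "(X, U) \<in> Quilts (n + m - 1)"
proof -
  let ?P = "shift a ` {1..n}" and ?c = "collapse n a"
  have XF: "X \<in> F2S (n + m - 1)" and fX: "remdups_adj (filter (\<lambda>u. u \<in> ?P) X) = map (shift a) W"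
    and cX: "remdups_adj (map ?c X) = V" using X by (auto simp: Ext_word_def)
  have letter: "x \<in> {1..n + m - 1}" if "subseq xs X" "x \<in> set xs" for x xs
    using list_emb_set[OF that] XF by (auto simp: F2S_iff)
  have outer: "subseq (map ?c xs) V" if "subseq xs X" "distinct_adj (map ?c xs)" for xs
    using subseq_remdups_adj[OF subseq_map[OF that(1)] that(2)] cX by simp
  have inner: "subseq xs (map (shift a) W)" if "subseq xs X" "set xs \<subseteq> ?P" "distinct_adj xs" for xs
  proof -
    have "filter (\<lambda>u. u \<in> ?P) xs = xs" using that(2) by (auto simp: filter_id_conv)
    then have "subseq xs (filter (\<lambda>u. u \<in> ?P) X)" using subseq_filter[OF that(1)] by metis
    then show ?thesis using subseq_remdups_adj[OF _ that(3)] fX by metis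
  qed
  have shift_sub: "subseq rs W" if "subseq (map (shift a) rs) (map (shift a) W)" for rs
    using that subseq_map_inj[OF inj_shift[OF a_ge_1]] by blast
  have cases: "?c u \<noteq> ?c v \<or> u = v \<or> (\<exists>r s. u = shift a r \<and> v = shift a s \<and> r \<in> {1..n} \<and> s \<in> {1..n} \<and> r \<noteq> s)" for u v
  proof (cases "?c u = ?c v \<and> u \<noteq> v")
    case True
    then have "?c u = a" "?c v = a" using collapse_inj[OF n_ge_1] by metis+
    then have "u \<in> ?P" "v \<in> ?P" by (simp_all only: collapse_eq_iff[OF n_ge_1 a_ge_1])
    then obtain r s where "u = shift a r" "v = shift a s" "r \<in> {1..n}" "s \<in> {1..n}"
      by (elim imageE)
    then show ?thesis using True by metis
  qed auto
  have 1: "(v, u) \<notin> vless U" if uv: "subseq [u, v] X" for u v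
  proof
    assume vu: "(v, u) \<in> vless U"
    then have path: "(v, u) \<in> (edges U)\<^sup>*" and ne: "v \<noteq> u" by (auto simp: vless_def vle_def)
    have in_range: "u \<in> {1..n + m - 1}" "v \<in> {1..n + m - 1}" using letter[OF uv] by auto
    consider "?c u \<noteq> ?c v"
      | r s where "u = shift a r" "v = shift a s" "r \<in> {1..n}" "s \<in> {1..n}" "r \<noteq> s"
      using cases[of u v] ne by auto
    then show False
    proof cases
      case 1
      then have "subseq [?c u, ?c v] V" using outer[OF uv] by simp
      then have "(?c v, ?c u) \<notin> vless S" using VS by (simp add: Quilts_iff)
      moreover have "(?c v, ?c u) \<in> vle S"
        using collapse_path[OF path] collapse_in[OF n_ge_1 a] in_range Tree_facts(1)[OF S]
        by (simp add: vle_def)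
      ultimately show False using 1 by (simp add: vless_def)
    next
      case 2
      then have "subseq (map (shift a) [r, s]) (map (shift a) W)"
        using inner[OF uv] ne by auto
      then have "(s, r) \<notin> vless T" using WT shift_sub by (simp add: Quilts_iff)
      moreover have "(s, r) \<in> vle T"
        using inner_path[OF path] 2 Tree_facts(1)[OF T] by (simp add: vle_def)
      ultimately show False using 2 by (simp add: vless_def)
    qed
  qed
  have 2: "(v, u) \<in> horder U" if uv: "subseq [u, v, u] X" for u v
  proof -
    have in_range: "u \<in> {1..n + m - 1}" "v \<in> {1..n + m - 1}" using letter[OF uv] by auto
    consider "?c u \<noteq> ?c v" | "u = v"
      | r s where "u = shift a r" "v = shift a s" "r \<in> {1..n}" "s \<in> {1..n}" "r \<noteq> s" "u \<noteq> v"
      using cases[of u v] by auto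
    then show ?thesis
    proof cases
      case 1
      then have "subseq [?c u, ?c v, ?c u] V" using outer[OF uv] by simp
      then have "(?c v, ?c u) \<in> horder S" using VS by (simp add: Quilts_iff)
      \<comment> \<open>\<open>Ext_tree\<close> transports only the strict horizontal order;
        strictness is available because the collapsed letters differ.\<close>
      then have "(?c v, ?c u) \<in> hless S" using 1 by (simp add: hless_def)
      then have "(v, u) \<in> hless U" using ext_tree_facts(5) in_range by blast
      then show ?thesis by (simp add: hless_def)
    next
      case 2
      have "refl_on {1..n + m - 1} (horder U)"
        using Tree_facts(3)[OF ext_tree_facts(1)] by (simp add: partial_order_on_def preorder_on_def)
      then show ?thesis using 2 in_range by (simp add: refl_on_def)
    next
      case 3
      then have "subseq (map (shift a) [r, s, r]) (map (shift a) W)"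
        using inner[OF uv] by auto
      then have "(s, r) \<in> horder T" using WT shift_sub by (simp add: Quilts_iff)
      then have "(s, r) \<in> hless T" using 3 by (simp add: hless_def)
      then have "(v, u) \<in> hless U" using ext_tree_facts(3)[of s r] 3 by simp
      then show ?thesis by (simp add: hless_def)
    qed
  qed
  show ?thesis using XF ext_tree_facts(1) 1 2 by (simp add: Quilts_iff)
qed

end

end

section \<open>The boundary is a derivation of the composition of quilts\<close>

lemma Quilts_arity: "(W, T) \<in> Quilts n \<Longrightarrow> qarity (W, T) = n"
  by (simp add: Quilts_iff qarity_def Tree_def)

text \<open>The sign of a summand depends only on its word, so exchanging the sums leaves one copy
  of the substitution of words for every tree.\<close>

lemma quilt_comp_basis_eq:
  assumes "(V, S) \<in> Quilts m" "(W, T) \<in> Quilts n" "a \<in> {1..m}"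
  shows "quilt_comp_basis (V, S) a (W, T) =
    (\<Sum>U \<in> Ext_tree m n S T a. qpair U (wsub (map (outer_letter n a) V) (map (shift a) W)))"
proof -
  have Q: "V \<in> F2S m" "W \<in> F2S n" "n \<ge> 1" using assms Tree_facts(5)[of T n] by (auto simp: Quilts_iff)
  have "qpair U (wsub (map (outer_letter n a) V) (map (shift a) W)) =
      (\<Sum>X \<in> Ext_word m n V W a. frag_cmul (ext_sgn n V W a X) (frag_of (X, U)))" for U
    using finite_Ext_word[OF Q(1,2) assms(3) Q(3)]
    by (simp add: wsub_eq_sum_Ext_word[OF Q(1,2) assms(3) Q(3)] qpair_sum qpair_cmul)
  then show ?thesis
    unfolding quilt_comp_basis_def Let_def Quilts_arity[OF assms(1)] Quilts_arity[OF assms(2)]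
    by (simp add: sum.swap[of _ "Ext_word m n V W a"])
qed

lemma quilt_comp_left: "quilt_comp (x - y) a z = quilt_comp x a z - quilt_comp y a z"
  and quilt_comp_left_0 [simp]: "quilt_comp 0 a z = 0"
  by (simp_all add: quilt_comp_def frag_extend_diff frag_extend_add)

lemma quilt_comp_right: "quilt_comp x a (y - z) = quilt_comp x a y - quilt_comp x a z"
  by (rule frag_additive_eqI[where c = x]) (simp_all add: quilt_comp_def frag_extend_diff)

lemma quilt_comp_of: "quilt_comp (frag_of P) a (frag_of Q) = quilt_comp_basis P a Q"
  by (simp add: quilt_comp_def)

lemma quilt_comp_qpair_left:
  assumes "(\<And>q. q \<in> Poly_Mapping.keys z \<Longrightarrow> (q, S) \<in> Quilts m)" "(W, T) \<in> Quilts n" "a \<in> {1..m}"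
  shows "quilt_comp (qpair S z) a (frag_of (W, T)) =
    (\<Sum>U \<in> Ext_tree m n S T a. qpair U (wsub_left (mapc (outer_letter n a) z) (map (shift a) W)))"
  by (rule frag_additive_eqI[where c = z])
    (use assms in \<open>simp_all add: qpair_diff quilt_comp_left mapc_diff wsub_left_linear sum_subtractf
      quilt_comp_of quilt_comp_basis_eq\<close>)

lemma quilt_comp_qpair_right:
  assumes "(V, S) \<in> Quilts m" "(\<And>q. q \<in> Poly_Mapping.keys z \<Longrightarrow> (q, T) \<in> Quilts n)" "a \<in> {1..m}"
  shows "quilt_comp (frag_of (V, S)) a (qpair T z) =
    (\<Sum>U \<in> Ext_tree m n S T a. qpair U (wsub_right (map (outer_letter n a) V) (mapc (shift a) z)))"
  by (rule frag_additive_eqI[where c = z])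
    (use assms in \<open>simp_all add: qpair_diff quilt_comp_right mapc_diff wsub_right_linear sum_subtractf
      quilt_comp_of quilt_comp_basis_eq\<close>)

lemma quilt_bd_sum': "quilt_bd (sum g I) = (\<Sum>i \<in> I. quilt_bd (g i))"
  by (cases "finite I") (simp_all add: quilt_bd_sum)

lemma wexc_map: "inj f \<Longrightarrow> wexc (map f w) = wexc w"
  by (simp add: wexc_def card_image inj_on_subset)

lemma ksgn_eq_power: "ksgn (int n) = (-1) ^ n"
  by (simp add: ksgn_def)

lemma quilt_bd_comp_basis:
  assumes VS: "(V, S) \<in> Quilts m" and WT: "(W, T) \<in> Quilts n" and a: "a \<in> {1..m}"
  shows "quilt_bd (quilt_comp_basis (V, S) a (W, T)) =
    quilt_comp (quilt_bd (frag_of (V, S))) a (frag_of (W, T)) +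
    frag_cmul (ksgn (qdeg (V, S))) (quilt_comp (frag_of (V, S)) a (quilt_bd (frag_of (W, T))))"
proof -
  let ?V = "map (outer_letter n a) V" and ?W = "map (shift a) W"
  have Q: "V \<in> F2S m" "W \<in> F2S n" "n \<ge> 1" "a \<ge> 1"
    using assms Tree_facts(5)[of T n] by (auto simp: Quilts_iff)
  have iV: "inj (outer_letter n a)" and iW: "inj (shift a)"
    using inj_outer_letter inj_shift Q by auto
  have wV: "wbd ?V = mapc (outer_letter n a) (wbd V)" and wW: "wbd ?W = mapc (shift a) (wbd W)"
    using iV iW by (auto intro!: wbd_map intro: inj_on_subset)
  have "wbdm (wsub ?V ?W) = wsub_left (wbd ?V) ?W + frag_cmul ((-1) ^ wexc ?V) (wsub_right ?V (wbd ?W))"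
    by (rule wbdm_wsub) (rule ext_disjoint[OF Q(1,2) a Q(3)])
  moreover have "(-1) ^ wexc ?V = ksgn (qdeg (V, S))"
    using iV by (simp add: wexc_map qdeg_def wdeg_eq_wexc ksgn_eq_power)
  ultimately have D: "wbdm (wsub ?V ?W) =
      wsub_left (wbd ?V) ?W + frag_cmul (ksgn (qdeg (V, S))) (wsub_right ?V (wbd ?W))" by simp
  have csum: "frag_cmul c (sum g I) = (\<Sum>i \<in> I. frag_cmul c (g i))" for c g and I :: "tree set"
    by (simp add: frag_cmul_sum o_def)
  have "quilt_bd (quilt_comp_basis (V, S) a (W, T)) =
      (\<Sum>U \<in> Ext_tree m n S T a. qpair U (wbdm (wsub ?V ?W)))"
    by (simp add: quilt_comp_basis_eq[OF assms] quilt_bd_sum' quilt_bd_qpair)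
  also have "\<dots> = (\<Sum>U \<in> Ext_tree m n S T a. qpair U (wsub_left (wbd ?V) ?W)) +
      frag_cmul (ksgn (qdeg (V, S))) (\<Sum>U \<in> Ext_tree m n S T a. qpair U (wsub_right ?V (wbd ?W)))"
    unfolding D qpair_add qpair_cmul sum.distrib csum ..
  also have "(\<Sum>U \<in> Ext_tree m n S T a. qpair U (wsub_left (wbd ?V) ?W)) =
      quilt_comp (quilt_bd (frag_of (V, S))) a (frag_of (W, T))"
    unfolding quilt_bd_of quilt_bd_basis_eq wV
    by (rule quilt_comp_qpair_left[symmetric]) (use Quilts_wbd VS WT a in auto)
  also have "(\<Sum>U \<in> Ext_tree m n S T a. qpair U (wsub_right ?V (wbd ?W))) =
      quilt_comp (frag_of (V, S)) a (quilt_bd (frag_of (W, T)))"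
    unfolding quilt_bd_of quilt_bd_basis_eq wW
    by (rule quilt_comp_qpair_right[symmetric]) (use Quilts_wbd VS WT a in auto)
  finally show ?thesis .
qed

theorem quilt_bd_comp:
  assumes "x \<in> qchains m j" "y \<in> qchains n k" "a \<in> {1..m}"
  shows "quilt_bd (quilt_comp x a y) =
    quilt_comp (quilt_bd x) a y + frag_cmul (ksgn j) (quilt_comp x a (quilt_bd y))"
proof (rule frag_additive_eqI[where c = x], goal_cases)
  case (3 P)
  show ?case
  proof (rule frag_additive_eqI[where c = y], goal_cases)
    case (3 Q)
    then show ?case
      using assms \<open>P \<in> Poly_Mapping.keys x\<close> quilt_bd_comp_basis[of "fst P" "snd P" m "fst Q" "snd Q" n a]
      by (auto simp: quilt_comp_of)
  qed (simp_all add: quilt_comp_right quilt_bd_diff frag_cmul_diff)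
qed (simp_all add: quilt_comp_left quilt_bd_diff frag_cmul_diff)

lemma quilt_comp_closed:
  assumes "x \<in> qchains m j" "y \<in> qchains n k" "a \<in> {1..m}"
  shows "quilt_comp x a y \<in> qchains (m + n - 1) (j + k)"
proof -
  have "R \<in> Quilts (m + n - 1) \<and> qdeg R = j + k" if "R \<in> Poly_Mapping.keys (quilt_comp x a y)" for R
  proof -
    obtain P where P: "P \<in> Poly_Mapping.keys x"
      and R1: "R \<in> Poly_Mapping.keys (frag_extend (\<lambda>Q. quilt_comp_basis P a Q) y)"
      using \<open>R \<in> Poly_Mapping.keys (quilt_comp x a y)\<close> unfolding quilt_comp_def
      by (rule keys_frag_extend_imp)
    obtain Q where Q: "Q \<in> Poly_Mapping.keys y" and R2: "R \<in> Poly_Mapping.keys (quilt_comp_basis P a Q)"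
      using R1 by (rule keys_frag_extend_imp)
    obtain V S W T where PQ: "P = (V, S)" "Q = (W, T)" by (metis surj_pair)
    have VS: "(V, S) \<in> Quilts m" "wdeg V = j" and WT: "(W, T) \<in> Quilts n" "wdeg W = k"
      using assms P Q PQ by (auto simp: qdeg_def)
    have F: "V \<in> F2S m" "W \<in> F2S n" "S \<in> Tree m" "T \<in> Tree n" "n \<ge> 1"
      using VS WT Tree_facts(5)[of T n] by (auto simp: Quilts_iff)
    have "R \<in> Poly_Mapping.keys (\<Sum>X \<in> Ext_word m n V W a. \<Sum>U \<in> Ext_tree m n S T a.
        frag_cmul (ext_sgn n V W a X) (frag_of (X, U)))"
      using R2 unfolding PQ quilt_comp_basis_def Let_def Quilts_arity[OF VS(1)] Quilts_arity[OF WT(1)]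
      by simp
    then obtain X where X: "X \<in> Ext_word m n V W a"
      and "R \<in> Poly_Mapping.keys (\<Sum>U \<in> Ext_tree m n S T a. frag_cmul (ext_sgn n V W a X) (frag_of (X, U)))"
      using keys_sum[of "\<lambda>X. \<Sum>U \<in> Ext_tree m n S T a. frag_cmul (ext_sgn n V W a X) (frag_of (X, U))"]
      by blast
    then obtain U where U: "U \<in> Ext_tree m n S T a"
      and "R \<in> Poly_Mapping.keys (frag_cmul (ext_sgn n V W a X) (frag_of (X, U)))"
      using keys_sum[of "\<lambda>U. frag_cmul (ext_sgn n V W a X) (frag_of (X, U))"] by blast
    then have R: "R = (X, U)" by simp
    have "(X, U) \<in> Quilts (n + m - 1)"
      by (rule Quilts_Ext[OF F(3,4) assms(3) U VS(1) WT(1) X])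
    moreover have "wdeg X = j + k"
      using Ext_word_wdeg[OF F(1,2) assms(3) F(5) X] VS WT by simp
    ultimately show ?thesis by (simp add: R qdeg_def add.commute)
  qed
  then show ?thesis by auto
qed

lemma quilt_act_diff: "quilt_act (x - y) \<sigma> = quilt_act x \<sigma> - quilt_act y \<sigma>"
  by (simp add: quilt_act_def frag_extend_diff)

lemma quilt_bd_act:
  assumes "\<sigma> permutes {1..n}"
  shows "quilt_bd (quilt_act x \<sigma>) = quilt_act (quilt_bd x) \<sigma>"
proof (rule frag_additive_eqI[where c = x], goal_cases)
  case (3 Q)
  let ?s = "inv_into UNIV \<sigma>"
  obtain W T where Q: "Q = (W, T)" by fastforce
  have "inj ?s" using permutes_inj[OF permutes_inv[OF assms]] .
  then have w: "wbd (map ?s W) = mapc ?s (wbd W)" by (intro wbd_map) (rule inj_on_subset, auto)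
  have "quilt_act (qpair T z) \<sigma> = qpair (relabel_tree ?s T) (mapc ?s z)" for z
    by (rule frag_additive_eqI[where c = z])
      (simp_all add: qpair_diff quilt_act_diff mapc_diff, simp add: quilt_act_def)
  then show ?case
    unfolding Q quilt_bd_of quilt_bd_basis_eq by (simp add: quilt_act_def quilt_bd_basis_eq w)
qed (simp_all add: quilt_act_diff quilt_bd_diff)

section \<open>Signs in abelian groups\<close>

abbreviation sg :: "('a, 'b) monoid_scheme \<Rightarrow> int \<Rightarrow> 'a \<Rightarrow> 'a" where
  "sg G k x \<equiv> x [^]\<^bsub>G\<^esub> ksgn k"

lemma hom_sg:
  "group G \<Longrightarrow> group H \<Longrightarrow> h \<in> hom G H \<Longrightarrow> x \<in> carrier G \<Longrightarrow> h (sg G k x) = sg H k (h x)"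
  by (rule hom_int_pow)

context comm_group
begin

lemma sg_even: "even k \<Longrightarrow> x \<in> carrier G \<Longrightarrow> sg G k x = x"
  by (simp add: ksgn_def)

lemma sg_odd: "odd k \<Longrightarrow> x \<in> carrier G \<Longrightarrow> sg G k x = inv x"
  using int_pow_neg[of x 1] by (simp add: ksgn_def)

lemma sg_mult: "x \<in> carrier G \<Longrightarrow> y \<in> carrier G \<Longrightarrow> sg G k (x \<otimes> y) = sg G k x \<otimes> sg G k y"
  by (rule int_pow_distrib)

lemma ksgn_mult: "ksgn i * ksgn j = ksgn (i + j)"
  by (auto simp: ksgn_def)

lemma sg_sg: "x \<in> carrier G \<Longrightarrow> sg G i (sg G j x) = sg G (i + j) x"
  by (simp add: int_pow_pow ksgn_mult add.commute)

lemma sg_cong: "even i \<longleftrightarrow> even j \<Longrightarrow> sg G i x = sg G j x"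
  by (simp add: ksgn_def)

lemma sg_cancel: "x \<in> carrier G \<Longrightarrow> odd (i + j) \<Longrightarrow> sg G i x \<otimes> sg G j x = \<one>"
  by (cases "even i"; cases "even j") (auto simp: sg_even sg_odd)

lemma sg_leibniz_seq:
  "x \<in> carrier G \<Longrightarrow> y \<in> carrier G \<Longrightarrow> z \<in> carrier G \<Longrightarrow>
   (x \<otimes> sg G i y) \<otimes> sg G (i + j) z = x \<otimes> sg G i (y \<otimes> sg G j z)"
  by (simp add: sg_mult sg_sg m_assoc)

text \<open>Applied with \<open>s = j * k\<close>, \<open>s' = (j - 1) * k\<close> and
  \<open>s'' = j * (k - 1)\<close>, the Koszul signs of exchanging \<open>y\<close> and
  \<open>z\<close> when none or one of them has been differentiated.\<close>

lemma sg_leibniz_par: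
  assumes "x \<in> carrier G" "y \<in> carrier G" "z \<in> carrier G"
    "even (i + s') \<longleftrightarrow> even (s + (i + k))" "even (i + j + s'') \<longleftrightarrow> even (s + i)"
  shows "(sg G s x \<otimes> sg G i (sg G s' y)) \<otimes> sg G (i + j) (sg G s'' z) =
    sg G s ((x \<otimes> sg G i z) \<otimes> sg G (i + k) y)"
proof -
  have "sg G (i + s') y = sg G (s + (i + k)) y" "sg G (i + j + s'') z = sg G (s + i) z"
    using assms(4,5) by (intro sg_cong; simp)+
  then show ?thesis using assms(1-3) by (simp add: sg_mult sg_sg m_ac)
qed

lemma finprod_hom:
  assumes "comm_group H" "h \<in> hom G H" "f \<in> A \<rightarrow> carrier G"
  shows "h (finprod G f A) = finprod H (\<lambda>x. h (f x)) A"
proof -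
  interpret H: comm_group H by fact
  have one: "h \<one> = \<one>\<^bsub>H\<^esub>" using assms(2) by (simp add: hom_one)
  have cl: "h x \<in> carrier H" if "x \<in> carrier G" for x using hom_in_carrier[OF assms(2) that] .
  show ?thesis
    using assms(3)
  proof (induction A rule: infinite_finite_induct)
    case (infinite A)
    then show ?case by (simp add: one)
  next
    case empty
    then show ?case by (simp add: one)
  next
    case (insert x A)
    then have "f x \<in> carrier G" "f \<in> A \<rightarrow> carrier G" by auto
    moreover have "(\<lambda>x. h (f x)) \<in> A \<rightarrow> carrier H" using calculation cl by auto
    ultimately show ?case using insert cl assms(2) by (simp add: hom_mult)
  qed
qed

lemma finprod_sg: "f \<in> A \<rightarrow> carrier G \<Longrightarrow> sg G k (finprod G f A) = finprod G (\<lambda>x. sg G k (f x)) A"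
proof (rule finprod_hom)
  show "(\<lambda>x. sg G k x) \<in> hom G G" by (auto simp: hom_def int_pow_distrib)
qed (simp_all add: comm_group_axioms)

text \<open>Adding an index adds a row and a column that cancel entry by entry. The array in
  question will be two insertions of an odd element into the inputs of an operation.\<close>

lemma finprod_antisymmetric:
  assumes "finite A" "\<And>a b. a \<in> A \<Longrightarrow> b \<in> A \<Longrightarrow> f a b \<in> carrier G"
    "\<And>a. a \<in> A \<Longrightarrow> f a a = \<one>" "\<And>a b. a \<in> A \<Longrightarrow> b \<in> A \<Longrightarrow> a \<noteq> b \<Longrightarrow> f a b \<otimes> f b a = \<one>"
  shows "finprod G (\<lambda>a. finprod G (f a) A) A = \<one>"
  using assms
proof (induction A rule: finite_induct)
  case (insert x A)
  have c1: "f x \<in> A \<rightarrow> carrier G" and c2: "(\<lambda>a. f a x) \<in> A \<rightarrow> carrier G"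
    and c3: "\<And>a. a \<in> A \<Longrightarrow> f a \<in> A \<rightarrow> carrier G" and cx: "f x x \<in> carrier G"
    using insert.prems by auto
  have "finprod G (\<lambda>a. finprod G (f a) (insert x A)) (insert x A) =
      finprod G (\<lambda>a. f a x \<otimes> finprod G (f a) A) (insert x A)"
    by (rule finprod_cong')
      (use insert c1 c3 cx in \<open>auto intro!: finprod_insert\<close>)
  also have "\<dots> = (f x x \<otimes> finprod G (f x) A) \<otimes> finprod G (\<lambda>a. f a x \<otimes> finprod G (f a) A) A"
    using insert c1 c2 c3 cx by (subst finprod_insert) auto
  also have "finprod G (\<lambda>a. f a x \<otimes> finprod G (f a) A) A =
      finprod G (\<lambda>a. f a x) A \<otimes> finprod G (\<lambda>a. finprod G (f a) A) A"
    using c2 c3 by (intro finprod_multf) auto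
  also have "finprod G (\<lambda>a. finprod G (f a) A) A = \<one>"
    using insert by simp
  also have "f x x = \<one>" using insert.prems by simp
  also have "(\<one> \<otimes> finprod G (f x) A) \<otimes> (finprod G (\<lambda>a. f a x) A \<otimes> \<one>) =
      finprod G (\<lambda>a. f x a \<otimes> f a x) A"
    using c1 c2 by (simp add: finprod_multf)
  also have "\<dots> = \<one>"
  proof (rule finprod_one_eqI)
    fix b assume "b \<in> A"
    then show "f x b \<otimes> f b x = \<one>" using insert.hyps(2) by (intro insert.prems(3)) auto
  qed
  finally show ?case .
qed simp

end

section \<open>Derivations of graded operads\<close>

locale operad =
  fixes P :: "'a operad_data"
  assumes graded: "graded_operad P"
begin

abbreviation pc :: "nat \<Rightarrow> int \<Rightarrow> 'a monoid" where
  "pc n k \<equiv> piece P n k"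

abbreviation oc :: "'a \<Rightarrow> nat \<Rightarrow> 'a \<Rightarrow> 'a" where
  "oc x a y \<equiv> opcomp P x a y"

lemmas graded_conj = graded[unfolded graded_operad_def]

lemma comm_group_piece: "comm_group (pc n k)"
  using graded_conj[THEN conjunct1] by blast

sublocale pc: comm_group "pc n k" for n k
  by (rule comm_group_piece)

lemma group_piece: "group (pc n k)"
  by (rule pc.is_group)

lemma act_hom: "\<sigma> permutes {1..n} \<Longrightarrow> (\<lambda>x. opact P x \<sigma>) \<in> hom (pc n k) (pc n k)"
  using graded_conj[THEN conjunct2, THEN conjunct2, THEN conjunct1] by blast

lemma act_id: "x \<in> carrier (pc n k) \<Longrightarrow> opact P x id = x"
  using graded_conj[THEN conjunct2, THEN conjunct2, THEN conjunct2, THEN conjunct1] by blast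

lemma comp_hom_left:
  "a \<in> {1..m} \<Longrightarrow> y \<in> carrier (pc n k) \<Longrightarrow> (\<lambda>x. oc x a y) \<in> hom (pc m j) (pc (m + n - 1) (j + k))"
  using graded_conj[THEN conjunct2, THEN conjunct2, THEN conjunct2, THEN conjunct2, THEN conjunct2, THEN conjunct1] by blast

lemma comp_hom_right:
  "a \<in> {1..m} \<Longrightarrow> x \<in> carrier (pc m j) \<Longrightarrow> (\<lambda>y. oc x a y) \<in> hom (pc n k) (pc (m + n - 1) (j + k))"
  using graded_conj[THEN conjunct2, THEN conjunct2, THEN conjunct2, THEN conjunct2, THEN conjunct2, THEN conjunct2, THEN conjunct1] by blast

lemma comp_seq:
  "x \<in> carrier (pc m i) \<Longrightarrow> y \<in> carrier (pc n j) \<Longrightarrow> z \<in> carrier (pc p k) \<Longrightarrow>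
   a \<in> {1..m} \<Longrightarrow> b \<in> {1..n} \<Longrightarrow> oc (oc x a y) (a + b - 1) z = oc x a (oc y b z)"
  using graded_conj[THEN conjunct2, THEN conjunct2, THEN conjunct2, THEN conjunct2, THEN conjunct2, THEN conjunct2, THEN conjunct2, THEN conjunct2, THEN conjunct1] by blast

lemma comp_par:
  "x \<in> carrier (pc m i) \<Longrightarrow> y \<in> carrier (pc n j) \<Longrightarrow> z \<in> carrier (pc p k) \<Longrightarrow>
   a \<in> {1..m} \<Longrightarrow> b \<in> {1..m} \<Longrightarrow> a < b \<Longrightarrow>
   oc (oc x a y) (b + n - 1) z = sg (pc (m + n + p - 2) (i + j + k)) (j * k) (oc (oc x b z) a y)"
  using graded_conj[THEN conjunct2, THEN conjunct2, THEN conjunct2, THEN conjunct2, THEN conjunct2, THEN conjunct2, THEN conjunct2, THEN conjunct2, THEN conjunct2, THEN conjunct1] by blast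

lemma comp_equivariant:
  "\<sigma> permutes {1..m} \<Longrightarrow> \<tau> permutes {1..n} \<Longrightarrow> x \<in> carrier (pc m j) \<Longrightarrow> y \<in> carrier (pc n k) \<Longrightarrow>
   a \<in> {1..m} \<Longrightarrow> oc (opact P x \<sigma>) a (opact P y \<tau>) = opact P (oc x (\<sigma> a) y) (perm_comp n \<sigma> a \<tau>)"
  using graded_conj[THEN conjunct2, THEN conjunct2, THEN conjunct2, THEN conjunct2, THEN conjunct2, THEN conjunct2, THEN conjunct2, THEN conjunct2, THEN conjunct2, THEN conjunct2] by blast

lemma act_closed: "\<sigma> permutes {1..n} \<Longrightarrow> x \<in> carrier (pc n k) \<Longrightarrow> opact P x \<sigma> \<in> carrier (pc n k)"
  using hom_in_carrier[OF act_hom] .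

text \<open>Arity and degree of the result are free variables tied by equations, since expressions
  with truncated subtraction such as \<open>m + n - 1\<close> take many different shapes.\<close>

lemma comp_closed:
  "x \<in> carrier (pc m j) \<Longrightarrow> y \<in> carrier (pc n k) \<Longrightarrow> a \<in> {1..m} \<Longrightarrow> N = m + n - 1 \<Longrightarrow> K = j + k \<Longrightarrow>
   oc x a y \<in> carrier (pc N K)"
  using hom_in_carrier[OF comp_hom_left] by blast

lemma comp_mult_left:
  "x \<in> carrier (pc m j) \<Longrightarrow> x' \<in> carrier (pc m j) \<Longrightarrow> y \<in> carrier (pc n k) \<Longrightarrow> a \<in> {1..m} \<Longrightarrow>
   N = m + n - 1 \<Longrightarrow> K = j + k \<Longrightarrow>
   oc (x \<otimes>\<^bsub>pc m j\<^esub> x') a y = oc x a y \<otimes>\<^bsub>pc N K\<^esub> oc x' a y"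
  using hom_mult[OF comp_hom_left] by blast

lemma comp_mult_right:
  "x \<in> carrier (pc m j) \<Longrightarrow> y \<in> carrier (pc n k) \<Longrightarrow> y' \<in> carrier (pc n k) \<Longrightarrow> a \<in> {1..m} \<Longrightarrow>
   N = m + n - 1 \<Longrightarrow> K = j + k \<Longrightarrow>
   oc x a (y \<otimes>\<^bsub>pc n k\<^esub> y') = oc x a y \<otimes>\<^bsub>pc N K\<^esub> oc x a y'"
  using hom_mult[OF comp_hom_right] by blast

lemma comp_sg_left:
  "x \<in> carrier (pc m j) \<Longrightarrow> y \<in> carrier (pc n k) \<Longrightarrow> a \<in> {1..m} \<Longrightarrow> N = m + n - 1 \<Longrightarrow> K = j + k \<Longrightarrow>
   oc (sg (pc m j) i x) a y = sg (pc N K) i (oc x a y)"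
  using hom_sg[OF group_piece group_piece comp_hom_left, of a m y n k x j i] by simp

lemma comp_sg_right:
  "x \<in> carrier (pc m j) \<Longrightarrow> y \<in> carrier (pc n k) \<Longrightarrow> a \<in> {1..m} \<Longrightarrow> N = m + n - 1 \<Longrightarrow> K = j + k \<Longrightarrow>
   oc x a (sg (pc n k) i y) = sg (pc N K) i (oc x a y)"
  using hom_sg[OF group_piece group_piece comp_hom_right, of a m x j y n k i] by simp

lemma comp_one_left:
  "y \<in> carrier (pc n k) \<Longrightarrow> a \<in> {1..m} \<Longrightarrow> N = m + n - 1 \<Longrightarrow> K = j + k \<Longrightarrow>
   oc \<one>\<^bsub>pc m j\<^esub> a y = \<one>\<^bsub>pc N K\<^esub>"
  using hom_one[OF comp_hom_left group_piece group_piece] by blast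

lemma comp_one_right:
  "x \<in> carrier (pc m j) \<Longrightarrow> a \<in> {1..m} \<Longrightarrow> N = m + n - 1 \<Longrightarrow> K = j + k \<Longrightarrow>
   oc x a \<one>\<^bsub>pc n k\<^esub> = \<one>\<^bsub>pc N K\<^esub>"
  using hom_one[OF comp_hom_right group_piece group_piece] by blast

lemma act_mult:
  "\<sigma> permutes {1..n} \<Longrightarrow> x \<in> carrier (pc n k) \<Longrightarrow> y \<in> carrier (pc n k) \<Longrightarrow>
   opact P (x \<otimes>\<^bsub>pc n k\<^esub> y) \<sigma> = opact P x \<sigma> \<otimes>\<^bsub>pc n k\<^esub> opact P y \<sigma>"
  using hom_mult[OF act_hom] .

lemma act_sg:
  "\<sigma> permutes {1..n} \<Longrightarrow> x \<in> carrier (pc n k) \<Longrightarrow> opact P (sg (pc n k) i x) \<sigma> = sg (pc n k) i (opact P x \<sigma>)"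
  using hom_sg[OF group_piece group_piece act_hom] .

lemma comp_lin_left:
  assumes "u \<in> carrier (pc m j)" "v \<in> carrier (pc m j)" "y \<in> carrier (pc n k)" "a \<in> {1..m}"
    "N = m + n - 1" "K = j + k"
  shows "oc (u \<otimes>\<^bsub>pc m j\<^esub> sg (pc m j) i v) a y = oc u a y \<otimes>\<^bsub>pc N K\<^esub> sg (pc N K) i (oc v a y)"
  using comp_mult_left[OF assms(1) pc.int_pow_closed[OF assms(2)] assms(3-6)]
    comp_sg_left[OF assms(2-6)] by simp

lemma comp_lin_right:
  assumes "x \<in> carrier (pc m j)" "u \<in> carrier (pc n k)" "v \<in> carrier (pc n k)" "a \<in> {1..m}"
    "N = m + n - 1" "K = j + k"
  shows "oc x a (u \<otimes>\<^bsub>pc n k\<^esub> sg (pc n k) i v) = oc x a u \<otimes>\<^bsub>pc N K\<^esub> sg (pc N K) i (oc x a v)"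
  using comp_mult_right[OF assms(1,2) pc.int_pow_closed[OF assms(3)] assms(4-6)]
    comp_sg_right[OF assms(1,3-6)] by simp

text \<open>The value prescribed by the Leibniz rule on \<open>x \<circ>\<^sub>a y\<close> when the values on \<open>x\<close> and \<open>y\<close> are \<open>dx\<close> and \<open>dy\<close>.\<close>

definition leibniz :: "nat \<Rightarrow> int \<Rightarrow> int \<Rightarrow> 'a \<Rightarrow> 'a \<Rightarrow> nat \<Rightarrow> 'a \<Rightarrow> 'a \<Rightarrow> 'a" where
  "leibniz N K j x dx a y dy = oc dx a y \<otimes>\<^bsub>pc N K\<^esub> sg (pc N K) j (oc x a dy)"

text \<open>\<open>dx\<close>, \<open>dy\<close>, \<open>dz\<close> are arbitrary elements and not
  values of an operator. This form is what is needed to define a derivation on expressions modulo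
  associativity.\<close>

lemma leibniz_seq:
  assumes x: "x \<in> carrier (pc m i)" "dx \<in> carrier (pc m (i - 1))"
    and y: "y \<in> carrier (pc n j)" "dy \<in> carrier (pc n (j - 1))"
    and z: "z \<in> carrier (pc p k)" "dz \<in> carrier (pc p (k - 1))"
    and a: "a \<in> {1..m}" and b: "b \<in> {1..n}" and N: "N = m + n + p - 2" and K: "K = i + j + k - 1"
  shows "leibniz N K (i + j) (oc x a y) (leibniz (m + n - 1) (i + j - 1) i x dx a y dy) (a + b - 1) z dz =
    leibniz N K i x dx a (oc y b z) (leibniz (n + p - 1) (j + k - 1) j y dy b z dz)"
proof -
  let ?G = "pc N K" and ?M = "pc (m + n - 1) (i + j - 1)" and ?M' = "pc (n + p - 1) (j + k - 1)"
  have ab: "a + b - 1 \<in> {1..m + n - 1}" using a b by auto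
  have N1: "N = (m + n - 1) + p - 1" "N = m + (n + p - 1) - 1" using N a b by auto
  have c1: "oc dx a y \<in> carrier ?M" "oc x a dy \<in> carrier ?M"
    using x y a by (auto intro!: comp_closed[of _ m _ _ n])
  have c2: "oc dy b z \<in> carrier ?M'" "oc y b dz \<in> carrier ?M'"
    using y z b by (auto intro!: comp_closed[of _ n _ _ p])
  have g: "oc dx a (oc y b z) \<in> carrier ?G" "oc x a (oc dy b z) \<in> carrier ?G" "oc x a (oc y b dz) \<in> carrier ?G"
    by (rule comp_closed[OF x(2) comp_closed[OF y(1) z(1) b refl refl] a N1(2)]
      comp_closed[OF x(1) c2(1) a N1(2)] comp_closed[OF x(1) c2(2) a N1(2)]; simp add: K)+
  have K1: "K = (i + j - 1) + k" "K = i + (j + k - 1)" using K by auto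
  have l: "oc (leibniz (m + n - 1) (i + j - 1) i x dx a y dy) (a + b - 1) z =
      oc dx a (oc y b z) \<otimes>\<^bsub>?G\<^esub> sg ?G i (oc x a (oc dy b z))"
    unfolding leibniz_def comp_lin_left[OF c1 z(1) ab N1(1) K1(1)]
      comp_seq[OF x(2) y(1) z(1) a b] comp_seq[OF x(1) y(2) z(1) a b] ..
  have r: "oc x a (leibniz (n + p - 1) (j + k - 1) j y dy b z dz) =
      oc x a (oc dy b z) \<otimes>\<^bsub>?G\<^esub> sg ?G j (oc x a (oc y b dz))"
    unfolding leibniz_def by (rule comp_lin_right[OF x(1) c2 a N1(2) K1(2)])
  show ?thesis
    unfolding leibniz_def[of N K] l r comp_seq[OF x(1) y(1) z(2) a b]
    using g by (rule pc.sg_leibniz_seq)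
qed

lemma leibniz_par:
  assumes x: "x \<in> carrier (pc m i)" "dx \<in> carrier (pc m (i - 1))"
    and y: "y \<in> carrier (pc n j)" "dy \<in> carrier (pc n (j - 1))"
    and z: "z \<in> carrier (pc p k)" "dz \<in> carrier (pc p (k - 1))"
    and a: "a \<in> {1..m}" and b: "b \<in> {1..m}" and ab: "a < b"
    and N: "N = m + n + p - 2" and K: "K = i + j + k - 1"
  shows "leibniz N K (i + j) (oc x a y) (leibniz (m + n - 1) (i + j - 1) i x dx a y dy) (b + n - 1) z dz =
    sg (pc N K) (j * k)
      (leibniz N K (i + k) (oc x b z) (leibniz (m + p - 1) (i + k - 1) i x dx b z dz) a y dy)"
proof -
  let ?G = "pc N K" and ?M = "pc (m + n - 1) (i + j - 1)" and ?M' = "pc (m + p - 1) (i + k - 1)"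
  have bn: "b + n - 1 \<in> {1..m + n - 1}" and am: "a \<in> {1..m + p - 1}" using a b ab by auto
  have N1: "N = (m + n - 1) + p - 1" "N = (m + p - 1) + n - 1" using N a b ab by auto
  have c1: "oc dx a y \<in> carrier ?M" "oc x a dy \<in> carrier ?M"
    using x y a by (auto intro!: comp_closed[of _ m _ _ n])
  have c2: "oc dx b z \<in> carrier ?M'" "oc x b dz \<in> carrier ?M'"
    using x z b by (auto intro!: comp_closed[of _ m _ _ p])
  have c3: "oc x b z \<in> carrier (pc (m + p - 1) (i + k))"
    using x z b by (auto intro!: comp_closed[of _ m _ _ p])
  have g: "oc (oc dx b z) a y \<in> carrier ?G" "oc (oc x b dz) a y \<in> carrier ?G" "oc (oc x b z) a dy \<in> carrier ?G"
    by (rule comp_closed[OF c2(1) y(1) am N1(2)] comp_closed[OF c2(2) y(1) am N1(2)]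
      comp_closed[OF c3 y(2) am N1(2)]; simp add: K)+
  \<comment> \<open>Replacing \<open>y\<close> or \<open>z\<close> by its candidate derivative
    lowers one factor of \<open>j * k\<close>; the discrepancy is absorbed by the different Leibniz
    signs on the two sides.\<close>
  have e1: "oc (oc dx a y) (b + n - 1) z = sg ?G (j * k) (oc (oc dx b z) a y)"
    and e2: "oc (oc x a dy) (b + n - 1) z = sg ?G ((j - 1) * k) (oc (oc x b z) a dy)"
    and e3: "oc (oc x a y) (b + n - 1) dz = sg ?G (j * (k - 1)) (oc (oc x b dz) a y)"
    using comp_par[OF x(2) y(1) z(1) a b ab] comp_par[OF x(1) y(2) z(1) a b ab]
      comp_par[OF x(1) y(1) z(2) a b ab] by (simp_all add: N K algebra_simps)
  have K1: "K = (i + j - 1) + k" "K = (i + k - 1) + j" using K by auto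
  have l: "oc (leibniz (m + n - 1) (i + j - 1) i x dx a y dy) (b + n - 1) z =
      sg ?G (j * k) (oc (oc dx b z) a y) \<otimes>\<^bsub>?G\<^esub> sg ?G i (sg ?G ((j - 1) * k) (oc (oc x b z) a dy))"
    unfolding leibniz_def comp_lin_left[OF c1 z(1) bn N1(1) K1(1)] e1 e2 ..
  have r: "oc (leibniz (m + p - 1) (i + k - 1) i x dx b z dz) a y =
      oc (oc dx b z) a y \<otimes>\<^bsub>?G\<^esub> sg ?G i (oc (oc x b dz) a y)"
    unfolding leibniz_def by (rule comp_lin_left[OF c2 y(1) am N1(2) K1(2)])
  show ?thesis
    unfolding leibniz_def[of N K] l r e3
    by (rule pc.sg_leibniz_par[OF g(1,3,2)]) (simp_all add: algebra_simps)
qed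

lemma derivation_hom: "operad_derivation P d \<Longrightarrow> d n k \<in> hom (pc n k) (pc n (k - 1))"
  and derivation_act: "operad_derivation P d \<Longrightarrow> \<sigma> permutes {1..n} \<Longrightarrow> x \<in> carrier (pc n k) \<Longrightarrow>
    d n k (opact P x \<sigma>) = opact P (d n k x) \<sigma>"
  and derivation_comp: "operad_derivation P d \<Longrightarrow> x \<in> carrier (pc m j) \<Longrightarrow> y \<in> carrier (pc n k) \<Longrightarrow>
    a \<in> {1..m} \<Longrightarrow> N = m + n - 1 \<Longrightarrow> K = j + k \<Longrightarrow>
    d N K (oc x a y) = leibniz N (K - 1) j x (d m j x) a y (d n k y)"
  unfolding operad_derivation_def leibniz_def by blast+

lemma derivation_closed:
  "operad_derivation P d \<Longrightarrow> x \<in> carrier (pc n k) \<Longrightarrow> K = k - 1 \<Longrightarrow> d n k x \<in> carrier (pc n K)"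
  using hom_in_carrier[OF derivation_hom] by blast

lemma derivation_sg:
  "operad_derivation P d \<Longrightarrow> x \<in> carrier (pc n k) \<Longrightarrow> K = k - 1 \<Longrightarrow> d n k (sg (pc n k) i x) = sg (pc n K) i (d n k x)"
  using hom_sg[OF group_piece group_piece derivation_hom] by blast

lemma derivation_add:
  assumes d: "operad_derivation P d" and d': "operad_derivation P d'"
  shows "operad_derivation P (\<lambda>n k x. d n k x \<otimes>\<^bsub>pc n (k - 1)\<^esub> d' n k x)"
  unfolding operad_derivation_def
proof (intro conjI allI impI ballI)
  fix n k
  show "(\<lambda>x. d n k x \<otimes>\<^bsub>pc n (k - 1)\<^esub> d' n k x) \<in> hom (pc n k) (pc n (k - 1))"
  proof (rule homI)
    fix x assume x: "x \<in> carrier (pc n k)"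
    then show "d n k x \<otimes>\<^bsub>pc n (k - 1)\<^esub> d' n k x \<in> carrier (pc n (k - 1))"
      using derivation_closed[OF d] derivation_closed[OF d'] by (intro pc.m_closed) auto
    fix y assume y: "y \<in> carrier (pc n k)"
    have c: "d n k x \<in> carrier (pc n (k - 1))" "d' n k x \<in> carrier (pc n (k - 1))"
      "d n k y \<in> carrier (pc n (k - 1))" "d' n k y \<in> carrier (pc n (k - 1))"
      using derivation_closed[OF d] derivation_closed[OF d'] x y by auto
    show "d n k (x \<otimes>\<^bsub>pc n k\<^esub> y) \<otimes>\<^bsub>pc n (k - 1)\<^esub> d' n k (x \<otimes>\<^bsub>pc n k\<^esub> y) =
        (d n k x \<otimes>\<^bsub>pc n (k - 1)\<^esub> d' n k x) \<otimes>\<^bsub>pc n (k - 1)\<^esub> (d n k y \<otimes>\<^bsub>pc n (k - 1)\<^esub> d' n k y)"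
      using hom_mult[OF derivation_hom[OF d] x y] hom_mult[OF derivation_hom[OF d'] x y] c
      by (simp add: pc.m_ac)
  qed
next
  fix n k \<sigma> x assume "\<sigma> permutes {1..n}" "x \<in> carrier (pc n k)"
  then show "d n k (opact P x \<sigma>) \<otimes>\<^bsub>pc n (k - 1)\<^esub> d' n k (opact P x \<sigma>) =
      opact P (d n k x \<otimes>\<^bsub>pc n (k - 1)\<^esub> d' n k x) \<sigma>"
    using d d' by (simp add: derivation_act act_mult derivation_closed)
next
  fix m n j k x y a
  assume x: "x \<in> carrier (pc m j)" and y: "y \<in> carrier (pc n k)" and a: "a \<in> {1..m}"
  let ?G = "pc (m + n - 1) (j + k - 1)"
  have c: "d m j x \<in> carrier (pc m (j - 1))" "d' m j x \<in> carrier (pc m (j - 1))"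
    "d n k y \<in> carrier (pc n (k - 1))" "d' n k y \<in> carrier (pc n (k - 1))"
    using derivation_closed[OF d] derivation_closed[OF d'] x y by auto
  have g: "oc (d m j x) a y \<in> carrier ?G" "oc (d' m j x) a y \<in> carrier ?G"
    "oc x a (d n k y) \<in> carrier ?G" "oc x a (d' n k y) \<in> carrier ?G"
    using c x y a by (auto intro!: comp_closed[of _ m _ _ n])
  have "oc (d m j x \<otimes>\<^bsub>pc m (j - 1)\<^esub> d' m j x) a y = oc (d m j x) a y \<otimes>\<^bsub>?G\<^esub> oc (d' m j x) a y"
    using c y a by (intro comp_mult_left) auto
  moreover have "oc x a (d n k y \<otimes>\<^bsub>pc n (k - 1)\<^esub> d' n k y) = oc x a (d n k y) \<otimes>\<^bsub>?G\<^esub> oc x a (d' n k y)"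
    using c x a by (intro comp_mult_right) auto
  ultimately show "d (m + n - 1) (j + k) (oc x a y) \<otimes>\<^bsub>?G\<^esub> d' (m + n - 1) (j + k) (oc x a y) =
      oc (d m j x \<otimes>\<^bsub>pc m (j - 1)\<^esub> d' m j x) a y \<otimes>\<^bsub>?G\<^esub>
      sg ?G j (oc x a (d n k y \<otimes>\<^bsub>pc n (k - 1)\<^esub> d' n k y))"
    using g derivation_comp[OF d x y a refl refl] derivation_comp[OF d' x y a refl refl]
    by (simp add: leibniz_def pc.sg_mult pc.m_ac)
qed

text \<open>The two mixed terms are both \<open>oc (d m j x) a (d n k y)\<close>, with signs of
  exponents \<open>j - 1\<close> and \<open>j\<close>, so they cancel.\<close>

lemma derivation_square_comp:
  assumes d: "operad_derivation P d" and x: "x \<in> carrier (pc m j)" and y: "y \<in> carrier (pc n k)"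
    and a: "a \<in> {1..m}" and dx: "d m (j - 1) (d m j x) = \<one>\<^bsub>pc m (j - 2)\<^esub>"
    and dy: "d n (k - 1) (d n k y) = \<one>\<^bsub>pc n (k - 2)\<^esub>"
  shows "d (m + n - 1) (j + k - 1) (d (m + n - 1) (j + k) (oc x a y)) = \<one>\<^bsub>pc (m + n - 1) (j + k - 2)\<^esub>"
proof -
  let ?G = "pc (m + n - 1) (j + k - 1)" and ?H = "pc (m + n - 1) (j + k - 2)"
  have c: "d m j x \<in> carrier (pc m (j - 1))" "d n k y \<in> carrier (pc n (k - 1))"
    using derivation_closed[OF d] x y by auto
  have g: "oc (d m j x) a y \<in> carrier ?G" "oc x a (d n k y) \<in> carrier ?G"
    using c x y a by (auto intro!: comp_closed[of _ m _ _ n])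
  have h: "oc (d m j x) a (d n k y) \<in> carrier ?H"
    using c a by (auto intro!: comp_closed[of _ m _ _ n])
  have 1: "d (m + n - 1) (j + k - 1) (oc (d m j x) a y) = sg ?H (j - 1) (oc (d m j x) a (d n k y))"
    using derivation_comp[OF d c(1) y a refl, of "j + k - 1"] comp_one_left[OF y a refl, of "j + k - 2" "j - 2"] h
    by (simp add: leibniz_def dx diff_diff_eq)
  have 2: "d (m + n - 1) (j + k - 1) (oc x a (d n k y)) = oc (d m j x) a (d n k y)"
    using derivation_comp[OF d x c(2) a refl, of "j + k - 1"] comp_one_right[OF x a refl, of "j + k - 2" "k - 2" n] h
    by (simp add: leibniz_def dy diff_diff_eq)
  have "d (m + n - 1) (j + k - 1) (d (m + n - 1) (j + k) (oc x a y)) =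
      d (m + n - 1) (j + k - 1) (oc (d m j x) a y \<otimes>\<^bsub>?G\<^esub> sg ?G j (oc x a (d n k y)))"
    using derivation_comp[OF d x y a refl refl] by (simp add: leibniz_def)
  also have "\<dots> = d (m + n - 1) (j + k - 1) (oc (d m j x) a y) \<otimes>\<^bsub>?H\<^esub>
      sg ?H j (d (m + n - 1) (j + k - 1) (oc x a (d n k y)))"
    using g hom_mult[OF derivation_hom[OF d, of "m + n - 1" "j + k - 1"]]
      derivation_sg[OF d, of _ "m + n - 1" "j + k - 1" "j + k - 2"] by (simp add: diff_diff_eq)
  also have "\<dots> = \<one>\<^bsub>?H\<^esub>"
    unfolding 1 2 using h by (intro pc.sg_cancel) auto
  finally show ?thesis .
qed

end

section \<open>The adjoint derivation\<close>

lemma ksgn_uminus: "- ksgn k = ksgn (k + 1)"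
  by (simp add: ksgn_def)

text \<open>Here \<open>A\<close> has \<delta> at the output of the composite, \<open>B\<close> has
  it between \<open>x\<close> and \<open>y\<close>, \<open>Z\<close> at the other inputs of
  \<open>x\<close> and \<open>C\<close> at the inputs of \<open>y\<close>. Only \<open>B\<close>
  arises twice, at an input of \<open>x\<close> and at the output of \<open>y\<close>, with opposite
  signs.\<close>

lemma (in comm_group) sg_leibniz_ad:
  assumes "A \<in> carrier G" "B \<in> carrier G" "C \<in> carrier G" "Z \<in> carrier G"
  shows "A \<otimes> sg G (j + k + 1) (sg G k Z \<otimes> C) =
    (A \<otimes> sg G (j + 1) (B \<otimes> Z)) \<otimes> sg G j (B \<otimes> sg G (k + 1) C)"
proof -
  have 1: "sg G (j + k + 1 + k) Z = sg G (j + 1) Z" by (rule sg_cong) simp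
  have 2: "sg G (j + (k + 1)) C = sg G (j + k + 1) C" by (rule sg_cong) simp
  have 3: "sg G (j + 1) B \<otimes> sg G j B = \<one>" using assms(2) by (rule sg_cancel) simp
  have "(A \<otimes> sg G (j + 1) (B \<otimes> Z)) \<otimes> sg G j (B \<otimes> sg G (k + 1) C) =
      (A \<otimes> (sg G (j + 1) B \<otimes> sg G (j + 1) Z)) \<otimes> (sg G j B \<otimes> sg G (j + k + 1) C)"
    using assms 2 by (simp add: sg_mult sg_sg)
  also have "\<dots> = (sg G (j + 1) B \<otimes> sg G j B) \<otimes> (A \<otimes> (sg G (j + 1) Z \<otimes> sg G (j + k + 1) C))"
    using assms by (simp add: m_ac)
  also have "\<dots> = A \<otimes> sg G (j + k + 1) (sg G k Z \<otimes> C)"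
    unfolding 3 using assms 1 by (simp add: sg_mult sg_sg)
  finally show ?thesis ..
qed

locale operad_element = operad +
  fixes \<delta> :: 'a
  assumes delta: "\<delta> \<in> carrier (pc 1 (-1))"
begin

abbreviation ad :: "nat \<Rightarrow> int \<Rightarrow> 'a \<Rightarrow> 'a" where
  "ad \<equiv> operad_ad P \<delta>"

definition rsum :: "nat \<Rightarrow> int \<Rightarrow> 'a \<Rightarrow> 'a" where
  "rsum n k x = finprod (pc n (k - 1)) (\<lambda>a. oc x a \<delta>) {1..n}"

lemma ad_eq: "ad n k x = oc \<delta> 1 x \<otimes>\<^bsub>pc n (k - 1)\<^esub> sg (pc n (k - 1)) (k + 1) (rsum n k x)"
  by (simp only: operad_ad_def rsum_def ksgn_uminus)

lemma left_closed: "x \<in> carrier (pc n k) \<Longrightarrow> oc \<delta> 1 x \<in> carrier (pc n (k - 1))"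
  by (rule comp_closed[OF delta]) auto

lemma right_closed: "x \<in> carrier (pc n k) \<Longrightarrow> a \<in> {1..n} \<Longrightarrow> oc x a \<delta> \<in> carrier (pc n (k - 1))"
  by (rule comp_closed[OF _ delta]) auto

lemma rsum_closed: "x \<in> carrier (pc n k) \<Longrightarrow> rsum n k x \<in> carrier (pc n (k - 1))"
  unfolding rsum_def by (rule pc.finprod_closed) (auto intro: right_closed)

lemma ad_closed: "x \<in> carrier (pc n k) \<Longrightarrow> ad n k x \<in> carrier (pc n (k - 1))"
  unfolding ad_eq by (intro pc.m_closed pc.int_pow_closed left_closed rsum_closed)

lemma left_mult: "x \<in> carrier (pc n k) \<Longrightarrow> y \<in> carrier (pc n k) \<Longrightarrow>
    oc \<delta> 1 (x \<otimes>\<^bsub>pc n k\<^esub> y) = oc \<delta> 1 x \<otimes>\<^bsub>pc n (k - 1)\<^esub> oc \<delta> 1 y"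
  by (rule comp_mult_right[OF delta]) auto

lemma right_mult: "x \<in> carrier (pc n k) \<Longrightarrow> y \<in> carrier (pc n k) \<Longrightarrow> a \<in> {1..n} \<Longrightarrow>
    oc (x \<otimes>\<^bsub>pc n k\<^esub> y) a \<delta> = oc x a \<delta> \<otimes>\<^bsub>pc n (k - 1)\<^esub> oc y a \<delta>"
  by (rule comp_mult_left[OF _ _ delta]) auto

lemma rsum_mult:
  assumes "x \<in> carrier (pc n k)" "y \<in> carrier (pc n k)"
  shows "rsum n k (x \<otimes>\<^bsub>pc n k\<^esub> y) = rsum n k x \<otimes>\<^bsub>pc n (k - 1)\<^esub> rsum n k y"
proof -
  have "rsum n k (x \<otimes>\<^bsub>pc n k\<^esub> y) =
      finprod (pc n (k - 1)) (\<lambda>a. oc x a \<delta> \<otimes>\<^bsub>pc n (k - 1)\<^esub> oc y a \<delta>) {1..n}"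
    unfolding rsum_def
    by (rule pc.finprod_cong') (use assms in \<open>auto intro!: right_closed right_mult pc.m_closed\<close>)
  also have "\<dots> = rsum n k x \<otimes>\<^bsub>pc n (k - 1)\<^esub> rsum n k y"
    unfolding rsum_def by (rule pc.finprod_multf) (use assms in \<open>auto intro: right_closed\<close>)
  finally show ?thesis .
qed

lemma ad_hom: "ad n k \<in> hom (pc n k) (pc n (k - 1))"
proof (rule homI)
  fix x y assume x: "x \<in> carrier (pc n k)" and y: "y \<in> carrier (pc n k)"
  show "ad n k (x \<otimes>\<^bsub>pc n k\<^esub> y) = ad n k x \<otimes>\<^bsub>pc n (k - 1)\<^esub> ad n k y"
    unfolding ad_eq left_mult[OF x y] rsum_mult[OF x y]
    using left_closed[OF x] left_closed[OF y] rsum_closed[OF x] rsum_closed[OF y]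
    by (simp add: pc.sg_mult pc.m_ac)
qed (rule ad_closed)

lemma perm_comp_id_left: "\<tau> permutes {1..n} \<Longrightarrow> perm_comp n id 1 \<tau> = \<tau>"
proof
  fix k assume "\<tau> permutes {1..n}"
  then show "perm_comp n id 1 \<tau> k = \<tau> k"
    by (auto simp: perm_comp_def shift_def collapse_def permutes_def)
qed

lemma perm_comp_id_right: "a \<ge> 1 \<Longrightarrow> \<sigma> a \<ge> 1 \<Longrightarrow> perm_comp 1 \<sigma> a id = \<sigma>"
proof
  fix k assume "a \<ge> 1" "\<sigma> a \<ge> 1"
  then show "perm_comp 1 \<sigma> a id k = \<sigma> k"
    by (cases "k = a") (auto simp: perm_comp_def shift_def collapse_def Let_def)
qed

text \<open>Since \<delta> has arity one, inserting it does not alter the permutation, and \<sigma>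
  merely permutes the summands of \<open>rsum\<close>.\<close>

lemma ad_act:
  assumes s: "\<sigma> permutes {1..n}" and x: "x \<in> carrier (pc n k)"
  shows "ad n k (opact P x \<sigma>) = opact P (ad n k x) \<sigma>"
proof -
  let ?G = "pc n (k - 1)"
  have l: "oc \<delta> 1 (opact P x \<sigma>) = opact P (oc \<delta> 1 x) \<sigma>"
    using comp_equivariant[OF permutes_id s delta x, of 1] act_id[OF delta] perm_comp_id_left[OF s] by simp
  have r: "oc (opact P x \<sigma>) a \<delta> = opact P (oc x (\<sigma> a) \<delta>) \<sigma>" if a: "a \<in> {1..n}" for a
  proof -
    have "\<sigma> a \<in> {1..n}" using a by (simp only: permutes_in_image[OF s])
    then have "perm_comp 1 \<sigma> a id = \<sigma>" using a by (intro perm_comp_id_right) auto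
    then show ?thesis using comp_equivariant[OF s permutes_id x delta a] act_id[OF delta] by simp
  qed
  have sn: "\<sigma> a \<in> {1..n}" if "a \<in> {1..n}" for a using that by (simp only: permutes_in_image[OF s])
  have "rsum n k (opact P x \<sigma>) = finprod ?G (\<lambda>a. opact P (oc x (\<sigma> a) \<delta>) \<sigma>) {1..n}"
    unfolding rsum_def
    by (rule pc.finprod_cong') (use r sn in \<open>auto intro!: act_closed[OF s] right_closed[OF x]\<close>)
  also have "\<dots> = opact P (finprod ?G (\<lambda>a. oc x (\<sigma> a) \<delta>) {1..n}) \<sigma>"
    by (rule pc.finprod_hom[OF comm_group_piece act_hom[OF s], symmetric])
      (use sn in \<open>auto intro!: right_closed[OF x]\<close>)
  also have "finprod ?G (\<lambda>a. oc x (\<sigma> a) \<delta>) {1..n} = finprod ?G (\<lambda>a. oc x a \<delta>) (\<sigma> ` {1..n})"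
    by (rule pc.finprod_reindex[symmetric])
      (use sn in \<open>auto intro!: right_closed[OF x] permutes_inj_on[OF s]\<close>)
  also have "\<sigma> ` {1..n} = {1..n}" using s by (rule permutes_image)
  finally have rs: "rsum n k (opact P x \<sigma>) = opact P (rsum n k x) \<sigma>" by (simp add: rsum_def)
  show ?thesis
    unfolding ad_eq l rs
    using left_closed[OF x] rsum_closed[OF x] by (simp add: act_mult[OF s] act_sg[OF s])
qed

text \<open>The inputs of the composite are those of \<open>x\<close> before \<open>b\<close>, those
  of \<open>x\<close> after \<open>b\<close> and those of \<open>y\<close>. In the first two groups
  \<delta> has to be exchanged with \<open>y\<close>, which costs the sign with exponent
  \<open>k\<close> as \<delta> is odd.\<close>

lemma rsum_comp:
  assumes x: "x \<in> carrier (pc m j)" and y: "y \<in> carrier (pc n k)" and b: "b \<in> {1..m}"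
  shows "rsum (m + n - 1) (j + k) (oc x b y) =
    sg (pc (m + n - 1) (j + k - 1)) k
      (finprod (pc (m + n - 1) (j + k - 1)) (\<lambda>c. oc (oc x c \<delta>) b y) ({1..m} - {b}))
    \<otimes>\<^bsub>pc (m + n - 1) (j + k - 1)\<^esub> oc x b (rsum n k y)"
proof -
  let ?G = "pc (m + n - 1) (j + k - 1)" and ?f = "\<lambda>c. oc (oc x b y) c \<delta>"
    and ?g = "\<lambda>c. oc (oc x c \<delta>) b y"
  let ?A = "{1..<b}" and ?B = "(\<lambda>c. c + n - 1) ` {b + 1..m}" and ?C = "(\<lambda>i. b + i - 1) ` {1..n}"
  have xy: "oc x b y \<in> carrier (pc (m + n - 1) (j + k))" by (rule comp_closed[OF x y b refl refl])
  have f: "?f c \<in> carrier ?G" if "c \<in> {1..m + n - 1}" for c by (rule right_closed[OF xy that])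
  have g: "?g c \<in> carrier ?G" if "c \<in> {1..m}" for c
    by (rule comp_closed[OF right_closed[OF x that] y b]) auto
  have split: "{1..m + n - 1} = (?A \<union> ?B) \<union> ?C"
  proof (intro equalityI subsetI)
    fix c assume c: "c \<in> {1..m + n - 1}"
    consider "c < b" | "b \<le> c" "c < b + n" | "b + n \<le> c" by linarith
    then show "c \<in> (?A \<union> ?B) \<union> ?C"
    proof cases
      case 2
      then have "c = b + (c + 1 - b) - 1" "c + 1 - b \<in> {1..n}" by auto
      then show ?thesis by blast
    next
      case 3
      then have "c = (c + 1 - n) + n - 1" "c + 1 - n \<in> {b + 1..m}" using b c by auto
      then show ?thesis by blast
    qed (use c in auto)
  qed (use b in auto)
  have sub: "?A \<subseteq> {1..m + n - 1}" "?B \<subseteq> {1..m + n - 1}" "?C \<subseteq> {1..m + n - 1}"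
    using split by blast+
  have A: "?f c = sg ?G k (?g c)" if "c \<in> ?A" for c
  proof -
    have c: "c \<in> {1..m}" "c < b" using that b by auto
    \<comment> \<open>For \<open>c < b\<close> the law of parallel composition puts the sign on the
      other side; it is carried over because signs square to one.\<close>
    have xd: "?g c = sg ?G (- 1 * k) (?f c)"
      using comp_par[OF x delta y c(1) b c(2)] by (simp add: algebra_simps)
    have "sg ?G k (?g c) = sg ?G (k + - 1 * k) (?f c)"
      unfolding xd using f[of c] c sub that by (intro pc.sg_sg) auto
    also have "\<dots> = ?f c" using f[of c] sub that by (intro pc.sg_even) auto
    finally show ?thesis by simp
  qed
  have B: "?f (c + n - 1) = sg ?G k (?g c)" if "c \<in> {b + 1..m}" for c
  proof -
    have c: "c \<in> {1..m}" "b < c" using that b by auto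
    have "?f (c + n - 1) = sg ?G (k * - 1) (?g c)"
      using comp_par[OF x y delta b c(1,2)] by (simp add: algebra_simps)
    also have "\<dots> = sg ?G k (?g c)" by (rule pc.sg_cong) simp
    finally show ?thesis .
  qed
  have C: "?f (b + i - 1) = oc x b (oc y i \<delta>)" if "i \<in> {1..n}" for i
    by (rule comp_seq[OF x y delta b that])
  have "finprod ?G ?f {1..m + n - 1} = finprod ?G ?f (?A \<union> ?B) \<otimes>\<^bsub>?G\<^esub> finprod ?G ?f ?C"
    unfolding split by (rule pc.finprod_Un_disjoint) (use f sub in auto)
  also have "finprod ?G ?f (?A \<union> ?B) = finprod ?G ?f ?A \<otimes>\<^bsub>?G\<^esub> finprod ?G ?f ?B"
    by (rule pc.finprod_Un_disjoint) (use f sub in auto)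
  also have "finprod ?G ?f ?A = finprod ?G (\<lambda>c. sg ?G k (?g c)) ?A"
    by (rule pc.finprod_cong') (use A g b in \<open>auto intro!: pc.int_pow_closed\<close>)
  also have "finprod ?G ?f ?B = finprod ?G (\<lambda>c. ?f (c + n - 1)) {b + 1..m}"
    by (rule pc.finprod_reindex) (use f sub b in \<open>auto intro!: inj_onI\<close>)
  also have "\<dots> = finprod ?G (\<lambda>c. sg ?G k (?g c)) {b + 1..m}"
    by (rule pc.finprod_cong') (use B g b in \<open>auto intro!: pc.int_pow_closed\<close>)
  also have "finprod ?G (\<lambda>c. sg ?G k (?g c)) ?A \<otimes>\<^bsub>?G\<^esub> finprod ?G (\<lambda>c. sg ?G k (?g c)) {b + 1..m} =
      finprod ?G (\<lambda>c. sg ?G k (?g c)) (?A \<union> {b + 1..m})"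
    by (rule pc.finprod_Un_disjoint[symmetric]) (use g b in \<open>auto intro!: pc.int_pow_closed\<close>)
  also have "?A \<union> {b + 1..m} = {1..m} - {b}" using b by auto
  also have "finprod ?G (\<lambda>c. sg ?G k (?g c)) ({1..m} - {b}) = sg ?G k (finprod ?G ?g ({1..m} - {b}))"
    by (rule pc.finprod_sg[symmetric]) (use g in auto)
  also have "finprod ?G ?f ?C = finprod ?G (\<lambda>i. ?f (b + i - 1)) {1..n}"
    by (rule pc.finprod_reindex) (use f sub b in \<open>auto intro!: inj_onI\<close>)
  also have "\<dots> = finprod ?G (\<lambda>i. oc x b (oc y i \<delta>)) {1..n}"
    by (rule pc.finprod_cong')
      (use C in \<open>auto intro!: comp_closed[OF x right_closed[OF y] b]\<close>)
  also have "\<dots> = oc x b (rsum n k y)"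
  proof -
    have "(\<lambda>y. oc x b y) \<in> hom (pc n (k - 1)) ?G"
      using comp_hom_right[OF b x, of n "k - 1"] by (simp add: algebra_simps)
    from pc.finprod_hom[OF comm_group_piece this, of "\<lambda>i. oc y i \<delta>" "{1..n}"]
    show ?thesis using right_closed[OF y] by (simp add: rsum_def)
  qed
  finally show ?thesis by (simp add: rsum_def)
qed

lemma ad_derivation: "operad_derivation P ad"
  unfolding operad_derivation_def
proof (intro conjI allI impI ballI)
  fix m n j k x y b
  assume x: "x \<in> carrier (pc m j)" and y: "y \<in> carrier (pc n k)" and b: "b \<in> {1..m}"
  let ?G = "pc (m + n - 1) (j + k - 1)" and ?g = "\<lambda>c. oc (oc x c \<delta>) b y"
  define Z where "Z = finprod ?G ?g ({1..m} - {b})"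
  have g: "?g c \<in> carrier ?G" if "c \<in> {1..m}" for c
    by (rule comp_closed[OF right_closed[OF x that] y b]) auto
  have c: "oc (oc \<delta> 1 x) b y \<in> carrier ?G" "oc x b (oc \<delta> 1 y) \<in> carrier ?G"
    "oc x b (rsum n k y) \<in> carrier ?G"
    using comp_closed[OF left_closed[OF x] y b refl, of "j + k - 1"]
      comp_closed[OF x left_closed[OF y] b refl, of "j + k - 1"]
      comp_closed[OF x rsum_closed[OF y] b refl, of "j + k - 1"] by auto
  have Z: "Z \<in> carrier ?G" unfolding Z_def by (rule pc.finprod_closed) (use g in auto)
  have l: "oc \<delta> 1 (oc x b y) = oc (oc \<delta> 1 x) b y"
    using comp_seq[OF delta x y, of 1 b] b by simp
  have rx: "oc (rsum m j x) b y = oc x b (oc \<delta> 1 y) \<otimes>\<^bsub>?G\<^esub> Z"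
  proof -
    have "(\<lambda>z. oc z b y) \<in> hom (pc m (j - 1)) ?G"
      using comp_hom_left[OF b y, of "j - 1"] by (simp add: algebra_simps)
    from pc.finprod_hom[OF comm_group_piece this, of "\<lambda>i. oc x i \<delta>" "{1..m}"]
    have "oc (rsum m j x) b y = finprod ?G ?g {1..m}"
      using right_closed[OF x] by (simp add: rsum_def)
    also have "{1..m} = insert b ({1..m} - {b})" using b by auto
    also have "finprod ?G ?g (insert b ({1..m} - {b})) = ?g b \<otimes>\<^bsub>?G\<^esub> Z"
      unfolding Z_def using g b by (intro pc.finprod_insert) auto
    also have "?g b = oc x b (oc \<delta> 1 y)"
      using comp_seq[OF x delta y b, of 1] by simp
    finally show ?thesis .
  qed
  have adx: "oc (ad m j x) b y = oc (oc \<delta> 1 x) b y \<otimes>\<^bsub>?G\<^esub> sg ?G (j + 1) (oc (rsum m j x) b y)"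
    unfolding ad_eq by (rule comp_lin_left[OF left_closed[OF x] rsum_closed[OF x] y b refl]) simp
  have ady: "oc x b (ad n k y) = oc x b (oc \<delta> 1 y) \<otimes>\<^bsub>?G\<^esub> sg ?G (k + 1) (oc x b (rsum n k y))"
    unfolding ad_eq by (rule comp_lin_right[OF x left_closed[OF y] rsum_closed[OF y] b refl]) simp
  show "ad (m + n - 1) (j + k) (oc x b y) =
      oc (ad m j x) b y \<otimes>\<^bsub>?G\<^esub> sg ?G j (oc x b (ad n k y))"
    unfolding ad_eq[of _ "j + k"] adx ady l rsum_comp[OF x y b] rx Z_def[symmetric]
    by (rule pc.sg_leibniz_ad[OF c(1,2,3) Z])
qed (use ad_hom ad_act in auto)

text \<open>Two insertions at the output vanish by \<open>dd\<close>. Two insertions at inputs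
  cancel in pairs, or vanish by \<open>dd\<close> when they are stacked. Insertions at the output
  and at an input commute and occur with opposite signs, because the sign in \<open>ad\<close>
  changes with the degree.\<close>

lemma ad_ad:
  assumes x: "x \<in> carrier (pc n k)" and dd: "oc \<delta> 1 \<delta> = \<one>\<^bsub>pc 1 (-2)\<^esub>"
  shows "ad n (k - 1) (ad n k x) = \<one>\<^bsub>pc n (k - 2)\<^esub>"
proof -
  let ?G = "pc n (k - 1)" and ?H = "pc n (k - 2)"
  have k2: "k - 1 - 1 = k - 2" by simp
  have lx: "oc \<delta> 1 x \<in> carrier ?G" and rx: "rsum n k x \<in> carrier ?G"
    using left_closed[OF x] rsum_closed[OF x] by auto
  have rlx: "rsum n (k - 1) (oc \<delta> 1 x) \<in> carrier ?H" using rsum_closed[OF lx] by simp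
  have ll: "oc \<delta> 1 (oc \<delta> 1 x) = \<one>\<^bsub>?H\<^esub>"
    using comp_seq[OF delta delta x, of 1 1] comp_one_left[OF x, of 1 1 n "k - 2" "-2"] dd by simp
  have lr: "oc \<delta> 1 (rsum n k x) = rsum n (k - 1) (oc \<delta> 1 x)"
  proof -
    have "(\<lambda>y. oc \<delta> 1 y) \<in> hom ?G ?H"
      using comp_hom_right[OF _ delta, of 1 n "k - 1"] by (simp add: algebra_simps)
    from pc.finprod_hom[OF comm_group_piece this, of "\<lambda>i. oc x i \<delta>" "{1..n}"]
    have "oc \<delta> 1 (rsum n k x) = finprod ?H (\<lambda>i. oc \<delta> 1 (oc x i \<delta>)) {1..n}"
      using right_closed[OF x] by (simp add: rsum_def)
    also have "\<dots> = finprod ?H (\<lambda>i. oc (oc \<delta> 1 x) i \<delta>) {1..n}"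
    proof (rule pc.finprod_cong')
      fix i assume i: "i \<in> {1..n}"
      show "oc \<delta> 1 (oc x i \<delta>) = oc (oc \<delta> 1 x) i \<delta>"
        using comp_seq[OF delta x delta, of 1 i] i by simp
    qed (use right_closed[OF lx] in auto)
    finally show ?thesis unfolding rsum_def k2 .
  qed
  have rr: "rsum n (k - 1) (rsum n k x) = \<one>\<^bsub>?H\<^esub>"
  proof -
    let ?f = "\<lambda>a b. oc (oc x b \<delta>) a \<delta>"
    have f: "?f a b \<in> carrier ?H" if "a \<in> {1..n}" "b \<in> {1..n}" for a b
      using right_closed[OF right_closed[OF x that(2)] that(1)] by simp
    have "rsum n (k - 1) (rsum n k x) = finprod ?H (\<lambda>a. finprod ?H (?f a) {1..n}) {1..n}"
      unfolding rsum_def[of n "k - 1"] k2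
    proof (rule pc.finprod_cong')
      fix a assume a: "a \<in> {1..n}"
      have "(\<lambda>y. oc y a \<delta>) \<in> hom ?G ?H"
        using comp_hom_left[OF a delta, of "k - 1"] by simp
      from pc.finprod_hom[OF comm_group_piece this, of "\<lambda>i. oc x i \<delta>" "{1..n}"]
      show "oc (rsum n k x) a \<delta> = finprod ?H (?f a) {1..n}"
        using right_closed[OF x] by (simp add: rsum_def)
    qed (use f in \<open>auto intro!: pc.finprod_closed\<close>)
    also have "\<dots> = \<one>\<^bsub>?H\<^esub>"
    proof (rule pc.finprod_antisymmetric)
      fix a assume a: "a \<in> {1..n}"
      show "?f a a = \<one>\<^bsub>?H\<^esub>"
        using comp_seq[OF x delta delta a, of 1] comp_one_right[OF x a, of n 1 "k - 2" "-2"] dd by simp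
    next
      have lt: "?f a b \<otimes>\<^bsub>?H\<^esub> ?f b a = \<one>\<^bsub>?H\<^esub>" if a: "a \<in> {1..n}" and b: "b \<in> {1..n}" and ab: "a < b" for a b
      proof -
        have "?f b a = sg ?H 1 (?f a b)"
          using comp_par[OF x delta delta a b ab] by simp
        moreover have "?f a b = sg ?H 0 (?f a b)" using f[OF a b] by (simp add: pc.sg_even)
        ultimately show ?thesis using pc.sg_cancel[OF f[OF a b], of 0 1] by simp
      qed
      fix a b assume ab: "a \<in> {1..n}" "b \<in> {1..n}" "a \<noteq> b"
      then consider "a < b" | "b < a" by linarith
      then show "?f a b \<otimes>\<^bsub>?H\<^esub> ?f b a = \<one>\<^bsub>?H\<^esub>"
        using lt[OF ab(1,2)] lt[OF ab(2,1)] pc.m_comm[OF f[OF ab(1,2)] f[OF ab(2,1)]] by cases auto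
    qed (use f in auto)
    finally show ?thesis .
  qed
  have h: "oc \<delta> 1 (ad n k x) = sg ?H (k + 1) (rsum n (k - 1) (oc \<delta> 1 x))"
  proof -
    have "oc \<delta> 1 (ad n k x) = oc \<delta> 1 (oc \<delta> 1 x) \<otimes>\<^bsub>?H\<^esub> sg ?H (k + 1) (oc \<delta> 1 (rsum n k x))"
      unfolding ad_eq by (rule comp_lin_right[OF delta lx rx]) auto
    then show ?thesis unfolding ll lr using rlx by simp
  qed
  have h': "rsum n (k - 1) (ad n k x) = rsum n (k - 1) (oc \<delta> 1 x)"
  proof -
    have hom: "rsum n (k - 1) \<in> hom ?G ?H"
      using rsum_mult[of _ n "k - 1"] rsum_closed[of _ n "k - 1"] by (intro homI) auto
    have "rsum n (k - 1) (ad n k x) =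
        rsum n (k - 1) (oc \<delta> 1 x) \<otimes>\<^bsub>?H\<^esub> sg ?H (k + 1) (rsum n (k - 1) (rsum n k x))"
      unfolding ad_eq
      using hom_mult[OF hom lx] hom_sg[OF group_piece group_piece hom rx] rx by simp
    then show ?thesis unfolding rr using rlx by simp
  qed
  show ?thesis
    unfolding ad_eq[of n "k - 1"] h h' k2
    using rlx by (intro pc.sg_cancel) auto
qed

text \<open>With \<open>dd\<close>, moving \<open>d\<close> past \<delta> at the output gives a
  minus sign. It commutes with \<open>rsum\<close>, but the sign in front of \<open>rsum\<close>
  differs between the degrees \<open>k\<close> and \<open>k - 1\<close>.\<close>

lemma derivation_ad:
  assumes d: "operad_derivation P d" and x: "x \<in> carrier (pc n k)"
    and dd: "d 1 (-1) \<delta> = \<one>\<^bsub>pc 1 (-2)\<^esub>"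
  shows "d n (k - 1) (ad n k x) \<otimes>\<^bsub>pc n (k - 2)\<^esub> ad n (k - 1) (d n k x) = \<one>\<^bsub>pc n (k - 2)\<^esub>"
proof -
  let ?G = "pc n (k - 1)" and ?H = "pc n (k - 2)"
  have k2: "k - 1 - 1 = k - 2" by simp
  have dx: "d n k x \<in> carrier ?G" using derivation_closed[OF d x] by simp
  have lx: "oc \<delta> 1 x \<in> carrier ?G" and rx: "rsum n k x \<in> carrier ?G"
    using left_closed[OF x] rsum_closed[OF x] by auto
  have ldx: "oc \<delta> 1 (d n k x) \<in> carrier ?H" and rdx: "rsum n (k - 1) (d n k x) \<in> carrier ?H"
    using left_closed[OF dx] rsum_closed[OF dx] by auto
  have 1: "d n (k - 1) (oc \<delta> 1 x) = sg ?H (- 1) (oc \<delta> 1 (d n k x))"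
    using derivation_comp[OF d delta x, of 1 n "k - 1"] comp_one_left[OF x, of 1 1 n "k - 2" "-2"] ldx dd
    by (simp add: leibniz_def)
  have 2: "d n (k - 1) (rsum n k x) = rsum n (k - 1) (d n k x)"
  proof -
    have hom: "d n (k - 1) \<in> hom ?G ?H" using derivation_hom[OF d, of n "k - 1"] by simp
    have "d n (k - 1) (rsum n k x) = finprod ?H (\<lambda>a. d n (k - 1) (oc x a \<delta>)) {1..n}"
      unfolding rsum_def
      by (rule pc.finprod_hom[OF comm_group_piece hom]) (use right_closed[OF x] in auto)
    also have "\<dots> = finprod ?H (\<lambda>a. oc (d n k x) a \<delta>) {1..n}"
    proof (rule pc.finprod_cong')
      fix a assume a: "a \<in> {1..n}"
      have "oc (d n k x) a \<delta> \<in> carrier ?H" using right_closed[OF dx a] by simp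
      then show "d n (k - 1) (oc x a \<delta>) = oc (d n k x) a \<delta>"
        using derivation_comp[OF d x delta a, of n "k - 1"] comp_one_right[OF x a, of n 1 "k - 2" "-2"] dd
        by (simp add: leibniz_def)
    qed (use right_closed[OF dx] in auto)
    finally show ?thesis unfolding rsum_def k2 .
  qed
  have hom: "d n (k - 1) \<in> hom ?G ?H" using derivation_hom[OF d, of n "k - 1"] by simp
  have "d n (k - 1) (ad n k x) = sg ?H (- 1) (oc \<delta> 1 (d n k x)) \<otimes>\<^bsub>?H\<^esub> sg ?H (k + 1) (rsum n (k - 1) (d n k x))"
    unfolding ad_eq using hom_mult[OF hom lx] hom_sg[OF group_piece group_piece hom rx] rx 1 2 by simp
  moreover have "ad n (k - 1) (d n k x) = oc \<delta> 1 (d n k x) \<otimes>\<^bsub>?H\<^esub> sg ?H k (rsum n (k - 1) (d n k x))"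
    unfolding ad_eq k2 by simp
  moreover have "sg ?H (- 1) (oc \<delta> 1 (d n k x)) \<otimes>\<^bsub>?H\<^esub> oc \<delta> 1 (d n k x) = \<one>\<^bsub>?H\<^esub>"
    using pc.sg_cancel[OF ldx, of "-1" 0] ldx by (simp add: pc.sg_even)
  moreover have "sg ?H (k + 1) (rsum n (k - 1) (d n k x)) \<otimes>\<^bsub>?H\<^esub> sg ?H k (rsum n (k - 1) (d n k x)) = \<one>\<^bsub>?H\<^esub>"
    using rdx by (intro pc.sg_cancel) auto
  moreover have "(A \<otimes>\<^bsub>?H\<^esub> B) \<otimes>\<^bsub>?H\<^esub> (C \<otimes>\<^bsub>?H\<^esub> D) = (A \<otimes>\<^bsub>?H\<^esub> C) \<otimes>\<^bsub>?H\<^esub> (B \<otimes>\<^bsub>?H\<^esub> D)"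
    if "A \<in> carrier ?H" "B \<in> carrier ?H" "C \<in> carrier ?H" "D \<in> carrier ?H" for A B C D
    using that by (simp add: pc.m_ac)
  ultimately show ?thesis using ldx rdx by simp
qed

end

section \<open>Adjoining a generator\<close>

primrec opterm_arity :: "nat \<Rightarrow> 'a opterm \<Rightarrow> nat" where
  "opterm_arity r (Elem n k x) = n"
| "opterm_arity r Gen = r"
| "opterm_arity r (Zero n k) = n"
| "opterm_arity r (Plus t s) = opterm_arity r t"
| "opterm_arity r (Neg t) = opterm_arity r t"
| "opterm_arity r (Act t \<sigma>) = opterm_arity r t"
| "opterm_arity r (Comp t a s) = opterm_arity r t + opterm_arity r s - 1"

primrec opterm_degree :: "int \<Rightarrow> 'a opterm \<Rightarrow> int" where
  "opterm_degree e (Elem n k x) = k"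
| "opterm_degree e Gen = e"
| "opterm_degree e (Zero n k) = k"
| "opterm_degree e (Plus t s) = opterm_degree e t"
| "opterm_degree e (Neg t) = opterm_degree e t"
| "opterm_degree e (Act t \<sigma>) = opterm_degree e t"
| "opterm_degree e (Comp t a s) = opterm_degree e t + opterm_degree e s"

lemma opterm_typ_arity:
  "opterm_typ P r e n k t \<Longrightarrow> opterm_arity r t = n \<and> opterm_degree e t = k"
  by (induction rule: opterm_typ.induct) auto

lemma opterm_arity_signed: "opterm_arity r (signed j t) = opterm_arity r t"
  and opterm_degree_signed: "opterm_degree e (signed j t) = opterm_degree e t"
  by (simp_all add: signed_def)

text \<open>An expression determines its arity and degree, so the unions over all \<open>n\<close>
  and \<open>k\<close> in \<open>adjoin\<close> contain a single nonempty class.\<close>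

lemma opterm_eq_arity:
  "opterm_eq P r e R n k t s \<Longrightarrow>
   opterm_arity r t = n \<and> opterm_arity r s = n \<and> opterm_degree e t = k \<and> opterm_degree e s = k"
proof (induction rule: opterm_eq.induct)
  case (assoc_seq m i t n j s p k u a b)
  then have "opterm_arity r t = m" "opterm_degree e t = i" "opterm_arity r s = n" "opterm_degree e s = j"
    "opterm_arity r u = p" "opterm_degree e u = k" using opterm_typ_arity by blast+
  then show ?case using assoc_seq by auto
next
  case (assoc_par m i t n j s p k u a b)
  then have "opterm_arity r t = m" "opterm_degree e t = i" "opterm_arity r s = n" "opterm_degree e s = j"
    "opterm_arity r u = p" "opterm_degree e u = k" using opterm_typ_arity by blast+
  then show ?case using assoc_par by (auto simp: opterm_arity_signed opterm_degree_signed)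
qed (auto simp: opterm_arity_signed opterm_degree_signed dest: opterm_typ_arity)

lemma signed_typ: "opterm_typ P r e n k t \<Longrightarrow> opterm_typ P r e n k (signed j t)"
  by (simp add: signed_def typ_Neg)

lemma typ_Comp': "opterm_typ P r e m j t \<Longrightarrow> opterm_typ P r e n k s \<Longrightarrow> a \<in> {1..m} \<Longrightarrow>
    N = m + n - 1 \<Longrightarrow> K = j + k \<Longrightarrow> opterm_typ P r e N K (Comp t a s)"
  by (simp only: typ_Comp)

lemma UN_const_eq: "A \<noteq> {} \<Longrightarrow> (\<And>x. x \<in> A \<Longrightarrow> f x = c) \<Longrightarrow> (\<Union>x \<in> A. f x) = c"
  by auto

text \<open>The block of inserted inputs is carried to the block at \<open>\<sigma> a\<close> and
  the other inputs avoid that block; this makes the right-hand side of equivariance well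
  typed.\<close>

lemma permutes_perm_comp:
  assumes \<sigma>: "\<sigma> permutes {1..m}" and \<tau>: "\<tau> permutes {1..n}" and a: "a \<in> {1..m}"
  shows "perm_comp n \<sigma> a \<tau> permutes {1..m + n - 1}"
proof -
  let ?p = "perm_comp n \<sigma> a \<tau>" and ?A = "{1..m + n - 1}"
  have sa: "\<sigma> a \<in> {1..m}" using a by (simp only: permutes_in_image[OF \<sigma>])
  have tau: "\<tau> i \<in> {1..n}" if "i \<in> {1..n}" for i using that by (simp only: permutes_in_image[OF \<tau>])
  have sig: "\<sigma> i \<in> {1..m}" if "i \<in> {1..m}" for i using that by (simp only: permutes_in_image[OF \<sigma>])
  have inner: "Suc (?p k) = \<sigma> a + \<tau> (k + 1 - a) \<and> \<tau> (k + 1 - a) \<in> {1..n}" if "a \<le> k" "k < a + n" for k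
  proof -
    have "k + 1 - a \<in> {1..n}" using that by (simp add: Suc_diff_le)
    then have "\<tau> (k + 1 - a) \<in> {1..n}" by (rule tau)
    then show ?thesis using that sa by (simp add: perm_comp_def shift_def)
  qed
  have outer: "?p k = (let j = \<sigma> (collapse n a k) in if j < \<sigma> a then j else j + n - 1) \<and>
      \<sigma> (collapse n a k) \<noteq> \<sigma> a \<and> \<sigma> (collapse n a k) \<in> {1..m}"
    if "\<not> (a \<le> k \<and> k < a + n)" "k \<in> ?A" for k
  proof -
    have "collapse n a k \<noteq> a" using that by (auto simp: collapse_def)
    then have "\<sigma> (collapse n a k) \<noteq> \<sigma> a" using permutes_inj[OF \<sigma>] by (simp add: inj_eq)
    moreover have "collapse n a k \<in> {1..m}" using that a by (auto simp: collapse_def)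
    ultimately show ?thesis using sig that(1) by (auto simp: perm_comp_def)
  qed
  have into: "?p ` ?A \<subseteq> ?A"
  proof
    fix y assume "y \<in> ?p ` ?A"
    then obtain k where k: "k \<in> ?A" "y = ?p k" by blast
    show "y \<in> ?A"
    proof (cases "a \<le> k \<and> k < a + n")
      case True
      then show ?thesis using inner[of k] k sa by auto
    next
      case False
      then show ?thesis using outer[of k] k sa by (auto simp: Let_def)
    qed
  qed
  have "inj_on ?p ?A"
  proof (rule inj_onI)
    fix k l assume kl: "k \<in> ?A" "l \<in> ?A" "?p k = ?p l"
    have mixed: False if "a \<le> k \<and> k < a + n" "\<not> (a \<le> l \<and> l < a + n)" "k \<in> ?A" "l \<in> ?A" "?p k = ?p l" for k l
      using inner[of k] outer[of l] that by (auto simp: Let_def split: if_splits)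
    consider "a \<le> k \<and> k < a + n" "a \<le> l \<and> l < a + n"
      | "\<not> (a \<le> k \<and> k < a + n)" "\<not> (a \<le> l \<and> l < a + n)"
      using mixed[of k l] mixed[of l k] kl by metis
    then show "k = l"
    proof cases
      case 1
      then have "\<tau> (k + 1 - a) = \<tau> (l + 1 - a)" using inner[of k] inner[of l] kl(3) sa by auto
      then have "k + 1 - a = l + 1 - a" using permutes_inj[OF \<tau>] by (simp only: inj_eq)
      then show ?thesis using 1 by auto
    next
      case 2
      have aux: "(if i < s then i else i + n - 1) = (if j < s then j else j + n - 1) \<Longrightarrow> i \<noteq> s \<Longrightarrow> j \<noteq> s \<Longrightarrow> i = j"
        for i j s :: nat by (cases "i < s"; cases "j < s") simp_all
      have "\<sigma> (collapse n a k) = \<sigma> (collapse n a l)"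
        using outer[OF 2(1) kl(1)] outer[OF 2(2) kl(2)] kl(3) unfolding Let_def
        by (intro aux[of "\<sigma> (collapse n a k)" "\<sigma> a" "\<sigma> (collapse n a l)"]) simp_all
      then have "collapse n a k = collapse n a l" using permutes_inj[OF \<sigma>] by (simp only: inj_eq)
      then show ?thesis using 2 by (auto simp: collapse_def split: if_splits)
    qed
  qed
  then have "bij_betw ?p ?A ?A" using into by (simp add: bij_betw_def endo_inj_surj)
  moreover have "?p k = k" if "k \<notin> ?A" for k
  proof -
    have \<sigma>0: "\<sigma> i = i" if "i \<notin> {1..m}" for i using \<sigma> that by (rule permutes_not_in)
    have "k = 0 \<or> k > m + n - 1" using that by auto
    then show ?thesis
    proof
      assume "k = 0"
      then show ?thesis using a sa \<sigma>0[of 0] by (simp add: perm_comp_def collapse_def)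
    next
      assume k: "k > m + n - 1"
      then have l: "k \<ge> a + n" "k + 1 - n > m" using a by auto
      then have "\<sigma> (collapse n a k) = k + 1 - n" using \<sigma>0[of "k + 1 - n"] by (simp add: collapse_def)
      moreover have "\<not> k + 1 - n < \<sigma> a" using l sa by auto
      ultimately show ?thesis using l by (simp add: perm_comp_def Let_def)
    qed
  qed
  ultimately show ?thesis by (rule bij_imp_permutes)
qed

locale adjoining =
  fixes P :: "'a operad_data" and r :: nat and e :: int
    and R :: "nat \<Rightarrow> int \<Rightarrow> 'a opterm \<Rightarrow> 'a opterm \<Rightarrow> bool"
  assumes unit_carrier: "opunit P \<in> carrier (piece P 1 0)"
begin

abbreviation wt :: "nat \<Rightarrow> int \<Rightarrow> 'a opterm \<Rightarrow> bool" where
  "wt \<equiv> opterm_typ P r e"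

abbreviation eqt :: "nat \<Rightarrow> int \<Rightarrow> 'a opterm \<Rightarrow> 'a opterm \<Rightarrow> bool" where
  "eqt \<equiv> opterm_eq P r e R"

abbreviation cls :: "nat \<Rightarrow> int \<Rightarrow> 'a opterm \<Rightarrow> 'a opterm set" where
  "cls \<equiv> opterm_class P r e R"

abbreviation M :: "'a opterm set operad_data" where
  "M \<equiv> adjoin P r e R"

lemma wt_imp_typed: "wt n k t \<Longrightarrow> \<exists>t'. wt n k t' \<and> eqt n k t t'"
  using eq_refl by blast

text \<open>The rules for the operations of \<open>P\<close> mention terms such as
  \<open>Elem n k (opact P x \<sigma>)\<close> without asking for membership in a carrier. Each of
  them is still congruent to a typed term, so the rules for classes may assume
  \<open>eqt n k t t\<close> only.\<close>

lemma eqt_typed: "eqt n k t s \<Longrightarrow> \<exists>t'. wt n k t' \<and> eqt n k t t'"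
proof (induction rule: opterm_eq.induct)
  case (eq_refl n k t)
  then show ?case using opterm_eq.eq_refl by blast
next
  case (eq_sym n k t s)
  then show ?case using opterm_eq.eq_sym eq_trans by blast
next
  case (cong_Plus n k t t' s s')
  then obtain u v where "wt n k u" "eqt n k t u" "wt n k v" "eqt n k s v" by blast
  then show ?case by (intro exI[of _ "Plus u v"] conjI typ_Plus opterm_eq.cong_Plus)
next
  case (cong_Neg n k t t')
  then obtain u where "wt n k u" "eqt n k t u" by blast
  then show ?case by (intro exI[of _ "Neg u"] conjI typ_Neg opterm_eq.cong_Neg)
next
  case (cong_Act n k t t' \<sigma>)
  then obtain u where "wt n k u" "eqt n k t u" by blast
  with cong_Act(2) show ?case by (intro exI[of _ "Act u \<sigma>"] conjI typ_Act opterm_eq.cong_Act)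
next
  case (cong_Comp m j t t' n k s s' a)
  then obtain u v where "wt m j u" "eqt m j t u" "wt n k v" "eqt n k s v" by blast
  with cong_Comp(3) show ?case by (intro exI[of _ "Comp u a v"] conjI typ_Comp opterm_eq.cong_Comp)
next
  case (assoc_seq m i t n j s p k u a b)
  then have "wt (m + n + p - 2) (i + j + k) (Comp t a (Comp s b u))"
    by (intro typ_Comp'[OF assoc_seq(1) typ_Comp[OF assoc_seq(2,3,5)] assoc_seq(4)]) auto
  then show ?case using opterm_eq.assoc_seq[OF assoc_seq] by blast
next
  case (assoc_par m i t n j s p k u a b)
  then have "wt (m + n + p - 2) (i + j + k) (signed (j * k) (Comp (Comp t b u) a s))"
    by (intro signed_typ typ_Comp'[OF typ_Comp[OF assoc_par(1,3,5)] assoc_par(2)]) auto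
  then show ?case using opterm_eq.assoc_par[OF assoc_par] by blast
next
  case (Elem_mult x n k y)
  then show ?case using opterm_eq.Elem_mult typ_Plus typ_Elem by metis
next
  case (Elem_act x n k \<sigma>)
  then show ?case using opterm_eq.Elem_act typ_Act typ_Elem by metis
next
  case (Elem_comp x m j y n k a)
  then show ?case using opterm_eq.Elem_comp typ_Comp typ_Elem by metis
next
  case (equivariance m j t n k s a \<sigma> \<tau>)
  then have "wt (m + n - 1) (j + k) (Comp (Act t \<sigma>) a (Act s \<tau>))"
    by (intro typ_Comp typ_Act)
  then show ?case using opterm_eq.eq_refl by blast
next
  case (unit_left n k t)
  then show ?case using opterm_eq.unit_left by blast
next
  case (unit_right n k t a)
  then show ?case using opterm_eq.unit_right by blast
next
  case (eq_trans n k t s u)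
  then show ?case by simp
next
  case (Plus_assoc n k t s u)
  then show ?case by (intro wt_imp_typed typ_Plus)
next
  case (Plus_commute n k t s)
  then show ?case by (intro wt_imp_typed typ_Plus)
next
  case (Plus_Zero n k t)
  then show ?case by (intro wt_imp_typed typ_Plus typ_Zero)
next
  case (Plus_Neg n k t)
  then show ?case by (intro wt_imp_typed typ_Plus typ_Neg)
next
  case (Act_Plus n k t s \<sigma>)
  then show ?case by (intro wt_imp_typed typ_Act typ_Plus)
next
  case (Act_id n k t)
  then show ?case by (intro wt_imp_typed typ_Act permutes_id)
next
  case (Act_Act n k t \<sigma> \<tau>)
  then show ?case by (intro wt_imp_typed typ_Act permutes_compose)
next
  case (Comp_Plus_left m j t t' n k s a)
  then show ?case by (intro wt_imp_typed typ_Comp typ_Plus)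
next
  case (Comp_Plus_right m j t n k s s' a)
  then show ?case by (intro wt_imp_typed typ_Comp typ_Plus)
next
  case (relation n k t s)
  then show ?case by (intro wt_imp_typed)
qed

lemma mem_cls: "s \<in> cls n k t \<longleftrightarrow> eqt n k t s"
  by (simp add: opterm_class_def)

lemma cls_eqI: "eqt n k t s \<Longrightarrow> cls n k t = cls n k s"
  unfolding opterm_class_def using eq_trans[of P r e R n k] eq_sym[of P r e R n k t s] by blast

lemma eqt_iff: "eqt n k t t \<Longrightarrow> eqt n k t s \<longleftrightarrow> cls n k t = cls n k s"
  using cls_eqI mem_cls eq_sym by blast

lemma carrier_M: "carrier (piece M n k) = {cls n k t | t. wt n k t}"
  by (auto simp: adjoin_def quotient_def opterm_class_def)

lemma cls_closed: "eqt n k t t \<Longrightarrow> cls n k t \<in> carrier (piece M n k)"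
proof -
  assume "eqt n k t t"
  then obtain t' where t': "wt n k t'" "eqt n k t t'" using eqt_typed by blast
  have "cls n k t = cls n k t'" by (rule cls_eqI[OF t'(2)])
  then show ?thesis using t'(1) unfolding carrier_M by (simp only: mem_Collect_eq) (intro exI[of _ t'] conjI refl)
qed

lemma typ_cls_closed: "wt n k t \<Longrightarrow> cls n k t \<in> carrier (piece M n k)"
  unfolding carrier_M by (simp only: mem_Collect_eq) (intro exI[of _ t] conjI refl)

lemma carrier_ME:
  assumes "A \<in> carrier (piece M n k)" obtains t where "wt n k t" "A = cls n k t"
  using assms carrier_M by blast

lemma cls_nonempty: "eqt n k t t \<Longrightarrow> cls n k t \<noteq> {}"
  using mem_cls by blast

lemma cls_mult:
  assumes "eqt n k t t" "eqt n k s s"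
  shows "cls n k t \<otimes>\<^bsub>piece M n k\<^esub> cls n k s = cls n k (Plus t s)"
proof -
  have "(\<Union>t' \<in> cls n k t. \<Union>s' \<in> cls n k s. cls n k (Plus t' s')) = cls n k (Plus t s)"
    using assms by (intro UN_const_eq cls_nonempty cls_eqI) (auto simp: mem_cls intro: eq_sym cong_Plus)
  then show ?thesis by (simp add: adjoin_def)
qed

lemma cls_one: "\<one>\<^bsub>piece M n k\<^esub> = cls n k (Zero n k)"
  by (simp add: adjoin_def)

lemma UN_cls: "eqt n k t s \<Longrightarrow> (\<Union>n. \<Union>k. cls n k t) = cls n k t"
proof (intro equalityI subsetI)
  fix x assume t: "eqt n k t s" and "x \<in> (\<Union>n. \<Union>k. cls n k t)"
  then obtain n' k' where x: "eqt n' k' t x" by (auto simp: mem_cls)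
  then have "n' = n" "k' = k" using opterm_eq_arity[OF t] opterm_eq_arity[OF x] by auto
  then show "x \<in> cls n k t" using x by (simp add: mem_cls)
qed auto

lemma cls_act:
  assumes "eqt n k t t" "\<sigma> permutes {1..n}"
  shows "opact M (cls n k t) \<sigma> = cls n k (Act t \<sigma>)"
proof -
  have "(\<Union>t' \<in> cls n k t. \<Union>n. \<Union>k. cls n k (Act t' \<sigma>)) = cls n k (Act t \<sigma>)"
  proof (rule UN_const_eq[OF cls_nonempty[OF assms(1)]])
    fix t' assume "t' \<in> cls n k t"
    then have "eqt n k (Act t' \<sigma>) (Act t \<sigma>)"
      using assms(2) by (auto simp: mem_cls intro: eq_sym cong_Act)
    then show "(\<Union>n. \<Union>k. cls n k (Act t' \<sigma>)) = cls n k (Act t \<sigma>)"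
      using UN_cls cls_eqI by metis
  qed
  then show ?thesis by (simp add: adjoin_def)
qed

lemma cls_comp:
  assumes "eqt m j t t" "eqt n k s s" "a \<in> {1..m}" "N = m + n - 1" "K = j + k"
  shows "opcomp M (cls m j t) a (cls n k s) = cls N K (Comp t a s)"
proof -
  have "(\<Union>t' \<in> cls m j t. \<Union>s' \<in> cls n k s. \<Union>n. \<Union>k. cls n k (Comp t' a s')) = cls N K (Comp t a s)"
  proof (rule UN_const_eq[OF cls_nonempty[OF assms(1)]], rule UN_const_eq[OF cls_nonempty[OF assms(2)]])
    fix t' s' assume "t' \<in> cls m j t" "s' \<in> cls n k s"
    then have "eqt m j t' t" "eqt n k s' s" by (simp_all add: mem_cls eq_sym)
    then have "eqt N K (Comp t' a s') (Comp t a s)"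
      unfolding assms(4,5) using assms(3) by (rule cong_Comp)
    then show "(\<Union>n. \<Union>k. cls n k (Comp t' a s')) = cls N K (Comp t a s)"
      using UN_cls cls_eqI by metis
  qed
  then show ?thesis by (simp add: adjoin_def)
qed

lemma comm_group_M: "comm_group (piece M n k)"
proof (rule comm_groupI)
  fix A B assume "A \<in> carrier (piece M n k)" "B \<in> carrier (piece M n k)"
  then obtain t s where t: "wt n k t" "A = cls n k t" and s: "wt n k s" "B = cls n k s"
    by (meson carrier_ME)
  then show "A \<otimes>\<^bsub>piece M n k\<^esub> B \<in> carrier (piece M n k)"
    by (auto simp: cls_mult eq_refl intro!: typ_cls_closed typ_Plus)
  show "A \<otimes>\<^bsub>piece M n k\<^esub> B = B \<otimes>\<^bsub>piece M n k\<^esub> A"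
    using t s by (auto simp: cls_mult eq_refl intro!: cls_eqI Plus_commute)
  fix C assume "C \<in> carrier (piece M n k)"
  then obtain u where u: "wt n k u" "C = cls n k u" by (meson carrier_ME)
  show "A \<otimes>\<^bsub>piece M n k\<^esub> B \<otimes>\<^bsub>piece M n k\<^esub> C = A \<otimes>\<^bsub>piece M n k\<^esub> (B \<otimes>\<^bsub>piece M n k\<^esub> C)"
    using t s u by (auto simp: cls_mult eq_refl typ_Plus intro!: cls_eqI Plus_assoc)
next
  show "\<one>\<^bsub>piece M n k\<^esub> \<in> carrier (piece M n k)"
    by (simp add: cls_one typ_cls_closed typ_Zero)
next
  fix A assume "A \<in> carrier (piece M n k)"
  then obtain t where t: "wt n k t" "A = cls n k t" by (meson carrier_ME)
  have z: "wt n k (Zero n k)" by (rule typ_Zero)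
  have "eqt n k (Plus (Zero n k) t) t"
    using eq_trans[OF Plus_commute[OF z t(1)] Plus_Zero[OF t(1)]] .
  then show "\<one>\<^bsub>piece M n k\<^esub> \<otimes>\<^bsub>piece M n k\<^esub> A = A"
    using t z by (simp add: cls_one cls_mult eq_refl cls_eqI)
  have n: "wt n k (Neg t)" using t(1) by (rule typ_Neg)
  have "eqt n k (Plus (Neg t) t) (Zero n k)"
    using eq_trans[OF Plus_commute[OF n t(1)] Plus_Neg[OF t(1)]] .
  then have "cls n k (Neg t) \<otimes>\<^bsub>piece M n k\<^esub> A = \<one>\<^bsub>piece M n k\<^esub>"
    using t n by (simp add: cls_one cls_mult eq_refl cls_eqI)
  then show "\<exists>B \<in> carrier (piece M n k). B \<otimes>\<^bsub>piece M n k\<^esub> A = \<one>\<^bsub>piece M n k\<^esub>"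
    using typ_cls_closed[OF n] by blast
qed

lemma cls_neg:
  assumes "eqt n k t t"
  shows "inv\<^bsub>piece M n k\<^esub> (cls n k t) = cls n k (Neg t)"
proof -
  interpret G: comm_group "piece M n k" by (rule comm_group_M)
  obtain t' where t': "wt n k t'" "eqt n k t t'" using eqt_typed[OF assms] by blast
  then have c: "cls n k t = cls n k t'" "cls n k (Neg t) = cls n k (Neg t')"
    using cls_eqI cong_Neg by blast+
  have n: "wt n k (Neg t')" using t'(1) by (rule typ_Neg)
  have "cls n k t' \<otimes>\<^bsub>piece M n k\<^esub> cls n k (Neg t') = \<one>\<^bsub>piece M n k\<^esub>"
    using t' n cls_eqI[OF Plus_Neg[OF t'(1)]] by (simp add: cls_one cls_mult eq_refl)
  then have "cls n k (Neg t') \<otimes>\<^bsub>piece M n k\<^esub> cls n k t' = \<one>\<^bsub>piece M n k\<^esub>"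
    using G.m_comm typ_cls_closed t'(1) n by metis
  then show ?thesis unfolding c using typ_cls_closed t'(1) n by (intro G.inv_equality)
qed

lemma cls_sg: "eqt n k t t \<Longrightarrow> sg (piece M n k) j (cls n k t) = cls n k (signed j t)"
proof -
  interpret G: comm_group "piece M n k" by (rule comm_group_M)
  assume t: "eqt n k t t"
  show ?thesis
    using cls_closed[OF t] cls_neg[OF t] by (cases "even j") (simp_all add: G.sg_even G.sg_odd signed_def)
qed

lemma unit_typ: "wt 1 0 (Elem 1 0 (opunit P))"
  using unit_carrier by (rule typ_Elem)

text \<open>After choosing typed representatives, each axiom is a rule of the congruence.\<close>

theorem graded_operad_adjoin: "graded_operad M"
  unfolding graded_operad_def
proof (intro conjI allI impI ballI)
  fix n k
  show "comm_group (piece M n k)" by (rule comm_group_M)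
next
  show "opunit M \<in> carrier (piece M 1 0)"
    using typ_cls_closed[OF unit_typ] by (simp add: adjoin_def)
next
  fix n k and \<sigma> :: "nat \<Rightarrow> nat" assume \<sigma>: "\<sigma> permutes {1..n}"
  show "(\<lambda>x. opact M x \<sigma>) \<in> hom (piece M n k) (piece M n k)"
  proof (rule homI)
    fix A assume "A \<in> carrier (piece M n k)"
    then obtain t where t: "wt n k t" "A = cls n k t" by (rule carrier_ME)
    then show "opact M A \<sigma> \<in> carrier (piece M n k)"
      using \<sigma> by (simp add: cls_act eq_refl typ_cls_closed typ_Act)
    fix B assume "B \<in> carrier (piece M n k)"
    then obtain s where s: "wt n k s" "B = cls n k s" by (rule carrier_ME)
    show "opact M (A \<otimes>\<^bsub>piece M n k\<^esub> B) \<sigma> = opact M A \<sigma> \<otimes>\<^bsub>piece M n k\<^esub> opact M B \<sigma>"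
      using t s \<sigma> by (simp add: cls_act cls_mult eq_refl typ_Plus typ_Act cls_eqI Act_Plus)
  qed
next
  fix n k A assume "A \<in> carrier (piece M n k)"
  then obtain t where t: "wt n k t" "A = cls n k t" by (rule carrier_ME)
  then show "opact M A id = A" by (simp add: cls_act eq_refl permutes_id cls_eqI Act_id)
next
  fix n k \<sigma> \<tau> A assume st: "\<sigma> permutes {1..n} \<and> \<tau> permutes {1..n}" and "A \<in> carrier (piece M n k)"
  then obtain t where t: "wt n k t" "A = cls n k t" by (meson carrier_ME)
  then show "opact M A (\<sigma> \<circ> \<tau>) = opact M (opact M A \<sigma>) \<tau>"
    using st permutes_compose[of \<tau> "{1..n}" \<sigma>]
    by (simp add: cls_act eq_refl typ_Act cls_eqI Act_Act)
next
  fix m n a :: nat and j k A assume a: "a \<in> {1..m}" and "A \<in> carrier (piece M n k)"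
  then obtain s where s: "wt n k s" "A = cls n k s" by (meson carrier_ME)
  show "(\<lambda>x. opcomp M x a A) \<in> hom (piece M m j) (piece M (m + n - 1) (j + k))"
  proof (rule homI)
    fix B assume "B \<in> carrier (piece M m j)"
    then obtain t where t: "wt m j t" "B = cls m j t" by (rule carrier_ME)
    note c = cls_comp[OF _ eq_refl[OF s(1)] a refl refl]
    show "opcomp M B a A \<in> carrier (piece M (m + n - 1) (j + k))"
      unfolding t(2) s(2) c[OF eq_refl[OF t(1)]] using t s a by (intro typ_cls_closed typ_Comp)
    fix C assume "C \<in> carrier (piece M m j)"
    then obtain u where u: "wt m j u" "C = cls m j u" by (rule carrier_ME)
    show "opcomp M (B \<otimes>\<^bsub>piece M m j\<^esub> C) a A =
        opcomp M B a A \<otimes>\<^bsub>piece M (m + n - 1) (j + k)\<^esub> opcomp M C a A"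
      unfolding t(2) s(2) u(2) cls_mult[OF eq_refl[OF t(1)] eq_refl[OF u(1)]]
        c[OF eq_refl[OF t(1)]] c[OF eq_refl[OF u(1)]] c[OF eq_refl[OF typ_Plus[OF t(1) u(1)]]]
        cls_mult[OF eq_refl[OF typ_Comp[OF t(1) s(1) a]] eq_refl[OF typ_Comp[OF u(1) s(1) a]]]
      by (rule cls_eqI[OF Comp_Plus_left[OF t(1) u(1) s(1) a]])
  qed
next
  fix m n a :: nat and j k A assume a: "a \<in> {1..m}" and "A \<in> carrier (piece M m j)"
  then obtain t where t: "wt m j t" "A = cls m j t" by (meson carrier_ME)
  show "opcomp M A a \<in> hom (piece M n k) (piece M (m + n - 1) (j + k))"
  proof (rule homI)
    fix B assume "B \<in> carrier (piece M n k)"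
    then obtain s where s: "wt n k s" "B = cls n k s" by (rule carrier_ME)
    note c = cls_comp[OF eq_refl[OF t(1)] _ a refl refl]
    show "opcomp M A a B \<in> carrier (piece M (m + n - 1) (j + k))"
      unfolding t(2) s(2) c[OF eq_refl[OF s(1)]] using t s a by (intro typ_cls_closed typ_Comp)
    fix C assume "C \<in> carrier (piece M n k)"
    then obtain u where u: "wt n k u" "C = cls n k u" by (rule carrier_ME)
    show "opcomp M A a (B \<otimes>\<^bsub>piece M n k\<^esub> C) =
        opcomp M A a B \<otimes>\<^bsub>piece M (m + n - 1) (j + k)\<^esub> opcomp M A a C"
      unfolding t(2) s(2) u(2) cls_mult[OF eq_refl[OF s(1)] eq_refl[OF u(1)]]
        c[OF eq_refl[OF s(1)]] c[OF eq_refl[OF u(1)]] c[OF eq_refl[OF typ_Plus[OF s(1) u(1)]]]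
        cls_mult[OF eq_refl[OF typ_Comp[OF t(1) s(1) a]] eq_refl[OF typ_Comp[OF t(1) u(1) a]]]
      by (rule cls_eqI[OF Comp_Plus_right[OF t(1) s(1) u(1) a]])
  qed
next
  fix n k A assume "A \<in> carrier (piece M n k)"
  then obtain t where t: "wt n k t" "A = cls n k t" by (rule carrier_ME)
  have u: "opunit M = cls 1 0 (Elem 1 0 (opunit P))" by (simp add: adjoin_def)
  have one: "(1 :: nat) \<in> {1..1}" by simp
  have "opcomp M (opunit M) 1 A = cls n k (Comp (Elem 1 0 (opunit P)) 1 t)"
    unfolding u t(2) by (rule cls_comp[OF eq_refl[OF unit_typ] eq_refl[OF t(1)] one]) simp_all
  then show "opcomp M (opunit M) 1 A = A"
    unfolding t(2) by (simp only: cls_eqI[OF unit_left[OF t(1)]])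
  fix a assume a: "a \<in> {1..n}"
  have "opcomp M A a (opunit M) = cls n k (Comp t a (Elem 1 0 (opunit P)))"
    unfolding u t(2) by (rule cls_comp[OF eq_refl[OF t(1)] eq_refl[OF unit_typ] a]) simp_all
  then show "opcomp M A a (opunit M) = A"
    unfolding t(2) by (simp only: cls_eqI[OF unit_right[OF t(1) a]])
next
  fix m n p i j k A B C a b
  assume "A \<in> carrier (piece M m i)" "B \<in> carrier (piece M n j)" "C \<in> carrier (piece M p k)"
    and a: "a \<in> {1..m}" and b: "b \<in> {1..n}"
  then obtain t s u where t: "wt m i t" "A = cls m i t" and s: "wt n j s" "B = cls n j s"
    and u: "wt p k u" "C = cls p k u" by (meson carrier_ME)
  have ab: "a + b - 1 \<in> {1..m + n - 1}" using a b by auto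
  have N: "m + n + p - 2 = m + n - 1 + p - 1" "m + n + p - 2 = m + (n + p - 1) - 1"
    "i + j + k = i + (j + k)" using a b by auto
  have 1: "opcomp M (opcomp M A a B) (a + b - 1) C = cls (m + n + p - 2) (i + j + k) (Comp (Comp t a s) (a + b - 1) u)"
    unfolding t(2) s(2) u(2) cls_comp[OF eq_refl[OF t(1)] eq_refl[OF s(1)] a refl refl]
    by (rule cls_comp[OF eq_refl[OF typ_Comp[OF t(1) s(1) a]] eq_refl[OF u(1)] ab N(1) refl])
  have 2: "opcomp M A a (opcomp M B b C) = cls (m + n + p - 2) (i + j + k) (Comp t a (Comp s b u))"
    unfolding t(2) s(2) u(2) cls_comp[OF eq_refl[OF s(1)] eq_refl[OF u(1)] b refl refl]
    by (rule cls_comp[OF eq_refl[OF t(1)] eq_refl[OF typ_Comp[OF s(1) u(1) b]] a N(2,3)])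
  show "opcomp M (opcomp M A a B) (a + b - 1) C = opcomp M A a (opcomp M B b C)"
    unfolding 1 2 by (rule cls_eqI[OF assoc_seq[OF t(1) s(1) u(1) a b]])
next
  fix m n p i j k A B C a b
  assume "A \<in> carrier (piece M m i)" "B \<in> carrier (piece M n j)" "C \<in> carrier (piece M p k)"
    and a: "a \<in> {1..m}" and b: "b \<in> {1..m}" and ab: "a < b"
  then obtain t s u where t: "wt m i t" "A = cls m i t" and s: "wt n j s" "B = cls n j s"
    and u: "wt p k u" "C = cls p k u" by (meson carrier_ME)
  have bn: "b + n - 1 \<in> {1..m + n - 1}" and ap: "a \<in> {1..m + p - 1}" using a b ab by auto
  have N: "m + n + p - 2 = m + n - 1 + p - 1" "m + n + p - 2 = m + p - 1 + n - 1"
    "i + j + k = i + k + j" using a b ab by auto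
  have 1: "opcomp M (opcomp M A a B) (b + n - 1) C = cls (m + n + p - 2) (i + j + k) (Comp (Comp t a s) (b + n - 1) u)"
    unfolding t(2) s(2) u(2) cls_comp[OF eq_refl[OF t(1)] eq_refl[OF s(1)] a refl refl]
    by (rule cls_comp[OF eq_refl[OF typ_Comp[OF t(1) s(1) a]] eq_refl[OF u(1)] bn N(1) refl])
  have 2: "opcomp M (opcomp M A b C) a B = cls (m + n + p - 2) (i + j + k) (Comp (Comp t b u) a s)"
    unfolding t(2) s(2) u(2) cls_comp[OF eq_refl[OF t(1)] eq_refl[OF u(1)] b refl refl]
    by (rule cls_comp[OF eq_refl[OF typ_Comp[OF t(1) u(1) b]] eq_refl[OF s(1)] ap N(2,3)])
  have ty: "wt (m + n + p - 2) (i + j + k) (Comp (Comp t b u) a s)"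
    by (rule typ_Comp'[OF typ_Comp[OF t(1) u(1) b] s(1) ap N(2,3)])
  show "opcomp M (opcomp M A a B) (b + n - 1) C =
      sg (piece M (m + n + p - 2) (i + j + k)) (j * k) (opcomp M (opcomp M A b C) a B)"
    unfolding 1 2 cls_sg[OF eq_refl[OF ty]] by (rule cls_eqI[OF assoc_par[OF t(1) s(1) u(1) a b ab]])
next
  fix m n j k \<sigma> \<tau> A B a
  assume st: "\<sigma> permutes {1..m} \<and> \<tau> permutes {1..n}"
    and "A \<in> carrier (piece M m j)" "B \<in> carrier (piece M n k)" and a: "a \<in> {1..m}"
  then obtain t s where t: "wt m j t" "A = cls m j t" and s: "wt n k s" "B = cls n k s"
    by (meson carrier_ME)
  have \<sigma>: "\<sigma> permutes {1..m}" and \<tau>: "\<tau> permutes {1..n}" using st by auto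
  have sa: "\<sigma> a \<in> {1..m}" using a by (simp only: permutes_in_image[OF \<sigma>])
  show "opcomp M (opact M A \<sigma>) a (opact M B \<tau>) = opact M (opcomp M A (\<sigma> a) B) (perm_comp n \<sigma> a \<tau>)"
    unfolding t(2) s(2) cls_act[OF eq_refl[OF t(1)] \<sigma>] cls_act[OF eq_refl[OF s(1)] \<tau>]
      cls_comp[OF eq_refl[OF t(1)] eq_refl[OF s(1)] sa refl refl]
      cls_comp[OF eq_refl[OF typ_Act[OF t(1) \<sigma>]] eq_refl[OF typ_Act[OF s(1) \<tau>]] a refl refl]
      cls_act[OF eq_refl[OF typ_Comp[OF t(1) s(1) sa]] permutes_perm_comp[OF \<sigma> \<tau> a]]
    by (rule cls_eqI[OF equivariance[OF t(1) s(1) a \<sigma> \<tau>]])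
qed

sublocale operad M
  by unfold_locales (rule graded_operad_adjoin)

abbreviation incl :: "nat \<Rightarrow> int \<Rightarrow> 'a \<Rightarrow> 'a opterm set" where
  "incl \<equiv> adjoin_incl P r e R"

lemma incl_closed: "x \<in> carrier (piece P n k) \<Longrightarrow> incl n k x \<in> carrier (piece M n k)"
  by (simp add: adjoin_incl_def typ_cls_closed typ_Elem)

lemma incl_hom: "incl n k \<in> hom (piece P n k) (piece M n k)"
  by (rule homI)
    (simp_all add: incl_closed, simp add: adjoin_incl_def cls_mult eq_refl typ_Elem cls_eqI Elem_mult)

lemma incl_act: "x \<in> carrier (piece P n k) \<Longrightarrow> \<sigma> permutes {1..n} \<Longrightarrow>
    incl n k (opact P x \<sigma>) = opact M (incl n k x) \<sigma>"
  by (simp add: adjoin_incl_def cls_act eq_refl typ_Elem cls_eqI Elem_act)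

lemma incl_comp: "x \<in> carrier (piece P m j) \<Longrightarrow> y \<in> carrier (piece P n k) \<Longrightarrow> a \<in> {1..m} \<Longrightarrow>
    N = m + n - 1 \<Longrightarrow> K = j + k \<Longrightarrow> incl N K (opcomp P x a y) = opcomp M (incl m j x) a (incl n k y)"
  using cls_comp[of m j "Elem m j x" n k "Elem n k y" a N K]
  by (simp add: adjoin_incl_def eq_refl typ_Elem) (metis One_nat_def atLeastAtMost_iff cls_eqI Elem_comp)

abbreviation gen :: "'a opterm set" where
  "gen \<equiv> adjoin_gen P r e R"

lemma gen_closed: "gen \<in> carrier (piece M r e)"
  by (simp add: adjoin_gen_def typ_cls_closed typ_Gen)

text \<open>Induction on a typed representative: every element is built from the image of
  \<open>P\<close> and the generator by the operations of the operad.\<close>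

lemma adjoin_induct [consumes 1, case_names incl gen one mult inv act comp]:
  assumes "A \<in> carrier (piece M n k)"
    and "\<And>n k x. x \<in> carrier (piece P n k) \<Longrightarrow> Q n k (incl n k x)"
    and "Q r e gen" and "\<And>n k. Q n k \<one>\<^bsub>piece M n k\<^esub>"
    and "\<And>n k A B. A \<in> carrier (piece M n k) \<Longrightarrow> B \<in> carrier (piece M n k) \<Longrightarrow> Q n k A \<Longrightarrow> Q n k B \<Longrightarrow>
      Q n k (A \<otimes>\<^bsub>piece M n k\<^esub> B)"
    and "\<And>n k A. A \<in> carrier (piece M n k) \<Longrightarrow> Q n k A \<Longrightarrow> Q n k (inv\<^bsub>piece M n k\<^esub> A)"
    and "\<And>n k A \<sigma>. A \<in> carrier (piece M n k) \<Longrightarrow> Q n k A \<Longrightarrow> \<sigma> permutes {1..n} \<Longrightarrow> Q n k (opact M A \<sigma>)"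
    and "\<And>m j n k A B a. A \<in> carrier (piece M m j) \<Longrightarrow> B \<in> carrier (piece M n k) \<Longrightarrow> Q m j A \<Longrightarrow> Q n k B \<Longrightarrow>
      a \<in> {1..m} \<Longrightarrow> Q (m + n - 1) (j + k) (opcomp M A a B)"
  shows "Q n k A"
proof -
  obtain t where "wt n k t" "A = cls n k t" using assms(1) by (rule carrier_ME)
  moreover have "wt n k t \<Longrightarrow> Q n k (cls n k t)" for t
  proof (induction rule: opterm_typ.induct)
    case (typ_Elem x n k)
    then show ?case using assms(2) by (simp add: adjoin_incl_def)
  next
    case typ_Gen
    then show ?case using assms(3) by (simp add: adjoin_gen_def)
  next
    case (typ_Zero n k)
    then show ?case using assms(4) by (simp add: cls_one)
  next
    case (typ_Plus n k t s)
    then show ?case using assms(5)[of "cls n k t" n k "cls n k s"] by (simp add: cls_mult eq_refl typ_cls_closed)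
  next
    case (typ_Neg n k t)
    then show ?case using assms(6)[of "cls n k t" n k] by (simp add: cls_neg eq_refl typ_cls_closed)
  next
    case (typ_Act n k t \<sigma>)
    then show ?case using assms(7)[of "cls n k t" n k \<sigma>] by (simp add: cls_act eq_refl typ_cls_closed)
  next
    case (typ_Comp m j t n k s a)
    then show ?case
      using assms(8)[of "cls m j t" m j "cls n k s" n k a]
        cls_comp[OF eq_refl eq_refl, of m j t n k s a "m + n - 1" "j + k"] by (simp add: typ_cls_closed)
  qed
  ultimately show ?thesis by simp
qed

text \<open>The elements with vanishing square are closed under all operations; composites are the
  only case in which signs matter, and there the mixed terms cancel.\<close>

theorem square_zero_adjoin:
  assumes d: "operad_derivation M d"
    and incl: "\<And>n k x. x \<in> carrier (piece P n k) \<Longrightarrow> d n (k - 1) (d n k (incl n k x)) = \<one>\<^bsub>piece M n (k - 2)\<^esub>"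
    and gen: "d r (e - 1) (d r e gen) = \<one>\<^bsub>piece M r (e - 2)\<^esub>"
  shows "square_zero M d"
  unfolding square_zero_def
proof (intro allI ballI)
  fix n k A assume "A \<in> carrier (piece M n k)"
  have h: "d n k \<in> hom (pc n k) (pc n (k - 1))" and h': "d n (k - 1) \<in> hom (pc n (k - 1)) (pc n (k - 2))" for n k
    using derivation_hom[OF d, of n k] derivation_hom[OF d, of n "k - 1"] by simp_all
  have c: "d n k A \<in> carrier (pc n (k - 1))" if "A \<in> carrier (pc n k)" for n k A
    using hom_in_carrier[OF h that] .
  show "d n (k - 1) (d n k A) = \<one>\<^bsub>piece M n (k - 2)\<^esub>"
    using \<open>A \<in> carrier (piece M n k)\<close>
  proof (induction rule: adjoin_induct)
    case (one n k)
    then show ?case using hom_one[OF h] hom_one[OF h'] by (simp add: comm_group_M group_piece)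
  next
    case (mult n k A B)
    then show ?case using c hom_mult[OF h] hom_mult[OF h'] by simp
  next
    case (inv n k A)
    have "d n k (inv\<^bsub>pc n k\<^esub> A) = inv\<^bsub>pc n (k - 1)\<^esub> (d n k A)"
      using derivation_sg[OF d inv(1) refl, of 1] c[OF inv(1)] inv(1) by (simp add: pc.sg_odd)
    moreover have "d n (k - 1) (inv\<^bsub>pc n (k - 1)\<^esub> (d n k A)) = inv\<^bsub>pc n (k - 2)\<^esub> (d n (k - 1) (d n k A))"
      using derivation_sg[OF d c[OF inv(1)] refl, of 1] c[OF inv(1)] c[OF c[OF inv(1)]]
      by (simp add: pc.sg_odd)
    ultimately show ?case using inv by simp
  next
    case (act n k A \<sigma>)
    then show ?case
      using derivation_act[OF d act(2,1)] derivation_act[OF d act(2) c[OF act(1)]]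
        hom_one[OF act_hom[OF act(2)] group_piece group_piece] act(3) by simp
  next
    case (comp m j n k A B a)
    then show ?case using derivation_square_comp[OF d] by blast
  qed (use incl gen in auto)
qed

end

section \<open>Extending derivations to the adjoined generator\<close>

context operad
begin

text \<open>This lemma, its right-hand analogue, \<open>leibniz_act\<close>,
  \<open>leibniz_seq\<close> and \<open>leibniz_par\<close> match the rules of the congruence that
  involve composition one by one.\<close>

lemma leibniz_mult_left:
  assumes "x \<in> carrier (pc m j)" "x' \<in> carrier (pc m j)" "dx \<in> carrier (pc m (j - 1))"
    "dx' \<in> carrier (pc m (j - 1))" "y \<in> carrier (pc n k)" "dy \<in> carrier (pc n (k - 1))"
    "a \<in> {1..m}" "N = m + n - 1" "K = j + k - 1"
  shows "leibniz N K j (x \<otimes>\<^bsub>pc m j\<^esub> x') (dx \<otimes>\<^bsub>pc m (j - 1)\<^esub> dx') a y dy =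
    leibniz N K j x dx a y dy \<otimes>\<^bsub>pc N K\<^esub> leibniz N K j x' dx' a y dy"
proof -
  have K: "K = (j - 1) + k" "K = j + (k - 1)" using assms(9) by auto
  have c: "oc dx a y \<in> carrier (pc N K)" "oc dx' a y \<in> carrier (pc N K)"
    "oc x a dy \<in> carrier (pc N K)" "oc x' a dy \<in> carrier (pc N K)"
    by (rule comp_closed[OF assms(3,5,7,8) K(1)] comp_closed[OF assms(4,5,7,8) K(1)]
      comp_closed[OF assms(1,6,7,8) K(2)] comp_closed[OF assms(2,6,7,8) K(2)])+
  show ?thesis
    unfolding leibniz_def comp_mult_left[OF assms(3,4,5,7,8) K(1)] comp_mult_left[OF assms(1,2,6,7,8) K(2)]
    using c by (simp add: pc.sg_mult pc.m_ac)
qed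

lemma leibniz_mult_right:
  assumes "x \<in> carrier (pc m j)" "dx \<in> carrier (pc m (j - 1))" "y \<in> carrier (pc n k)"
    "y' \<in> carrier (pc n k)" "dy \<in> carrier (pc n (k - 1))" "dy' \<in> carrier (pc n (k - 1))"
    "a \<in> {1..m}" "N = m + n - 1" "K = j + k - 1"
  shows "leibniz N K j x dx a (y \<otimes>\<^bsub>pc n k\<^esub> y') (dy \<otimes>\<^bsub>pc n (k - 1)\<^esub> dy') =
    leibniz N K j x dx a y dy \<otimes>\<^bsub>pc N K\<^esub> leibniz N K j x dx a y' dy'"
proof -
  have K: "K = (j - 1) + k" "K = j + (k - 1)" using assms(9) by auto
  have c: "oc dx a y \<in> carrier (pc N K)" "oc dx a y' \<in> carrier (pc N K)"
    "oc x a dy \<in> carrier (pc N K)" "oc x a dy' \<in> carrier (pc N K)"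
    by (rule comp_closed[OF assms(2,3,7,8) K(1)] comp_closed[OF assms(2,4,7,8) K(1)]
      comp_closed[OF assms(1,5,7,8) K(2)] comp_closed[OF assms(1,6,7,8) K(2)])+
  show ?thesis
    unfolding leibniz_def comp_mult_right[OF assms(2,3,4,7,8) K(1)] comp_mult_right[OF assms(1,5,6,7,8) K(2)]
    using c by (simp add: pc.sg_mult pc.m_ac)
qed

lemma leibniz_act:
  assumes "x \<in> carrier (pc m j)" "dx \<in> carrier (pc m (j - 1))" "y \<in> carrier (pc n k)"
    "dy \<in> carrier (pc n (k - 1))" "a \<in> {1..m}" "\<sigma> permutes {1..m}" "\<tau> permutes {1..n}"
    "N = m + n - 1" "K = j + k - 1"
  shows "leibniz N K j (opact P x \<sigma>) (opact P dx \<sigma>) a (opact P y \<tau>) (opact P dy \<tau>) =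
    opact P (leibniz N K j x dx (\<sigma> a) y dy) (perm_comp n \<sigma> a \<tau>)"
proof -
  have K: "K = (j - 1) + k" "K = j + (k - 1)" using assms(9) by auto
  have sa: "\<sigma> a \<in> {1..m}" using assms(5) by (simp only: permutes_in_image[OF assms(6)])
  have p: "perm_comp n \<sigma> a \<tau> permutes {1..N}"
    unfolding assms(8) using assms(6,7,5) by (rule permutes_perm_comp)
  have c: "oc dx (\<sigma> a) y \<in> carrier (pc N K)" "oc x (\<sigma> a) dy \<in> carrier (pc N K)"
    by (rule comp_closed[OF assms(2,3) sa assms(8) K(1)] comp_closed[OF assms(1,4) sa assms(8) K(2)])+
  show ?thesis
    unfolding leibniz_def comp_equivariant[OF assms(6,7,2,3,5)] comp_equivariant[OF assms(6,7,1,4,5)]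
      act_mult[OF p c(1) pc.int_pow_closed[OF c(2)]] act_sg[OF p c(2)] ..
qed

lemma unit_comp: "x \<in> carrier (pc n k) \<Longrightarrow> oc (opunit P) 1 x = x"
  and comp_unit: "x \<in> carrier (pc n k) \<Longrightarrow> a \<in> {1..n} \<Longrightarrow> oc x a (opunit P) = x"
  using graded_conj[THEN conjunct2, THEN conjunct2, THEN conjunct2, THEN conjunct2, THEN conjunct2,
      THEN conjunct2, THEN conjunct2, THEN conjunct1] by blast+

end

text \<open>The extension of \<delta> by zero on the generator, at the level of raw expressions. The
  sign of a composite uses the degree read off from the expression itself.\<close>

primrec tder :: "(nat \<Rightarrow> int \<Rightarrow> 'a \<Rightarrow> 'a) \<Rightarrow> nat \<Rightarrow> int \<Rightarrow> 'a opterm \<Rightarrow> 'a opterm" where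
  "tder \<delta> r e (Elem n k x) = Elem n (k - 1) (\<delta> n k x)"
| "tder \<delta> r e Gen = Zero r (e - 1)"
| "tder \<delta> r e (Zero n k) = Zero n (k - 1)"
| "tder \<delta> r e (Plus t s) = Plus (tder \<delta> r e t) (tder \<delta> r e s)"
| "tder \<delta> r e (Neg t) = Neg (tder \<delta> r e t)"
| "tder \<delta> r e (Act t \<sigma>) = Act (tder \<delta> r e t) \<sigma>"
| "tder \<delta> r e (Comp t a s) =
    Plus (Comp (tder \<delta> r e t) a s) (signed (opterm_degree e t) (Comp t a (tder \<delta> r e s)))"

lemma tder_signed: "tder \<delta> r e (signed j t) = signed j (tder \<delta> r e t)"
  by (simp add: signed_def)

locale adjoining_leibniz = adjoining +
  fixes \<delta> :: "nat \<Rightarrow> int \<Rightarrow> 'a \<Rightarrow> 'a"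
  assumes comm_group_P: "\<And>n k. comm_group (piece P n k)"
    and comp_P: "\<And>m j n k x y a. x \<in> carrier (piece P m j) \<Longrightarrow> y \<in> carrier (piece P n k) \<Longrightarrow> a \<in> {1..m} \<Longrightarrow>
      opcomp P x a y \<in> carrier (piece P (m + n - 1) (j + k))"
    and derivation_P: "operad_derivation P \<delta>"
    and unit_P: "\<delta> 1 0 (opunit P) = \<one>\<^bsub>piece P 1 (-1)\<^esub>"
begin

abbreviation D :: "'a opterm \<Rightarrow> 'a opterm" where
  "D \<equiv> tder \<delta> r e"

lemma delta_hom: "\<delta> n k \<in> hom (piece P n k) (piece P n (k - 1))"
  using derivation_P by (simp add: operad_derivation_def)

lemma delta_closed: "x \<in> carrier (piece P n k) \<Longrightarrow> \<delta> n k x \<in> carrier (piece P n (k - 1))"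
  using hom_in_carrier[OF delta_hom] .

lemma D_wt: "wt n k t \<Longrightarrow> wt n (k - 1) (D t)"
proof (induction rule: opterm_typ.induct)
  case (typ_Comp m j t n k s a)
  have "opterm_degree e t = j" using opterm_typ_arity[OF typ_Comp(1)] by simp
  moreover have "wt (m + n - 1) (j + k - 1) (Comp (D t) a s)"
    by (rule typ_Comp'[OF typ_Comp(4,2,3)]) simp_all
  moreover have "wt (m + n - 1) (j + k - 1) (Comp t a (D s))"
    by (rule typ_Comp'[OF typ_Comp(1,5,3)]) simp_all
  ultimately show ?case by (simp add: typ_Plus signed_typ)
qed (auto intro: opterm_typ.intros delta_closed)

lemma eqtI: "wt n k t \<Longrightarrow> cls n k t = cls n k s \<Longrightarrow> eqt n k t s"
  using eqt_iff eq_refl by blast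

lemma cls_D_comp:
  assumes "wt m j t" "wt n k s" "a \<in> {1..m}" "N = m + n - 1" "K = j + k - 1"
  shows "cls N K (D (Comp t a s)) =
    leibniz N K j (cls m j t) (cls m (j - 1) (D t)) a (cls n k s) (cls n (k - 1) (D s))"
proof -
  have deg: "opterm_degree e t = j" using opterm_typ_arity[OF assms(1)] by simp
  have K: "K = (j - 1) + k" "K = j + (k - 1)" using assms(5) by auto
  have w: "wt N K (Comp (D t) a s)" "wt N K (Comp t a (D s))"
    by (rule typ_Comp'[OF D_wt[OF assms(1)] assms(2,3,4) K(1)]
      typ_Comp'[OF assms(1) D_wt[OF assms(2)] assms(3,4) K(2)])+
  show ?thesis
    unfolding leibniz_def
      cls_comp[OF eq_refl[OF D_wt[OF assms(1)]] eq_refl[OF assms(2)] assms(3,4) K(1)]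
      cls_comp[OF eq_refl[OF assms(1)] eq_refl[OF D_wt[OF assms(2)]] assms(3,4) K(2)]
      cls_sg[OF eq_refl[OF w(2)]] cls_mult[OF eq_refl[OF w(1)] eq_refl[OF signed_typ[OF w(2)]]]
    by (simp add: deg)
qed

lemma incl_one: "incl n k \<one>\<^bsub>piece P n k\<^esub> = \<one>\<^bsub>piece M n k\<^esub>"
  by (rule hom_one[OF incl_hom comm_group.axioms(2)[OF comm_group_P] group_piece])

end

text \<open>Compatibility with the imposed relations is a separate stage because, for
  \<open>mQuilt\<close>, its verification already computes in the quotient operad.\<close>

locale adjoining_derivation = adjoining_leibniz +
  assumes relation_P: "\<And>n k t s. R n k t s \<Longrightarrow> wt n k t \<Longrightarrow> wt n k s \<Longrightarrow> eqt n (k - 1) (D t) (D s)"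
begin

text \<open>Hence \<open>D\<close> descends to classes. The rules about composition reduce to
  equalities of Leibniz values, those about \<open>P\<close> to the fact that \<delta> is a
  derivation there, and the imposed relations to \<open>relation_P\<close>.\<close>

lemma D_eqt: "eqt n k t s \<Longrightarrow> eqt n (k - 1) (D t) (D s)"
proof (induction rule: opterm_eq.induct)
  case (eq_refl n k t)
  then show ?case by (intro opterm_eq.eq_refl D_wt)
next
  case (eq_sym n k t s)
  show ?case by (rule opterm_eq.eq_sym) fact
next
  case (eq_trans n k t s u)
  show ?case by (rule opterm_eq.eq_trans) fact+
next
  case (cong_Plus n k t t' s s')
  then show ?case by (simp add: opterm_eq.cong_Plus)
next
  case (cong_Neg n k t t')
  then show ?case by (simp add: opterm_eq.cong_Neg)
next
  case (cong_Act n k t t' \<sigma>)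
  then show ?case by (simp add: opterm_eq.cong_Act)
next
  case (cong_Comp m j t t' n k s s' a)
  have deg: "opterm_degree e t = j" "opterm_degree e t' = j"
    using opterm_eq_arity[OF cong_Comp(1)] by simp_all
  have "eqt (m + n - 1) (j + k - 1) (Comp (D t) a s) (Comp (D t') a s')"
    using opterm_eq.cong_Comp[OF cong_Comp(4,2,3)] by (simp add: algebra_simps)
  moreover have c: "eqt (m + n - 1) (j + k - 1) (Comp t a (D s)) (Comp t' a (D s'))"
    using opterm_eq.cong_Comp[OF cong_Comp(1,5,3)] by (simp add: algebra_simps)
  moreover have "eqt (m + n - 1) (j + k - 1) (signed j (Comp t a (D s))) (signed j (Comp t' a (D s')))"
    using c by (simp add: signed_def opterm_eq.cong_Neg)
  ultimately show ?case by (simp add: deg opterm_eq.cong_Plus)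
next
  case (Plus_assoc n k t s u)
  then show ?case by (simp add: opterm_eq.Plus_assoc D_wt)
next
  case (Plus_commute n k t s)
  then show ?case by (simp add: opterm_eq.Plus_commute D_wt)
next
  case (Plus_Zero n k t)
  then show ?case by (simp add: opterm_eq.Plus_Zero D_wt)
next
  case (Plus_Neg n k t)
  then show ?case by (simp add: opterm_eq.Plus_Neg D_wt)
next
  case (Act_Plus n k t s \<sigma>)
  then show ?case by (simp add: opterm_eq.Act_Plus D_wt)
next
  case (Act_id n k t)
  then show ?case by (simp add: opterm_eq.Act_id D_wt)
next
  case (Act_Act n k t \<sigma> \<tau>)
  then show ?case by (simp add: opterm_eq.Act_Act D_wt)
next
  case (Comp_Plus_left m j t t' n k s a)
  note w = Comp_Plus_left and c = typ_cls_closed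
  note refl' = opterm_eq.eq_refl
  have wp: "wt (m + n - 1) (j + k - 1) (D (Comp t a s))" "wt (m + n - 1) (j + k - 1) (D (Comp t' a s))"
    by (rule D_wt[OF typ_Comp[OF w(1,3,4)]] D_wt[OF typ_Comp[OF w(2,3,4)]])+
  show ?case
  proof (rule eqtI[OF D_wt[OF typ_Comp[OF typ_Plus[OF w(1,2)] w(3,4)]]])
    have "cls (m + n - 1) (j + k - 1) (D (Comp (Plus t t') a s)) =
        leibniz (m + n - 1) (j + k - 1) j (cls m j t \<otimes>\<^bsub>piece M m j\<^esub> cls m j t')
          (cls m (j - 1) (D t) \<otimes>\<^bsub>piece M m (j - 1)\<^esub> cls m (j - 1) (D t')) a (cls n k s) (cls n (k - 1) (D s))"
      unfolding cls_D_comp[OF typ_Plus[OF w(1,2)] w(3,4) refl refl]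
        cls_mult[OF refl'[OF w(1)] refl'[OF w(2)]] cls_mult[OF refl'[OF D_wt[OF w(1)]] refl'[OF D_wt[OF w(2)]]]
      by simp
    also have "\<dots> = cls (m + n - 1) (j + k - 1) (D (Comp t a s)) \<otimes>\<^bsub>piece M (m + n - 1) (j + k - 1)\<^esub>
        cls (m + n - 1) (j + k - 1) (D (Comp t' a s))"
      unfolding cls_D_comp[OF w(1,3,4) refl refl] cls_D_comp[OF w(2,3,4) refl refl]
      by (rule leibniz_mult_left[OF c[OF w(1)] c[OF w(2)] c[OF D_wt[OF w(1)]] c[OF D_wt[OF w(2)]]
          c[OF w(3)] c[OF D_wt[OF w(3)]] w(4) refl refl])
    also have "\<dots> = cls (m + n - 1) (j + k - 1) (D (Plus (Comp t a s) (Comp t' a s)))"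
      unfolding cls_mult[OF refl'[OF wp(1)] refl'[OF wp(2)]] by simp
    finally show "cls (m + n - 1) (j + k - 1) (D (Comp (Plus t t') a s)) =
      cls (m + n - 1) (j + k - 1) (D (Plus (Comp t a s) (Comp t' a s)))" .
  qed
next
  case (Comp_Plus_right m j t n k s s' a)
  note w = Comp_Plus_right and c = typ_cls_closed
  note refl' = opterm_eq.eq_refl
  have wp: "wt (m + n - 1) (j + k - 1) (D (Comp t a s))" "wt (m + n - 1) (j + k - 1) (D (Comp t a s'))"
    by (rule D_wt[OF typ_Comp[OF w(1,2,4)]] D_wt[OF typ_Comp[OF w(1,3,4)]])+
  show ?case
  proof (rule eqtI[OF D_wt[OF typ_Comp[OF w(1) typ_Plus[OF w(2,3)] w(4)]]])
    have "cls (m + n - 1) (j + k - 1) (D (Comp t a (Plus s s'))) =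
        leibniz (m + n - 1) (j + k - 1) j (cls m j t) (cls m (j - 1) (D t)) a
          (cls n k s \<otimes>\<^bsub>piece M n k\<^esub> cls n k s')
          (cls n (k - 1) (D s) \<otimes>\<^bsub>piece M n (k - 1)\<^esub> cls n (k - 1) (D s'))"
      unfolding cls_D_comp[OF w(1) typ_Plus[OF w(2,3)] w(4) refl refl]
        cls_mult[OF refl'[OF w(2)] refl'[OF w(3)]] cls_mult[OF refl'[OF D_wt[OF w(2)]] refl'[OF D_wt[OF w(3)]]]
      by simp
    also have "\<dots> = cls (m + n - 1) (j + k - 1) (D (Comp t a s)) \<otimes>\<^bsub>piece M (m + n - 1) (j + k - 1)\<^esub>
        cls (m + n - 1) (j + k - 1) (D (Comp t a s'))"
      unfolding cls_D_comp[OF w(1,2,4) refl refl] cls_D_comp[OF w(1,3,4) refl refl]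
      by (rule leibniz_mult_right[OF c[OF w(1)] c[OF D_wt[OF w(1)]] c[OF w(2)] c[OF w(3)]
          c[OF D_wt[OF w(2)]] c[OF D_wt[OF w(3)]] w(4) refl refl])
    also have "\<dots> = cls (m + n - 1) (j + k - 1) (D (Plus (Comp t a s) (Comp t a s')))"
      unfolding cls_mult[OF refl'[OF wp(1)] refl'[OF wp(2)]] by simp
    finally show "cls (m + n - 1) (j + k - 1) (D (Comp t a (Plus s s'))) =
      cls (m + n - 1) (j + k - 1) (D (Plus (Comp t a s) (Comp t a s')))" .
  qed
next
  case (unit_left n k t)
  note w = unit_left and c = typ_cls_closed
  have one: "(1 :: nat) \<in> {1..1}" by simp
  have u: "cls 1 0 (Elem 1 0 (opunit P)) = opunit M" by (simp add: adjoin_def)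
  have du: "cls 1 (0 - 1) (D (Elem 1 0 (opunit P))) = \<one>\<^bsub>piece M 1 (-1)\<^esub>"
    using incl_one[of 1 "-1"] unit_P by (simp add: adjoin_incl_def)
  have dt: "cls n (k - 1) (D t) \<in> carrier (piece M n (k - 1))" by (rule c[OF D_wt[OF w]])
  have n: "n = 1 + n - 1" "k - 1 = 0 + k - 1" "k - 1 = -1 + k" by simp_all
  have "cls n (k - 1) (D (Comp (Elem 1 0 (opunit P)) 1 t)) = cls n (k - 1) (D t)"
    unfolding cls_D_comp[OF unit_typ w one n(1,2)] u du leibniz_def
      comp_one_left[OF c[OF w] one n(1,3)] unit_comp[OF dt]
    using dt by (simp add: pc.sg_even)
  moreover have "wt n k (Comp (Elem 1 0 (opunit P)) 1 t)"
    using typ_Comp[OF unit_typ w one] by simp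
  ultimately show ?case by (intro eqtI D_wt)
next
  case (unit_right n k t a)
  note w = unit_right and c = typ_cls_closed
  have u: "cls 1 0 (Elem 1 0 (opunit P)) = opunit M" by (simp add: adjoin_def)
  have du: "cls 1 (0 - 1) (D (Elem 1 0 (opunit P))) = \<one>\<^bsub>piece M 1 (-1)\<^esub>"
    using incl_one[of 1 "-1"] unit_P by (simp add: adjoin_incl_def)
  have dt: "cls n (k - 1) (D t) \<in> carrier (piece M n (k - 1))" by (rule c[OF D_wt[OF w(1)]])
  have n: "n = n + 1 - 1" "k - 1 = k + 0 - 1" "k - 1 = k + -1" by simp_all
  have "cls n (k - 1) (D (Comp t a (Elem 1 0 (opunit P)))) = cls n (k - 1) (D t)"
    unfolding cls_D_comp[OF w(1) unit_typ w(2) n(1,2)] u du leibniz_def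
      comp_one_right[OF c[OF w(1)] w(2) n(1,3)] comp_unit[OF dt w(2)]
    using dt by simp
  moreover have "wt n k (Comp t a (Elem 1 0 (opunit P)))"
    using typ_Comp[OF w(1) unit_typ w(2)] by simp
  ultimately show ?case by (intro eqtI D_wt)
next
  case (assoc_seq m i t n j s p k u a b)
  note w = assoc_seq and c = typ_cls_closed and dc = typ_cls_closed[OF D_wt]
  note refl' = opterm_eq.eq_refl
  have ab: "a + b - 1 \<in> {1..m + n - 1}" using w(4,5) by auto
  have N: "m + n + p - 2 = m + n - 1 + p - 1" "m + n + p - 2 = m + (n + p - 1) - 1" using w(4,5) by auto
  have K: "i + j + k - 1 = i + j + k - 1" "i + j + k - 1 = i + (j + k) - 1" "i + j + k = i + (j + k)" by simp_all
  have ty: "wt (m + n + p - 2) (i + j + k) (Comp (Comp t a s) (a + b - 1) u)"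
    by (rule typ_Comp'[OF typ_Comp[OF w(1,2,4)] w(3) ab N(1) refl])
  show ?case
  proof (rule eqtI[OF D_wt[OF ty]])
    show "cls (m + n + p - 2) (i + j + k - 1) (D (Comp (Comp t a s) (a + b - 1) u)) =
        cls (m + n + p - 2) (i + j + k - 1) (D (Comp t a (Comp s b u)))"
      unfolding cls_D_comp[OF typ_Comp[OF w(1,2,4)] w(3) ab N(1) K(1)]
        cls_D_comp[OF w(1) typ_Comp[OF w(2,3,5)] w(4) N(2) K(2)]
        cls_D_comp[OF w(1,2,4) refl refl] cls_D_comp[OF w(2,3,5) refl refl]
        cls_comp[OF refl'[OF w(1)] refl'[OF w(2)] w(4) refl refl, symmetric]
        cls_comp[OF refl'[OF w(2)] refl'[OF w(3)] w(5) refl refl, symmetric]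
      by (rule leibniz_seq[OF c[OF w(1)] dc[OF w(1)] c[OF w(2)] dc[OF w(2)] c[OF w(3)] dc[OF w(3)] w(4,5) refl refl])
  qed
next
  case (assoc_par m i t n j s p k u a b)
  note w = assoc_par and c = typ_cls_closed and dc = typ_cls_closed[OF D_wt]
  note refl' = opterm_eq.eq_refl
  have bn: "b + n - 1 \<in> {1..m + n - 1}" and ap: "a \<in> {1..m + p - 1}" using w(4,5,6) by auto
  have N: "m + n + p - 2 = m + n - 1 + p - 1" "m + n + p - 2 = m + p - 1 + n - 1" using w(4,5,6) by auto
  have K: "i + j + k - 1 = i + j + k - 1" "i + j + k - 1 = i + k + j - 1" "i + j + k = i + k + j" by simp_all
  have ty: "wt (m + n + p - 2) (i + j + k) (Comp (Comp t a s) (b + n - 1) u)"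
    by (rule typ_Comp'[OF typ_Comp[OF w(1,2,4)] w(3) bn N(1) refl])
  have ty': "wt (m + n + p - 2) (i + j + k - 1) (D (Comp (Comp t b u) a s))"
    by (rule D_wt[OF typ_Comp'[OF typ_Comp[OF w(1,3,5)] w(2) ap N(2) K(3)]])
  show ?case
  proof (rule eqtI[OF D_wt[OF ty]])
    show "cls (m + n + p - 2) (i + j + k - 1) (D (Comp (Comp t a s) (b + n - 1) u)) =
        cls (m + n + p - 2) (i + j + k - 1) (D (signed (j * k) (Comp (Comp t b u) a s)))"
      unfolding tder_signed cls_sg[OF refl'[OF ty'], symmetric]
        cls_D_comp[OF typ_Comp[OF w(1,2,4)] w(3) bn N(1) K(1)]
        cls_D_comp[OF typ_Comp[OF w(1,3,5)] w(2) ap N(2) K(2)]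
        cls_D_comp[OF w(1,2,4) refl refl] cls_D_comp[OF w(1,3,5) refl refl]
        cls_comp[OF refl'[OF w(1)] refl'[OF w(2)] w(4) refl refl, symmetric]
        cls_comp[OF refl'[OF w(1)] refl'[OF w(3)] w(5) refl refl, symmetric]
      by (rule leibniz_par[OF c[OF w(1)] dc[OF w(1)] c[OF w(2)] dc[OF w(2)] c[OF w(3)] dc[OF w(3)] w(4,5,6) refl refl])
  qed
next
  case (equivariance m j t n k s a \<sigma> \<tau>)
  note w = equivariance and c = typ_cls_closed and dc = typ_cls_closed[OF D_wt]
  note refl' = opterm_eq.eq_refl
  have sa: "\<sigma> a \<in> {1..m}" using w(3) by (simp only: permutes_in_image[OF w(4)])
  have ty: "wt (m + n - 1) (j + k) (Comp (Act t \<sigma>) a (Act s \<tau>))"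
    by (rule typ_Comp[OF typ_Act[OF w(1,4)] typ_Act[OF w(2,5)] w(3)])
  have ty': "wt (m + n - 1) (j + k - 1) (D (Comp t (\<sigma> a) s))"
    by (rule D_wt[OF typ_Comp[OF w(1,2) sa]])
  show ?case
  proof (rule eqtI[OF D_wt[OF ty]])
    have "cls (m + n - 1) (j + k - 1) (D (Comp (Act t \<sigma>) a (Act s \<tau>))) =
        leibniz (m + n - 1) (j + k - 1) j (opact M (cls m j t) \<sigma>) (opact M (cls m (j - 1) (D t)) \<sigma>) a
          (opact M (cls n k s) \<tau>) (opact M (cls n (k - 1) (D s)) \<tau>)"
      unfolding cls_D_comp[OF typ_Act[OF w(1,4)] typ_Act[OF w(2,5)] w(3) refl refl]
        cls_act[OF refl'[OF w(1)] w(4)] cls_act[OF refl'[OF w(2)] w(5)]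
        cls_act[OF refl'[OF D_wt[OF w(1)]] w(4)] cls_act[OF refl'[OF D_wt[OF w(2)]] w(5)]
      by simp
    also have "\<dots> = opact M (cls (m + n - 1) (j + k - 1) (D (Comp t (\<sigma> a) s))) (perm_comp n \<sigma> a \<tau>)"
      unfolding cls_D_comp[OF w(1,2) sa refl refl]
      by (rule leibniz_act[OF c[OF w(1)] dc[OF w(1)] c[OF w(2)] dc[OF w(2)] w(3,4,5) refl refl])
    also have "\<dots> = cls (m + n - 1) (j + k - 1) (D (Act (Comp t (\<sigma> a) s) (perm_comp n \<sigma> a \<tau>)))"
      unfolding cls_act[OF refl'[OF ty'] permutes_perm_comp[OF w(4,5,3)]] by simp
    finally show "cls (m + n - 1) (j + k - 1) (D (Comp (Act t \<sigma>) a (Act s \<tau>))) =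
        cls (m + n - 1) (j + k - 1) (D (Act (Comp t (\<sigma> a) s) (perm_comp n \<sigma> a \<tau>)))" .
  qed
next
  case (Elem_mult x n k y)
  then show ?case
    using opterm_eq.Elem_mult[OF delta_closed delta_closed] hom_mult[OF delta_hom] by simp
next
  case (Elem_act x n k \<sigma>)
  have "\<delta> n k (opact P x \<sigma>) = opact P (\<delta> n k x) \<sigma>"
    using derivation_P Elem_act unfolding operad_derivation_def by blast
  then show ?case using opterm_eq.Elem_act[OF delta_closed[OF Elem_act(1)] Elem_act(2)] by simp
next
  case (Elem_comp x m j y n k a)
  let ?N = "m + n - 1" and ?K = "j + k - 1"
  have e: "?K = (j - 1) + k" "?K = j + (k - 1)" by simp_all
  have c1: "opcomp P (\<delta> m j x) a y \<in> carrier (piece P ?N ?K)"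
    using comp_P[OF delta_closed[OF Elem_comp(1)] Elem_comp(2,3)] by (simp add: e(1))
  have c2: "opcomp P x a (\<delta> n k y) \<in> carrier (piece P ?N ?K)"
    using comp_P[OF Elem_comp(1) delta_closed[OF Elem_comp(2)] Elem_comp(3)] by (simp add: e(2))
  interpret G: comm_group "piece P ?N ?K" by (rule comm_group_P)
  have "\<delta> ?N (j + k) (opcomp P x a y) =
      opcomp P (\<delta> m j x) a y \<otimes>\<^bsub>piece P ?N ?K\<^esub> sg (piece P ?N ?K) j (opcomp P x a (\<delta> n k y))"
    using derivation_P Elem_comp unfolding operad_derivation_def by blast
  then have "incl ?N ?K (\<delta> ?N (j + k) (opcomp P x a y)) =
      incl ?N ?K (opcomp P (\<delta> m j x) a y) \<otimes>\<^bsub>piece M ?N ?K\<^esub>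
      sg (piece M ?N ?K) j (incl ?N ?K (opcomp P x a (\<delta> n k y)))"
    using hom_mult[OF incl_hom c1 G.int_pow_closed[OF c2]]
      hom_sg[OF G.is_group group_piece incl_hom c2] by simp
  also have "incl ?N ?K (opcomp P (\<delta> m j x) a y) = opcomp M (incl m (j - 1) (\<delta> m j x)) a (incl n k y)"
    by (rule incl_comp[OF delta_closed[OF Elem_comp(1)] Elem_comp(2,3) refl e(1)])
  also have "incl ?N ?K (opcomp P x a (\<delta> n k y)) = opcomp M (incl m j x) a (incl n (k - 1) (\<delta> n k y))"
    by (rule incl_comp[OF Elem_comp(1) delta_closed[OF Elem_comp(2)] Elem_comp(3) refl e(2)])
  finally have "cls ?N ?K (D (Comp (Elem m j x) a (Elem n k y))) =
      cls ?N ?K (D (Elem ?N (j + k) (opcomp P x a y)))"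
    unfolding cls_D_comp[OF typ_Elem[OF Elem_comp(1)] typ_Elem[OF Elem_comp(2)] Elem_comp(3) refl refl]
    by (simp add: leibniz_def adjoin_incl_def)
  moreover have "wt ?N ?K (D (Comp (Elem m j x) a (Elem n k y)))"
    by (rule D_wt[OF typ_Comp[OF typ_Elem[OF Elem_comp(1)] typ_Elem[OF Elem_comp(2)] Elem_comp(3)]])
  ultimately show ?case by (intro opterm_eq.eq_sym[OF eqtI])
next
  case (relation n k t s)
  then show ?case by (rule relation_P)
qed

definition adjoin_derivation :: "nat \<Rightarrow> int \<Rightarrow> 'a opterm set \<Rightarrow> 'a opterm set" where
  "adjoin_derivation n k A = (\<Union>t \<in> A. cls n (k - 1) (D t))"

lemma adjoin_derivation_cls:
  assumes "wt n k t"
  shows "adjoin_derivation n k (cls n k t) = cls n (k - 1) (D t)"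
  unfolding adjoin_derivation_def
proof (rule UN_const_eq[OF cls_nonempty[OF eq_refl[OF assms]]])
  fix t' assume "t' \<in> cls n k t"
  then show "cls n (k - 1) (D t') = cls n (k - 1) (D t)"
    using D_eqt[of n k t t'] cls_eqI by (simp add: mem_cls)
qed

lemma adjoin_derivation_incl:
  "x \<in> carrier (piece P n k) \<Longrightarrow> adjoin_derivation n k (incl n k x) = incl n (k - 1) (\<delta> n k x)"
  using adjoin_derivation_cls[OF typ_Elem] by (simp add: adjoin_incl_def)

lemma adjoin_derivation_gen: "adjoin_derivation r e gen = \<one>\<^bsub>piece M r (e - 1)\<^esub>"
  using adjoin_derivation_cls[OF typ_Gen] by (simp add: adjoin_gen_def cls_one)

theorem operad_derivation_adjoin: "operad_derivation M adjoin_derivation"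
  unfolding operad_derivation_def
proof (intro conjI allI impI ballI)
  fix n k
  show "adjoin_derivation n k \<in> hom (piece M n k) (piece M n (k - 1))"
  proof (rule homI)
    fix A assume "A \<in> carrier (piece M n k)"
    then obtain t where t: "wt n k t" "A = cls n k t" by (rule carrier_ME)
    then show "adjoin_derivation n k A \<in> carrier (piece M n (k - 1))"
      by (simp add: adjoin_derivation_cls typ_cls_closed D_wt)
    fix B assume "B \<in> carrier (piece M n k)"
    then obtain s where s: "wt n k s" "B = cls n k s" by (rule carrier_ME)
    show "adjoin_derivation n k (A \<otimes>\<^bsub>piece M n k\<^esub> B) =
        adjoin_derivation n k A \<otimes>\<^bsub>piece M n (k - 1)\<^esub> adjoin_derivation n k B"
      using t s by (simp add: cls_mult eq_refl typ_Plus adjoin_derivation_cls D_wt)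
  qed
next
  fix n k and \<sigma> :: "nat \<Rightarrow> nat" and A assume \<sigma>: "\<sigma> permutes {1..n}" and "A \<in> carrier (piece M n k)"
  then obtain t where t: "wt n k t" "A = cls n k t" by (meson carrier_ME)
  show "adjoin_derivation n k (opact M A \<sigma>) = opact M (adjoin_derivation n k A) \<sigma>"
    unfolding t(2) cls_act[OF eq_refl[OF t(1)] \<sigma>] adjoin_derivation_cls[OF t(1)]
      adjoin_derivation_cls[OF typ_Act[OF t(1) \<sigma>]] cls_act[OF eq_refl[OF D_wt[OF t(1)]] \<sigma>] by simp
next
  fix m n a :: nat and j k A B
  assume a: "a \<in> {1..m}" and "A \<in> carrier (piece M m j)" "B \<in> carrier (piece M n k)"
  then obtain t s where t: "wt m j t" "A = cls m j t" and s: "wt n k s" "B = cls n k s"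
    by (meson carrier_ME)
  show "adjoin_derivation (m + n - 1) (j + k) (opcomp M A a B) =
      opcomp M (adjoin_derivation m j A) a B \<otimes>\<^bsub>piece M (m + n - 1) (j + k - 1)\<^esub>
      sg (piece M (m + n - 1) (j + k - 1)) j (opcomp M A a (adjoin_derivation n k B))"
    unfolding t(2) s(2) cls_comp[OF eq_refl[OF t(1)] eq_refl[OF s(1)] a refl refl]
      adjoin_derivation_cls[OF t(1)] adjoin_derivation_cls[OF s(1)]
      adjoin_derivation_cls[OF typ_Comp[OF t(1) s(1) a]] cls_D_comp[OF t(1) s(1) a refl refl]
    by (simp only: leibniz_def)
qed

end

section \<open>The relations of \<open>mQuilt\<close>\<close>

text \<open>\<open>L\<close> is a guess for the transitive closure of \<open>E\<close>. In the trees
  of interest no path has more than two edges, so the guess can be verified with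
  \<open>E O E\<close>.\<close>

lemma vle_eq:
  assumes "E \<subseteq> L" "trans L" "L \<subseteq> E \<union> E O E" "E \<subseteq> V \<times> V"
  shows "vle \<lparr>verts = V, edges = E, horder = H\<rparr> = Id_on V \<union> L"
proof -
  have "E\<^sup>+ = L"
  proof
    show "E\<^sup>+ \<subseteq> L" using trancl_mono_subset[OF assms(1)] trancl_id[OF assms(2)] by simp
    show "L \<subseteq> E\<^sup>+" using assms(3) by (auto intro: trancl_into_trancl)
  qed
  moreover have "L \<subseteq> V \<times> V" using assms(3,4) by blast
  ultimately show ?thesis by (auto simp: vle_def rtrancl_eq_or_trancl)
qed

text \<open>\<open>L\<close> and \<open>H\<close> are the intended strict vertical and horizontal
  orders. All conditions become checks on explicit finite sets; the five alternatives are symmetric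
  in the two vertices, so pairs with \<open>u < v\<close> suffice.\<close>

lemma is_treeI:
  assumes "E \<subseteq> L" "trans L" "L \<subseteq> E \<union> E O E" "E \<subseteq> V \<times> V" "finite V" "irrefl L"
    and "H \<subseteq> V \<times> V" "trans H" "irrefl H"
    and "\<exists>!r. r \<in> V \<and> (\<forall>v \<in> V. (v, r) \<notin> L)"
    and "\<forall>(u, v) \<in> E. \<forall>(x, t) \<in> L. x = u \<longrightarrow> (t, v) \<notin> L"
    and "\<forall>u \<in> V. \<forall>v \<in> V. u < v \<longrightarrow>
      length (filter (\<lambda>b. b) [(u, v) \<in> L, (v, u) \<in> L, (u, v) \<in> H, (v, u) \<in> H]) = 1"
    and "\<forall>(u, v) \<in> H. \<forall>(x, y) \<in> L. (x = u \<longrightarrow> (y, v) \<in> H) \<and> (x = v \<longrightarrow> (u, y) \<in> H)"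
  shows "is_tree \<lparr>verts = V :: nat set, edges = E, horder = Id_on V \<union> H\<rparr>"
proof -
  let ?T = "\<lparr>verts = V, edges = E, horder = Id_on V \<union> H\<rparr>"
  have vle: "vle ?T = Id_on V \<union> L" using assms(1-4) by (rule vle_eq)
  have vless: "vless ?T = L" using assms(6) by (auto simp: vless_def vle irrefl_def)
  have hless: "hless ?T = H" using assms(9) by (auto simp: hless_def irrefl_def)
  have LV: "L \<subseteq> V \<times> V" using assms(3,4) by blast
  have tr: "trans (Id_on V \<union> X) \<and> antisym (Id_on V \<union> X)" if "trans X" "irrefl X" for X :: "(nat \<times> nat) set"
  proof
    show "trans (Id_on V \<union> X)" using that(1) by (intro transI) (auto dest: transD)
    show "antisym (Id_on V \<union> X)" using that by (intro antisymI) (auto simp: irrefl_def dest: transD)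
  qed
  have tri: "length (filter (\<lambda>b. b) [u = v, (u, v) \<in> L, (v, u) \<in> L, (u, v) \<in> H, (v, u) \<in> H]) = 1"
    if uv: "u \<in> V" "v \<in> V" for u v
  proof -
    consider "u = v" | "u < v" | "v < u" by linarith
    then show ?thesis
    proof cases
      case 1
      then show ?thesis using assms(6,9) by (simp add: irrefl_def)
    next
      case 2
      then show ?thesis using assms(12) uv by simp
    next
      case 3
      then show ?thesis using bspec[OF bspec[OF assms(12) uv(2)] uv(1)] by (auto split: if_splits)
    qed
  qed
  have po: "partial_order_on V (Id_on V \<union> X)" if "trans X" "irrefl X" "X \<subseteq> V \<times> V" for X
    using tr[OF that(1,2)] that(3) by (auto simp: partial_order_on_def preorder_on_def refl_on_def)
  have l: "(y, v) \<in> H" if "(u, v) \<in> H" "(u, y) \<in> L" for u v y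
    using bspec[OF assms(13) that(1)] that(2) by auto
  have r: "(u, y) \<in> H" if "(u, v) \<in> H" "(v, y) \<in> L" for u v y
    using bspec[OF assms(13) that(1)] that(2) by auto
  show ?thesis
    unfolding is_tree_def vless hless unfolding vle
  proof (intro conjI ballI)
    show "length (filter (\<lambda>b. b) [u = v, (u, v) \<in> L, (v, u) \<in> L, (u, v) \<in> H, (v, u) \<in> H]) = 1"
      if "u \<in> verts ?T" "v \<in> verts ?T" for u v
      using that by (intro tri) simp_all
    show "\<forall>u v u' v'. (u, v) \<in> H \<and> (u, u') \<in> Id_on V \<union> L \<and> (v, v') \<in> Id_on V \<union> L \<longrightarrow> (u', v') \<in> H"
      using l r by blast
    show "\<forall>u. (u, u) \<notin> edges ?T" using assms(1,6) by (auto simp: irrefl_def)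
    show "case x of (u, v) \<Rightarrow> \<nexists>t. (u, t) \<in> L \<and> (t, v) \<in> L" if "x \<in> edges ?T" for x
      using assms(11) that by fastforce
  qed (use assms(1,4,5,10) po[OF assms(2,6) LV] po[OF assms(8,9,7)] in simp_all)
qed

lemma unit_tree: "\<lparr>verts = {1}, edges = {}, horder = {(1, 1)}\<rparr> \<in> Tree 1"
proof -
  have "is_tree \<lparr>verts = {1}, edges = {}, horder = Id_on {1} \<union> {}\<rparr>"
    by (rule is_treeI[where L = "{}"]) (auto simp: irrefl_def trans_def)
  then show ?thesis by (simp add: Tree_def Id_on_def)
qed

lemma quilt_unit_Quilts: "quilt_unit \<in> Quilts 1" "qdeg quilt_unit = 0"
proof -
  have "[1] \<in> F2S 1" by (auto simp: F2S_def)
  then show "quilt_unit \<in> Quilts 1"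
    using unit_tree by (auto simp: quilt_unit_def Quilts_def vless_def)
qed (simp add: qdeg_def wdeg_def quilt_unit_def)

lemma operad_derivation_quilt_bd: "operad_derivation Quilt_op (\<lambda>n k. quilt_bd)"
  unfolding operad_derivation_def
proof (intro conjI allI impI ballI)
  fix n k
  show "quilt_bd \<in> hom (piece Quilt_op n k) (piece Quilt_op n (k - 1))"
  proof (rule homI)
    fix x assume "x \<in> carrier (piece Quilt_op n k)"
    then show "quilt_bd x \<in> carrier (piece Quilt_op n (k - 1))"
      unfolding carrier_Quilt_op by (rule quilt_bd_closed)
  qed (simp add: Quilt_op_def quilt_bd_add)
next
  fix n k and \<sigma> :: "nat \<Rightarrow> nat" and x assume "\<sigma> permutes {1..n}"
  then show "quilt_bd (opact Quilt_op x \<sigma>) = opact Quilt_op (quilt_bd x) \<sigma>"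
    by (simp add: Quilt_op_def quilt_bd_act)
next
  fix m n a :: nat and j k x y
  assume x: "x \<in> carrier (piece Quilt_op m j)" and y: "y \<in> carrier (piece Quilt_op n k)" and a: "a \<in> {1..m}"
  have "quilt_comp x a (quilt_bd y) \<in> qchains (m + n - 1) (j + (k - 1))"
    using x quilt_bd_closed y a unfolding carrier_Quilt_op by (intro quilt_comp_closed)
  then show "quilt_bd (opcomp Quilt_op x a y) =
      opcomp Quilt_op (quilt_bd x) a y \<otimes>\<^bsub>piece Quilt_op (m + n - 1) (j + k - 1)\<^esub>
      sg (piece Quilt_op (m + n - 1) (j + k - 1)) j (opcomp Quilt_op x a (quilt_bd y))"
    using quilt_bd_comp[OF x[unfolded carrier_Quilt_op] y[unfolded carrier_Quilt_op] a]
    by (simp add: Quilt_op_def algebra_simps)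
qed

interpretation mquilt: adjoining_leibniz Quilt_op 0 "-1" mquilt_rel "\<lambda>n k. quilt_bd"
proof (intro adjoining_leibniz.intro adjoining.intro adjoining_leibniz_axioms.intro)
  show "opunit Quilt_op \<in> carrier (piece Quilt_op 1 0)"
    using quilt_unit_Quilts by (simp add: Quilt_op_def)
  show "comm_group (piece Quilt_op n k)" for n k
    by (simp add: Quilt_op_def abelian_free_Abelian_group)
  show "opcomp Quilt_op x a y \<in> carrier (piece Quilt_op (m + n - 1) (j + k))"
    if "x \<in> carrier (piece Quilt_op m j)" "y \<in> carrier (piece Quilt_op n k)" "a \<in> {1..m}" for m n j k x y a
    using quilt_comp_closed[OF that[unfolded carrier_Quilt_op]] unfolding carrier_Quilt_op
    by (simp add: Quilt_op_def)
  show "quilt_bd (opunit Quilt_op) = \<one>\<^bsub>piece Quilt_op 1 (- 1)\<^esub>"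
    by (simp add: Quilt_op_def quilt_unit_def quilt_bd_basis_eq)
qed (rule operad_derivation_quilt_bd)

section \<open>Substituting the generator into chains of quilts\<close>

definition plug :: "nat \<Rightarrow> int \<Rightarrow> nat \<Rightarrow> (quilt \<Rightarrow>\<^sub>0 int) \<Rightarrow> (quilt \<Rightarrow>\<^sub>0 int) opterm set" where
  "plug n k u z = opcomp mquilt.M (mquilt.incl n k z) u mquilt.gen"

lemma plug_hom:
  assumes "u \<in> {1..n}"
  shows "plug n k u \<in> hom (free_Abelian_group {Q \<in> Quilts n. qdeg Q = k}) (mquilt.pc (n - 1) (k - 1))"
proof -
  have "mquilt.incl n k \<in> hom (free_Abelian_group {Q \<in> Quilts n. qdeg Q = k}) (mquilt.pc n k)"
    using mquilt.incl_hom[of n k] by (simp add: Quilt_op_def)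
  from hom_compose[OF this mquilt.comp_hom_left[OF assms mquilt.gen_closed]]
  show ?thesis by (simp add: plug_def[abs_def] comp_def)
qed

lemma plug_closed: "u \<in> {1..n} \<Longrightarrow> z \<in> qchains n k \<Longrightarrow> plug n k u z \<in> carrier (mquilt.pc (n - 1) (k - 1))"
  using hom_in_carrier[OF plug_hom, of u n z k] by simp

lemma plug_0: "u \<in> {1..n} \<Longrightarrow> plug n k u 0 = \<one>\<^bsub>mquilt.pc (n - 1) (k - 1)\<^esub>"
  using hom_one[OF plug_hom _ mquilt.group_piece, of u n k] by simp

lemma typ_plug_m:
  assumes "Q \<in> Quilts n" "u \<in> {1..n}"
  shows "mquilt.wt (n - 1) (qdeg Q - 1) (plug_m n Q u)"
  unfolding plug_m_def using assms
  by (intro typ_Comp'[OF typ_Elem typ_Gen]) (auto simp: carrier_Quilt_op)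

lemma cls_plug_m:
  assumes "Q \<in> Quilts n" "u \<in> {1..n}"
  shows "mquilt.cls (n - 1) (qdeg Q - 1) (plug_m n Q u) = plug n (qdeg Q) u (frag_of Q)"
proof -
  have "mquilt.wt n (qdeg Q) (Elem n (qdeg Q) (frag_of Q))"
    using assms(1) by (intro typ_Elem) (simp add: carrier_Quilt_op)
  then show ?thesis
    unfolding plug_def plug_m_def adjoin_incl_def adjoin_gen_def
    by (intro mquilt.cls_comp[symmetric] eq_refl typ_Gen assms(2)) auto
qed

text \<open>The other Leibniz term contains the derivative of the generator, which is zero.\<close>

lemma cls_D_plug_m:
  assumes Q: "Q \<in> Quilts n" and u: "u \<in> {1..n}"
  shows "mquilt.cls (n - 1) (qdeg Q - 2) (mquilt.D (plug_m n Q u)) =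
    plug n (qdeg Q - 1) u (quilt_bd_basis Q)"
proof -
  have x: "frag_of Q \<in> carrier (piece Quilt_op n (qdeg Q))" using Q by (simp add: carrier_Quilt_op)
  have K: "n - 1 = n + 0 - 1" "qdeg Q - 2 = qdeg Q + - 1 - 1" "qdeg Q - 2 = qdeg Q + (- 1 - 1)"
    "qdeg Q - 2 = qdeg Q - 1 + - 1" by simp_all
  have 1: "opcomp mquilt.M (mquilt.incl n (qdeg Q) (frag_of Q)) u \<one>\<^bsub>mquilt.pc 0 (- 1 - 1)\<^esub> =
      \<one>\<^bsub>mquilt.pc (n - 1) (qdeg Q - 2)\<^esub>"
    by (rule mquilt.comp_one_right[OF mquilt.incl_closed[OF x] u K(1,3)])
  have 2: "opcomp mquilt.M (mquilt.incl n (qdeg Q - 1) (quilt_bd_basis Q)) u mquilt.gen \<in>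
      carrier (mquilt.pc (n - 1) (qdeg Q - 2))"
    using mquilt.delta_closed[OF x]
    by (intro mquilt.comp_closed[OF mquilt.incl_closed mquilt.gen_closed u K(1,4)]) simp
  have 3: "mquilt.cls 0 (- 1 - 1) (mquilt.D Gen) = \<one>\<^bsub>mquilt.pc 0 (- 1 - 1)\<^esub>"
    by (simp add: mquilt.cls_one)
  have 4: "mquilt.cls n (qdeg Q - 1) (mquilt.D (Elem n (qdeg Q) (frag_of Q))) =
      mquilt.incl n (qdeg Q - 1) (quilt_bd_basis Q)"
    by (simp add: adjoin_incl_def)
  have 5: "mquilt.cls n (qdeg Q) (Elem n (qdeg Q) (frag_of Q)) = mquilt.incl n (qdeg Q) (frag_of Q)"
    "mquilt.cls 0 (- 1) Gen = mquilt.gen"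
    by (simp_all only: adjoin_incl_def adjoin_gen_def)
  show ?thesis
    unfolding plug_m_def mquilt.cls_D_comp[OF typ_Elem[OF x] typ_Gen u K(1,2)] mquilt.leibniz_def 3 4 5 1
      plug_def mquilt.pc.int_pow_one
    by (rule mquilt.pc.r_one[OF 2])
qed

lemma plug_cong:
  assumes r: "mquilt_rel (n - 1) (qdeg Q - 1) (plug_m n Q u) (plug_m n Q' u)"
    and Q: "Q \<in> Quilts n" "Q' \<in> Quilts n" "qdeg Q' = qdeg Q" and u: "u \<in> {1..n}"
  shows "plug n (qdeg Q) u (frag_of Q) = plug n (qdeg Q) u (frag_of Q')"
proof -
  note Q' = typ_plug_m[OF Q(2) u, unfolded Q(3)]
  have "mquilt.eqt (n - 1) (qdeg Q - 1) (plug_m n Q u) (plug_m n Q' u)"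
    by (rule relation[where R = mquilt_rel, OF r typ_plug_m[OF Q(1) u] Q'])
  from mquilt.cls_eqI[OF this] show ?thesis
    unfolding cls_plug_m[OF Q(1) u] cls_plug_m[OF Q(2) u, unfolded Q(3)] .
qed

lemma plug_eq_one:
  assumes r: "mquilt_rel (n - 1) (qdeg Q - 1) (plug_m n Q u) (Zero (n - 1) (qdeg Q - 1))"
    and Q: "Q \<in> Quilts n" and u: "u \<in> {1..n}"
  shows "plug n (qdeg Q) u (frag_of Q) = \<one>\<^bsub>mquilt.pc (n - 1) (qdeg Q - 1)\<^esub>"
proof -
  have "mquilt.eqt (n - 1) (qdeg Q - 1) (plug_m n Q u) (Zero (n - 1) (qdeg Q - 1))"
    by (rule relation[where R = mquilt_rel, OF r typ_plug_m[OF Q u] typ_Zero])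
  from mquilt.cls_eqI[OF this] show ?thesis
    unfolding cls_plug_m[OF Q u] mquilt.cls_one .
qed

text \<open>Deleting one letter can create equal neighbours only at the place where it stood, and
  this is exactly the shape required by relation (4).\<close>

lemma removeAll_single_split:
  assumes "distinct_adj q" "count_list q u = 1" "\<not> distinct_adj (removeAll u q)"
  obtains xs v ys where "q = xs @ [v, u, v] @ ys"
proof -
  have "u \<in> set q" using assms(2) count_list_0_iff[of q u] by auto
  then obtain A B where q: "q = A @ u # B" "u \<notin> set A" by (meson split_list_first)
  moreover have "u \<notin> set B" using assms(2) q by (simp add: count_list_0_iff)
  ultimately have "removeAll u q = A @ B" by simp
  then have nd: "\<not> distinct_adj (A @ B)" using assms(3) by simp
  have AB: "distinct_adj A" "distinct_adj B"
    using assms(1) unfolding q by (auto simp: distinct_adj_append_iff distinct_adj_Cons)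
  then have "A \<noteq> []" "B \<noteq> []" "last A = hd B" using nd by (auto simp: distinct_adj_append_iff)
  then have "q = butlast A @ [hd B, u, hd B] @ tl B" using q by (metis append.assoc append_Cons append_Nil append_butlast_last_id list.collapse)
  then show thesis by (rule that)
qed

lemma hom_free_Abelian_group_diff:
  assumes "group G" "F \<in> hom (free_Abelian_group A) G"
    and "Poly_Mapping.keys a \<subseteq> A" "Poly_Mapping.keys b \<subseteq> A"
  shows "F (a - b) = F a \<otimes>\<^bsub>G\<^esub> inv\<^bsub>G\<^esub> (F b)"
proof -
  interpret F: group_hom "free_Abelian_group A" G F
    using assms(1,2) by (simp add: group_hom_def group_hom_axioms_def)
  show ?thesis
    using F.hom_mult[of a "- b"] F.hom_inv[of b] assms(3,4) by simp
qed

text \<open>The imposed relations make the substitution of the generator for \<open>u\<close> factor through the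
  deletion of \<open>u\<close>, where words containing adjacent equal letters count as zero.\<close>

lemma plug_qpair_eq_one:
  assumes u: "u \<in> {1..n}"
    and z: "\<And>q. q \<in> Poly_Mapping.keys z \<Longrightarrow> (q, T) \<in> Quilts n \<and> wdeg q = k"
    and 0: "dadj (wrem u z) = 0"
  shows "plug n k u (qpair T z) = \<one>\<^bsub>mquilt.pc (n - 1) (k - 1)\<^esub>"
proof -
  define good where "good q \<longleftrightarrow> (q, T) \<in> Quilts n \<and> wdeg q = k" for q
  \<comment> \<open>One word is chosen for each possible result of the deletion; relation (5) makes
    the choice irrelevant.\<close>
  define rep where "rep r = (SOME q. good q \<and> count_list q u = 1 \<and> removeAll u q = r)" for r
  define S where "S = {r. distinct_adj r \<and> (\<exists>q. good q \<and> count_list q u = 1 \<and> removeAll u q = r)}"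
  let ?G = "mquilt.pc (n - 1) (k - 1)" and ?f = "\<lambda>r. plug n k u (frag_of (rep r, T))"
  have rep: "good (rep r) \<and> count_list (rep r) u = 1 \<and> removeAll u (rep r) = r" if "r \<in> S" for r
    unfolding rep_def by (rule someI_ex) (use that in \<open>auto simp: S_def\<close>)
  have fS: "?f ` S \<subseteq> carrier ?G"
  proof (rule image_subsetI)
    fix r assume "r \<in> S"
    then have "frag_of (rep r, T) \<in> qchains n k" using rep by (simp add: good_def qdeg_def)
    then show "?f r \<in> carrier ?G" by (rule plug_closed[OF u])
  qed
  \<comment> \<open>The homomorphism through which \<open>plug\<close> factors, obtained from the
    universal property of the free abelian group on the nondegenerate deleted words.\<close>
  obtain h where h: "h \<in> hom (free_Abelian_group S) ?G" "\<And>r. r \<in> S \<Longrightarrow> h (frag_of r) = ?f r"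
    by (rule comm_group.free_Abelian_group_universal[OF mquilt.comm_group_piece fS]) (rule that)
  have h0: "h 0 = \<one>\<^bsub>?G\<^esub>" using hom_one[OF h(1) _ mquilt.group_piece] by simp
  have "Poly_Mapping.keys z \<subseteq> {q. good q}" using z by (auto simp: good_def)
  then have "plug n k u (qpair T z) = h (dadj (wrem u z)) \<and> Poly_Mapping.keys (dadj (wrem u z)) \<subseteq> S \<and>
      Poly_Mapping.keys (qpair T z) \<subseteq> {Q \<in> Quilts n. qdeg Q = k}"
  proof (induction rule: frag_induction)
    case zero
    then show ?case using plug_0[OF u] h0 by (simp add: wrem_linear)
  next
    case (one q)
    then have q: "(q, T) \<in> Quilts n" "qdeg (q, T) = k" by (auto simp: good_def qdeg_def)
    have q': "q \<in> F2S n" using q by (simp add: Quilts_iff)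
    then have "u \<in> set q" "distinct_adj q" using u by (auto simp: F2S_def)
    then have c: "count_list q u \<noteq> 0" by (simp add: count_list_0_iff)
    \<comment> \<open>The three cases use relations (3), (4) and (5) respectively; \<open>u\<close>
      does occur because the word contains every vertex.\<close>
    have ?case if "count_list q u \<noteq> 1"
      using plug_eq_one[OF rel_repeated[OF q(1) u] q(1) u] that c q h0 by (simp add: wrem_of)
    moreover have ?case if c1: "count_list q u = 1" and nd: "\<not> distinct_adj (removeAll u q)"
    proof -
      obtain xs v ys where "q = xs @ [v, u, v] @ ys"
        using \<open>distinct_adj q\<close> c1 nd by (rule removeAll_single_split)
      then show ?case
        using plug_eq_one[OF rel_between[OF q(1) u] q(1) u, of xs v ys] c1 nd q h0
        by (simp add: wrem_of dadj_of)
    qed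
    moreover have ?case if c1: "count_list q u = 1" and da: "distinct_adj (removeAll u q)"
    proof -
      have S: "removeAll u q \<in> S" using c1 da one by (auto simp: S_def)
      note r = rep[OF S]
      have r': "(rep (removeAll u q), T) \<in> Quilts n" "qdeg (rep (removeAll u q), T) = k"
        using r by (auto simp: good_def qdeg_def)
      have "plug n k u (frag_of (q, T)) = ?f (removeAll u q)"
        using plug_cong[OF rel_move[OF q(1) r'(1) u] q(1) r'(1) _ u] r r' q c1 by simp
      then show ?case using S c1 da h(2) q by (simp add: wrem_of dadj_of)
    qed
    ultimately show ?case by blast
  next
    case (diff a b)
    have "Poly_Mapping.keys (dadj (wrem u (a - b))) \<subseteq> S"
      using diff keys_diff[of "dadj (wrem u a)" "dadj (wrem u b)"] by (auto simp: wrem_diff dadj_diff)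
    moreover have "Poly_Mapping.keys (qpair T (a - b)) \<subseteq> {Q \<in> Quilts n. qdeg Q = k}"
      using diff keys_diff[of "qpair T a" "qpair T b"] by (auto simp: qpair_diff)
    moreover have "plug n k u (qpair T (a - b)) = h (dadj (wrem u (a - b)))"
      using diff hom_free_Abelian_group_diff[OF mquilt.group_piece plug_hom[OF u]]
        hom_free_Abelian_group_diff[OF mquilt.group_piece h(1)] by (simp add: wrem_diff dadj_diff qpair_diff)
    ultimately show ?case by blast
  qed
  then show ?thesis using 0 h0 by simp
qed

lemma plug_diff:
  assumes u: "u \<in> {1..n}" and x: "x \<in> qchains n k" and y: "y \<in> qchains n k"
  shows "plug n k u (x - y) =
    plug n k u x \<otimes>\<^bsub>mquilt.pc (n - 1) (k - 1)\<^esub> inv\<^bsub>mquilt.pc (n - 1) (k - 1)\<^esub> plug n k u y"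
  by (rule hom_free_Abelian_group_diff[OF mquilt.group_piece plug_hom[OF u]]) (use x y in auto)

lemma plug_vanish:
  assumes u: "u \<in> {1..n}" and x: "x \<in> qchains n k"
    and one: "\<And>Q. Q \<in> Poly_Mapping.keys x \<Longrightarrow> plug n k u (frag_of Q) = \<one>\<^bsub>mquilt.pc (n - 1) (k - 1)\<^esub>"
  shows "plug n k u x = \<one>\<^bsub>mquilt.pc (n - 1) (k - 1)\<^esub>"
proof -
  let ?A = "{Q \<in> Quilts n. qdeg Q = k \<and> plug n k u (frag_of Q) = \<one>\<^bsub>mquilt.pc (n - 1) (k - 1)\<^esub>}"
  have "Poly_Mapping.keys x \<subseteq> ?A" using x one by auto
  then have "x \<in> qchains n k \<and> plug n k u x = \<one>\<^bsub>mquilt.pc (n - 1) (k - 1)\<^esub>"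
  proof (induction rule: frag_induction)
    case (diff a b)
    moreover have "a - b \<in> qchains n k" using diff keys_diff[of a b] by auto
    ultimately show ?case
      using plug_diff[OF u, of a k b] by (simp del: One_nat_def)
  qed (simp_all add: plug_0[OF u, simplified])
  then show ?thesis by simp
qed

lemma plug_bd_eq_one:
  assumes Q: "(W, T) \<in> Quilts n" and u: "u \<in> {1..n}" and 0: "dadj (wrem u (wbd W)) = 0"
  shows "plug n (wdeg W - 1) u (qpair T (wbd W)) = \<one>\<^bsub>mquilt.pc (n - 1) (wdeg W - 2)\<^esub>"
proof -
  have "plug n (wdeg W - 1) u (qpair T (wbd W)) = \<one>\<^bsub>mquilt.pc (n - 1) (wdeg W - 1 - 1)\<^esub>"
    by (rule plug_qpair_eq_one[OF u _ 0]) (use Quilts_wbd[OF Q] wdeg_wbd in blast)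
  then show ?thesis by simp
qed

lemma vle_B: "vle (snd quilt_B) = {(1, 1), (2, 2), (1, 2)}"
proof -
  have "vle (snd quilt_B) = Id_on {1, 2} \<union> {(1, 2)}"
    unfolding quilt_B_def snd_conv by (rule vle_eq) (auto simp: trans_def)
  then show ?thesis by auto
qed

lemma B_tree: "snd quilt_B \<in> Tree 2"
proof -
  have "is_tree \<lparr>verts = {1, 2}, edges = {(1, 2)}, horder = Id_on {1, 2} \<union> {}\<rparr>"
  proof (rule is_treeI[where L = "{(1, 2)}"])
    show "\<exists>!r. r \<in> {1, 2} \<and> (\<forall>v \<in> {1, 2}. (v, r) \<notin> {(1 :: nat, 2 :: nat)})"
      by (rule ex1I[of _ 1]) auto
  qed (auto simp: irrefl_def trans_def)
  moreover have "{1..2} = {1, 2 :: nat}" by auto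
  ultimately show ?thesis by (simp add: quilt_B_def Tree_def Id_on_def insert_commute)
qed

lemma F2S_distinct: "distinct w \<Longrightarrow> set w = {1..n} \<Longrightarrow> w \<in> F2S n"
proof -
  assume w: "distinct w" "set w = {1..n}"
  have "\<not> subseq [u, v, u, v] w" for u v
  proof
    assume "subseq [u, v, u, v] w"
    then have "distinct [u, v, u, v]" using w(1) distinct_nthsI by (metis subseq_conv_nths)
    then show False by simp
  qed
  moreover have "distinct_adj w" using w(1) by (auto simp: distinct_adj_conv_nth nth_eq_iff_index_eq)
  ultimately show ?thesis using w by (simp add: F2S_def)
qed

lemma Quilts_distinct:
  assumes "distinct w" "T \<in> Tree n" "set w = {1..n}"
    and "\<And>i j. i < j \<Longrightarrow> j < length w \<Longrightarrow> (w ! j, w ! i) \<notin> vless T"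
  shows "(w, T) \<in> Quilts n" "qdeg (w, T) = 0"
proof -
  have "w ! i \<noteq> w ! k" if "i < j" "j < k" "k < length w" for i j k
    using nth_eq_iff_index_eq[OF assms(1)] that by auto
  then show "(w, T) \<in> Quilts n" using assms F2S_distinct[OF assms(1,3)] by (auto simp: Quilts_def)
  show "qdeg (w, T) = 0" using distinct_card[OF assms(1)] by (simp add: qdeg_def wdeg_def)
qed

lemma quilt_B_Quilts: "quilt_B \<in> Quilts 2" "qdeg quilt_B = 0"
proof -
  have "([1, 2], snd quilt_B) \<in> Quilts 2" "qdeg ([1, 2], snd quilt_B) = 0"
    by (rule Quilts_distinct[OF _ B_tree];
      auto simp: vless_def vle_B less_Suc_eq numeral_eq_Suc nth_Cons split: nat.splits)+
  then show "quilt_B \<in> Quilts 2" "qdeg quilt_B = 0" by (simp_all add: quilt_B_def)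
qed

lemma eqt_D_plug_m_Zero:
  assumes "Q \<in> Quilts n" "u \<in> {1..n}" "plug n (qdeg Q - 1) u (quilt_bd_basis Q) = \<one>\<^bsub>mquilt.pc (n - 1) (qdeg Q - 2)\<^esub>"
  shows "mquilt.eqt (n - 1) (qdeg Q - 1 - 1) (mquilt.D (plug_m n Q u)) (mquilt.D (Zero (n - 1) (qdeg Q - 1)))"
proof (rule mquilt.eqtI[OF mquilt.D_wt[OF typ_plug_m[OF assms(1,2)]]])
  have k: "qdeg Q - 1 - 1 = qdeg Q - 2" by simp
  show "mquilt.cls (n - 1) (qdeg Q - 1 - 1) (mquilt.D (plug_m n Q u)) =
      mquilt.cls (n - 1) (qdeg Q - 1 - 1) (mquilt.D (Zero (n - 1) (qdeg Q - 1)))"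
    unfolding k cls_D_plug_m[OF assms(1,2)] assms(3) mquilt.cls_one by simp
qed

text \<open>The image of each relation under \<open>D\<close> is computed as a class by
  \<open>cls_D_plug_m\<close> and recognised there as a consequence of the same set of
  relations.\<close>

lemma mquilt_rel_derivation:
  assumes "mquilt_rel n k t s"
  shows "mquilt.eqt n (k - 1) (mquilt.D t) (mquilt.D s)"
  using assms
proof (cases rule: mquilt_rel.cases)
  case rel_B
  have one: "1 \<in> {1..2 :: nat}" "1 \<in> {1..1 :: nat}" by simp_all
  have w: "mquilt.wt 1 (- 1) (plug_m 2 quilt_B 1)"
    using typ_plug_m[OF quilt_B_Quilts(1) one(1)] by (simp add: quilt_B_Quilts)
  have t: "mquilt.wt 0 (- 2) (Comp (plug_m 2 quilt_B 1) 1 Gen)"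
    by (rule typ_Comp'[OF w typ_Gen one(2)]) simp_all
  \<comment> \<open>The word \<open>12\<close> repeats no letter, so every Leibniz term has a factor
    zero.\<close>
  have "quilt_bd_basis quilt_B = 0" by (simp add: quilt_B_def quilt_bd_basis_eq)
  then have D: "mquilt.cls 1 (- 1 - 1) (mquilt.D (plug_m 2 quilt_B 1)) = \<one>\<^bsub>mquilt.pc 1 (- 1 - 1)\<^esub>"
    using cls_D_plug_m[OF quilt_B_Quilts(1) one(1)] plug_0[OF one(1), of "- 1"] by (simp add: quilt_B_Quilts)
  have G: "mquilt.cls 0 (- 1 - 1) (mquilt.D Gen) = \<one>\<^bsub>mquilt.pc 0 (- 1 - 1)\<^esub>"
    by (simp add: mquilt.cls_one)
  have g: "mquilt.cls 0 (- 1) Gen \<in> carrier (mquilt.pc 0 (- 1))"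
    by (rule mquilt.typ_cls_closed[OF typ_Gen])
  have K: "0 = 1 + 0 - (1 :: nat)" "- 3 = - 1 + - 1 - (1 :: int)" "- 3 = - 1 - 1 + - (1 :: int)"
    "- 3 = - 1 + (- 1 - (1 :: int))" by simp_all
  have "mquilt.cls 0 (- 3) (mquilt.D (Comp (plug_m 2 quilt_B 1) 1 Gen)) = \<one>\<^bsub>mquilt.pc 0 (- 3)\<^esub>"
    unfolding mquilt.cls_D_comp[OF w typ_Gen one(2) K(1,2)] mquilt.leibniz_def D G
      mquilt.comp_one_left[OF g one(2) K(1,3)] mquilt.comp_one_right[OF mquilt.typ_cls_closed[OF w] one(2) K(1,4)]
      mquilt.pc.int_pow_one
    by (rule mquilt.pc.r_one[OF mquilt.pc.one_closed])
  then have "mquilt.cls 0 (- 2 - 1) (mquilt.D (Comp (plug_m 2 quilt_B 1) 1 Gen)) =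
      mquilt.cls 0 (- 2 - 1) (mquilt.D (Zero 0 (- 2)))"
    by (simp add: mquilt.cls_one)
  then show ?thesis unfolding rel_B by (rule mquilt.eqtI[OF mquilt.D_wt[OF t]])
next
  case (rel_children Q N u)
  obtain W T where Q: "Q = (W, T)" by fastforce
  note q = rel_children(5)[unfolded Q]
  have d: "qdeg Q = wdeg W" by (simp add: qdeg_def Q)
  have "plug N (qdeg Q - 1) u (quilt_bd_basis Q) = \<one>\<^bsub>mquilt.pc (N - 1) (qdeg Q - 1 - 1)\<^esub>"
  proof (rule plug_vanish[OF rel_children(6)])
    have "frag_of Q \<in> qchains N (qdeg Q)" using rel_children(5) by simp
    from quilt_bd_closed[OF this] show "quilt_bd_basis Q \<in> qchains N (qdeg Q - 1)" by simp
    fix R assume "R \<in> Poly_Mapping.keys (quilt_bd_basis Q)"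
    then obtain q where q': "q \<in> Poly_Mapping.keys (wbd W)" "R = (q, T)"
      unfolding Q quilt_bd_basis_eq by (blast dest: keys_qpair)
    have R: "R \<in> Quilts N" "qdeg R = qdeg Q - 1" "snd R = snd Q"
      using Quilts_wbd[OF q q'(1)] wdeg_wbd[OF q'(1)] q'(2) by (simp_all add: d qdeg_def Q)
    \<comment> \<open>The boundary leaves the tree untouched, so each summand still has more than
      two children at \<open>u\<close> and is killed by the same relation.\<close>
    have "card {v. (u, v) \<in> edges (snd R)} > 2" using rel_children(7) R(3) by simp
    from plug_eq_one[OF mquilt_rel.rel_children[OF R(1) rel_children(6) this] R(1) rel_children(6)]
    show "plug N (qdeg Q - 1) u (frag_of R) = \<one>\<^bsub>mquilt.pc (N - 1) (qdeg Q - 1 - 1)\<^esub>"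
      unfolding R(2) .
  qed
  then show ?thesis
    unfolding rel_children(1-4) by (intro eqt_D_plug_m_Zero rel_children(5,6)) simp
next
  case (rel_repeated Q N u)
  obtain W T where Q: "Q = (W, T)" by fastforce
  have "wrem u (wbd W) = 0" using rel_repeated(7) by (intro wrem_wbd_repeated) (simp add: Q)
  then have "plug N (qdeg Q - 1) u (quilt_bd_basis Q) = \<one>\<^bsub>mquilt.pc (N - 1) (qdeg Q - 2)\<^esub>"
    using plug_bd_eq_one[OF rel_repeated(5)[unfolded Q] rel_repeated(6)]
    by (simp add: Q qdeg_def quilt_bd_basis_eq)
  then show ?thesis
    unfolding rel_repeated(1-4) by (intro eqt_D_plug_m_Zero rel_repeated(5,6))
next
  case (rel_between Q N u xs v ys)
  obtain W T where Q: "Q = (W, T)" by fastforce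
  have W: "W = xs @ [v, u, v] @ ys" using rel_between(7) by (simp add: Q)
  have "distinct_adj W" using rel_between(5) by (simp add: Q Quilts_iff F2S_def)
  then have vu: "v \<noteq> u" by (auto simp: W distinct_adj_append_iff)
  have "dadj (wrem u (wbd W)) = 0"
  proof (cases "count_list W u = 1")
    case True
    \<comment> \<open>The two copies of \<open>v\<close> become neighbours, so the boundary of the
      deleted word stays in the degenerate subcomplex.\<close>
    have "\<not> distinct_adj (removeAll u W)" using vu by (simp add: W distinct_adj_append_iff)
    then show ?thesis using wrem_wbd_single[OF True] dadj_wbd by simp
  qed (simp add: wrem_wbd_repeated)
  then have "plug N (qdeg Q - 1) u (quilt_bd_basis Q) = \<one>\<^bsub>mquilt.pc (N - 1) (qdeg Q - 2)\<^esub>"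
    using plug_bd_eq_one[OF rel_between(5)[unfolded Q] rel_between(6)]
    by (simp add: Q qdeg_def quilt_bd_basis_eq)
  then show ?thesis
    unfolding rel_between(1-4) by (intro eqt_D_plug_m_Zero rel_between(5,6))
next
  case (rel_move Q N Q' u)
  obtain W T W' where Q: "Q = (W, T)" "Q' = (W', T)" using rel_move(8) by (cases Q; cases Q') auto
  note q = rel_move(5)[unfolded Q] and q' = rel_move(6)[unfolded Q] and u = rel_move(7)
  have c: "count_list W u = 1" "count_list W' u = 1" "removeAll u W = removeAll u W'"
    using rel_move(9-11) by (simp_all add: Q)
  have deg: "wdeg W' = wdeg W"
    using wexc_removeAll_single[OF c(1)] wexc_removeAll_single[OF c(2)] c(3) by (simp add: wdeg_eq_wexc)
  let ?k = "wdeg W - 1"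
  have keys: "(p, T) \<in> Quilts N \<and> wdeg p = ?k"
    if "p \<in> Poly_Mapping.keys (wbd W) \<or> p \<in> Poly_Mapping.keys (wbd W')" for p
    using that Quilts_wbd[OF q] Quilts_wbd[OF q'] wdeg_wbd[of p W] wdeg_wbd[of p W'] deg by auto
  \<comment> \<open>Relation (5) compares single quilts, while the boundaries are chains without an
    evident matching of summands. Their difference is treated as a whole: deleting \<open>u\<close>
    from both words gives the same word, so the difference is deleted to zero.\<close>
  have z: "plug N ?k u (qpair T (wbd W - wbd W')) = \<one>\<^bsub>mquilt.pc (N - 1) (?k - 1)\<^esub>"
  proof (rule plug_qpair_eq_one[OF u])
    show "(p, T) \<in> Quilts N \<and> wdeg p = ?k" if "p \<in> Poly_Mapping.keys (wbd W - wbd W')" for p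
      using keys that keys_diff[of "wbd W" "wbd W'"] by blast
    show "dadj (wrem u (wbd W - wbd W')) = 0"
      using wrem_wbd_single[OF c(1)] wrem_wbd_single[OF c(2)] c(3) by (simp add: wrem_diff)
  qed
  have cl: "qpair T (wbd W) \<in> qchains N ?k" "qpair T (wbd W') \<in> qchains N ?k"
    using keys by (auto simp: qdeg_def dest!: keys_qpair)
  have eq: "plug N ?k u (qpair T (wbd W)) = plug N ?k u (qpair T (wbd W'))"
    using z plug_closed[OF u cl(1)] plug_closed[OF u cl(2)]
    unfolding qpair_diff plug_diff[OF u cl]
    by (simp only: mquilt.pc.inv_solve_right' mquilt.pc.one_closed mquilt.pc.l_one)
  have k: "qdeg Q - 1 - 1 = qdeg Q - 2" "qdeg Q' = qdeg Q" "qdeg Q = wdeg W" by (simp_all add: qdeg_def Q deg)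
  show ?thesis
    unfolding rel_move(1-4)
  proof (rule mquilt.eqtI[OF mquilt.D_wt[OF typ_plug_m[OF rel_move(5) u]]])
    show "mquilt.cls (N - 1) (qdeg Q - 1 - 1) (mquilt.D (plug_m N Q u)) =
        mquilt.cls (N - 1) (qdeg Q - 1 - 1) (mquilt.D (plug_m N Q' u))"
      using cls_D_plug_m[OF rel_move(5) u] cls_D_plug_m[OF rel_move(6) u] eq
      unfolding k by (simp add: Q quilt_bd_basis_eq)
  qed
qed

interpretation mquilt: adjoining_derivation Quilt_op 0 "-1" mquilt_rel "\<lambda>n k. quilt_bd"
proof (intro adjoining_derivation.intro adjoining_derivation_axioms.intro mquilt.adjoining_leibniz_axioms)
qed (rule mquilt_rel_derivation)

lemma mquilt_boundary_exists: "mquilt_boundary mquilt.adjoin_derivation"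
  unfolding mquilt_boundary_def mQuilt_def mquilt_incl_def mquilt_m_def
  using mquilt.operad_derivation_adjoin mquilt.adjoin_derivation_incl mquilt.adjoin_derivation_gen by simp

section \<open>The Maurer-Cartan equation\<close>

lemma (in operad) comp_sg_comp:
  assumes p: "p \<in> carrier (pc 1 (-1))" and q: "q \<in> carrier (pc 1 (-1))"
  shows "oc (p \<otimes>\<^bsub>pc 1 (-1)\<^esub> inv\<^bsub>pc 1 (-1)\<^esub> q) 1 (p \<otimes>\<^bsub>pc 1 (-1)\<^esub> inv\<^bsub>pc 1 (-1)\<^esub> q) =
    (oc p 1 p \<otimes>\<^bsub>pc 1 (-2)\<^esub> inv\<^bsub>pc 1 (-2)\<^esub> oc p 1 q) \<otimes>\<^bsub>pc 1 (-2)\<^esub>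
      inv\<^bsub>pc 1 (-2)\<^esub> (oc q 1 p \<otimes>\<^bsub>pc 1 (-2)\<^esub> inv\<^bsub>pc 1 (-2)\<^esub> oc q 1 q)"
proof -
  have one: "1 \<in> {1..1 :: nat}" and N: "1 = 1 + 1 - (1 :: nat)" and K: "-2 = -1 + -(1 :: int)" by simp_all
  have c: "oc x 1 y \<in> carrier (pc 1 (-2))" if "x \<in> carrier (pc 1 (-1))" "y \<in> carrier (pc 1 (-1))" for x y
    by (rule comp_closed[OF that one N K])
  have i: "inv\<^bsub>pc 1 j\<^esub> x = sg (pc 1 j) 1 x" if "x \<in> carrier (pc 1 j)" for x j
    using that by (simp add: pc.sg_odd)
  have pq: "p \<otimes>\<^bsub>pc 1 (-1)\<^esub> sg (pc 1 (-1)) 1 q \<in> carrier (pc 1 (-1))"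
    using p q by (intro pc.m_closed pc.int_pow_closed)
  have r: "oc x 1 (p \<otimes>\<^bsub>pc 1 (-1)\<^esub> sg (pc 1 (-1)) 1 q) = oc x 1 p \<otimes>\<^bsub>pc 1 (-2)\<^esub> inv\<^bsub>pc 1 (-2)\<^esub> oc x 1 q"
    if "x \<in> carrier (pc 1 (-1))" for x
    unfolding i[OF c[OF that q]] by (rule comp_lin_right[OF that p q one N K])
  have "oc (p \<otimes>\<^bsub>pc 1 (-1)\<^esub> sg (pc 1 (-1)) 1 q) 1 (p \<otimes>\<^bsub>pc 1 (-1)\<^esub> sg (pc 1 (-1)) 1 q) =
      oc p 1 (p \<otimes>\<^bsub>pc 1 (-1)\<^esub> sg (pc 1 (-1)) 1 q) \<otimes>\<^bsub>pc 1 (-2)\<^esub>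
      inv\<^bsub>pc 1 (-2)\<^esub> oc q 1 (p \<otimes>\<^bsub>pc 1 (-1)\<^esub> sg (pc 1 (-1)) 1 q)"
    unfolding i[OF c[OF q pq]] by (rule comp_lin_left[OF p q pq one N K])
  then show ?thesis unfolding i[OF q] r[OF p] r[OF q] .
qed

text \<open>\<open>C\<close> stands for the quilt of the chain on \<open>123\<close>,
  \<open>L\<close> and \<open>R\<close> for those of the two forks. The hypotheses isolate what the
  computation takes from quilts; the rest is the bookkeeping of signs in any graded operad.\<close>

lemma (in operad) Maurer_Cartan:
  assumes B: "B \<in> carrier (pc 2 0)" and m: "m \<in> carrier (pc 0 (-1))"
    and CLR: "C \<in> carrier (pc 3 0)" "L \<in> carrier (pc 3 0)" "R \<in> carrier (pc 3 0)"
    and BB1: "oc B 1 B = C \<otimes>\<^bsub>pc 3 0\<^esub> (L \<otimes>\<^bsub>pc 3 0\<^esub> R)" and BB2: "oc B 2 B = C"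
    and Bmm: "oc (oc B 1 m) 1 m = \<one>\<^bsub>pc 0 (-2)\<^esub>"
    and R: "oc R 3 m = oc L 2 m" and L: "oc L 3 m = oc R 2 m"
  defines "p \<equiv> oc B 1 m" and "q \<equiv> oc B 2 m"
  shows "oc (p \<otimes>\<^bsub>pc 1 (-1)\<^esub> inv\<^bsub>pc 1 (-1)\<^esub> q) 1 (p \<otimes>\<^bsub>pc 1 (-1)\<^esub> inv\<^bsub>pc 1 (-1)\<^esub> q) = \<one>\<^bsub>pc 1 (-2)\<^esub>"
proof -
  let ?H = "pc 1 (-2)"
  \<comment> \<open>The second index refers to the inputs left after the first substitution. The
    order matters, as \<open>m\<close> is odd; see \<open>anti\<close>.\<close>
  define E where "E a b z = oc (oc z a m) b m" for a b z
  have n: "1 \<in> {1..1 :: nat}" "1 \<in> {1..2 :: nat}" "2 \<in> {1..2 :: nat}" "1 \<in> {1..3 :: nat}" "2 \<in> {1..3 :: nat}"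
    "3 \<in> {1..3 :: nat}" by simp_all
  have nn: "1 + 2 - 1 = (2 :: nat)" "1 + 1 - 1 = (1 :: nat)" by simp_all
  have p: "p \<in> carrier (pc 1 (-1))" and q: "q \<in> carrier (pc 1 (-1))"
    unfolding p_def q_def using n by (auto intro!: comp_closed[OF B m])
  have zm: "oc z a m \<in> carrier (pc 2 (-1))" if "z \<in> carrier (pc 3 0)" "a \<in> {1..3}" for z a
    by (rule comp_closed[OF that(1) m that(2)]) simp_all
  have E: "E a b z \<in> carrier ?H" if "z \<in> carrier (pc 3 0)" "a \<in> {1..3}" "b \<in> {1..2}" for z a b
    unfolding E_def by (rule comp_closed[OF zm[OF that(1,2)] m that(3)]) simp_all
  have Emult: "E a b (x \<otimes>\<^bsub>pc 3 0\<^esub> y) = E a b x \<otimes>\<^bsub>?H\<^esub> E a b y"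
    if "x \<in> carrier (pc 3 0)" "y \<in> carrier (pc 3 0)" "a \<in> {1..3}" "b \<in> {1..2}" for a b x y
  proof -
    have "oc (x \<otimes>\<^bsub>pc 3 0\<^esub> y) a m = oc x a m \<otimes>\<^bsub>pc 2 (-1)\<^esub> oc y a m"
      by (rule comp_mult_left[OF that(1,2) m that(3)]) simp_all
    then show ?thesis
      unfolding E_def using comp_mult_left[OF zm[OF that(1,3)] zm[OF that(2,3)] m that(4), of 1 "-2"] by simp
  qed
  have LR: "L \<otimes>\<^bsub>pc 3 0\<^esub> R \<in> carrier (pc 3 0)" using CLR by (intro pc.m_closed)
  have EBB: "E a b (oc B 1 B) = E a b C \<otimes>\<^bsub>?H\<^esub> (E a b L \<otimes>\<^bsub>?H\<^esub> E a b R)"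
    if "a \<in> {1..3}" "b \<in> {1..2}" for a b
    unfolding BB1 Emult[OF CLR(1) LR that] Emult[OF CLR(2,3) that] ..
  have qm: "oc q 1 m = \<one>\<^bsub>pc 0 (-2)\<^esub>"
  proof -
    have "oc (oc B 1 m) 1 m = sg (pc 0 (-2)) 1 (oc q 1 m)"
      using comp_par[OF B m m n(2,3)] by (simp add: q_def)
    then have "sg (pc 0 (-2)) 1 (oc q 1 m) = \<one>\<^bsub>pc 0 (-2)\<^esub>" using Bmm by simp
    moreover have "oc q 1 m \<in> carrier (pc 0 (-2))" by (rule comp_closed[OF q m n(1)]) simp_all
    ultimately show ?thesis using pc.inv_eq_1_iff by (simp add: pc.sg_odd)
  qed
  \<comment> \<open>The inputs 1 and 2 of \<open>oc B 1 B\<close> both belong to the inner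
    \<open>B\<close>, so filling them produces \<open>B\<close> with \<open>m\<close> in both
    inputs. The same argument for the inputs 2 and 3 of \<open>oc B 2 B\<close> gives
    \<open>E3\<close>.\<close>
  have E1: "E 2 1 (oc B 1 B) = \<one>\<^bsub>?H\<^esub>"
  proof -
    have "oc (oc B 1 B) 2 m = oc B 1 q" using comp_seq[OF B B m n(2,3), unfolded nn] by (simp only: q_def)
    then have "E 2 1 (oc B 1 B) = oc B 1 (oc q 1 m)" unfolding E_def using comp_seq[OF B q m n(2,1)] by simp
    then show ?thesis unfolding qm using comp_one_right[OF B n(2), of 1 0 "-2" "-2"] by simp
  qed
  have E3: "E 3 2 C = \<one>\<^bsub>?H\<^esub>"
  proof -
    have "oc (oc B 2 B) 3 m = oc B 2 q" using comp_seq[OF B B m n(3,3)] by (simp add: q_def)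
    then have "E 3 2 (oc B 2 B) = oc B 2 (oc q 1 m)" unfolding E_def using comp_seq[OF B q m n(3,1)] by simp
    then show ?thesis unfolding qm BB2 using comp_one_right[OF B n(3), of 1 0 "-2" "-2"] by simp
  qed
  have anti: "E a (b - 1) z = inv\<^bsub>?H\<^esub> E b a z" if "z \<in> carrier (pc 3 0)" "a \<in> {1..3}" "b \<in> {1..3}" "a < b" for a b z
  proof -
    have "a \<in> {1..2}" using that by auto
    then show ?thesis
      using comp_par[OF that(1) m m that(2-4)] E[OF that(1,3)] unfolding E_def by (simp add: pc.sg_odd)
  qed
  have pB: "oc p 1 B = oc C 1 m"
    using comp_par[OF B m B n(2,3)] zm[OF CLR(1) n(4)] by (simp add: p_def BB2 pc.sg_even)
  have qB: "oc q 1 B = oc (oc B 1 B) 3 m"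
    using comp_par[OF B B m n(2,3)] zm[OF _ n(6), of "oc B 1 B"] comp_closed[OF B B n(2), of 3 0]
      comp_closed[OF q B n(1), of 2 "-1"] by (simp add: q_def pc.sg_even)
  have pp: "oc p 1 p = inv\<^bsub>?H\<^esub> E 2 1 C"
    using comp_seq[OF p B m n(1,2), unfolded nn] anti[OF CLR(1) n(4,5), unfolded E_def]
    unfolding pB p_def[symmetric] E_def by simp
  have pq: "oc p 1 q = inv\<^bsub>?H\<^esub> E 3 1 C"
    using comp_seq[OF p B m n(1,3), unfolded nn] anti[OF CLR(1) n(4,6), unfolded E_def]
    unfolding pB q_def[symmetric] E_def by simp
  have qp: "oc q 1 p = E 3 1 (oc B 1 B)" and qq: "oc q 1 q = E 3 2 (oc B 1 B)"
    using comp_seq[OF q B m n(1,2), unfolded nn] comp_seq[OF q B m n(1,3), unfolded nn]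
    by (simp_all only: qB p_def[symmetric] q_def[symmetric] E_def)
  \<comment> \<open>The first equation combines the exchange of the forks with the sign of
    exchanging the two copies of \<open>m\<close>; it makes the fork terms of
    \<open>oc q 1 q\<close> cancel each other.\<close>
  have ER: "E 3 2 R = inv\<^bsub>?H\<^esub> E 3 2 L" "E 3 1 R = E 2 1 L" "E 3 1 L = E 2 1 R"
    using anti[OF CLR(2), of 2 3] by (simp_all add: E_def R L)
  note c = E[OF CLR(1) n(5,2)] E[OF CLR(2) n(5,2)] E[OF CLR(3) n(5,2)] E[OF CLR(1) n(6,2)] E[OF CLR(2) n(6,3)]
  \<comment> \<open>Here \<open>c1\<close> and \<open>c2\<close> are \<open>E 2 1 C\<close> and
    \<open>E 3 1 C\<close>, \<open>l\<close> and \<open>r\<close> are \<open>E 2 1\<close> of the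
    forks, and \<open>e\<close> is \<open>E 3 2 L\<close>. The last hypothesis is \<open>E1\<close>
    expanded by \<open>BB1\<close>.\<close>
  have fin: "(inv\<^bsub>G\<^esub> c1 \<otimes>\<^bsub>G\<^esub> inv\<^bsub>G\<^esub> (inv\<^bsub>G\<^esub> c2)) \<otimes>\<^bsub>G\<^esub> inv\<^bsub>G\<^esub> ((c2 \<otimes>\<^bsub>G\<^esub> (r \<otimes>\<^bsub>G\<^esub> l)) \<otimes>\<^bsub>G\<^esub> inv\<^bsub>G\<^esub> (\<one>\<^bsub>G\<^esub> \<otimes>\<^bsub>G\<^esub> (e \<otimes>\<^bsub>G\<^esub> inv\<^bsub>G\<^esub> e))) = \<one>\<^bsub>G\<^esub>"
    if "comm_group G" "c1 \<in> carrier G" "c2 \<in> carrier G" "r \<in> carrier G" "l \<in> carrier G" "e \<in> carrier G"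
      "c1 \<otimes>\<^bsub>G\<^esub> (l \<otimes>\<^bsub>G\<^esub> r) = \<one>\<^bsub>G\<^esub>" for G :: "'a monoid" and c1 c2 r l e
  proof -
    interpret G: comm_group G by fact
    have "(inv\<^bsub>G\<^esub> c1 \<otimes>\<^bsub>G\<^esub> c2) \<otimes>\<^bsub>G\<^esub> inv\<^bsub>G\<^esub> (c2 \<otimes>\<^bsub>G\<^esub> (r \<otimes>\<^bsub>G\<^esub> l)) =
        (c2 \<otimes>\<^bsub>G\<^esub> inv\<^bsub>G\<^esub> c2) \<otimes>\<^bsub>G\<^esub> inv\<^bsub>G\<^esub> (c1 \<otimes>\<^bsub>G\<^esub> (l \<otimes>\<^bsub>G\<^esub> r))"
      using that(2-6) by (simp only: G.inv_mult G.m_closed G.inv_closed G.m_ac)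
    then show ?thesis using that(2-7) by simp
  qed
  show ?thesis
    unfolding comp_sg_comp[OF p q] pp pq qp qq EBB[OF n(6,2)] EBB[OF n(6,3)] E3 ER
    by (rule fin[OF comm_group_piece c(1,4,3,2,5)]) (use E1 EBB[OF n(5,2)] in simp)
qed


section \<open>Trees on three vertices and the composites of \<open>B\<close> with itself\<close>

definition chain_tree :: tree where
  "chain_tree = \<lparr>verts = {1, 2, 3}, edges = {(1, 2), (2, 3)}, horder = Id_on {1, 2, 3}\<rparr>"

text \<open>The pair \<open>h\<close> fixes the left-to-right order of the leaves \<open>2\<close>
  and \<open>3\<close>.\<close>

definition fork_tree :: "nat \<times> nat \<Rightarrow> tree" where
  "fork_tree h = \<lparr>verts = {1, 2, 3}, edges = {(1, 2), (1, 3)}, horder = Id_on {1, 2, 3} \<union> {h}\<rparr>"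

lemma interval_1_3: "{1..3} = {1, 2, 3 :: nat}"
  by auto

lemma vless_chain_tree: "vless chain_tree = {(1, 2), (1, 3), (2, 3)}"
proof -
  have "vle chain_tree = Id_on {1, 2, 3} \<union> {(1, 2), (1, 3), (2, 3)}"
    unfolding chain_tree_def by (rule vle_eq) (auto simp: trans_def)
  then show ?thesis by (auto simp: vless_def)
qed

lemma vless_fork_tree: "vless (fork_tree h) = {(1, 2), (1, 3)}"
proof -
  have "vle (fork_tree h) = Id_on {1, 2, 3} \<union> {(1, 2), (1, 3)}"
    unfolding fork_tree_def by (rule vle_eq) (auto simp: trans_def)
  then show ?thesis by (auto simp: vless_def)
qed

lemma chain_tree: "chain_tree \<in> Tree 3"
proof -
  let ?E = "{(1, 2), (2, 3)} :: (nat \<times> nat) set" and ?L = "{(1, 2), (1, 3), (2, 3)} :: (nat \<times> nat) set"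
  have "is_tree \<lparr>verts = {1, 2, 3}, edges = ?E, horder = Id_on {1, 2, 3} \<union> {}\<rparr>"
  proof (rule is_treeI[where L = "?L"])
    show "trans ?L" by (rule transI) auto
    show "\<exists>!r. r \<in> {1, 2, 3} \<and> (\<forall>v \<in> {1, 2, 3}. (v, r) \<notin> ?L)" by (rule ex1I[of _ 1]) auto
    show "?L \<subseteq> ?E \<union> ?E O ?E" by auto
  qed (simp_all add: irrefl_def)
  then show ?thesis unfolding chain_tree_def Tree_def interval_1_3 by simp
qed

lemma fork_tree:
  assumes h: "h = (2, 3) \<or> h = (3, 2)" shows "fork_tree h \<in> Tree 3"
proof -
  let ?E = "{(1, 2), (1, 3)} :: (nat \<times> nat) set"
  have "is_tree \<lparr>verts = {1, 2, 3}, edges = ?E, horder = Id_on {1, 2, 3} \<union> {h}\<rparr>"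
  proof (rule is_treeI[where L = "?E"])
    show "trans ?E" "trans {h}" by (rule transI, use h in auto)+
    show "\<exists>!r. r \<in> {1, 2, 3} \<and> (\<forall>v \<in> {1, 2, 3}. (v, r) \<notin> ?E)" by (rule ex1I[of _ 1]) auto
  qed (use h in \<open>elim disjE; simp add: irrefl_def\<close>)+
  then show ?thesis unfolding fork_tree_def Tree_def interval_1_3 by simp
qed

lemma Tree_horder: "T \<in> Tree n \<Longrightarrow> horder T = Id_on {1..n} \<union> hless T"
  using Tree_facts(3)[of T n] by (auto simp: hless_def partial_order_on_def preorder_on_def refl_on_def)

lemma Tree_trichotomy:
  assumes "T \<in> Tree n" "u \<in> {1..n}" "v \<in> {1..n}"
  shows "length (filter (\<lambda>b. b)
    [u = v, (u, v) \<in> vless T, (v, u) \<in> vless T, (u, v) \<in> hless T, (v, u) \<in> hless T]) = 1"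
  using assms by (simp add: Tree_def is_tree_def)

lemma Tree_root:
  assumes "T \<in> Tree n" shows "\<exists>!r. r \<in> {1..n} \<and> (\<forall>v \<in> {1..n}. (v, r) \<notin> vless T)"
proof -
  have "verts T = {1..n}" "\<exists>!r. r \<in> verts T \<and> (\<forall>v \<in> verts T. (v, r) \<notin> vless T)"
    using assms unfolding Tree_def is_tree_def by blast+
  then show ?thesis by (simp only:)
qed

lemma Tree_no_shortcut: "T \<in> Tree n \<Longrightarrow> (u, v) \<in> edges T \<Longrightarrow> (u, t) \<in> vless T \<Longrightarrow> (t, v) \<notin> vless T"
  unfolding Tree_def is_tree_def by blast

lemma Tree_edges_vless: "T \<in> Tree n \<Longrightarrow> edges T \<subseteq> vless T"
  by (simp add: Tree_def is_tree_def)

lemma vless_incoming: "(v, u) \<in> vless T \<Longrightarrow> \<exists>w. (w, u) \<in> edges T"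
  by (auto simp: vless_def vle_def elim: rtranclE)

text \<open>All edges increase, so \<open>1\<close> is the root and \<open>2\<close> hangs below it.
  The vertex \<open>3\<close> hangs below \<open>1\<close> or \<open>2\<close> but not below both,
  as that would give a shortcut; if below \<open>1\<close>, the trichotomy leaves the two orders of
  the leaves.\<close>

lemma Tree_3_cases:
  assumes U: "U \<in> Tree 3" and E: "edges U \<subseteq> {(1, 2), (1, 3), (2, 3)}"
  shows "U \<in> {chain_tree, fork_tree (2, 3), fork_tree (3, 2)}"
proof -
  let ?H = "hless U"
  have verts: "verts U = {1, 2, 3}" using U unfolding Tree_def interval_1_3 by simp
  have root: "(v, 1) \<notin> vless U" for v using vless_incoming[of v 1 U] subsetD[OF E, of "(_, 1)"] by fastforce
  have nonroot: "\<exists>w. (w, u) \<in> edges U" if "u \<in> {1..3}" "u \<noteq> 1" for u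
  proof (rule ccontr)
    assume "\<nexists>w. (w, u) \<in> edges U"
    then have "\<forall>v \<in> {1..3}. (v, u) \<notin> vless U" using vless_incoming by blast
    moreover have "1 \<in> {1..3 :: nat} \<and> (\<forall>v \<in> {1..3}. (v, 1) \<notin> vless U)" using root by simp
    ultimately show False using Tree_root[OF U] that by blast
  qed
  have 12: "(1, 2) \<in> edges U" using nonroot[of 2] E by auto
  have 3: "(1, 3) \<in> edges U \<or> (2, 3) \<in> edges U" using nonroot[of 3] E by auto
  have n3: "\<not> ((1, 3) \<in> edges U \<and> (2, 3) \<in> edges U)"
    using Tree_no_shortcut[OF U, of 1 3 2] Tree_edges_vless[OF U] 12 by blast
  have H: "?H \<subseteq> {1, 2, 3} \<times> {1, 2, 3} - Id"
    using Tree_facts(3)[OF U] unfolding hless_def interval_1_3 partial_order_on_def preorder_on_def by blast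
  have tri: "length (filter (\<lambda>b. b) [u = v, (u, v) \<in> vless U, (v, u) \<in> vless U, (u, v) \<in> ?H, (v, u) \<in> ?H]) = 1"
    if "u \<in> {1, 2, 3}" "v \<in> {1, 2, 3}" for u v
    using Tree_trichotomy[OF U] that unfolding interval_1_3 by blast
  have Ueq: "U = \<lparr>verts = {1, 2, 3}, edges = edges U, horder = Id_on {1, 2, 3} \<union> ?H\<rparr>"
    using Tree_horder[OF U] verts unfolding interval_1_3 by (intro tree.equality) simp_all
  have no: "(u, v) \<notin> ?H \<and> (v, u) \<notin> ?H" if "(u, v) \<in> vless U" for u v
    using tri[of u v] that verts by (auto simp: vless_def vle_def split: if_splits)
  consider "edges U = {(1, 2), (2, 3)}" | "edges U = {(1, 2), (1, 3)}" using 12 3 n3 E by blast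
  then show ?thesis
  proof cases
    case 1
    have vl: "vle U = Id_on {1, 2, 3} \<union> {(1, 2), (1, 3), (2, 3)}"
      by (subst Ueq, rule vle_eq) (auto simp: 1 trans_def)
    have "(1, 2) \<in> vless U" "(1, 3) \<in> vless U" "(2, 3) \<in> vless U" by (auto simp: vless_def vl)
    then have "?H = {}" using H no[of 1 2] no[of 1 3] no[of 2 3] by blast
    then have "U = chain_tree" by (subst Ueq) (simp add: 1 chain_tree_def)
    then show ?thesis by simp
  next
    case 2
    have vl: "vle U = Id_on {1, 2, 3} \<union> {(1, 2), (1, 3)}"
      by (subst Ueq, rule vle_eq) (auto simp: 2 trans_def)
    have v: "(1, 2) \<in> vless U" "(1, 3) \<in> vless U" "(2, 3) \<notin> vless U" "(3, 2) \<notin> vless U"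
      by (auto simp: vless_def vl)
    have "(2, 3) \<in> ?H \<and> (3, 2) \<notin> ?H \<or> (2, 3) \<notin> ?H \<and> (3, 2) \<in> ?H"
      using tri[of 2 3] v(3,4) by (auto split: if_splits)
    then have "?H = {(2, 3)} \<or> ?H = {(3, 2)}" using H no[OF v(1)] no[OF v(2)] by blast
    then show ?thesis using 2 Ueq by (auto simp: fork_tree_def)
  qed
qed

lemma hless_trees: "hless (snd quilt_B) = {}" "hless chain_tree = {}" "h \<notin> Id \<Longrightarrow> hless (fork_tree h) = {h}"
  by (auto simp: hless_def quilt_B_def chain_tree_def fork_tree_def)

lemma interval_1_2: "{1..2} = {1, 2 :: nat}"
  by auto

text \<open>The inserted vertices are \<open>1\<close> and \<open>2\<close>, and the former child of
  the slot becomes \<open>3\<close>. It may be attached below \<open>2\<close>, giving the chain, or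
  below \<open>1\<close>, and then on either side of \<open>2\<close>.\<close>

lemma Ext_tree_B_1: "Ext_tree 2 2 (snd quilt_B) (snd quilt_B) 1 = {chain_tree, fork_tree (2, 3), fork_tree (3, 2)}"
  (is "?E = ?S")
proof
  show "?E \<subseteq> ?S"
  proof
    fix U assume "U \<in> ?E"
    then have U: "U \<in> Tree 3"
      and 21: "\<forall>r \<in> {1, 2}. \<forall>s \<in> {1, 2}. (r, s) \<in> edges (snd quilt_B) \<longleftrightarrow> (shift 1 r, shift 1 s) \<in> edges U"
      and c: "\<forall>(u, w) \<in> edges U. (collapse 2 1 u, collapse 2 1 w) \<in> edges (snd quilt_B) \<or>
        collapse 2 1 u = 1 \<and> collapse 2 1 w = 1"
      unfolding Ext_tree_def interval_1_2 by simp_all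
    have "edges U \<subseteq> {(1, 2), (1, 3), (2, 3)}"
    proof
      fix e assume e: "e \<in> edges U"
      obtain u w where uw: "e = (u, w)" "u \<in> {1, 2, 3}" "w \<in> {1, 2, 3}"
        using Tree_facts(2)[OF U] e unfolding interval_1_3 by blast
      then show "e \<in> {(1, 2), (1, 3), (2, 3)}"
        using bspec[OF c e] 21 e by (auto simp: quilt_B_def collapse_def shift_def)
    qed
    then show "U \<in> ?S" by (rule Tree_3_cases[OF U])
  qed
  show "?S \<subseteq> ?E"
    using chain_tree fork_tree[of "(2, 3)"] fork_tree[of "(3, 2)"]
    by (auto simp: Ext_tree_def interval_1_2 interval_1_3 hless_trees)
      (auto simp: quilt_B_def chain_tree_def fork_tree_def collapse_def shift_def)
qed

text \<open>The inserted vertices are \<open>2\<close> and \<open>3\<close>, so the edge from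
  \<open>2\<close> to \<open>3\<close> is forced, and only the chain has it.\<close>

lemma Ext_tree_B_2: "Ext_tree 2 2 (snd quilt_B) (snd quilt_B) 2 = {chain_tree}" (is "?E = ?S")
proof
  show "?E \<subseteq> ?S"
  proof
    fix U assume "U \<in> ?E"
    then have U: "U \<in> Tree 3"
      and 21: "\<forall>r \<in> {1, 2}. \<forall>s \<in> {1, 2}. (r, s) \<in> edges (snd quilt_B) \<longleftrightarrow> (shift 2 r, shift 2 s) \<in> edges U"
      and c: "\<forall>(u, w) \<in> edges U. (collapse 2 2 u, collapse 2 2 w) \<in> edges (snd quilt_B) \<or>
        collapse 2 2 u = 2 \<and> collapse 2 2 w = 2"
      unfolding Ext_tree_def interval_1_2 by simp_all
    have "shift 2 1 = 2" "shift 2 2 = 3" by (simp_all add: shift_def)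
    then have 23: "(2, 3) \<in> edges U" "(2, 2) \<notin> edges U" "(3, 2) \<notin> edges U" "(3, 3) \<notin> edges U"
      using 21 by (simp_all add: quilt_B_def del: One_nat_def)
    have "edges U \<subseteq> {(1, 2), (1, 3), (2, 3)}"
    proof
      fix e assume e: "e \<in> edges U"
      obtain u w where uw: "e = (u, w)" "u \<in> {1, 2, 3}" "w \<in> {1, 2, 3}"
        using Tree_facts(2)[OF U] e unfolding interval_1_3 by blast
      then show "e \<in> {(1, 2), (1, 3), (2, 3)}"
        using bspec[OF c e] 23 e by (auto simp: quilt_B_def collapse_def)
    qed
    from Tree_3_cases[OF U this] show "U \<in> ?S" using 23 by (auto simp: fork_tree_def)
  qed
  show "?S \<subseteq> ?E"
    using chain_tree by (auto simp: Ext_tree_def interval_1_2 interval_1_3 hless_trees)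
      (auto simp: quilt_B_def chain_tree_def collapse_def shift_def)
qed

lemma quilt_comp_B:
  "quilt_comp (frag_of quilt_B) 1 (frag_of quilt_B) =
     frag_of ([1, 2, 3], chain_tree) + (frag_of ([1, 2, 3], fork_tree (2, 3)) + frag_of ([1, 2, 3], fork_tree (3, 2)))"
  "quilt_comp (frag_of quilt_B) 2 (frag_of quilt_B) = frag_of ([1, 2, 3], chain_tree)"
proof -
  have B: "([1, 2], snd quilt_B) \<in> Quilts 2" "quilt_B = ([1, 2], snd quilt_B)"
    using quilt_B_Quilts by (simp_all add: quilt_B_def)
  have dist: "chain_tree \<noteq> fork_tree (2, 3)" "chain_tree \<noteq> fork_tree (3, 2)" "fork_tree (2, 3) \<noteq> fork_tree (3, 2)"
    using hless_trees(2) hless_trees(3)[of "(2, 3)"] hless_trees(3)[of "(3, 2)"] by auto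
  have 1: "quilt_comp_basis quilt_B 1 quilt_B = (\<Sum>U \<in> Ext_tree 2 2 (snd quilt_B) (snd quilt_B) 1.
      qpair U (wsub (map (outer_letter 2 1) [1, 2]) (map (shift 1) [1, 2])))"
    using quilt_comp_basis_eq[OF B(1) B(1), of 1] B(2) by simp
  have 2: "quilt_comp_basis quilt_B 2 quilt_B = (\<Sum>U \<in> Ext_tree 2 2 (snd quilt_B) (snd quilt_B) 2.
      qpair U (wsub (map (outer_letter 2 2) [1, 2]) (map (shift 2) [1, 2])))"
    using quilt_comp_basis_eq[OF B(1) B(1), of 2] B(2) by simp
  have w: "wsub (map (outer_letter 2 1) [1, 2]) (map (shift 1) [1, 2]) = frag_of [1, 2, 3]"
    "wsub (map (outer_letter 2 2) [1, 2]) (map (shift 2) [1, 2]) = frag_of [1, 2, 3]"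
    by (simp_all add: outer_letter_def shift_def consm_linear numeral_2_eq_2 numeral_3_eq_3)
  show "quilt_comp (frag_of quilt_B) 1 (frag_of quilt_B) =
     frag_of ([1, 2, 3], chain_tree) + (frag_of ([1, 2, 3], fork_tree (2, 3)) + frag_of ([1, 2, 3], fork_tree (3, 2)))"
    unfolding quilt_comp_of 1 w Ext_tree_B_1 using dist by simp
  show "quilt_comp (frag_of quilt_B) 2 (frag_of quilt_B) = frag_of ([1, 2, 3], chain_tree)"
    unfolding quilt_comp_of 2 w Ext_tree_B_2 by simp
qed

lemma Quilts_3:
  assumes "w = [1, 2, 3] \<and> T = chain_tree \<or>
    w \<in> {[1, 2, 3], [1, 3, 2]} \<and> T \<in> {fork_tree (2, 3), fork_tree (3, 2)}"
  shows "(w, T) \<in> Quilts 3" "qdeg (w, T) = 0"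
proof -
  have T: "T \<in> Tree 3" using assms chain_tree fork_tree[of "(2, 3)"] fork_tree[of "(3, 2)"] by auto
  have w: "distinct w" "set w = {1..3}" using assms by (auto simp: interval_1_3)
  have lt: "(w ! j, w ! i) \<notin> vless T" if "i < j" "j < length w" for i j
  proof -
    have "(i, j) \<in> {(0, 1), (0, 2), (1, 2)}" using that assms by auto
    then show ?thesis using assms by (auto simp: vless_chain_tree vless_fork_tree)
  qed
  show "(w, T) \<in> Quilts 3" "qdeg (w, T) = 0"
    by (rule Quilts_distinct[OF w(1) T w(2)]; rule lt; assumption)+
qed

lemma quilt_act_fork:
  assumes "h = (2, 3) \<or> h = (3, 2)"
  shows "quilt_act (frag_of ([1, 2, 3], fork_tree h)) (Transposition.transpose 2 3) =
    frag_of ([1, 3, 2], fork_tree (prod.swap h))"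
proof -
  let ?s = "Transposition.transpose 2 (3 :: nat)"
  have "relabel_tree ?s (fork_tree h) = fork_tree (prod.swap h)"
    using assms by (auto simp: relabel_tree_def fork_tree_def Id_on_def transpose_eq_iff)
  then show ?thesis by (simp add: quilt_act_def transpose_def)
qed

lemma mquilt_Delta_closed: "mquilt_Delta \<in> carrier (mquilt.pc 1 (- 1))"
  and mquilt_Delta_Delta: "opcomp mquilt.M mquilt_Delta 1 mquilt_Delta = \<one>\<^bsub>mquilt.pc 1 (- 2)\<^esub>"
  and mquilt_boundary_Delta: "mquilt_boundary d \<Longrightarrow> d 1 (- 1) mquilt_Delta = \<one>\<^bsub>mquilt.pc 1 (- 2)\<^esub>"
proof -
  let ?i = "mquilt.incl 3 0" and ?B = "mquilt.incl 2 0 (frag_of quilt_B)" and ?m = mquilt.gen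
  let ?C = "([1, 2, 3], chain_tree)" and ?L = "([1, 2, 3], fork_tree (2, 3))"
    and ?R = "([1, 2, 3], fork_tree (3, 2))"
  let ?s = "Transposition.transpose 2 3 :: nat \<Rightarrow> nat"
  have n: "1 \<in> {1..2 :: nat}" "2 \<in> {1..2 :: nat}" "3 \<in> {1..3 :: nat}" "2 \<in> {1..3 :: nat}" by simp_all
  have B: "frag_of quilt_B \<in> carrier (piece Quilt_op 2 0)"
    using quilt_B_Quilts by (simp add: carrier_Quilt_op)
  note iB = mquilt.incl_closed[OF B] and m = mquilt.gen_closed
  have x: "frag_of (w, T) \<in> carrier (piece Quilt_op 3 0)"
    if "w = [1, 2, 3] \<and> T = chain_tree \<or> w \<in> {[1, 2, 3], [1, 3, 2]} \<and> T \<in> {fork_tree (2, 3), fork_tree (3, 2)}" for w T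
    using Quilts_3[OF that] by (simp add: carrier_Quilt_op)
  have CLR: "frag_of ?C \<in> carrier (piece Quilt_op 3 0)" "frag_of ?L \<in> carrier (piece Quilt_op 3 0)"
    "frag_of ?R \<in> carrier (piece Quilt_op 3 0)" by (rule x, simp)+
  have i_add: "?i (x + y) = ?i x \<otimes>\<^bsub>mquilt.pc 3 0\<^esub> ?i y"
    if "x \<in> carrier (piece Quilt_op 3 0)" "y \<in> carrier (piece Quilt_op 3 0)" for x y
    using hom_mult[OF mquilt.incl_hom that] by (simp add: Quilt_op_def)
  have LR: "frag_of ?L + frag_of ?R \<in> carrier (piece Quilt_op 3 0)"
    using CLR(2,3) keys_add[of "frag_of ?L" "frag_of ?R"] unfolding carrier_Quilt_op by blast
  have comp: "opcomp Quilt_op = quilt_comp" by (simp add: Quilt_op_def)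
  have BB1: "opcomp mquilt.M ?B 1 ?B = ?i (frag_of ?C) \<otimes>\<^bsub>mquilt.pc 3 0\<^esub> (?i (frag_of ?L) \<otimes>\<^bsub>mquilt.pc 3 0\<^esub> ?i (frag_of ?R))"
    using mquilt.incl_comp[OF B B n(1), of 3 0] i_add[OF CLR(1) LR] i_add[OF CLR(2,3)]
    unfolding comp quilt_comp_B by simp
  have BB2: "opcomp mquilt.M ?B 2 ?B = ?i (frag_of ?C)"
    using mquilt.incl_comp[OF B B n(2), of 3 0] by (simp add: Quilt_op_def quilt_comp_B)
  have Bmm: "opcomp mquilt.M (opcomp mquilt.M ?B 1 ?m) 1 ?m = \<one>\<^bsub>mquilt.pc 0 (- 2)\<^esub>"
  proof -
    have w: "mquilt.wt 1 (- 1) (plug_m 2 quilt_B 1)"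
      using typ_plug_m[OF quilt_B_Quilts(1) n(1)] by (simp add: quilt_B_Quilts)
    have one: "1 \<in> {1..1 :: nat}" by simp
    have t: "mquilt.wt 0 (- 2) (Comp (plug_m 2 quilt_B 1) 1 Gen)"
      by (rule typ_Comp'[OF w typ_Gen one]) simp_all
    have "mquilt.cls 0 (- 2) (Comp (plug_m 2 quilt_B 1) 1 Gen) = \<one>\<^bsub>mquilt.pc 0 (- 2)\<^esub>"
      unfolding mquilt.cls_one by (rule mquilt.cls_eqI[OF relation[where R = mquilt_rel, OF rel_B t typ_Zero]])
    moreover have "mquilt.cls 0 (- 2) (Comp (plug_m 2 quilt_B 1) 1 Gen) =
        opcomp mquilt.M (mquilt.cls 1 (- 1) (plug_m 2 quilt_B 1)) 1 (mquilt.cls 0 (- 1) Gen)"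
      by (rule mquilt.cls_comp[symmetric, OF eq_refl[OF w] eq_refl[OF typ_Gen] one]) simp_all
    moreover have "mquilt.cls 1 (- 1) (plug_m 2 quilt_B 1) = opcomp mquilt.M ?B 1 ?m"
      using cls_plug_m[OF quilt_B_Quilts(1) n(1)] by (simp add: quilt_B_Quilts plug_def)
    ultimately show ?thesis by (simp only: adjoin_gen_def)
  qed
  have swap: "opcomp mquilt.M (?i (frag_of ([1, 2, 3], fork_tree h))) 3 ?m =
      opcomp mquilt.M (?i (frag_of ([1, 2, 3], fork_tree (prod.swap h)))) 2 ?m"
    if h: "h = (2, 3) \<or> h = (3, 2)" for h
  proof -
    let ?Q = "([1, 2, 3], fork_tree h)" and ?Q' = "([1, 3, 2], fork_tree h)"
      and ?S = "([1, 2, 3], fork_tree (prod.swap h))"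
    have Q: "?Q \<in> Quilts 3" "?Q' \<in> Quilts 3" "qdeg ?Q = 0" "qdeg ?Q' = 0" "frag_of ?S \<in> carrier (piece Quilt_op 3 0)"
      using h by (auto intro!: Quilts_3 x)
    have h': "prod.swap h = (2, 3) \<or> prod.swap h = (3, 2)" using h by auto
    have s: "?s permutes {1..3}" by (rule permutes_swap_id) simp_all
    \<comment> \<open>Filling input \<open>3\<close> removes it from the transposition of
      \<open>2\<close> and \<open>3\<close>, and the two remaining inputs keep their order.\<close>
    have p: "perm_comp 0 ?s 3 id = id"
      by (rule ext) (auto simp: perm_comp_def collapse_def Let_def Transposition.transpose_def)
    have "plug 3 (qdeg ?Q) 3 (frag_of ?Q) = plug 3 (qdeg ?Q) 3 (frag_of ?Q')"
      by (rule plug_cong[OF rel_move[OF Q(1,2) n(3)] Q(1,2) _ n(3)]) (simp_all only: Q(3,4), simp_all)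
    moreover have "?i (frag_of ?Q') = opact mquilt.M (?i (frag_of ?S)) ?s"
      using mquilt.incl_act[OF Q(5) s] quilt_act_fork[OF h'] by (simp add: Quilt_op_def)
    moreover have "opcomp mquilt.M (opact mquilt.M (?i (frag_of ?S)) ?s) 3 (opact mquilt.M ?m id) =
        opact mquilt.M (opcomp mquilt.M (?i (frag_of ?S)) (?s 3) ?m) (perm_comp 0 ?s 3 id)"
      by (rule mquilt.comp_equivariant[OF s permutes_id mquilt.incl_closed[OF Q(5)] m n(3)])
    moreover have "opact mquilt.M ?m id = ?m" by (rule mquilt.act_id[OF m])
    moreover have "opcomp mquilt.M (?i (frag_of ?S)) 2 ?m \<in> carrier (mquilt.pc 2 (- 1))"
      by (rule mquilt.comp_closed[OF mquilt.incl_closed[OF Q(5)] m n(4)]) simp_all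
    ultimately show ?thesis unfolding plug_def Q(3) p using mquilt.act_id by simp
  qed
  have Delta: "mquilt_Delta = opcomp mquilt.M ?B 1 ?m \<otimes>\<^bsub>mquilt.pc 1 (- 1)\<^esub>
      inv\<^bsub>mquilt.pc 1 (- 1)\<^esub> (opcomp mquilt.M ?B 2 ?m)"
    unfolding mquilt_Delta_def mQuilt_def mquilt_incl_def mquilt_m_def Let_def ..
  have K: "1 = 2 + 0 - (1 :: nat)" "- 1 = 0 + - (1 :: int)" by simp_all
  have pq: "opcomp mquilt.M ?B 1 ?m \<in> carrier (mquilt.pc 1 (- 1))" "opcomp mquilt.M ?B 2 ?m \<in> carrier (mquilt.pc 1 (- 1))"
    by (rule mquilt.comp_closed[OF iB m n(1) K] mquilt.comp_closed[OF iB m n(2) K])+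
  show "mquilt_Delta \<in> carrier (mquilt.pc 1 (- 1))"
    unfolding Delta by (rule mquilt.pc.m_closed[OF pq(1) mquilt.pc.inv_closed[OF pq(2)]])
  show "opcomp mquilt.M mquilt_Delta 1 mquilt_Delta = \<one>\<^bsub>mquilt.pc 1 (- 2)\<^esub>"
    unfolding Delta
    by (rule mquilt.Maurer_Cartan[OF iB m mquilt.incl_closed[OF CLR(1)] mquilt.incl_closed[OF CLR(2)]
          mquilt.incl_closed[OF CLR(3)] BB1 BB2 Bmm])
      (use swap[of "(2, 3)"] swap[of "(3, 2)"] in simp_all)
  assume d: "mquilt_boundary d"
  then have der: "operad_derivation mquilt.M d"
    and dB: "d 2 0 ?B = mquilt.incl 2 (0 - 1) (quilt_bd (frag_of quilt_B))"
    and dm: "d 0 (- 1) ?m = \<one>\<^bsub>mquilt.pc 0 (- 2)\<^esub>"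
    using B unfolding mquilt_boundary_def mQuilt_def mquilt_incl_def mquilt_m_def by blast+
  have "quilt_bd (frag_of quilt_B) = 0" by (simp add: quilt_B_def quilt_bd_basis_eq)
  then have dB: "d 2 0 ?B = \<one>\<^bsub>mquilt.pc 2 (- 1)\<^esub>"
    using dB mquilt.incl_one[of 2 "- 1"] by (simp add: Quilt_op_def)
  have dp: "d 1 (- 1) (opcomp mquilt.M ?B a ?m) = \<one>\<^bsub>mquilt.pc 1 (- 2)\<^esub>" if a: "a \<in> {1..2}" for a
  proof -
    have "d 1 (- 1) (opcomp mquilt.M ?B a ?m) =
        mquilt.leibniz 1 (- 2) 0 ?B \<one>\<^bsub>mquilt.pc 2 (- 1)\<^esub> a ?m \<one>\<^bsub>mquilt.pc 0 (- 2)\<^esub>"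
      using mquilt.derivation_comp[OF der iB m a, of 1 "- 1"] by (simp add: dB dm)
    then show ?thesis
      using mquilt.comp_one_left[OF m a, of 1 "- 2" "- 1"] mquilt.comp_one_right[OF iB a, of 1 0 "- 2" "- 2"]
      by (simp add: mquilt.leibniz_def)
  qed
  interpret h: group_hom "mquilt.pc 1 (- 1)" "mquilt.pc 1 (- 2)" "d 1 (- 1)"
    using mquilt.derivation_hom[OF der, of 1 "- 1"] mquilt.group_piece
    by (simp add: group_hom_def group_hom_axioms_def)
  show "d 1 (- 1) mquilt_Delta = \<one>\<^bsub>mquilt.pc 1 (- 2)\<^esub>"
    unfolding Delta using pq dp[OF n(1)] dp[OF n(2)] by (simp del: One_nat_def)
qed

text \<open>The boundary enters as any \<open>d\<close> with \<open>mquilt_boundary d\<close>, so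
  its existence is part of the claim; otherwise the second part could hold vacuously.\<close>

theorem theorem5p4:
  shows "(\<exists>d. mquilt_boundary d) \<and>
    (\<forall>d. mquilt_boundary d \<longrightarrow>
       square_zero mQuilt (twisted_boundary d) \<and> dg_operad mQuilt (twisted_boundary d))"
proof (intro conjI allI impI)
  show "\<exists>d. mquilt_boundary d" using mquilt_boundary_exists by blast
  fix d assume d: "mquilt_boundary d"
  interpret twist: operad_element mquilt.M mquilt_Delta
    by (intro operad_element.intro operad_element_axioms.intro mquilt.operad_axioms mquilt_Delta_closed)
  have der: "operad_derivation mquilt.M d"
    and d_incl: "\<And>n k x. x \<in> carrier (piece Quilt_op n k) \<Longrightarrow>
      d n k (mquilt.incl n k x) = mquilt.incl n (k - 1) (quilt_bd x)"
    and d_gen: "d 0 (- 1) mquilt.gen = \<one>\<^bsub>mquilt.pc 0 (- 2)\<^esub>"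
    using d unfolding mquilt_boundary_def mQuilt_def mquilt_incl_def mquilt_m_def by blast+
  have twisted: "twisted_boundary d = (\<lambda>n k x. d n k x \<otimes>\<^bsub>mquilt.pc n (k - 1)\<^esub> twist.ad n k x)"
    by (intro ext) (simp only: twisted_boundary_def mQuilt_def)
  have der': "operad_derivation mquilt.M (twisted_boundary d)"
    unfolding twisted by (rule mquilt.derivation_add[OF der twist.ad_derivation])
  \<comment> \<open>The square of the sum splits into the square of \<open>d\<close>, the
    anticommutator with \<open>ad\<close>, and the square of \<open>ad\<close>. The last two vanish
    on every element, the first is assumed for \<open>x\<close>.\<close>
  have sq: "twisted_boundary d n (k - 1) (twisted_boundary d n k x) = \<one>\<^bsub>mquilt.pc n (k - 2)\<^esub>"
    if x: "x \<in> carrier (mquilt.pc n k)" and dd: "d n (k - 1) (d n k x) = \<one>\<^bsub>mquilt.pc n (k - 2)\<^esub>" for n k x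
  proof -
    let ?G = "mquilt.pc n (k - 1)" and ?H = "mquilt.pc n (k - 2)"
    have hd: "d n (k - 1) \<in> hom ?G ?H" and ha: "twist.ad n (k - 1) \<in> hom ?G ?H"
      using mquilt.derivation_hom[OF der, of n "k - 1"] twist.ad_hom[of n "k - 1"] by simp_all
    have c: "d n k x \<in> carrier ?G" "twist.ad n k x \<in> carrier ?G"
      using hom_in_carrier[OF mquilt.derivation_hom[OF der] x] twist.ad_closed[OF x] by simp_all
    note c' = hom_in_carrier[OF hd c(1)] hom_in_carrier[OF hd c(2)] hom_in_carrier[OF ha c(1)] hom_in_carrier[OF ha c(2)]
    have "twisted_boundary d n (k - 1) (twisted_boundary d n k x) =
        (d n (k - 1) (d n k x) \<otimes>\<^bsub>?H\<^esub> d n (k - 1) (twist.ad n k x)) \<otimes>\<^bsub>?H\<^esub>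
        (twist.ad n (k - 1) (d n k x) \<otimes>\<^bsub>?H\<^esub> twist.ad n (k - 1) (twist.ad n k x))"
      unfolding twisted by (simp add: hom_mult[OF hd c] hom_mult[OF ha c])
    also have "\<dots> = d n (k - 1) (twist.ad n k x) \<otimes>\<^bsub>?H\<^esub> twist.ad n (k - 1) (d n k x)"
      unfolding dd twist.ad_ad[OF x mquilt_Delta_Delta] using c' by simp
    also have "\<dots> = \<one>\<^bsub>?H\<^esub>"
      by (rule twist.derivation_ad[OF der x mquilt_boundary_Delta[OF d]])
    finally show ?thesis .
  qed
  have sz: "square_zero mquilt.M (twisted_boundary d)"
  \<comment> \<open>The twisted operator is itself a derivation, so its square need only be tested
    on quilts and on \<open>m\<close>, where the square of \<open>d\<close> is known to
    vanish.\<close>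
  proof (rule mquilt.square_zero_adjoin[OF der'])
    fix n k x assume x: "x \<in> carrier (piece Quilt_op n k)"
    have k: "k - 1 - 1 = k - 2" by simp
    have "d n (k - 1) (d n k (mquilt.incl n k x)) = mquilt.incl n (k - 2) (quilt_bd (quilt_bd x))"
      unfolding d_incl[OF x] d_incl[OF mquilt.delta_closed[OF x]] k ..
    also have "\<dots> = \<one>\<^bsub>mquilt.pc n (k - 2)\<^esub>"
      using mquilt.incl_one[of n "k - 2"] by (simp add: quilt_bd_quilt_bd Quilt_op_def)
    finally show "twisted_boundary d n (k - 1) (twisted_boundary d n k (mquilt.incl n k x)) = \<one>\<^bsub>mquilt.pc n (k - 2)\<^esub>"
      by (rule sq[OF mquilt.incl_closed[OF x]])
  next
    have "d 0 (- 1 - 1) (d 0 (- 1) mquilt.gen) = \<one>\<^bsub>mquilt.pc 0 (- 1 - 2)\<^esub>"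
      unfolding d_gen using hom_one[OF mquilt.derivation_hom[OF der, of 0 "- 2"]] mquilt.group_piece by simp
    then show "twisted_boundary d 0 (- 1 - 1) (twisted_boundary d 0 (- 1) mquilt.gen) = \<one>\<^bsub>mquilt.pc 0 (- 1 - 2)\<^esub>"
      by (rule sq[OF mquilt.gen_closed])
  qed
  then show "square_zero mQuilt (twisted_boundary d)" unfolding mQuilt_def .
  show "dg_operad mQuilt (twisted_boundary d)"
    unfolding dg_operad_def mQuilt_def using mquilt.graded_operad_adjoin der' sz by blast
qed

end
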